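(* Let $G$ be the fundamental group of a finite connected graph $(\mathcal{G}, X)$ of finitely generated torsion-free nilpotent groups such that, for every $e \in A$, $G_e$ is a proper subgroup of finite index in $G_{o(e)}$ and $\phi_e(G_e)$ is a proper subgroup of finite index in $G_{\tau(e)}$. Assume further that one edge group $G_e$ (and hence every edge group) is commensurable with the Heisenberg group. Then the following statements are equivalent: (i) $G$ is self-similar; (ii) $G$ is residually finite; (iii) $G$ is linear over $\mathbb{Z}$; (iv) $G$ is subgroup separable.
   Context: The Heisenberg group is $\langle x, y \mid [x,y] = z, [z,x] = 1 = [z,y] \rangle$. Two groups are (abstractly) commensurable if they have isomorphic subgroups of finite index. Graph of groups notation: $X$ is a finite connected graph (loops are allowed), $V(X)$ its vertices, $A$ an orientation of its edges $E(X)$, with $o(e)$ and $\tau(e)$ the beginning and the end of $e \in A$. For each $v\in V(X)$ a group $G_v$ is given, and for each $e \in A$ a subgroup $G_e \le G_{o(e)}$ and an isomorphism $\phi_e : G_e \to \phi_e(G_e) \leq G_{\tau(e)}$. Let $T$ be a maximal subtree of $X$. The fundamental group $G=\pi(\mathcal{G},X)$ is generated by the groups $G_v$ ($v\in V(X)$) and elements $t_e$ ($e \in A$), subject to the relations of each $G_v$, the relations $t_e g t_e^{-1} = \phi_e(g)$ for $e\in A$, $g\in G_e$, and $t_e = 1$ for $e \in A \cap E(T)$. Self-similar: for an integer $m\ge 2$ let $\mathcal{T}_m$ be the rooted tree in which every vertex has exactly $m$ descendants (children). Each automorphism $g$ of $\mathcal{T}_m$ can be written as $g = (g_0,\dots,g_{m-1})\sigma$,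 where $\sigma\in S_m$ is the permutation induced by $g$ on the first level and $g_0,\dots,g_{m-1} \in \mathrm{Aut}(\mathcal{T}_m)$ (the states of $g$) describe the action of $g$ on the $m$ subtrees rooted at the first-level vertices, each such subtree being identified with $\mathcal{T}_m$ in the standard way. A group $G$ is self-similar if for some $m$ it has a faithful action on $\mathcal{T}_m$ by automorphisms such that, viewing $G \le \mathrm{Aut}(\mathcal{T}_m)$, all states $g_0,\dots,g_{m-1}$ of every $g\in G$ belong to $G$. A group is linear over $\mathbb{Z}$ if it embeds in $GL_k(\mathbb{Z})$ for some $k$. A group $G$ is subgroup separable if any two distinct finitely generated subgroups of $G$ have distinct images in some finite quotient of $G$. *)

theory Defs
  imports
    "HOL-Algebra.Group_Action"
    "HOL-Algebra.Generated_Groups"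
    "Graph_Theory.Digraph_Component"
    "Jordan_Normal_Form.Matrix"
begin

section \<open>Properties of groups\<close>

definition finitely_generated :: "('a, 'b) monoid_scheme \<Rightarrow> bool" where
  "finitely_generated G \<longleftrightarrow> (\<exists>S. finite S \<and> S \<subseteq> carrier G \<and> generate G S = carrier G)"

definition torsion_free :: "('a, 'b) monoid_scheme \<Rightarrow> bool" where
  "torsion_free G \<longleftrightarrow>
     (\<forall>x \<in> carrier G. \<forall>n::nat. n > 0 \<longrightarrow> x [^]\<^bsub>G\<^esub> n = \<one>\<^bsub>G\<^esub> \<longrightarrow> x = \<one>\<^bsub>G\<^esub>)"

fun lower_central_series :: "('a, 'b) monoid_scheme \<Rightarrow> nat \<Rightarrow> 'a set" where
  "lower_central_series G 0 = carrier G"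
| "lower_central_series G (Suc n) =
     generate G {g \<otimes>\<^bsub>G\<^esub> h \<otimes>\<^bsub>G\<^esub> inv\<^bsub>G\<^esub> g \<otimes>\<^bsub>G\<^esub> inv\<^bsub>G\<^esub> h | g h.
                   g \<in> lower_central_series G n \<and> h \<in> carrier G}"

definition nilpotent :: "('a, 'b) monoid_scheme \<Rightarrow> bool" where
  "nilpotent G \<longleftrightarrow> (\<exists>n. lower_central_series G n = {\<one>\<^bsub>G\<^esub>})"

definition finite_index_subgroup :: "'a set \<Rightarrow> ('a, 'b) monoid_scheme \<Rightarrow> bool" where
  "finite_index_subgroup H G \<longleftrightarrow> subgroup H G \<and> finite (rcosets\<^bsub>G\<^esub> H)"

definition commensurable :: "('a, 'b) monoid_scheme \<Rightarrow> ('c, 'd) monoid_scheme \<Rightarrow> bool" where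
  "commensurable G H \<longleftrightarrow>
     (\<exists>K L. finite_index_subgroup K G \<and> finite_index_subgroup L H \<and>
            G\<lparr>carrier := K\<rparr> \<cong> H\<lparr>carrier := L\<rparr>)"

definition residually_finite :: "('a, 'b) monoid_scheme \<Rightarrow> bool" where
  "residually_finite G \<longleftrightarrow>
     (\<forall>g \<in> carrier G. g \<noteq> \<one>\<^bsub>G\<^esub> \<longrightarrow>
        (\<exists>N. N \<lhd> G \<and> finite (carrier (G Mod N)) \<and> g \<notin> N))"

definition subgroup_separable :: "('a, 'b) monoid_scheme \<Rightarrow> bool" where
  "subgroup_separable G \<longleftrightarrow>
     (\<forall>H K. subgroup H G \<and> finitely_generated (G\<lparr>carrier := H\<rparr>) \<and>
            subgroup K G \<and> finitely_generated (G\<lparr>carrier := K\<rparr>) \<and> H \<noteq> K \<longrightarrow>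
        (\<exists>N. N \<lhd> G \<and> finite (carrier (G Mod N)) \<and>
             (\<lambda>g. N #>\<^bsub>G\<^esub> g) ` H \<noteq> (\<lambda>g. N #>\<^bsub>G\<^esub> g) ` K))"

abbreviation GL_int :: "nat \<Rightarrow> int mat monoid" where
  "GL_int k \<equiv> units_of (ring_mat TYPE(int) k ())"

definition linear_over_int :: "('a, 'b) monoid_scheme \<Rightarrow> bool" where
  "linear_over_int G \<longleftrightarrow> (\<exists>k. mon G (GL_int k) \<noteq> {})"


section \<open>Self-similar groups\<close>

text \<open>The vertices of the \<open>m\<close>-ary rooted tree are the words over \<open>{0,\<dots>,m-1}\<close>; the root is the
  empty word and the children of \<open>u\<close> are the words \<open>u @ [i]\<close>.\<close>

definition tree_verts :: "nat \<Rightarrow> nat list set" where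
  "tree_verts m = lists {..<m}"

definition is_child :: "nat list \<Rightarrow> nat list \<Rightarrow> bool" where
  "is_child u v \<longleftrightarrow> (\<exists>i. v = u @ [i])"

definition tree_aut :: "nat \<Rightarrow> (nat list \<Rightarrow> nat list) set" where
  "tree_aut m = {f \<in> Bij (tree_verts m). f [] = [] \<and>
     (\<forall>u \<in> tree_verts m. \<forall>v \<in> tree_verts m. is_child u v \<longleftrightarrow> is_child (f u) (f v))}"

text \<open>The subtree rooted at the first-level vertex \<open>[i]\<close> consists of the words \<open>i # w\<close> and is identified
  with the whole tree by \<open>i # w \<mapsto> w\<close>. An automorphism \<open>f\<close> maps it onto the subtree at \<open>f [i]\<close>.\<close>

definition tree_state :: "nat \<Rightarrow> (nat list \<Rightarrow> nat list) \<Rightarrow> nat \<Rightarrow> nat list \<Rightarrow> nat list" where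
  "tree_state m f i = (\<lambda>w \<in> tree_verts m. tl (f (i # w)))"

definition self_similar :: "('a, 'b) monoid_scheme \<Rightarrow> bool" where
  "self_similar G \<longleftrightarrow>
     (\<exists>m \<ge> 2. \<exists>\<phi>. faithful_action G (tree_verts m) \<phi> \<and> \<phi> ` carrier G \<subseteq> tree_aut m \<and>
        (\<forall>g \<in> carrier G. \<forall>i < m. tree_state m (\<phi> g) i \<in> \<phi> ` carrier G))"


section \<open>Groups given by generators and relators\<close>

text \<open>A letter \<open>(a, True)\<close> stands for the generator \<open>a\<close>, and \<open>(a, False)\<close> for its inverse.\<close>

type_synonym 'a word = "('a \<times> bool) list"

definition words :: "'a set \<Rightarrow> 'a word set" where
  "words S = lists (S \<times> UNIV)"

definition word_inv :: "'a word \<Rightarrow> 'a word" where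
  "word_inv w = rev (map (\<lambda>(a, b). (a, \<not> b)) w)"

definition word_comm :: "'a word \<Rightarrow> 'a word \<Rightarrow> 'a word" where
  "word_comm u v = u @ v @ word_inv u @ word_inv v"

inductive_set pres_rel :: "'a set \<Rightarrow> 'a word set \<Rightarrow> ('a word \<times> 'a word) set"
  for S :: "'a set" and R :: "'a word set"
where
  refl: "u \<in> words S \<Longrightarrow> (u, u) \<in> pres_rel S R"
| sym: "(u, v) \<in> pres_rel S R \<Longrightarrow> (v, u) \<in> pres_rel S R"
| trans: "(u, v) \<in> pres_rel S R \<Longrightarrow> (v, w) \<in> pres_rel S R \<Longrightarrow> (u, w) \<in> pres_rel S R"
| cancel: "u \<in> words S \<Longrightarrow> v \<in> words S \<Longrightarrow> a \<in> S \<Longrightarrow>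
    (u @ [(a, b), (a, \<not> b)] @ v, u @ v) \<in> pres_rel S R"
| relator: "u \<in> words S \<Longrightarrow> v \<in> words S \<Longrightarrow> r \<in> R \<Longrightarrow> r \<in> words S \<Longrightarrow>
    (u @ r @ v, u @ v) \<in> pres_rel S R"

definition presented_group :: "'a set \<Rightarrow> 'a word set \<Rightarrow> 'a word set monoid" where
  "presented_group S R =
     \<lparr>carrier = words S // pres_rel S R,
      monoid.mult = (\<lambda>C D. \<Union>u \<in> C. \<Union>v \<in> D. pres_rel S R `` {u @ v}),
      monoid.one = pres_rel S R `` {[]}\<rparr>"

lemma pres_rel_words: "(u, v) \<in> pres_rel S R \<Longrightarrow> u \<in> words S \<and> v \<in> words S"
  by (induction rule: pres_rel.induct) (auto simp: words_def)

lemma equiv_pres_rel: "equiv (words S) (pres_rel S R)"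
  by (rule equivI)
    (auto intro!: refl_onI symI transI intro: pres_rel.refl pres_rel.sym pres_rel.trans
      dest: pres_rel_words)

lemma pres_rel_context:
  assumes "(u, v) \<in> pres_rel S R" "x \<in> words S" "y \<in> words S"
  shows "(x @ u @ y, x @ v @ y) \<in> pres_rel S R"
  using assms
proof (induction rule: pres_rel.induct)
  case (refl u)
  then show ?case by (intro pres_rel.refl) (auto simp: words_def)
next
  case (cancel u v a b)
  then show ?case using pres_rel.cancel[of "x @ u" S "v @ y" a b R] by (auto simp: words_def)
next
  case (relator u v r)
  then show ?case using pres_rel.relator[of "x @ u" S "v @ y" r R] by (auto simp: words_def)
qed (blast intro: pres_rel.sym pres_rel.trans)+

lemma pres_rel_append:
  assumes "(u, u') \<in> pres_rel S R" "(v, v') \<in> pres_rel S R"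
  shows "(u @ v, u' @ v') \<in> pres_rel S R"
proof -
  have "[] \<in> words S" by (simp add: words_def)
  then show ?thesis
    using pres_rel_context[OF assms(1), of "[]" v] pres_rel_context[OF assms(2), of u' "[]"]
      pres_rel_words[OF assms(1)] pres_rel_words[OF assms(2)]
    by (auto intro: pres_rel.trans)
qed

lemma presented_group_mult:
  assumes "u \<in> words S" "v \<in> words S"
  shows "pres_rel S R `` {u} \<otimes>\<^bsub>presented_group S R\<^esub> pres_rel S R `` {v} = pres_rel S R `` {u @ v}"
proof -
  have "congruent2 (pres_rel S R) (pres_rel S R) (\<lambda>u v. pres_rel S R `` {u @ v})"
    by (intro congruent2I' equiv_class_eq[OF equiv_pres_rel]) (rule pres_rel_append)
  then show ?thesis
    unfolding presented_group_def
    using UN_equiv_class2[OF equiv_pres_rel equiv_pres_rel _ assms] by simp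
qed

lemma word_inv_words: "u \<in> words S \<Longrightarrow> word_inv u \<in> words S"
  by (force simp: words_def word_inv_def)

lemma word_inv_left: "u \<in> words S \<Longrightarrow> (word_inv u @ u, []) \<in> pres_rel S R"
proof (induction u)
  case Nil
  then show ?case by (simp add: word_inv_def pres_rel.refl)
next
  case (Cons p u)
  obtain a b where p: "p = (a, b)" by (cases p)
  from Cons.prems p have a: "a \<in> S" and u: "u \<in> words S" by (auto simp: words_def)
  have "(word_inv u @ [(a, \<not> b), (a, \<not> \<not> b)] @ u, word_inv u @ u) \<in> pres_rel S R"
    by (rule pres_rel.cancel[OF word_inv_words[OF u] u a])
  then show ?case using Cons.IH[OF u] p by (auto simp: word_inv_def intro: pres_rel.trans)
qed

lemma group_presented_group: "group (presented_group S R)"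
proof (rule groupI)
  fix A assume "A \<in> carrier (presented_group S R)"
  then obtain u where u: "u \<in> words S" "A = pres_rel S R `` {u}"
    by (auto simp: presented_group_def elim: quotientE)
  have e: "[] \<in> words S" "\<one>\<^bsub>presented_group S R\<^esub> = pres_rel S R `` {[]}"
    by (simp_all add: words_def presented_group_def)
  show "\<one>\<^bsub>presented_group S R\<^esub> \<otimes>\<^bsub>presented_group S R\<^esub> A = A"
    using u e by (simp add: presented_group_mult)
  show "\<exists>B \<in> carrier (presented_group S R).
          B \<otimes>\<^bsub>presented_group S R\<^esub> A = \<one>\<^bsub>presented_group S R\<^esub>"
  proof
    show "pres_rel S R `` {word_inv u} \<in> carrier (presented_group S R)"
      using word_inv_words[OF u(1)] by (simp add: presented_group_def quotientI)
    show "pres_rel S R `` {word_inv u} \<otimes>\<^bsub>presented_group S R\<^esub> A = \<one>\<^bsub>presented_group S R\<^esub>"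
      using u e word_inv_words[OF u(1)] word_inv_left[OF u(1)]
      by (simp add: presented_group_mult equiv_class_eq[OF equiv_pres_rel])
  qed
next
  fix A B C
  assume "A \<in> carrier (presented_group S R)" "B \<in> carrier (presented_group S R)"
  then obtain u v where *: "u \<in> words S" "A = pres_rel S R `` {u}"
    "v \<in> words S" "B = pres_rel S R `` {v}"
    by (auto simp: presented_group_def elim!: quotientE)
  then have uv: "u @ v \<in> words S" by (simp add: words_def)
  with * show "A \<otimes>\<^bsub>presented_group S R\<^esub> B \<in> carrier (presented_group S R)"
    by (simp add: presented_group_mult) (simp add: presented_group_def quotientI)
  assume "C \<in> carrier (presented_group S R)"
  then obtain w where w: "w \<in> words S" "C = pres_rel S R `` {w}"
    by (auto simp: presented_group_def elim: quotientE)
  then have "v @ w \<in> words S" using * by (simp add: words_def)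
  with * uv w show "A \<otimes>\<^bsub>presented_group S R\<^esub> B \<otimes>\<^bsub>presented_group S R\<^esub> C =
      A \<otimes>\<^bsub>presented_group S R\<^esub> (B \<otimes>\<^bsub>presented_group S R\<^esub> C)"
    by (simp add: presented_group_mult)
qed (simp add: presented_group_def quotientI words_def)

datatype heisenberg_gen = HX | HY

definition heisenberg_group :: "heisenberg_gen word set monoid" where
  "heisenberg_group =
     (let x = [(HX, True)]; y = [(HY, True)]; z = word_comm x y
      in presented_group UNIV {word_comm z x, word_comm z y})"


section \<open>Graphs of groups\<close>

text \<open>The arcs of the digraph \<open>X\<close> are the edges in the orientation \<open>A\<close>, with \<open>tail X\<close> as \<open>o\<close> and
  \<open>head X\<close> as \<open>\<tau>\<close>; loops and parallel edges are allowed. Connectedness of a digraph refers to the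
  underlying undirected graph, but the library's notion of a tree only forbids directed cycles,
  so undirected trees are defined here.

  A pair \<open>(e, True)\<close> is the edge \<open>e\<close> traversed from tail to head, \<open>(e, False)\<close> the reversed edge.
  A circuit is a closed path without repeated edges or vertices.\<close>

fun or_start :: "('v, 'e) pre_digraph \<Rightarrow> 'e \<times> bool \<Rightarrow> 'v" where
  "or_start X (e, b) = (if b then tail X e else head X e)"

fun or_end :: "('v, 'e) pre_digraph \<Rightarrow> 'e \<times> bool \<Rightarrow> 'v" where
  "or_end X (e, b) = (if b then head X e else tail X e)"

definition undirected_circuit :: "('v, 'e) pre_digraph \<Rightarrow> ('e \<times> bool) list \<Rightarrow> bool" where
  "undirected_circuit X p \<longleftrightarrow>
     p \<noteq> [] \<and> fst ` set p \<subseteq> arcs X \<and>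
     (\<forall>i. Suc i < length p \<longrightarrow> or_end X (p ! i) = or_start X (p ! Suc i)) \<and>
     or_end X (last p) = or_start X (hd p) \<and>
     distinct (map fst p) \<and> distinct (map (or_start X) p)"

definition undirected_tree :: "('v, 'e) pre_digraph \<Rightarrow> bool" where
  "undirected_tree X \<longleftrightarrow> connected X \<and> (\<nexists>p. undirected_circuit X p)"

definition maximal_subtree :: "('v, 'e) pre_digraph \<Rightarrow> ('v, 'e) pre_digraph \<Rightarrow> bool" where
  "maximal_subtree T X \<longleftrightarrow> pre_digraph.max_subgraph X undirected_tree T"

locale graph_of_groups = fin_digraph X
  for X :: "('v, 'e) pre_digraph" +
  fixes Gv :: "'v \<Rightarrow> 'g monoid"
    and Ge :: "'e \<Rightarrow> 'g set"
    and \<phi> :: "'e \<Rightarrow> 'g \<Rightarrow> 'g"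
  assumes connected_graph: "connected X"
    and vertex_group: "v \<in> verts X \<Longrightarrow> group (Gv v)"
    and edge_subgroup: "e \<in> arcs X \<Longrightarrow> subgroup (Ge e) (Gv (tail X e))"
    and image_subgroup: "e \<in> arcs X \<Longrightarrow> subgroup (\<phi> e ` Ge e) (Gv (head X e))"
    and edge_iso: "e \<in> arcs X \<Longrightarrow>
      \<phi> e \<in> iso (Gv (tail X e)\<lparr>carrier := Ge e\<rparr>) (Gv (head X e)\<lparr>carrier := \<phi> e ` Ge e\<rparr>)"

datatype ('v, 'e, 'g) gog_gen = Vert 'v 'g | Stable 'e

definition gog_gens :: "('v, 'e) pre_digraph \<Rightarrow> ('v \<Rightarrow> 'g monoid) \<Rightarrow> ('v, 'e, 'g) gog_gen set" where
  "gog_gens X Gv = {Vert v g | v g. v \<in> verts X \<and> g \<in> carrier (Gv v)} \<union> Stable ` arcs X"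

definition gog_relators ::
  "('v, 'e) pre_digraph \<Rightarrow> ('v \<Rightarrow> 'g monoid) \<Rightarrow> ('e \<Rightarrow> 'g set) \<Rightarrow> ('e \<Rightarrow> 'g \<Rightarrow> 'g) \<Rightarrow>
   ('v, 'e) pre_digraph \<Rightarrow> ('v, 'e, 'g) gog_gen word set" where
  "gog_relators X Gv Ge \<phi> T =
     {[(Vert v g, True), (Vert v h, True), (Vert v (g \<otimes>\<^bsub>Gv v\<^esub> h), False)] | v g h.
        v \<in> verts X \<and> g \<in> carrier (Gv v) \<and> h \<in> carrier (Gv v)} \<union>
     {[(Stable e, True), (Vert (tail X e) g, True), (Stable e, False),
       (Vert (head X e) (\<phi> e g), False)] | e g. e \<in> arcs X \<and> g \<in> Ge e} \<union>
     {[(Stable e, True)] | e. e \<in> arcs T}"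

definition fundamental_group ::
  "('v, 'e) pre_digraph \<Rightarrow> ('v \<Rightarrow> 'g monoid) \<Rightarrow> ('e \<Rightarrow> 'g set) \<Rightarrow> ('e \<Rightarrow> 'g \<Rightarrow> 'g) \<Rightarrow>
   ('v, 'e) pre_digraph \<Rightarrow> ('v, 'e, 'g) gog_gen word set monoid" where
  "fundamental_group X Gv Ge \<phi> T = presented_group (gog_gens X Gv) (gog_relators X Gv Ge \<phi> T)"

end

theory Submission
 imports Defs "HOL-Combinatorics.Permutations" "HOL-Library.Countable_Set"
begin

text \<open>If \<open>G\<close> is residually finite, closures in the profinite topology show that the nilpotent vertex groups
 are closed, and hence that some normal subgroup \<open>J\<close> of \<open>G\<close> lies in all edge groups with finite index;
 it may be taken isomorphic to a subgroup of finite index of the Heisenberg group. Then \<open>G/J\<close> is the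
 fundamental group of a graph of finite groups, so it is virtually free. Up to inner automorphisms, \<open>G\<close>
 acts on \<open>J\<close> through \<open>GL\<^sub>2(\<int>)\<close>, and a subgroup of finite index of \<open>G\<close> is a semidirect product of \<open>J\<close> and
 a free group acting through \<open>SL\<^sub>2(\<int>)\<close>. This group embeds in \<open>(\<H> \<rtimes> SL\<^sub>2(\<int>))\<times>SL\<^sub>2(\<int>)\<close>, where \<open>\<H>\<close> is the
 integral Heisenberg group. The inverse of a dilation of \<open>J\<close>, an embedding of the free group into a free
 group of rank two and a virtual endomorphism of Sanov's group together make \<open>G\<close> self-similar. For
 subgroup separability, a partial action on finitely many cosets of \<open>HJ\<^sup>d\<close> is completed to a finite action.\<close>

section \<open>Generalities on groups\<close>

text \<open>Properness of the edge groups makes every vertex group its own normalizer, and for a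
  nilpotent group this is what turns residual finiteness into closedness. The main device afterwards
  is the construction of permutation actions. If all points of a set have one and the same
  stabilizer in an edge group under both of its embeddings, some permutation intertwines the two
  actions, and it can be prescribed on finitely many points. This takes the place of the action on
  the Bass-Serre tree in the normal form theorem, in the finite quotients and in the separation of
  subgroups. Actions built vertex by vertex do not make the letters of the maximal tree trivial,
  hence the gauge in \<open>transport\<close>. Freeness is expressed by a universal property with
  respect to one group fixed in advance; the target is therefore the product of the whole group with
  \<open>SL2\<close>, one factor giving a section over the free quotient and its endomorphisms, the
  other giving matrices. Matrices are needed twice: the action on \<open>J\<close> can be far from
  faithful on the free part, and self-similarity needs an explicit endomorphism without invariant
  normal subgroups.\<close>

context group
begin

lemma inv_cancel_left [simp]:
 "x\<in>carrier G ==> y\<in>carrier G ==> inv x\<otimes>(x\<otimes>y) = y"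
 "x\<in>carrier G ==> y\<in>carrier G ==> x\<otimes>(inv x\<otimes>y) = y"
 by (simp_all flip: m_assoc)

lemma conj_pow:
 assumes "g\<in>carrier G" "x\<in>carrier G"
 shows "(g\<otimes>x\<otimes>inv g) [^] (n::nat) = g\<otimes>x [^] n\<otimes>inv g"
 by (induction n) (use assms in \<open>simp_all add: m_assoc\<close>)

lemma l_coset_eq_iff:
 assumes "subgroup H G" "a\<in>carrier G" "b\<in>carrier G"
 shows "a <# H = b <# H\<longleftrightarrow>inv b\<otimes>a\<in>H"
proof
 interpret subgroup H G by fact
 assume "a <# H = b <# H"
 moreover have "a\<in>a <# H" using assms(2) by (force simp: l_coset_def)
 ultimately obtain h where "h\<in>H" "a = b\<otimes>h" by (auto simp: l_coset_def)
 then show "inv b\<otimes>a\<in>H" using assms by simp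
next
 interpret subgroup H G by fact
 assume h: "inv b\<otimes>a\<in>H"
 have *: "x <# H\<subseteq>y <# H" if "x\<in>carrier G" "y\<in>carrier G" "inv y\<otimes>x\<in>H" for x y
 proof
  fix z assume "z\<in>x <# H"
  then obtain k where "k\<in>H" "z = x\<otimes>k" by (auto simp: l_coset_def)
  then have "z = y\<otimes>(inv y\<otimes>x\<otimes>k)" using that by (simp add: m_assoc)
  then show "z\<in>y <# H" using that \<open>k\<in>H\<close> by (auto simp: l_coset_def)
 qed
 have "inv (inv b\<otimes>a)\<in>H" using h by simp
 then have "inv a\<otimes>b\<in>H" using assms by (simp add: inv_mult_group)
 with * h assms show "a <# H = b <# H" by blast
qed

lemma l_coset_mult:
 assumes "subgroup H G" "a\<in>carrier G" "b\<in>carrier G"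
 shows "a <# (b <# H) = (a\<otimes>b) <# H"
 using lcos_m_assoc[OF _ assms(2,3)] assms(1) subgroup.subset by blast

end

subsection \<open>Finite index\<close>

text \<open>\<open>A\<close> is covered by finitely many left translates of \<open>J\<close>; no inclusion is required.\<close>

definition fidx :: "('a, 'b) monoid_scheme => 'a set => 'a set => bool" where
 "fidx G A J\<longleftrightarrow>(\<exists>S. finite S\<and>S\<subseteq>carrier G \<and>
   (\<forall>a\<in>A. \<exists>s\<in>S. inv\<^bsub>G\<^esub> s \<otimes>\<^bsub>G\<^esub> a\<in>J))"

lemma fidx_mono: "fidx G A J ==> A'\<subseteq>A ==> J\<subseteq>J' ==> fidx G A' J'"
 unfolding fidx_def by (meson subset_iff)

context group
begin

text \<open>One chosen element of each colour class represents the whole class. Typical colours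
  \<kappa> are residues, cosets and images of a point.\<close>

lemma fidxI:
 assumes "A\<subseteq>carrier G" "finite (\<kappa> ` A)"
  and "!!a b. a\<in>A ==> b\<in>A ==> \<kappa> a = \<kappa> b ==> inv b\<otimes>a\<in>J"
 shows "fidx G A J"
 unfolding fidx_def
proof (intro exI conjI ballI)
 show "finite (inv_into A \<kappa> ` \<kappa> ` A)" using assms by simp
 show "inv_into A \<kappa> ` \<kappa> ` A\<subseteq>carrier G" 
 proof (rule image_subsetI)
  show "inv_into A \<kappa> x\<in>carrier G" if "x\<in>\<kappa> ` A" for x
   using inv_into_into[OF that] assms(1) by (rule subsetD[rotated])
 qed
 fix a assume "a\<in>A"
 then show "\<exists>s\<in>inv_into A \<kappa> ` \<kappa> ` A. inv s\<otimes>a\<in>J"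
  using assms(3)[of a "inv_into A \<kappa> (\<kappa> a)"]
  by (auto simp: f_inv_into_f inv_into_into)
qed

lemma fidxE:
 assumes "fidx G A J" "subgroup J G" "A\<subseteq>carrier G"
 obtains \<kappa> :: "'a => 'a" where "finite (\<kappa> ` A)"
  "!!a b. a\<in>A ==> b\<in>A ==> \<kappa> a = \<kappa> b ==> inv b\<otimes>a\<in>J"
proof -
 interpret J: subgroup J G by fact
 obtain S where S: "finite S" "S\<subseteq>carrier G" "\<forall>a\<in>A. \<exists>s\<in>S. inv s\<otimes>a\<in>J"
  using assms(1) by (auto simp: fidx_def)
 then obtain \<kappa> where \<kappa>: "!!a. a\<in>A ==> \<kappa> a\<in>S\<and>inv (\<kappa> a)\<otimes>a\<in>J" by metis
 show thesis
 proof (rule that)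
  show "finite (\<kappa> ` A)" using \<kappa> S(1) by (meson finite_subset image_subsetI)
  fix a b assume ab: "a\<in>A" "b\<in>A" "\<kappa> a = \<kappa> b"
  have c: "a\<in>carrier G" "b\<in>carrier G" "\<kappa> b\<in>carrier G" using ab assms S \<kappa> by auto
  have "inv (inv (\<kappa> b)\<otimes>b)\<otimes>(inv (\<kappa> b)\<otimes>a)\<in>J" using \<kappa>[OF ab(1)] \<kappa>[OF ab(2)] ab(3) by simp
  then show "inv b\<otimes>a\<in>J" using c by (simp add: inv_mult_group m_assoc)
 qed
qed

lemma fidx_trans:
 assumes "fidx G A N" "fidx G N J" "A\<subseteq>carrier G" "J\<subseteq>carrier G"
 shows "fidx G A J"
proof -
 obtain S where S: "finite S" "S\<subseteq>carrier G" "\<forall>a\<in>A. \<exists>s\<in>S. inv s\<otimes>a\<in>N"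
  using assms(1) by (auto simp: fidx_def)
 obtain S' where S': "finite S'" "S'\<subseteq>carrier G" "\<forall>a\<in>N. \<exists>s\<in>S'. inv s\<otimes>a\<in>J"
  using assms(2) by (auto simp: fidx_def)
 show ?thesis
  unfolding fidx_def
 proof (intro exI conjI ballI)
  show "finite ((%(s, s'). s\<otimes>s') ` (S\<times>S'))" using S S' by simp
  show "(%(s, s'). s\<otimes>s') ` (S\<times>S')\<subseteq>carrier G" using S S' by auto
  fix a assume a: "a\<in>A"
  obtain s where s: "s\<in>S" "inv s\<otimes>a\<in>N" using S a by auto
  obtain s' where s': "s'\<in>S'" "inv s'\<otimes>(inv s\<otimes>a)\<in>J" using S' s by auto
  have "inv (s\<otimes>s')\<otimes>a = inv s'\<otimes>(inv s\<otimes>a)"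
   using s s' S S' a assms by (simp add: inv_mult_group m_assoc subset_iff)
  then show "\<exists>x\<in>(%(s, s'). s\<otimes>s') ` (S\<times>S'). inv x\<otimes>a\<in>J"
   using s s' by force
 qed
qed

lemma fidx_Int:
 assumes "fidx G A H" "fidx G A K" "subgroup H G" "subgroup K G" "A\<subseteq>carrier G"
 shows "fidx G A (H\<inter>K)"
proof -
 obtain \<kappa> :: "'a => 'a" where \<kappa>: "finite (\<kappa> ` A)"
  "!!a b. a\<in>A ==> b\<in>A ==> \<kappa> a = \<kappa> b ==> inv b\<otimes>a\<in>H"
  using fidxE[OF assms(1,3,5)] by blast
 obtain \<kappa>' :: "'a => 'a" where \<kappa>': "finite (\<kappa>' ` A)"
  "!!a b. a\<in>A ==> b\<in>A ==> \<kappa>' a = \<kappa>' b ==> inv b\<otimes>a\<in>K"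
  using fidxE[OF assms(2,4,5)] by blast
 show ?thesis
 proof (rule fidxI[where \<kappa> = "%a. (\<kappa> a, \<kappa>' a)"])
  have "(%a. (\<kappa> a, \<kappa>' a)) ` A\<subseteq>\<kappa> ` A\<times>\<kappa>' ` A" by auto
  then show "finite ((%a. (\<kappa> a, \<kappa>' a)) ` A)" using \<kappa>(1) \<kappa>'(1) finite_subset by blast
 qed (use \<kappa> \<kappa>' assms in auto)
qed

lemma fidx_pow:
 assumes "fidx G A J" "subgroup J G" "subgroup A G"
 obtains d :: nat where "d > 0" "!!a. a\<in>A ==> a [^] d\<in>J"
proof -
 interpret A: subgroup A G by fact
 interpret J: subgroup J G by fact
 obtain \<kappa> :: "'a => 'a" where \<kappa>: "finite (\<kappa> ` A)"
  "!!a b. a\<in>A ==> b\<in>A ==> \<kappa> a = \<kappa> b ==> inv b\<otimes>a\<in>J"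
  using fidxE[OF assms(1,2) A.subset] by blast
 let ?k = "card (\<kappa> ` A)"
 have "a [^] (fact ?k :: nat)\<in>J" if a: "a\<in>A" for a
 proof -
  have ac: "a\<in>carrier G" using a by simp
  have pa: "a [^] (n::nat)\<in>A" for n by (induction n) (use a in auto)
  have "card ((%n. \<kappa> (a [^] n)) ` {0..?k})\<le>?k"
   by (rule card_mono[OF \<kappa>(1)]) (use pa in auto)
  then have "\<not> inj_on (%n. \<kappa> (a [^] n)) {0..?k}"
   using card_image by fastforce
  then obtain i j where ij: "i\<le>?k" "j\<le>?k" "i ~= j" "\<kappa> (a [^] i) = \<kappa> (a [^] j)"
   by (auto simp: inj_on_def)
  obtain i j where ij: "i < j" "j\<le>?k" "\<kappa> (a [^] i) = \<kappa> (a [^] j)"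
   using ij by (metis linorder_neqE_nat)
  have "inv (a [^] i)\<otimes>(a [^] j)\<in>J" using \<kappa>(2)[of "a [^] j" "a [^] i"] pa ij by auto
  moreover have "a [^] j = a [^] i\<otimes>a [^] (j - i)" using ac ij by (simp add: nat_pow_mult)
  ultimately have *: "a [^] (j - i)\<in>J" using ac by simp
  have "(j - i) dvd fact ?k" using ij by (intro dvd_fact) auto
  then obtain q where q: "fact ?k = (j - i) * q" by auto
  have "(a [^] (j - i)) [^] q\<in>J" by (induction q) (use * in auto)
  then show ?thesis by (simp add: q nat_pow_pow ac)
 qed
 then show thesis using that[of "fact ?k"] by simp
qed

lemma finite_rcosets_iff:
 assumes "subgroup H G"
 shows "finite (rcosets H)\<longleftrightarrow>fidx G (carrier G) H"
proof
 interpret H: subgroup H G by fact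
 assume fin: "finite (rcosets H)"
 \<comment> \<open>Inversion exchanges the left cosets counted by \<open>fidx\<close> with right
   cosets.\<close>
 show "fidx G (carrier G) H"
 proof (rule fidxI[where \<kappa> = "%a. H #> inv a"])
  have "(%a. H #> inv a) ` carrier G\<subseteq>rcosets H" by (auto intro!: rcosetsI H.subset)
  then show "finite ((%a. H #> inv a) ` carrier G)" using fin finite_subset by blast
  fix a b assume ab: "a\<in>carrier G" "b\<in>carrier G" "H #> inv a = H #> inv b"
  have "inv b\<in>H #> inv a" using ab rcos_self[OF _ assms, of "inv b"] by simp
  then obtain h where "h\<in>H" "inv b = h\<otimes>inv a" by (auto simp: r_coset_def)
  then show "inv b\<otimes>a\<in>H" using ab by (simp add: m_assoc)
 qed simp
next
 interpret H: subgroup H G by fact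
 assume "fidx G (carrier G) H"
 then obtain S where S: "finite S" "S\<subseteq>carrier G" "\<forall>a\<in>carrier G. \<exists>s\<in>S. inv s\<otimes>a\<in>H"
  by (auto simp: fidx_def)
 have "rcosets H\<subseteq>(%s. H #> inv s) ` S"
 proof
  fix R assume "R\<in>rcosets H"
  then obtain a where a: "a\<in>carrier G" "R = H #> a" by (auto simp: RCOSETS_def)
  obtain s where s: "s\<in>S" "inv s\<otimes>inv a\<in>H" using S(3)[rule_format, of "inv a"] a by auto
  have "inv (inv s\<otimes>inv a)\<in>H" using s(2) by simp
  moreover have "s\<in>carrier G" using s S by blast
  ultimately have "a\<otimes>s\<in>H" using a by (simp add: inv_mult_group)
  then have "a\<in>H #> inv s" using a s S
   by (auto simp: r_coset_def subset_iff m_assoc intro!: bexI[of _ "a\<otimes>s"])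
  then have "H #> inv s = H #> a" using repr_independence[OF _ _ assms, of a "inv s"] s S by auto
  then show "R\<in>(%s. H #> inv s) ` S" using a s by auto
 qed
 then show "finite (rcosets H)" using S(1) finite_surj by blast
qed

lemma finite_index_subgroup_iff:
 "finite_index_subgroup H G\<longleftrightarrow>subgroup H G\<and>fidx G (carrier G) H"
 unfolding finite_index_subgroup_def using finite_rcosets_iff by blast

lemma finite_Mod_iff:
 "N \<lhd> G ==> finite (carrier (G Mod N))\<longleftrightarrow>fidx G (carrier G) N"
 by (simp add: FactGroup_def finite_rcosets_iff normal_imp_subgroup)

end

definition fin_normal :: "('a, 'b) monoid_scheme => 'a set => bool" where
 "fin_normal G U\<longleftrightarrow>U \<lhd> G\<and>fidx G (carrier G) U"

text \<open>The intersection with the carrier matters for the empty family, whose plain intersection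
  is the whole type.\<close>

lemma (in group) fin_normal_Inter:
 assumes "finite \<U>" "!!U. U\<in>\<U> ==> fin_normal G U"
 shows "fin_normal G (\<Inter>\<U>\<inter>carrier G)"
 using assms
proof (induction \<U> rule: finite_induct)
 case empty
 have "carrier G \<lhd> G" by (rule normal_invI[OF subgroup_self]) auto
 moreover have "fidx G (carrier G) (carrier G)" by (rule fidxI[where \<kappa> = "%_. ()"]) auto
 ultimately show ?case by (simp add: fin_normal_def)
next
 case (insert U \<U>)
 then have U: "U \<lhd> G" "fidx G (carrier G) U" by (auto simp: fin_normal_def)
 have V: "\<Inter>\<U>\<inter>carrier G \<lhd> G" "fidx G (carrier G) (\<Inter>\<U>\<inter>carrier G)"
  using insert by (auto simp: fin_normal_def)
 have "\<Inter>(insert U \<U>)\<inter>carrier G = U\<inter>(\<Inter>\<U>\<inter>carrier G)" by auto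
 moreover have "U\<inter>(\<Inter>\<U>\<inter>carrier G) \<lhd> G"
 proof (rule normal_invI)
  show "subgroup (U\<inter>(\<Inter>\<U>\<inter>carrier G)) G"
   using U(1) V(1) by (simp add: normal_imp_subgroup subgroups_Inter_pair)
  show "x\<otimes>h\<otimes>inv x\<in>U\<inter>(\<Inter>\<U>\<inter>carrier G)"
   if "h\<in>U\<inter>(\<Inter>\<U>\<inter>carrier G)" "x\<in>carrier G" for h x
   using normal.inv_op_closed2[OF U(1) that(2)] normal.inv_op_closed2[OF V(1) that(2)] that by blast
 qed
 ultimately show ?case
  using fidx_Int[OF U(2) V(2)] U(1) V(1) by (simp add: fin_normal_def normal_imp_subgroup)
qed

lemma (in group) hom_kernel_fin_normal:
 assumes "group K" "h\<in>hom G K" "finite (h ` carrier G)"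
 shows "fin_normal G (kernel G K h)"
proof -
 have gh: "group_hom G K h" using assms by (simp add: group_hom_def group_hom_axioms_def group_axioms)
 have "h (inv b\<otimes>a) = \<one>\<^bsub>K\<^esub>" if "a\<in>carrier G" "b\<in>carrier G" "h a = h b" for a b
  using that group_hom.hom_mult[OF gh, of "inv b" a] group_hom.hom_inv[OF gh, of b]
   group_hom.hom_closed[OF gh, of b] group.l_inv[OF assms(1)] by simp
 then have "fidx G (carrier G) (kernel G K h)"
  by (intro fidxI[OF _ assms(3)]) (auto simp: kernel_def)
 then show ?thesis using group_hom.normal_kernel[OF gh] by (simp add: fin_normal_def)
qed

lemma residually_finite_alt:
 assumes "group G"
 shows "residually_finite G \<longleftrightarrow>
  (\<forall>g\<in>carrier G. g ~= \<one>\<^bsub>G\<^esub> --> (\<exists>N. fin_normal G N\<and>g\<notin>N))"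
 unfolding residually_finite_def fin_normal_def using group.finite_Mod_iff[OF assms] by metis

subsection \<open>Permutation groups\<close>

text \<open>Permutations are total functions fixing the complement of \<open>Y\<close>, so products
  are plain compositions and equations can be evaluated at every point without membership
  conditions.\<close>

definition permgrp :: "'x set => ('x => 'x) monoid" where
 "permgrp Y = (|carrier = {f. f permutes Y}, monoid.mult = (\<circ>), monoid.one = id|)"

lemma permgrp_simps [simp]:
 "f\<in>carrier (permgrp Y)\<longleftrightarrow>f permutes Y"
 "f \<otimes>\<^bsub>permgrp Y\<^esub> g = f\<circ>g"
 "\<one>\<^bsub>permgrp Y\<^esub> = id"
 by (auto simp: permgrp_def)

lemma group_permgrp [simp]: "group (permgrp Y)"
proof (rule groupI)
 fix f assume "f\<in>carrier (permgrp Y)"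
 then show "\<exists>g\<in>carrier (permgrp Y). g \<otimes>\<^bsub>permgrp Y\<^esub> f = \<one>\<^bsub>permgrp Y\<^esub>"
  by (intro bexI[of _ "inv_into UNIV f"]) (simp_all add: permutes_inv_o permutes_inv)
qed (auto intro: permutes_compose)

lemma finite_permgrp: "finite Y ==> finite (carrier (permgrp Y))"
 by (simp add: permgrp_def finite_permutations)

section \<open>Presented groups\<close>

definition weval :: "('k, 'b) monoid_scheme => ('a => 'k) => 'a word => 'k" where
 "weval K f w = foldr (%(a, b) k. (if b then f a else inv\<^bsub>K\<^esub> f a) \<otimes>\<^bsub>K\<^esub> k) w \<one>\<^bsub>K\<^esub>"

lemma weval_simps [simp]:
 "weval K f [] = \<one>\<^bsub>K\<^esub>"
 "weval K f ((a, b) # w) = (if b then f a else inv\<^bsub>K\<^esub> f a) \<otimes>\<^bsub>K\<^esub> weval K f w"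
 by (simp_all add: weval_def)

lemma words_simps [simp]:
 "[]\<in>words S" "(a, b) # w\<in>words S\<longleftrightarrow>a\<in>S\<and>w\<in>words S"
 "u @ w\<in>words S\<longleftrightarrow>u\<in>words S\<and>w\<in>words S"
 by (auto simp: words_def)

context group
begin

lemma weval_closed [simp]: "f\<in>S \<rightarrow> carrier G ==> w\<in>words S ==> weval G f w\<in>carrier G"
 by (induction w) (auto simp: Pi_iff)

lemma weval_append:
 "f\<in>S \<rightarrow> carrier G ==> u\<in>words S ==> w\<in>words S ==>
  weval G f (u @ w) = weval G f u\<otimes>weval G f w"
 by (induction u) (auto simp: m_assoc Pi_iff)

lemma weval_pres_rel:
 assumes "f\<in>S \<rightarrow> carrier G" "!!r. r\<in>R ==> r\<in>words S ==> weval G f r = \<one>"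
  and "(u, v)\<in>pres_rel S R"
 shows "weval G f u = weval G f v"
 using assms(3)
proof (induction rule: pres_rel.induct)
 case (cancel u v a b)
 then have "f a\<in>carrier G" "weval G f v\<in>carrier G" "weval G f u\<in>carrier G" using assms(1) by auto
 with cancel show ?case by (simp add: weval_append[OF assms(1)])
next
 case (relator u v r)
 then have "weval G f v\<in>carrier G" "weval G f u\<in>carrier G" using assms(1) by auto
 with relator show ?case by (simp add: weval_append[OF assms(1)] assms(2))
qed auto

end

definition pgen :: "'a set => 'a word set => 'a => 'a word set" where
 "pgen S R a = pres_rel S R `` {[(a, True)]}"

lemma presented_group_class_closed: "u\<in>words S ==> pres_rel S R `` {u}\<in>carrier (presented_group S R)"
 by (simp add: presented_group_def quotientI)

lemma pgen_closed: "a\<in>S ==> pgen S R a\<in>carrier (presented_group S R)"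
 by (simp add: pgen_def presented_group_class_closed)

lemma pgen_inv:
 assumes "a\<in>S"
 shows "inv\<^bsub>presented_group S R\<^esub> pgen S R a = pres_rel S R `` {[(a, False)]}"
proof (rule group.inv_equality[OF group_presented_group])
 have "([] @ [(a, False), (a, \<not> False)] @ [], [] @ [])\<in>pres_rel S R"
  by (rule pres_rel.cancel) (use assms in auto)
 then have "pres_rel S R `` {[(a, False), (a, True)]} = pres_rel S R `` {[]}"
  by (intro equiv_class_eq[OF equiv_pres_rel]) simp
 then show "pres_rel S R `` {[(a, False)]} \<otimes>\<^bsub>presented_group S R\<^esub> pgen S R a = \<one>\<^bsub>presented_group S R\<^esub>"
  using assms by (simp add: pgen_def presented_group_mult) (simp add: presented_group_def)
qed (use assms in \<open>simp_all add: pgen_closed presented_group_class_closed\<close>)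

lemma weval_pgen:
 "u\<in>words S ==> weval (presented_group S R) (pgen S R) u = pres_rel S R `` {u}"
proof (induction u)
 case Nil
 then show ?case by (simp add: presented_group_def)
next
 case (Cons l u)
 obtain a b where "l = (a, b)" by (cases l)
 with Cons show ?case
  using presented_group_mult[of "[(a, b)]" S u R] pgen_inv[of a S R] by (cases b) (simp_all add: pgen_def)
qed

lemma weval_relator:
 assumes "r\<in>R" "r\<in>words S"
 shows "weval (presented_group S R) (pgen S R) r = \<one>\<^bsub>presented_group S R\<^esub>"
proof -
 have "([] @ r @ [], [] @ [])\<in>pres_rel S R" by (rule pres_rel.relator) (use assms in auto)
 then have "pres_rel S R `` {r} = pres_rel S R `` {[]}"
  by (intro equiv_class_eq[OF equiv_pres_rel]) simp
 then show ?thesis using assms by (simp add: weval_pgen) (simp add: presented_group_def)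
qed

lemma presented_group_induct [consumes 1, case_names one gen inv]:
 assumes "g\<in>carrier (presented_group S R)"
  and "P \<one>\<^bsub>presented_group S R\<^esub>"
  and "!!a g. a\<in>S ==> g\<in>carrier (presented_group S R) ==> P g ==>
     P (pgen S R a \<otimes>\<^bsub>presented_group S R\<^esub> g)"
  and "!!a g. a\<in>S ==> g\<in>carrier (presented_group S R) ==> P g ==>
     P (inv\<^bsub>presented_group S R\<^esub> pgen S R a \<otimes>\<^bsub>presented_group S R\<^esub> g)"
 shows "P g"
proof -
 obtain u where u: "u\<in>words S" "g = pres_rel S R `` {u}"
  using assms(1) by (auto simp: presented_group_def elim: quotientE)
 have "P (weval (presented_group S R) (pgen S R) u)"
  using u(1)
 proof (induction u)
  case (Cons l u)
  obtain a b where "l = (a, b)" by (cases l)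
  with Cons show ?case
   using assms(3,4)[of a "weval (presented_group S R) (pgen S R) u"]
   by (auto simp: weval_pgen presented_group_class_closed)
 qed (use assms(2) in simp)
 then show ?thesis using u by (simp add: weval_pgen)
qed

theorem presented_group_hom:
 assumes K: "group K" and f: "f\<in>S \<rightarrow> carrier K"
  and rel: "!!r. r\<in>R ==> r\<in>words S ==> weval K f r = \<one>\<^bsub>K\<^esub>"
 obtains h where "h\<in>hom (presented_group S R) K" "!!a. a\<in>S ==> h (pgen S R a) = f a"
proof -
 \<comment> \<open>A class is evaluated at an arbitrary word in it; \<open>weval_pres_rel\<close>
   makes the value independent of the choice.\<close>
 define h where "h C = weval K f (SOME u. u\<in>C)" for C
 have h: "h (pres_rel S R `` {u}) = weval K f u" if "u\<in>words S" for u
 proof -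
  have "u\<in>pres_rel S R `` {u}" using that by (auto intro: pres_rel.refl)
  then have "(SOME v. v\<in>pres_rel S R `` {u})\<in>pres_rel S R `` {u}" by (rule someI)
  then have "(u, SOME v. v\<in>pres_rel S R `` {u})\<in>pres_rel S R" by blast
  from group.weval_pres_rel[OF K f rel this] show ?thesis by (simp add: h_def)
 qed
 show thesis
 proof (rule that)
  show "h\<in>hom (presented_group S R) K"
  proof (rule homI)
   fix C D assume "C\<in>carrier (presented_group S R)" "D\<in>carrier (presented_group S R)"
   then obtain u v where "u\<in>words S" "C = pres_rel S R `` {u}" "v\<in>words S" "D = pres_rel S R `` {v}"
    by (auto simp: presented_group_def elim!: quotientE)
   then show "h (C \<otimes>\<^bsub>presented_group S R\<^esub> D) = h C \<otimes>\<^bsub>K\<^esub> h D"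
    by (simp add: presented_group_mult h group.weval_append[OF K f])
  next
   fix C assume "C\<in>carrier (presented_group S R)"
   then obtain u where "u\<in>words S" "C = pres_rel S R `` {u}"
    by (auto simp: presented_group_def elim!: quotientE)
   then show "h C\<in>carrier K" by (simp add: h group.weval_closed[OF K f])
  qed
  fix a assume "a\<in>S"
  then have "f a\<in>carrier K" using f by auto
  then show "h (pgen S R a) = f a"
   using \<open>a\<in>S\<close> K by (simp add: pgen_def h monoid.r_one group.is_monoid)
 qed
qed

section \<open>Trees\<close>

definition uadj :: "('v, 'e) pre_digraph => 'e set => ('v\<times>'v) set" where
 "uadj D F = (\<Union>e\<in>F. {(tail D e, head D e), (head D e, tail D e)})"

lemma sym_uadj: "sym (uadj D F)" by (auto simp: sym_def uadj_def)

lemma (in wf_digraph) connected_uadj: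
 "connected G\<longleftrightarrow>verts G ~= {}\<and>(\<forall>u\<in>verts G. \<forall>v\<in>verts G. (u, v)\<in>(uadj G (arcs G))\<^sup>*)"
proof -
 have eq: "(arcs_ends G)\<^sup>s = uadj G (arcs G)"
  by (auto simp: symcl_def uadj_def arcs_ends_conv)
 have "(u, v)\<in>rtrancl_on (verts G) (uadj G (arcs G))\<longleftrightarrow>(u, v)\<in>(uadj G (arcs G))\<^sup>*"
  if "u\<in>verts G" "v\<in>verts G" for u v
 proof
  assume "(u, v)\<in>(uadj G (arcs G))\<^sup>*"
  then show "(u, v)\<in>rtrancl_on (verts G) (uadj G (arcs G))"
   by (rule rtrancl_consistent_rtrancl_on[OF _ that]) (auto simp: uadj_def)
 qed (rule rtrancl_on_rtranclI)
 then show ?thesis unfolding connected_conv eq by blast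
qed

section \<open>Simple paths and circuits in undirected graphs\<close>

fun simple_path :: "('v, 'e) pre_digraph => 'e set => 'v => ('e\<times>bool) list => 'v => bool" where
 "simple_path D F u [] w\<longleftrightarrow>u = w"
| "simple_path D F u (x # p) w\<longleftrightarrow>fst x\<in>F\<and>or_start D x = u\<and>fst x\<notin>fst ` set p \<and>
   u\<notin>set (map (or_start D) p)\<and>u ~= w\<and>simple_path D F (or_end D x) p w"

lemma simple_path_suffix:
 "simple_path D F u p w ==> z\<in>set (map (or_start D) p) ==> \<exists>q. simple_path D F z q w"
proof (induction p arbitrary: u)
 case (Cons x p)
 show ?case
 proof (cases "z = u")
  case True
  then show ?thesis using Cons.prems(1) by blast
 next
  case False
  then show ?thesis using Cons by auto
 qed
qed simp

lemma simple_path_ends: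
 "simple_path D F u p w ==> (e, b)\<in>set p ==>
  tail D e\<in>insert w (set (map (or_start D) p))\<and>head D e\<in>insert w (set (map (or_start D) p))"
proof (induction p arbitrary: u)
 case (Cons x p)
 have start: "or_end D x\<in>insert w (set (map (or_start D) p))"
  using Cons.prems(1) by (cases p) auto
 show ?case
 proof (cases "(e, b) = x")
  case True
  then have "tail D e\<in>{or_start D x, or_end D x}" "head D e\<in>{or_start D x, or_end D x}"
   by (auto split: if_splits)
  moreover have "{or_start D x, or_end D x}\<subseteq>insert w (set (map (or_start D) (x # p)))"
   using start by (simp, blast)
  ultimately show ?thesis by blast
 next
  case False
  then show ?thesis using Cons by auto
 qed
qed simp

text \<open>Loop erasure: if the new starting vertex already lies on the path, the suffix from there
  is taken. Otherwise the new edge is not on the path either, since both ends of every edge of the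
  path are among its vertices.\<close>

lemma rtrancl_uadj_simple_path:
 assumes "(u, w)\<in>(uadj D F)\<^sup>*"
 shows "\<exists>p. simple_path D F u p w"
 using assms
proof (induction rule: converse_rtrancl_induct)
 case base
 show ?case by (rule exI[of _ "[]"]) simp
next
 case (step u u')
 then obtain p where p: "simple_path D F u' p w" by blast
 from step(1) obtain x where x: "fst x\<in>F" "or_start D x = u" "or_end D x = u'"
  unfolding uadj_def
  by (auto intro: that[of "(_, True)"] that[of "(_, False)"])
 consider "u = w" | "u\<in>set (map (or_start D) p)" | "u ~= w" "u\<notin>set (map (or_start D) p)" by blast
 then show ?case
 proof cases
  case 1
  then show ?thesis by (intro exI[of _ "[]"]) simp
 next
  case 2
  then show ?thesis using simple_path_suffix[OF p] by blast
 next
  case 3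
  have "fst x\<notin>fst ` set p"
  proof
   assume "fst x\<in>fst ` set p"
   then obtain b where "(fst x, b)\<in>set p" by force
   from simple_path_ends[OF p this] x(2) 3 show False
    by (cases x) (auto split: if_splits)
  qed
  then show ?thesis using p x 3 by (intro exI[of _ "x # p"]) auto
 qed
qed

lemma simple_path_props:
 assumes "simple_path D F u p w"
 shows "fst ` set p\<subseteq>F" "distinct (map fst p)" "distinct (map (or_start D) p)"
  "w\<notin>set (map (or_start D) p)" "p ~= [] ==> or_start D (hd p) = u\<and>or_end D (last p) = w"
  "p = [] ==> u = w" "\<forall>i. Suc i < length p --> or_end D (p ! i) = or_start D (p ! Suc i)"
 using assms
proof (induction p arbitrary: u)
 case (Cons x p)
 {
  case 7
  then have sp: "simple_path D F (or_end D x) p w" by simp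
  show ?case
  proof (intro allI impI)
   fix i assume i: "Suc i < length (x # p)"
   show "or_end D ((x # p) ! i) = or_start D ((x # p) ! Suc i)"
   proof (cases i)
    case 0
    then show ?thesis using i sp by (cases p) auto
   next
    case (Suc j)
    then show ?thesis using i Cons.IH(7)[OF sp] by auto
   qed
  qed
 next
  case 4
  then have "w ~= or_start D x" "w\<notin>set (map (or_start D) p)"
   using Cons.IH(4)[of "or_end D x"] by auto
  then show ?case by auto
 next
  case 5
  then show ?case using Cons.IH(5,6)[of "or_end D x"] by auto
 }
qed (auto simp: image_iff)

lemma simple_path_circuit:
 assumes "simple_path D F (head D e) p (tail D e)" "e\<notin>F" "e\<in>arcs D" "F\<subseteq>arcs D"
 shows "undirected_circuit D ((e, True) # p)"
proof -
 note pr = simple_path_props[OF assms(1)]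
 have "or_end D (((e, True) # p) ! i) = or_start D (((e, True) # p) ! Suc i)"
  if "Suc i < length ((e, True) # p)" for i
 proof (cases i)
  case 0
  then show ?thesis using that pr(5) by (cases p) auto
 next
  case (Suc j)
  then show ?thesis using that pr(7) by auto
 qed
 moreover have "or_end D (last ((e, True) # p)) = tail D e" using pr(5,6) by (cases "p = []") auto
 moreover have "e\<notin>set (map fst p)" using pr(1) assms(2) by auto
 ultimately show ?thesis unfolding undirected_circuit_def using pr assms by auto
qed

text \<open>Induction on the set of edges. A new edge joins two components of the forest;
  multiplying \<theta> on the right by a constant on one of them repairs the equation at the new
  edge and respects the old ones, because \<open>s\<close> acts from the left.\<close>

lemma (in group) tree_potential:
 assumes "finite F" "F\<subseteq>arcs D" "\<nexists>p. undirected_circuit D p" "s\<in>F \<rightarrow> carrier G"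
 shows "\<exists>\<theta>. (\<forall>v. \<theta> v\<in>carrier G)\<and>(\<forall>e\<in>F. \<theta> (head D e) = s e\<otimes>\<theta> (tail D e))"
 using assms(1,2,4)
proof (induction F rule: finite_induct)
 case empty
 then show ?case by (intro exI[of _ "%_. \<one>"]) simp
next
 case (insert e F)
 then obtain \<theta> where \<theta>: "!!v. \<theta> v\<in>carrier G" "!!f. f\<in>F ==> \<theta> (head D f) = s f\<otimes>\<theta> (tail D f)"
  using insert.IH by (metis (no_types, lifting) Pi_split_insert_domain insert_subset)
 have se: "s f\<in>carrier G" if "f\<in>insert e F" for f using insert that by blast
 define C where "C = {v. (head D e, v)\<in>(uadj D F)\<^sup>*}"
 \<comment> \<open>Otherwise a simple path in \<open>F\<close> would close up with \<open>e\<close>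
   to a circuit.\<close>
 have tl: "tail D e\<notin>C"
 proof
  assume "tail D e\<in>C"
  then have "(head D e, tail D e)\<in>(uadj D F)\<^sup>*" by (simp add: C_def)
  from rtrancl_uadj_simple_path[OF this]
  obtain p where "simple_path D F (head D e) p (tail D e)" by blast
  from simple_path_circuit[OF this] insert assms(3) show False by auto
 qed
 have hd: "head D e\<in>C" by (simp add: C_def)
 have C: "head D f\<in>C\<longleftrightarrow>tail D f\<in>C" if "f\<in>F" for f
 proof -
  have "(tail D f, head D f)\<in>uadj D F" "(head D f, tail D f)\<in>uadj D F"
   using that by (auto simp: uadj_def)
  then show ?thesis unfolding C_def by (auto intro: rtrancl_into_rtrancl)
 qed
 \<comment> \<open>The constant forced by the equation at \<open>e\<close> when the value at its
   tail is kept.\<close>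
 define k where "k = inv (\<theta> (head D e))\<otimes>s e\<otimes>\<theta> (tail D e)"
 have kc: "k\<in>carrier G" using \<theta>(1) se by (simp add: k_def)
 show ?case
 proof (intro exI[of _ "%v. if v\<in>C then \<theta> v\<otimes>k else \<theta> v"] conjI allI ballI)
  fix f assume f: "f\<in>insert e F"
  show "(if head D f\<in>C then \<theta> (head D f)\<otimes>k else \<theta> (head D f)) =
   s f\<otimes>(if tail D f\<in>C then \<theta> (tail D f)\<otimes>k else \<theta> (tail D f))"
  proof (cases "f = e")
   case True
   then show ?thesis using hd tl \<theta>(1) se by (simp add: k_def m_assoc)
  next
   case False
   then have "f\<in>F" using f by simp
   then show ?thesis using C[of f] \<theta> se[OF f] kc by (simp add: m_assoc)
  qed
 qed (use \<theta> kc in simp)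
qed

text \<open>If a vertex were missing, some edge would leave the tree. Adding it with its new end
  \<open>b\<close> keeps connectedness and creates no circuit, since the new edge is the only one at
  \<open>b\<close>; this contradicts maximality.\<close>

lemma maximal_subtree_spanning:
 assumes X: "wf_digraph X" "connected X" and T: "maximal_subtree T X"
 shows "verts T = verts X"
proof (rule ccontr)
 have sub: "subgraph T X" and tree: "connected T" "\<nexists>p. undirected_circuit T p"
  and mx: "!!H. H ~= T ==> subgraph T H ==> subgraph H X ==> \<not> undirected_tree H"
  using T by (auto simp: maximal_subtree_def pre_digraph.max_subgraph_def undirected_tree_def)
 have T_X: "verts T\<subseteq>verts X" "arcs T\<subseteq>arcs X" "tail T = tail X" "head T = head X" "wf_digraph T"
  using sub by (auto simp: subgraph_def compatible_def)
 assume "verts T ~= verts X"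
 then obtain z where z: "z\<in>verts X" "z\<notin>verts T" using T_X by blast
 obtain u where u: "u\<in>verts T" using tree(1) wf_digraph.connected_uadj[OF T_X(5)] by blast
 have "(u, z)\<in>(uadj X (arcs X))\<^sup>*"
  using u z T_X X wf_digraph.connected_uadj[OF X(1)] by blast
 then have "\<exists>a b. (a, b)\<in>uadj X (arcs X)\<and>a\<in>verts T\<and>b\<notin>verts T"
  using u z(2) by (induction rule: converse_rtrancl_induct) blast+
 then obtain a b where ab: "(a, b)\<in>uadj X (arcs X)" "a\<in>verts T" "b\<notin>verts T" by blast
 then obtain e where e: "e\<in>arcs X" "{tail X e, head X e} = {a, b}" by (auto simp: uadj_def)
 have bX: "b\<in>verts X" using e wf_digraph.tail_in_verts[OF X(1) e(1)]
   wf_digraph.head_in_verts[OF X(1) e(1)] by (auto simp: doubleton_eq_iff)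
 define H where "H = T(|verts := insert b (verts T), arcs := insert e (arcs T)|)"
 have H: "verts H = insert b (verts T)" "arcs H = insert e (arcs T)" "tail H = tail X" "head H = head X"
  using T_X by (simp_all add: H_def)
 have ends: "tail X f\<in>verts T" "head X f\<in>verts T" if "f\<in>arcs T" for f
  using wf_digraph.tail_in_verts[OF T_X(5) that] wf_digraph.head_in_verts[OF T_X(5) that] T_X by auto
 have wfH: "wf_digraph H"
  by unfold_locales (use ends e ab in \<open>auto simp: H doubleton_eq_iff\<close>)
 have sH: "subgraph T H" "subgraph H X"
  using T_X bX e wfH X(1) by (auto simp: subgraph_def compatible_def H)
 have "H ~= T" using H ab by auto
 have adjT: "uadj T (arcs T)\<subseteq>uadj H (arcs H)" using H T_X by (auto simp: uadj_def)
 have "(a, v)\<in>(uadj H (arcs H))\<^sup>*" if "v\<in>insert b (verts T)" for v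
 proof (cases "v = b")
  case True
  have "(a, b)\<in>uadj H (arcs H)" using e by (auto simp: uadj_def H doubleton_eq_iff)
  then show ?thesis using True by auto
 next
  case False
  then have "(a, v)\<in>(uadj T (arcs T))\<^sup>*"
   using that ab tree(1) wf_digraph.connected_uadj[OF T_X(5)] by auto
  then show ?thesis using rtrancl_mono[OF adjT] by blast
 qed
 moreover have "sym ((uadj H (arcs H))\<^sup>*)" by (simp add: sym_uadj sym_rtrancl)
 ultimately have "connected H"
  unfolding wf_digraph.connected_uadj[OF wfH] H by (meson insertI1 insert_not_empty rtrancl_trans symD)
 moreover have "\<not> undirected_circuit H p" for p
 proof
  assume p: "undirected_circuit H p"
  have eb: "f = e" if "f\<in>arcs H" "tail X f = b\<or>head X f = b" for f
   using that ends[of f] ab(3) by (auto simp: H)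
  have nloop: "tail X e ~= head X e" using e ab by (auto simp: doubleton_eq_iff)
  have pH: "fst (p ! i)\<in>arcs H" if "i < length p" for i
   using p that by (auto simp: undirected_circuit_def subset_iff)
  have dist: "distinct (map fst p)" using p by (auto simp: undirected_circuit_def)
  have same: "i = j" if "i < length p" "j < length p" "fst (p ! i) = e" "fst (p ! j) = e" for i j
   using dist that by (metis distinct_conv_nth length_map nth_map)
  \<comment> \<open>The cyclic successor of an index, as the circuit closes up after its last
    edge.\<close>
  let ?n = "%i. if Suc i < length p then Suc i else 0"
  have nxt: "or_end H (p ! i) = or_start H (p ! ?n i)" if "i < length p" for i
  proof (cases "Suc i < length p")
   case False
   then have "i = length p - 1" using that by simp
   moreover have "or_end H (last p) = or_start H (hd p)" "p ~= []"
    using p by (simp_all add: undirected_circuit_def)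
   ultimately show ?thesis using False by (simp add: last_conv_nth hd_conv_nth)
  qed (use p in \<open>auto simp: undirected_circuit_def\<close>)
  \<comment> \<open>A circuit entering \<open>b\<close> must leave it along the same edge
    \<open>e\<close>; distinctness of its edges then makes \<open>e\<close> a loop, but its two ends
    are different.\<close>
  have nothb: "or_end H (p ! i) ~= b" if i: "i < length p" for i
  proof
   assume en: "or_end H (p ! i) = b"
   have n: "?n i < length p" using i by auto
   have 1: "fst (p ! i) = e" using eb[OF pH[OF i]] en by (cases "p ! i") (auto simp: H split: if_splits)
   have st: "or_start H (p ! ?n i) = b" using nxt[OF i] en by simp
   have 2: "fst (p ! ?n i) = e" using eb[OF pH[OF n]] st
    by (cases "p ! ?n i") (auto simp: H split: if_splits)
   have "?n i = i" using same[OF n i 2 1] .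
   then have "or_start H (p ! i) = or_end H (p ! i)" using en st by simp
   then show False using 1 nloop by (cases "p ! i") (auto simp: H split: if_splits)
  qed
  have nothb': "or_start H (p ! i) ~= b" if i: "i < length p" for i
  proof (cases i)
   case 0
   have "length p - 1 < length p" "?n (length p - 1) = 0" using i by auto
   then show ?thesis using nothb[of "length p - 1"] nxt[of "length p - 1"] 0 by auto
  next
   case (Suc j)
   then show ?thesis using nothb[of j] nxt[of j] i by auto
  qed
  have "e\<notin>fst ` set p"
  proof
   assume "e\<in>fst ` set p"
   then obtain i where i: "i < length p" "fst (p ! i) = e" by (auto simp: in_set_conv_nth)
   then show False using nothb[OF i(1)] nothb'[OF i(1)] e
    by (cases "p ! i") (auto simp: H doubleton_eq_iff split: if_splits)
  qed
  then have "fst ` set p\<subseteq>arcs T" using p by (auto simp: undirected_circuit_def H)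
  moreover have oH: "or_start H = or_start T" "or_end H = or_end T"
   using T_X H by (auto simp: fun_eq_iff)
  ultimately have "undirected_circuit T p" using p by (simp add: undirected_circuit_def oH)
  then show False using tree(2) by blast
 qed
 ultimately have "undirected_tree H" by (simp add: undirected_tree_def)
 then show False using mx[OF \<open>H ~= T\<close> sH] by blast
qed

section \<open>The fundamental group of a graph of groups\<close>

type_synonym ('v, 'e, 'g) gel = "('v, 'e, 'g) gog_gen word set"

locale gog_tree = graph_of_groups X Gv Ge \<phi>
 for X :: "('v, 'e) pre_digraph"
  and Gv :: "'v => 'g monoid"
  and Ge :: "'e => 'g set"
  and \<phi> :: "'e => 'g => 'g" +
 fixes T :: "('v, 'e) pre_digraph"
 assumes max_tree: "maximal_subtree T X"
begin

abbreviation PG :: "('v, 'e, 'g) gel monoid" where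
 "PG \<equiv> fundamental_group X Gv Ge \<phi> T"

abbreviation PGmult (infixl "\<cdot>" 70) where "g\<cdot>h \<equiv> g\<otimes>\<^bsub>PG\<^esub>h"
abbreviation PGinv ("iv _" [81] 80) where "iv g \<equiv> inv\<^bsub>PG\<^esub> g"
abbreviation PGone ("\<e>") where "\<e> \<equiv> \<one>\<^bsub>PG\<^esub>"
abbreviation PGcarrier ("\<P>") where "\<P> \<equiv> carrier PG"
abbreviation "Vs \<equiv> verts X"
abbreviation "Ar \<equiv> arcs X"
abbreviation "src \<equiv> tail X"
abbreviation "tgt \<equiv> head X"

definition \<iota> :: "'v => 'g => ('v, 'e, 'g) gel" where
 "\<iota> v a = pgen (gog_gens X Gv) (gog_relators X Gv Ge \<phi> T) (Vert v a)"

definition st :: "'e => ('v, 'e, 'g) gel" where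
 "st e = pgen (gog_gens X Gv) (gog_relators X Gv Ge \<phi> T) (Stable e)"

sublocale G: group PG
 unfolding fundamental_group_def by (rule group_presented_group)

lemma Gv_group: "v\<in>Vs ==> group (Gv v)" by (rule vertex_group)

lemma T_props: "arcs T\<subseteq>Ar" "tail T = src" "head T = tgt" "verts T = Vs" "finite (arcs T)"
 "\<nexists>p. undirected_circuit T p" "Vs ~= {}" "u\<in>Vs ==> v\<in>Vs ==> (u, v)\<in>(uadj X (arcs T))\<^sup>*"
proof -
 have sub: "subgraph T X" and c: "connected T" "\<nexists>p. undirected_circuit T p"
  using max_tree by (auto simp: maximal_subtree_def pre_digraph.max_subgraph_def undirected_tree_def)
 show s: "arcs T\<subseteq>Ar" "tail T = src" "head T = tgt"
  using sub by (auto simp: subgraph_def compatible_def)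
 show v: "verts T = Vs" by (rule maximal_subtree_spanning[OF wf_digraph connected_graph max_tree])
 show "finite (arcs T)" using s(1) finite_arcs finite_subset by blast
 show "\<nexists>p. undirected_circuit T p" by (rule c)
 have T: "wf_digraph T" using sub by (auto simp: subgraph_def)
 have "uadj T (arcs T) = uadj X (arcs T)" using s by (simp add: uadj_def)
 then show "Vs ~= {}" "u\<in>Vs ==> v\<in>Vs ==> (u, v)\<in>(uadj X (arcs T))\<^sup>*"
  using c(1) wf_digraph.connected_uadj[OF T] v by auto
qed

lemma Ge_sub: "e\<in>Ar ==> c\<in>Ge e ==> c\<in>carrier (Gv (src e))"
 using edge_subgroup subgroup.mem_carrier by fastforce

lemma \<phi>_closed: "e\<in>Ar ==> c\<in>Ge e ==> \<phi> e c\<in>carrier (Gv (tgt e))"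
 using image_subgroup subgroup.mem_carrier by fastforce

lemma \<phi>_mult: "e\<in>Ar ==> c\<in>Ge e ==> d\<in>Ge e ==>
  \<phi> e (c \<otimes>\<^bsub>Gv (src e)\<^esub> d) = \<phi> e c \<otimes>\<^bsub>Gv (tgt e)\<^esub> \<phi> e d"
 using edge_iso by (auto simp: iso_def hom_def)

lemma \<phi>_hom: "e\<in>Ar ==> \<phi> e\<in>hom (Gv (src e)(|carrier := Ge e|)) (Gv (tgt e))"
 by (intro homI) (auto simp: \<phi>_mult \<phi>_closed)

lemma edge_group: "e\<in>Ar ==> group (Gv (src e)(|carrier := Ge e|))"
 using edge_subgroup group.subgroup_imp_group Gv_group tail_in_verts by metis

lemma gens: "v\<in>Vs ==> a\<in>carrier (Gv v) ==> Vert v a\<in>gog_gens X Gv"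
 "e\<in>Ar ==> Stable e\<in>gog_gens X Gv"
 by (auto simp: gog_gens_def)

lemma st_closed [simp]: "e\<in>Ar ==> st e\<in>\<P>"
 by (simp add: st_def fundamental_group_def pgen_closed gens)

lemma \<iota>_closed [simp]: "v\<in>Vs ==> a\<in>carrier (Gv v) ==> \<iota> v a\<in>\<P>"
 by (simp add: \<iota>_def fundamental_group_def pgen_closed gens)

lemma relator_PG:
 assumes "r\<in>gog_relators X Gv Ge \<phi> T" "r\<in>words (gog_gens X Gv)"
 shows "weval PG (pgen (gog_gens X Gv) (gog_relators X Gv Ge \<phi> T)) r = \<e>"
 unfolding fundamental_group_def by (rule weval_relator[OF assms])

lemma \<iota>_mult:
 assumes v: "v\<in>Vs" and a: "a\<in>carrier (Gv v)" and b: "b\<in>carrier (Gv v)"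
 shows "\<iota> v (a \<otimes>\<^bsub>Gv v\<^esub> b) = \<iota> v a\<cdot>\<iota> v b"
proof -
 interpret A: group "Gv v" using v by (rule Gv_group)
 have ab: "a \<otimes>\<^bsub>Gv v\<^esub> b\<in>carrier (Gv v)" using a b by simp
 have "[(Vert v a, True), (Vert v b, True), (Vert v (a \<otimes>\<^bsub>Gv v\<^esub> b), False)]\<in>gog_relators X Gv Ge \<phi> T"
  using assms by (auto simp: gog_relators_def)
 from relator_PG[OF this] have "\<iota> v a\<cdot>(\<iota> v b\<cdot>iv \<iota> v (a \<otimes>\<^bsub>Gv v\<^esub> b)) = \<e>"
  using assms ab \<iota>_closed[OF v ab] by (simp add: gens flip: \<iota>_def)
 then have "\<iota> v a\<cdot>\<iota> v b\<cdot>iv \<iota> v (a \<otimes>\<^bsub>Gv v\<^esub> b) = \<e>"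
  using assms ab by (simp add: G.m_assoc)
 then show ?thesis
  using assms ab by (metis G.inv_comm G.inv_equality G.inv_closed G.inv_inv G.m_closed \<iota>_closed)
qed

lemma \<iota>_hom: "v\<in>Vs ==> \<iota> v\<in>hom (Gv v) PG"
 by (intro homI) (auto simp: \<iota>_mult)

lemma \<iota>_group_hom: "v\<in>Vs ==> group_hom (Gv v) PG (\<iota> v)"
 by (simp add: group_hom_def group_hom_axioms_def \<iota>_hom Gv_group G.group_axioms)

lemma \<iota>_one [simp]: "v\<in>Vs ==> \<iota> v \<one>\<^bsub>Gv v\<^esub> = \<e>"
 using group_hom.hom_one[OF \<iota>_group_hom] .

lemma \<iota>_inv: "v\<in>Vs ==> a\<in>carrier (Gv v) ==> \<iota> v (inv\<^bsub>Gv v\<^esub> a) = iv \<iota> v a"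
 using group_hom.hom_inv[OF \<iota>_group_hom] .

lemma st_\<iota>:
 assumes e: "e\<in>Ar" and c: "c\<in>Ge e"
 shows "st e\<cdot>\<iota> (src e) c = \<iota> (tgt e) (\<phi> e c)\<cdot>st e"
proof -
 have cc: "c\<in>carrier (Gv (src e))" "\<phi> e c\<in>carrier (Gv (tgt e))" using assms Ge_sub \<phi>_closed by auto
 have "[(Stable e, True), (Vert (src e) c, True), (Stable e, False), (Vert (tgt e) (\<phi> e c), False)]
   \<in>gog_relators X Gv Ge \<phi> T"
  using assms by (auto simp: gog_relators_def)
 from relator_PG[OF this]
 have "st e\<cdot>(\<iota> (src e) c\<cdot>(iv st e\<cdot>iv \<iota> (tgt e) (\<phi> e c))) = \<e>"
  using e cc by (simp add: gens flip: \<iota>_def st_def)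
 then have "(st e\<cdot>\<iota> (src e) c)\<cdot>iv (\<iota> (tgt e) (\<phi> e c)\<cdot>st e) = \<e>"
  using e cc by (simp add: G.m_assoc G.inv_mult_group)
 then show ?thesis
  using e cc by (metis G.inv_comm G.inv_equality G.inv_closed G.inv_inv G.m_closed \<iota>_closed st_closed
    head_in_verts tail_in_verts)
qed

lemma st_conj:
 assumes e: "e\<in>Ar" and c: "c\<in>Ge e"
 shows "st e\<cdot>\<iota> (src e) c\<cdot>iv st e = \<iota> (tgt e) (\<phi> e c)"
 using assms Ge_sub \<phi>_closed by (simp add: st_\<iota> G.m_assoc)

lemma st_tree: "e\<in>arcs T ==> st e = \<e>"
proof -
 assume e: "e\<in>arcs T"
 then have eE: "e\<in>Ar" using T_props(1) by auto
 have "[(Stable e, True)]\<in>gog_relators X Gv Ge \<phi> T" using e by (auto simp: gog_relators_def)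
 from relator_PG[OF this] show ?thesis using eE by (simp add: gens flip: st_def)
qed

text \<open>The inverse of a vertex letter is again a vertex letter, so only stable letters have a
  case for inverses.\<close>

lemma PG_induct [consumes 1, case_names one vert st inv_st]:
 assumes g: "g\<in>\<P>" and P1: "P \<e>"
  and Pv: "!!v a g. v\<in>Vs ==> a\<in>carrier (Gv v) ==> g\<in>\<P> ==> P g ==> P (\<iota> v a\<cdot>g)"
  and Ps: "!!e g. e\<in>Ar ==> g\<in>\<P> ==> P g ==> P (st e\<cdot>g)"
  and Pi: "!!e g. e\<in>Ar ==> g\<in>\<P> ==> P g ==> P (iv st e\<cdot>g)"
 shows "P g"
 using g unfolding fundamental_group_def
proof (induction rule: presented_group_induct)
 case one
 then show ?case using P1 by (simp add: fundamental_group_def)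
next
 case (gen a g)
 then show ?case using Pv Ps
  unfolding gog_gens_def fundamental_group_def \<iota>_def st_def by blast
next
 case (inv a g)
 then have g: "g\<in>\<P>" by (simp add: fundamental_group_def)
 from inv(1) consider v b where "a = Vert v b" "v\<in>Vs" "b\<in>carrier (Gv v)" | e where "a = Stable e" "e\<in>Ar"
  unfolding gog_gens_def by blast
 then show ?case
 proof cases
  case 1
  interpret A: group "Gv v" using 1 Gv_group by simp
  have "iv \<iota> v b = \<iota> v (inv\<^bsub>Gv v\<^esub> b)" using 1 by (simp add: \<iota>_inv)
  then have "P (iv \<iota> v b\<cdot>g)" using Pv[of v "inv\<^bsub>Gv v\<^esub> b" g] 1 inv g by simp
  then show ?thesis using 1 by (simp add: fundamental_group_def \<iota>_def)
 next
  case 2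
  then show ?thesis using Pi[OF 2(2) g inv(3)] by (simp add: fundamental_group_def st_def)
 qed
qed

definition v0 :: 'v where "v0 = (SOME v. v\<in>Vs)"

lemma v0 [simp]: "v0\<in>Vs" unfolding v0_def using T_props(7) by (simp add: some_in_eq)

text \<open>Since \<open>st e = 1\<close> on the tree, a statement about pairs \<open>(v, g)\<close> that is stable under the
 elementary moves of the path groupoid holds everywhere once it holds at one vertex.\<close>

lemma path_induct:
 assumes v: "v\<in>Vs" and g: "g\<in>\<P>" and u: "u\<in>Vs" "Q u \<e>"
  and Qv: "!!v a g. v\<in>Vs ==> a\<in>carrier (Gv v) ==> g\<in>\<P> ==> Q v g ==> Q v (\<iota> v a\<cdot>g)"
  and Qs: "!!e g. e\<in>Ar ==> g\<in>\<P> ==> Q (src e) g ==> Q (tgt e) (st e\<cdot>g)"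
  and Qi: "!!e g. e\<in>Ar ==> g\<in>\<P> ==> Q (tgt e) g ==> Q (src e) (iv st e\<cdot>g)"
 shows "Q v g"
proof -
 have step: "Q b g" if "(a, b)\<in>uadj X (arcs T)" "Q a g" "g\<in>\<P>" for a b g
 proof -
  from that obtain e where e: "e\<in>arcs T" "(a, b) = (src e, tgt e)\<or>(a, b) = (tgt e, src e)"
   by (auto simp: uadj_def)
  then have "e\<in>Ar" "st e = \<e>" using T_props(1) st_tree by auto
  then show ?thesis using e(2) Qs[of e g] Qi[of e g] that by auto
 qed
 have walk: "Q w g" if "u\<in>Vs" "w\<in>Vs" "Q u g" "g\<in>\<P>" for u w g
  using T_props(8)[OF that(1,2)]
  by (induction rule: rtrancl_induct) (use that step in auto)
 have "\<forall>v\<in>Vs. Q v g"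
  using g
 proof (induction rule: PG_induct)
  case one
  then show ?case using walk[OF u(1) _ u(2)] by simp
 next
  case (vert v a g)
  then show ?case using walk[OF vert(1) _ Qv[OF vert(1-3)]] by simp
 next
  case (st e g)
  then show ?case using walk[OF _ _ Qs[OF st(1,2)]] by simp
 next
  case (inv_st e g)
  then show ?case using walk[OF _ _ Qi[OF inv_st(1,2)]] by simp
 qed
 then show ?thesis using v by blast
qed

definition compat :: "('k, 'b) monoid_scheme => ('v => 'g => 'k) => ('e => 'k) => bool" where
 "compat K \<alpha> s\<longleftrightarrow>(\<forall>v\<in>Vs. \<alpha> v\<in>hom (Gv v) K)\<and>s\<in>Ar \<rightarrow> carrier K \<and>
   (\<forall>e\<in>Ar. \<forall>c\<in>Ge e. s e \<otimes>\<^bsub>K\<^esub> \<alpha> (src e) c = \<alpha> (tgt e) (\<phi> e c) \<otimes>\<^bsub>K\<^esub> s e)"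

text \<open>Compatible data need not be trivial on the tree; the gauge \<open>\<theta>\<close> corrects for this.\<close>

lemma transport:
 assumes K: "group K" and c: "compat K \<alpha> s"
 obtains \<rho> \<theta> where "\<rho>\<in>hom PG K" "!!v. v\<in>Vs ==> \<theta> v\<in>carrier K" "\<theta> v0 = \<one>\<^bsub>K\<^esub>"
  "!!v a. v\<in>Vs ==> a\<in>carrier (Gv v) ==> \<theta> v \<otimes>\<^bsub>K\<^esub> \<rho> (\<iota> v a) = \<alpha> v a \<otimes>\<^bsub>K\<^esub> \<theta> v"
  "!!e. e\<in>Ar ==> \<theta> (tgt e) \<otimes>\<^bsub>K\<^esub> \<rho> (st e) = s e \<otimes>\<^bsub>K\<^esub> \<theta> (src e)"
proof -
 interpret K: group K by fact
 have al: "\<alpha> v a\<in>carrier K" if "v\<in>Vs" "a\<in>carrier (Gv v)" for v a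
  using c that by (auto simp: compat_def hom_def)
 have alm: "\<alpha> v (a \<otimes>\<^bsub>Gv v\<^esub> b) = \<alpha> v a \<otimes>\<^bsub>K\<^esub> \<alpha> v b"
  if "v\<in>Vs" "a\<in>carrier (Gv v)" "b\<in>carrier (Gv v)" for v a b
  using c that by (auto simp: compat_def hom_def)
 have se: "s e\<in>carrier K" if "e\<in>Ar" for e using c that by (auto simp: compat_def)
 have sc: "s e \<otimes>\<^bsub>K\<^esub> \<alpha> (src e) d = \<alpha> (tgt e) (\<phi> e d) \<otimes>\<^bsub>K\<^esub> s e" if "e\<in>Ar" "d\<in>Ge e" for e d
  using c that by (auto simp: compat_def)
 have "\<exists>\<theta>. (\<forall>v. \<theta> v\<in>carrier K)\<and>(\<forall>e\<in>arcs T. \<theta> (head T e) = s e \<otimes>\<^bsub>K\<^esub> \<theta> (tail T e))"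
  by (rule K.tree_potential[OF T_props(5) order_refl T_props(6)]) (use se T_props(1) in auto)
 then obtain \<theta>' where \<theta>': "!!v. \<theta>' v\<in>carrier K"
  "!!e. e\<in>arcs T ==> \<theta>' (tgt e) = s e \<otimes>\<^bsub>K\<^esub> \<theta>' (src e)"
  using T_props(2,3) by auto
 \<comment> \<open>Right multiplication by a constant keeps the potential equation, so the gauge can
   be normalized at \<open>v0\<close>. Then \<rho> agrees with \<alpha> on the vertex group at
   \<open>v0\<close>.\<close>
 define \<theta> where "\<theta> v = \<theta>' v \<otimes>\<^bsub>K\<^esub> inv\<^bsub>K\<^esub> \<theta>' v0" for v
 have \<theta>: "\<theta> v\<in>carrier K" "\<theta> v0 = \<one>\<^bsub>K\<^esub>" for v using \<theta>' by (simp_all add: \<theta>_def)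
 have \<theta>T: "\<theta> (tgt e) = s e \<otimes>\<^bsub>K\<^esub> \<theta> (src e)" if "e\<in>arcs T" for e
  using that \<theta>' se[of e] T_props(1) by (auto simp: \<theta>_def K.m_assoc)
 \<comment> \<open>Generators are transported to the base vertex along \<theta>; by the potential
   equation the letters of tree edges become trivial.\<close>
 define f where "f x = (case x of Vert v a => inv\<^bsub>K\<^esub> \<theta> v \<otimes>\<^bsub>K\<^esub> \<alpha> v a \<otimes>\<^bsub>K\<^esub> \<theta> v
  | Stable e => inv\<^bsub>K\<^esub> \<theta> (tgt e) \<otimes>\<^bsub>K\<^esub> s e \<otimes>\<^bsub>K\<^esub> \<theta> (src e))" for x
 have f: "f (Vert v a) = inv\<^bsub>K\<^esub> \<theta> v \<otimes>\<^bsub>K\<^esub> (\<alpha> v a \<otimes>\<^bsub>K\<^esub> \<theta> v)"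
   "f (Stable e) = inv\<^bsub>K\<^esub> \<theta> (tgt e) \<otimes>\<^bsub>K\<^esub> (s e \<otimes>\<^bsub>K\<^esub> \<theta> (src e))"
  if "v\<in>Vs" "a\<in>carrier (Gv v)" "e\<in>Ar" for v a e
  using that al se \<theta> by (simp_all add: f_def K.m_assoc)
 have fV: "f (Vert v a) = inv\<^bsub>K\<^esub> \<theta> v \<otimes>\<^bsub>K\<^esub> (\<alpha> v a \<otimes>\<^bsub>K\<^esub> \<theta> v)" if "v\<in>Vs" "a\<in>carrier (Gv v)" for v a
  using that al \<theta> by (simp add: f_def K.m_assoc)
 have fS: "f (Stable e) = inv\<^bsub>K\<^esub> \<theta> (tgt e) \<otimes>\<^bsub>K\<^esub> (s e \<otimes>\<^bsub>K\<^esub> \<theta> (src e))" if "e\<in>Ar" for e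
  using that se \<theta> by (simp add: f_def K.m_assoc)
 have fc: "f\<in>gog_gens X Gv \<rightarrow> carrier K"
  by (auto simp: gog_gens_def fV fS al se \<theta>)
 have rel: "weval K f r = \<one>\<^bsub>K\<^esub>"
  if r: "r\<in>gog_relators X Gv Ge \<phi> T" "r\<in>words (gog_gens X Gv)" for r
 proof -
  consider v g h where "v\<in>Vs" "g\<in>carrier (Gv v)" "h\<in>carrier (Gv v)"
    "r = [(Vert v g, True), (Vert v h, True), (Vert v (g \<otimes>\<^bsub>Gv v\<^esub> h), False)]"
   | e g where "e\<in>Ar" "g\<in>Ge e"
    "r = [(Stable e, True), (Vert (src e) g, True), (Stable e, False), (Vert (tgt e) (\<phi> e g), False)]"
   | e where "e\<in>arcs T" "r = [(Stable e, True)]"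
   using r(1) unfolding gog_relators_def by blast
  then show ?thesis
  proof cases
   case 1
   interpret A: group "Gv v" using 1 Gv_group by simp
   show ?thesis using 1 al \<theta> by (simp add: fV alm K.m_assoc K.inv_mult_group)
  next
   case 2
   have g: "g\<in>carrier (Gv (src e))" "\<phi> e g\<in>carrier (Gv (tgt e))" using 2 Ge_sub \<phi>_closed by auto
   have sg: "s e \<otimes>\<^bsub>K\<^esub> (\<alpha> (src e) g \<otimes>\<^bsub>K\<^esub> x) = \<alpha> (tgt e) (\<phi> e g) \<otimes>\<^bsub>K\<^esub> (s e \<otimes>\<^bsub>K\<^esub> x)"
    if "x\<in>carrier K" for x
    using sc[OF 2(1,2)] that g 2(1) al se by (metis K.m_assoc head_in_verts tail_in_verts)
   show ?thesis using 2 g al \<theta> se by (simp add: fV fS sg K.m_assoc K.inv_mult_group)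
  next
   case 3
   have e: "e\<in>Ar" using 3 T_props(1) by auto
   then show ?thesis using 3 \<theta>(1) \<theta>T[OF 3(1)] by (simp add: fS \<theta>T[symmetric])
  qed
 qed
 obtain \<rho> where \<rho>: "\<rho>\<in>hom (presented_group (gog_gens X Gv) (gog_relators X Gv Ge \<phi> T)) K"
  "!!x. x\<in>gog_gens X Gv ==> \<rho> (pgen (gog_gens X Gv) (gog_relators X Gv Ge \<phi> T) x) = f x"
  using presented_group_hom[OF K fc rel] by blast
 show thesis
 proof (rule that[of \<rho> \<theta>])
  show "\<theta> v\<in>carrier K" "\<theta> v0 = \<one>\<^bsub>K\<^esub>" for v by (rule \<theta>)+
  show r: "\<rho>\<in>hom PG K" using \<rho>(1) by (simp add: fundamental_group_def)
  show "\<theta> v \<otimes>\<^bsub>K\<^esub> \<rho> (\<iota> v a) = \<alpha> v a \<otimes>\<^bsub>K\<^esub> \<theta> v" if "v\<in>Vs" "a\<in>carrier (Gv v)" for v a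
   using that \<theta> al by (simp add: \<iota>_def \<rho>(2) gens fV)
  show "\<theta> (tgt e) \<otimes>\<^bsub>K\<^esub> \<rho> (st e) = s e \<otimes>\<^bsub>K\<^esub> \<theta> (src e)" if "e\<in>Ar" for e
   using that \<theta> se by (simp add: st_def \<rho>(2) gens fS)
 qed
qed

end

section \<open>Extending partial equivariant maps\<close>

lemma hom_permgrpI:
 assumes "group A"
  and cl: "!!a x. a\<in>carrier A ==> x\<in>\<Omega> ==> \<alpha> a x\<in>\<Omega>"
  and out: "!!a x. a\<in>carrier A ==> x\<notin>\<Omega> ==> \<alpha> a x = x"
  and one: "!!x. x\<in>\<Omega> ==> \<alpha> \<one>\<^bsub>A\<^esub> x = x"
  and mult: "!!a b x. a\<in>carrier A ==> b\<in>carrier A ==> x\<in>\<Omega> ==>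
   \<alpha> (a \<otimes>\<^bsub>A\<^esub> b) x = \<alpha> a (\<alpha> b x)"
 shows "\<alpha>\<in>hom A (permgrp \<Omega>)"
proof -
 interpret A: group A by fact
 have m: "\<alpha> (a \<otimes>\<^bsub>A\<^esub> b) = \<alpha> a\<circ>\<alpha> b" if "a\<in>carrier A" "b\<in>carrier A" for a b
 proof
  fix x show "\<alpha> (a \<otimes>\<^bsub>A\<^esub> b) x = (\<alpha> a\<circ>\<alpha> b) x"
   by (cases "x\<in>\<Omega>") (use that mult out in auto)
 qed
 have o: "\<alpha> \<one>\<^bsub>A\<^esub> = id"
 proof
  fix x show "\<alpha> \<one>\<^bsub>A\<^esub> x = id x" by (cases "x\<in>\<Omega>") (use one out in auto)
 qed
 have "\<alpha> a permutes \<Omega>" if a: "a\<in>carrier A" for a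
 proof (rule bij_imp_permutes)
  have "\<alpha> (inv\<^bsub>A\<^esub> a)\<circ>\<alpha> a = id" "\<alpha> a\<circ>\<alpha> (inv\<^bsub>A\<^esub> a) = id"
   using m[of "inv\<^bsub>A\<^esub> a" a] m[of a "inv\<^bsub>A\<^esub> a"] a o by simp_all
  then have "\<alpha> (inv\<^bsub>A\<^esub> a) (\<alpha> a x) = x" "\<alpha> a (\<alpha> (inv\<^bsub>A\<^esub> a) x) = x" for x
   by (simp_all add: fun_eq_iff)
  then show "bij_betw (\<alpha> a) \<Omega> \<Omega>"
   using cl a A.inv_closed[OF a] by (intro bij_betwI[where g = "\<alpha> (inv\<^bsub>A\<^esub> a)"]) auto
 qed (use out a in auto)
 then show ?thesis by (intro homI) (auto simp: m)
qed

lemma card_image_same_kernel: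
 assumes "!!c d. c\<in>A ==> d\<in>A ==> f c = f d\<longleftrightarrow>g c = g d"
 shows "card (f ` A) = card (g ` A)"
proof (rule bij_betw_same_card)
 let ?h = "%y. g (inv_into A f y)"
 have *: "?h (f a) = g a" if "a\<in>A" for a
  using assms[of "inv_into A f (f a)" a] that by (simp add: inv_into_into f_inv_into_f)
 show "bij_betw ?h (f ` A) (g ` A)"
  unfolding bij_betw_def inj_on_def using assms * by (auto simp: image_iff)
qed

lemma countable_infinite_bij:
 assumes "countable A" "infinite A" "countable B" "infinite B"
 shows "\<exists>h. bij_betw h A B"
 using bij_betw_trans[OF to_nat_on_infinite[OF assms(1,2)] bij_betw_inv_into[OF to_nat_on_infinite[OF assms(3,4)]]]
 by blast

lemma bij_betw_extend:
 assumes "M\<subseteq>A" "inj_on g M" "g ` M\<subseteq>B" "bij_betw h (A - M) (B - g ` M)"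
 shows "bij_betw (%x. if x\<in>M then g x else h x) A B"
proof -
 have "bij_betw (%x. if x\<in>M then g x else h x) M (g ` M)"
  using inj_on_imp_bij_betw[OF assms(2)] by (rule bij_betw_cong[THEN iffD1, rotated]) simp
 moreover have "bij_betw (%x. if x\<in>M then g x else h x) (A - M) (B - g ` M)"
  using assms(4) by (rule bij_betw_cong[THEN iffD1, rotated]) simp
 ultimately have "bij_betw (%x. if x\<in>M then g x else h x) (M\<union>(A - M)) (g ` M\<union>(B - g ` M))"
  by (rule bij_betw_combine) blast
 moreover have "M\<union>(A - M) = A" "g ` M\<union>(B - g ` M) = B" using assms by auto
 ultimately show ?thesis by simp
qed

text \<open>The hypothesis \<open>stab\<close> says that one subgroup of \<open>C\<close> is the
  stabilizer of every point for both actions, so all orbits are isomorphic as \<open>C\<close>-sets.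
  An equivariant permutation is then a bijection between orbits with a choice of base points. The
  partial map fixes this on the orbits meeting \<open>D\<close>; the remaining orbits can be matched
  because there are equally many, by counting when \<Omega> is finite and by countable infinity
  otherwise.\<close>

lemma equivariant_extension:
 fixes C :: "('c, 'm) monoid_scheme" and \<Omega> :: "'x set"
 defines "orb \<equiv> %\<beta> p. (%c. (\<beta> :: 'c => 'x => 'x) c p) ` carrier C"
 assumes C: "group C" and hom: "\<beta>\<in>hom C (permgrp \<Omega>)" "\<beta>'\<in>hom C (permgrp \<Omega>)"
  and stab: "!!c p q. c\<in>carrier C ==> p\<in>\<Omega> ==> q\<in>\<Omega> ==> \<beta> c p = p\<longleftrightarrow>\<beta>' c q = q"
  and D: "D\<subseteq>\<Omega>" "f\<in>D \<rightarrow> \<Omega>"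
   "!!p q c. p\<in>D ==> q\<in>D ==> c\<in>carrier C ==> p = \<beta> c q\<longleftrightarrow>f p = \<beta>' c (f q)"
  and size: "finite \<Omega>\<or>(countable \<Omega>\<and>infinite {orb \<beta> p | p. p\<in>\<Omega>\<and>orb \<beta> p\<inter>D = {}} \<and>
   infinite {orb \<beta>' p | p. p\<in>\<Omega>\<and>orb \<beta>' p\<inter>f ` D = {}})"
 shows "\<exists>t. t permutes \<Omega>\<and>(\<forall>p\<in>D. t p = f p)\<and>(\<forall>c\<in>carrier C. t\<circ>\<beta> c = \<beta>' c\<circ>t)"
proof -
 interpret C: group C by fact
 have perm: "\<beta> c permutes \<Omega>" "\<beta>' c permutes \<Omega>" if "c\<in>carrier C" for c
  using hom that by (auto simp: hom_def)
 have mul: "\<beta> (c \<otimes>\<^bsub>C\<^esub> d) p = \<beta> c (\<beta> d p)" "\<beta>' (c \<otimes>\<^bsub>C\<^esub> d) p = \<beta>' c (\<beta>' d p)"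
  if "c\<in>carrier C" "d\<in>carrier C" for c d p
  using hom that by (auto simp: hom_def)
 have one: "\<beta> \<one>\<^bsub>C\<^esub> p = p" "\<beta>' \<one>\<^bsub>C\<^esub> p = p" for p
  using hom_one[OF hom(1) C group_permgrp] hom_one[OF hom(2) C group_permgrp] by simp_all
 have cl: "\<beta> c p\<in>\<Omega>" "\<beta>' c p\<in>\<Omega>" if "c\<in>carrier C" "p\<in>\<Omega>" for c p
  using perm[OF that(1)] that(2) by (simp_all add: permutes_in_image)
 have eqq: "\<beta> c p = \<beta> d p\<longleftrightarrow>\<beta> (inv\<^bsub>C\<^esub> d \<otimes>\<^bsub>C\<^esub> c) p = p"
  "\<beta>' c p = \<beta>' d p\<longleftrightarrow>\<beta>' (inv\<^bsub>C\<^esub> d \<otimes>\<^bsub>C\<^esub> c) p = p"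
  if "c\<in>carrier C" "d\<in>carrier C" for c d p
 proof -
  have "\<beta> d (\<beta> (inv\<^bsub>C\<^esub> d \<otimes>\<^bsub>C\<^esub> c) p) = \<beta> c p" "\<beta>' d (\<beta>' (inv\<^bsub>C\<^esub> d \<otimes>\<^bsub>C\<^esub> c) p) = \<beta>' c p"
   using that by (simp_all flip: mul add: C.m_assoc[symmetric])
  then show "\<beta> c p = \<beta> d p\<longleftrightarrow>\<beta> (inv\<^bsub>C\<^esub> d \<otimes>\<^bsub>C\<^esub> c) p = p"
   "\<beta>' c p = \<beta>' d p\<longleftrightarrow>\<beta>' (inv\<^bsub>C\<^esub> d \<otimes>\<^bsub>C\<^esub> c) p = p"
   using permutes_inj[OF perm(1)[OF that(2)]] permutes_inj[OF perm(2)[OF that(2)]]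
   by (metis injD)+
 qed
 have same: "\<beta> c p = \<beta> d p\<longleftrightarrow>\<beta>' c q = \<beta>' d q"
  if "c\<in>carrier C" "d\<in>carrier C" "p\<in>\<Omega>" "q\<in>\<Omega>" for c d p q
  unfolding eqq[OF that(1,2)] by (rule stab) (use that in auto)
 have orb_self: "p\<in>orb \<beta> p" "p\<in>orb \<beta>' p" for p
  using one by (auto simp: orb_def image_iff intro!: bexI[of _ "\<one>\<^bsub>C\<^esub>"])
 have orb_eq1: "orb \<beta> q = orb \<beta> p" if q: "q\<in>orb \<beta> p" for p q
 proof -
  obtain c where c: "c\<in>carrier C" "q = \<beta> c p" using q by (auto simp: orb_def)
  have p: "p = \<beta> (inv\<^bsub>C\<^esub> c) q" using c one by (simp flip: mul)
  have "\<beta> d q\<in>orb \<beta> p" "\<beta> d p\<in>orb \<beta> q" if "d\<in>carrier C" for d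
  proof -
   show "\<beta> d q\<in>orb \<beta> p" using c that by (auto simp: orb_def simp flip: mul)
   have "\<beta> d p = \<beta> (d \<otimes>\<^bsub>C\<^esub> inv\<^bsub>C\<^esub> c) q" using c that p mul(1) C.inv_closed by metis
   then show "\<beta> d p\<in>orb \<beta> q" using c that by (auto simp: orb_def)
  qed
  then show ?thesis by (auto simp: orb_def)
 qed
 have orb_eq2: "orb \<beta>' q = orb \<beta>' p" if q: "q\<in>orb \<beta>' p" for p q
 proof -
  obtain c where c: "c\<in>carrier C" "q = \<beta>' c p" using q by (auto simp: orb_def)
  have p: "p = \<beta>' (inv\<^bsub>C\<^esub> c) q" using c one by (simp flip: mul)
  have "\<beta>' d q\<in>orb \<beta>' p" "\<beta>' d p\<in>orb \<beta>' q" if "d\<in>carrier C" for d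
  proof -
   show "\<beta>' d q\<in>orb \<beta>' p" using c that by (auto simp: orb_def simp flip: mul)
   have "\<beta>' d p = \<beta>' (d \<otimes>\<^bsub>C\<^esub> inv\<^bsub>C\<^esub> c) q" using c that p mul(2) C.inv_closed by metis
   then show "\<beta>' d p\<in>orb \<beta>' q" using c that by (auto simp: orb_def)
  qed
  then show ?thesis by (auto simp: orb_def)
 qed
 have orb_sub: "orb \<beta> p\<subseteq>\<Omega>" "orb \<beta>' p\<subseteq>\<Omega>" if "p\<in>\<Omega>" for p
  using cl that by (auto simp: orb_def)
 define O1 where "O1 = orb \<beta> ` \<Omega>"
 define O2 where "O2 = orb \<beta>' ` \<Omega>"
 \<comment> \<open>Base points are taken in \<open>D\<close> whenever possible, so that the
   extension can agree with \<open>f\<close> there.\<close>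
 define r where "r Q = (if Q\<inter>D ~= {} then SOME p. p\<in>Q\<inter>D else SOME p. p\<in>Q)" for Q :: "'x set"
 have r: "r Q\<in>Q" "Q\<inter>D ~= {} ==> r Q\<in>D" if Q: "Q\<in>O1" for Q
 proof -
  have "Q ~= {}" using Q orb_self by (auto simp: O1_def)
  then have *: "(SOME p. p\<in>Q)\<in>Q" by (simp add: some_in_eq)
  have **: "(SOME p. p\<in>Q\<inter>D)\<in>Q\<inter>D" if "Q\<inter>D ~= {}" using that by (rule some_in_eq[THEN iffD2])
  show "r Q\<in>Q" using * ** by (cases "Q\<inter>D = {}") (auto simp: r_def)
  show "r Q\<in>D" if "Q\<inter>D ~= {}" using **[OF that] that by (auto simp: r_def)
 qed
 have O1_orb: "orb \<beta> p = Q" if "Q\<in>O1" "p\<in>Q" for p Q using that orb_eq1 by (auto simp: O1_def)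
 have O2_orb: "orb \<beta>' p = Q" if "Q\<in>O2" "p\<in>Q" for p Q using that orb_eq2 by (auto simp: O2_def)
 have O1_sub: "Q\<subseteq>\<Omega>" if "Q\<in>O1" for Q using that orb_sub by (auto simp: O1_def)
 have O2_sub: "Q\<subseteq>\<Omega>" if "Q\<in>O2" for Q using that orb_sub by (auto simp: O2_def)
 define M where "M = {Q\<in>O1. Q\<inter>D ~= {}}"
 define g where "g Q = orb \<beta>' (f (r Q))" for Q
 have MO: "M\<subseteq>O1" by (auto simp: M_def)
 have rM: "r Q\<in>Q" "r Q\<in>D" if "Q\<in>M" for Q using r that by (auto simp: M_def)
 have g_inj: "inj_on g M"
 proof (rule inj_onI)
  fix P Q assume PQ: "P\<in>M" "Q\<in>M" "g P = g Q"
  then have "f (r P)\<in>orb \<beta>' (f (r Q))" using orb_self(2) by (auto simp: g_def)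
  then obtain c where "c\<in>carrier C" "f (r P) = \<beta>' c (f (r Q))" by (auto simp: orb_def)
  then have "r P = \<beta> c (r Q)" "c\<in>carrier C" using D(3) rM PQ by auto
  then have "r P\<in>orb \<beta> (r Q)" by (auto simp: orb_def)
  then show "P = Q" using O1_orb[of P "r P"] O1_orb[of Q "r Q"] orb_eq1 rM PQ MO by (metis subsetD)
 qed
 have g_O2: "g ` M\<subseteq>O2" using rM D(2) by (auto simp: g_def O2_def)
 have gM: "Q\<in>g ` M\<longleftrightarrow>Q\<inter>f ` D ~= {}" if Q: "Q\<in>O2" for Q
 proof
  assume "Q\<in>g ` M"
  then obtain P where "P\<in>M" "Q = orb \<beta>' (f (r P))" by (auto simp: g_def)
  then have "f (r P)\<in>Q" "f (r P)\<in>f ` D" using orb_self(2) rM by auto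
  then show "Q\<inter>f ` D ~= {}" by blast
 next
  assume "Q\<inter>f ` D ~= {}"
  then obtain p where p: "p\<in>D" "f p\<in>Q" by auto
  then have "p\<in>\<Omega>" using D by auto
  then have PM: "orb \<beta> p\<in>M" using p orb_self by (auto simp: M_def O1_def)
  then obtain c where c: "c\<in>carrier C" "r (orb \<beta> p) = \<beta> c p" using rM[OF PM] by (auto simp: orb_def)
  then have "f (r (orb \<beta> p)) = \<beta>' c (f p)" using D(3) p rM[OF PM] by auto
  then have "f (r (orb \<beta> p))\<in>orb \<beta>' (f p)" using c by (auto simp: orb_def)
  then have "g (orb \<beta> p) = Q" using O2_orb[OF Q p(2)] orb_eq2[of "f (r (orb \<beta> p))" "f p"] by (simp add: g_def)
  then show "Q\<in>g ` M" using PM by auto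
 qed
 have "\<exists>h. bij_betw h (O1 - M) (O2 - g ` M)"
  using size
 proof
  assume fin: "finite \<Omega>"
  \<comment> \<open>All orbits of both actions have the size of \<open>C\<close> modulo the common
    stabilizer; the numbers of orbits agree since both families partition \<Omega>.\<close>
  have kk: "card P = card Q" if PQ: "P\<in>O1" "Q\<in>O2" for P Q
  proof -
   obtain p q where "p\<in>\<Omega>" "q\<in>\<Omega>" "P = orb \<beta> p" "Q = orb \<beta>' q" using PQ by (auto simp: O1_def O2_def)
   then have P: "P = (%c. \<beta> c p) ` carrier C" "Q = (%c. \<beta>' c q) ` carrier C" and "p\<in>\<Omega>" "q\<in>\<Omega>"
    by (simp_all add: orb_def)
   then show ?thesis unfolding P by (intro card_image_same_kernel same)
  qed
  have U: "\<Union>O1 = \<Omega>" "\<Union>O2 = \<Omega>" using orb_self orb_sub unfolding O1_def O2_def by blast+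
  have f12: "finite O1" "finite O2" using fin by (simp_all add: O1_def O2_def)
  have "card O1 = card O2"
  proof (cases "\<Omega> = {}")
   case False
   then obtain p where p: "p\<in>\<Omega>" by auto
   let ?k = "card (orb \<beta> p)"
   have pO: "orb \<beta> p\<in>O1" "orb \<beta>' p\<in>O2" using p by (auto simp: O1_def O2_def)
   have k2: "card Q = ?k" if "Q\<in>O2" for Q using kk[OF pO(1) that] by simp
   have k1: "card Q = ?k" if "Q\<in>O1" for Q using kk[OF that pO(2)] k2[OF pO(2)] by simp
   have dj: "\<lbrakk>P\<in>O1; Q\<in>O1; P ~= Q\<rbrakk> \<Longrightarrow> P\<inter>Q = {}" "\<lbrakk>P\<in>O2; Q\<in>O2; P ~= Q\<rbrakk> \<Longrightarrow> P\<inter>Q = {}" for P Q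
    using O1_orb O2_orb by blast+
   have "?k * card O1 = card (\<Union>O1)"
    by (rule card_partition) (use f12 fin U k1 dj in auto)
   moreover have "?k * card O2 = card (\<Union>O2)"
    by (rule card_partition) (use f12 fin U k2 dj in auto)
   moreover have "?k > 0"
    unfolding card_gt_0_iff using orb_self(1)[of p] finite_subset[OF orb_sub(1)[OF p] fin] by blast
   ultimately show ?thesis unfolding U by (metis mult_left_cancel not_gr_zero)
  qed (simp add: O1_def O2_def)
  then have "card (O1 - M) = card (O2 - g ` M)"
   using f12 MO g_O2 by (simp add: card_Diff_subset finite_subset[OF MO] card_image[OF g_inj])
  then show ?thesis using f12 by (intro finite_same_card_bij) auto
 next
  assume inf: "countable \<Omega>\<and>infinite {orb \<beta> p | p. p\<in>\<Omega>\<and>orb \<beta> p\<inter>D = {}} \<and>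
   infinite {orb \<beta>' p | p. p\<in>\<Omega>\<and>orb \<beta>' p\<inter>f ` D = {}}"
  have "O1 - M = {orb \<beta> p | p. p\<in>\<Omega>\<and>orb \<beta> p\<inter>D = {}}" by (auto simp: O1_def M_def)
  moreover have "O2 - g ` M = {orb \<beta>' p | p. p\<in>\<Omega>\<and>orb \<beta>' p\<inter>f ` D = {}}"
  proof -
   have "O2 - g ` M = {Q\<in>O2. Q\<inter>f ` D = {}}" using gM by blast
   also have "\<dots> = {orb \<beta>' p | p. p\<in>\<Omega>\<and>orb \<beta>' p\<inter>f ` D = {}}"
    unfolding O2_def by blast
   finally show ?thesis .
  qed
  moreover have "countable (O1 - M)" "countable (O2 - g ` M)"
   using inf unfolding O1_def O2_def by simp_all
  ultimately show ?thesis
   using inf by (intro countable_infinite_bij) simp_all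
 qed
 then obtain h where h: "bij_betw h (O1 - M) (O2 - g ` M)" by blast
 define F where "F = (%Q. if Q\<in>M then g Q else h Q)"
 have F: "bij_betw F O1 O2" unfolding F_def by (rule bij_betw_extend[OF MO g_inj g_O2 h])
 define r' where "r' Q = (if Q\<in>g ` M then f (r (inv_into M g Q)) else SOME p. p\<in>Q)" for Q
 have r': "r' Q\<in>Q" if Q: "Q\<in>O2" for Q
 proof (cases "Q\<in>g ` M")
  case True
  then obtain P where P: "P\<in>M" "Q = g P" by blast
  then have "r' Q = f (r P)" using True by (simp add: r'_def inv_into_f_f[OF g_inj])
  then show ?thesis using orb_self(2)[of "f (r P)"] P by (simp add: g_def)
 next
  case False
  have "Q ~= {}" using Q orb_self by (auto simp: O2_def)
  then have "(SOME p. p\<in>Q)\<in>Q" by (simp add: some_in_eq)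
  then show ?thesis using False by (simp add: r'_def)
 qed
 have FO: "F Q\<in>O2" if "Q\<in>O1" for Q using F that by (auto simp: bij_betw_def)
 have x\<Omega>: "r' (F Q)\<in>\<Omega>" "r Q\<in>\<Omega>" if "Q\<in>O1" for Q
  using r'[OF FO[OF that]] O2_sub[OF FO[OF that]] r(1)[OF that] O1_sub[OF that] by auto
 \<comment> \<open>The element \<open>c\<close> moving the base point to \<open>p\<close> is unique
   up to the stabilizer, which fixes the image of the base point as well.\<close>
 define t where "t p = (if p\<in>\<Omega> then \<beta>' (SOME c. c\<in>carrier C\<and>p = \<beta> c (r (orb \<beta> p))) (r' (F (orb \<beta> p))) else p)" for p
 have t: "t (\<beta> c (r Q)) = \<beta>' c (r' (F Q))" if c: "c\<in>carrier C" and Q: "Q\<in>O1" for c Q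
 proof -
  have "\<beta> c (r Q)\<in>orb \<beta> (r Q)" using c by (auto simp: orb_def)
  then have oQ: "orb \<beta> (\<beta> c (r Q)) = Q" using O1_orb[OF Q r(1)[OF Q]] orb_eq1 by metis
  let ?d = "SOME d. d\<in>carrier C\<and>\<beta> c (r Q) = \<beta> d (r Q)"
  have "?d\<in>carrier C\<and>\<beta> c (r Q) = \<beta> ?d (r Q)" by (rule someI[of _ c]) (simp add: c)
  then have "\<beta>' c (r' (F Q)) = \<beta>' ?d (r' (F Q))" using same[OF c _ x\<Omega>(2)[OF Q] x\<Omega>(1)[OF Q]] by blast
  then show ?thesis using cl(1)[OF c x\<Omega>(2)[OF Q]] by (simp add: t_def oQ)
 qed
 have rep: "\<exists>c Q. c\<in>carrier C\<and>Q\<in>O1\<and>p = \<beta> c (r Q)\<and>p\<in>Q" if p: "p\<in>\<Omega>" for p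
 proof -
  have Q: "orb \<beta> p\<in>O1" using p by (auto simp: O1_def)
  have "p\<in>orb \<beta> (r (orb \<beta> p))" using O1_orb[OF Q r(1)[OF Q]] orb_self(1) by simp
  then obtain c where "c\<in>carrier C" "p = \<beta> c (r (orb \<beta> p))" by (subst (asm) (2) orb_def) blast
  then show ?thesis using Q orb_self(1)[of p] by blast
 qed
 have "t permutes \<Omega>"
 proof (rule bij_imp_permutes)
  show "bij_betw t \<Omega> \<Omega>"
   unfolding bij_betw_def
  proof
   show "inj_on t \<Omega>"
   proof (rule inj_onI)
    fix p q assume pq: "p\<in>\<Omega>" "q\<in>\<Omega>" "t p = t q"
    obtain c P where P: "c\<in>carrier C" "P\<in>O1" "p = \<beta> c (r P)" using rep[OF pq(1)] by blast
    obtain d Q where Q: "d\<in>carrier C" "Q\<in>O1" "q = \<beta> d (r Q)" using rep[OF pq(2)] by blast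
    have eq: "\<beta>' c (r' (F P)) = \<beta>' d (r' (F Q))" using pq t P Q by simp
    have "\<beta>' c (r' (F P))\<in>orb \<beta>' (r' (F P))" "\<beta>' d (r' (F Q))\<in>orb \<beta>' (r' (F Q))"
     using P Q by (auto simp: orb_def)
    then have "F P = F Q"
     using eq O2_orb[OF FO[OF P(2)] r'[OF FO[OF P(2)]]] O2_orb[OF FO[OF Q(2)] r'[OF FO[OF Q(2)]]] orb_eq2
     by metis
    then have "P = Q" using F P Q by (auto simp: bij_betw_def inj_on_def)
    then show "p = q" using eq same[OF P(1) Q(1) x\<Omega>(2)[OF P(2)] x\<Omega>(1)[OF P(2)]] P Q by simp
   qed
   show "t ` \<Omega> = \<Omega>"
   proof
    show "t ` \<Omega>\<subseteq>\<Omega>"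
    proof
     fix q assume "q\<in>t ` \<Omega>"
     then obtain p where p: "p\<in>\<Omega>" "q = t p" by auto
     obtain c P where P: "c\<in>carrier C" "P\<in>O1" "p = \<beta> c (r P)" using rep[OF p(1)] by blast
     then show "q\<in>\<Omega>" using p t cl(2) x\<Omega>(1) by simp
    qed
    show "\<Omega>\<subseteq>t ` \<Omega>"
    proof
     fix q assume q: "q\<in>\<Omega>"
     then have "orb \<beta>' q\<in>O2" by (auto simp: O2_def)
     then obtain P where P: "P\<in>O1" "F P = orb \<beta>' q" using F by (auto simp: bij_betw_def image_iff)
     have "q\<in>orb \<beta>' (r' (F P))" using O2_orb[OF FO[OF P(1)] r'[OF FO[OF P(1)]]] P orb_self(2) by simp
     then obtain c where "c\<in>carrier C" "q = \<beta>' c (r' (F P))" by (auto simp: orb_def)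
     then have "q = t (\<beta> c (r P))" "\<beta> c (r P)\<in>\<Omega>" using t P cl(1) x\<Omega>(2) by simp_all
     then show "q\<in>t ` \<Omega>" by blast
    qed
   qed
  qed
 qed (simp add: t_def)
 moreover have "t p = f p" if p: "p\<in>D" for p
 proof -
  have "p\<in>\<Omega>" using p D by auto
  then obtain c Q where Q: "c\<in>carrier C" "Q\<in>O1" "p = \<beta> c (r Q)" "p\<in>Q" using rep by blast
  then have QM: "Q\<in>M" using p by (auto simp: M_def)
  have "f p = \<beta>' c (f (r Q))" using D(3)[OF p rM(2)[OF QM] Q(1)] Q by simp
  moreover have "r' (F Q) = f (r Q)" using QM by (simp add: F_def r'_def inv_into_f_f[OF g_inj])
  ultimately show ?thesis using t Q by simp
 qed
 moreover have "t\<circ>\<beta> c = \<beta>' c\<circ>t" if c: "c\<in>carrier C" for c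
 proof
  fix p show "(t\<circ>\<beta> c) p = (\<beta>' c\<circ>t) p"
  proof (cases "p\<in>\<Omega>")
   case True
   then obtain d Q where Q: "d\<in>carrier C" "Q\<in>O1" "p = \<beta> d (r Q)" using rep by blast
   have "t (\<beta> (c \<otimes>\<^bsub>C\<^esub> d) (r Q)) = \<beta>' (c \<otimes>\<^bsub>C\<^esub> d) (r' (F Q))" using c Q by (intro t) auto
   then show ?thesis using Q c t by (simp add: mul)
  next
   case False
   then show ?thesis using permutes_not_in[OF perm(1)[OF c]] permutes_not_in[OF perm(2)[OF c]]
    by (simp add: t_def)
  qed
 qed
 ultimately show ?thesis by blast
qed

section \<open>Reduced words\<close>

lemma countable_PiE_finite:
 "finite I ==> (!!i. i\<in>I ==> countable (F i)) ==> countable (PiE I F)"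
 by (induction I arbitrary: F rule: finite_induct) (auto simp: PiE_insert_eq)

lemma countable_lists_closure:
 assumes "countable S"
 shows "countable ((%w. foldr f w z) ` lists S)"
 using assms by simp

lemma (in group) finitely_generated_countable:
 assumes "finitely_generated G"
 shows "countable (carrier G)"
proof -
 obtain S where S: "finite S" "S\<subseteq>carrier G" "generate G S = carrier G"
  using assms by (auto simp: finitely_generated_def)
 let ?S = "S\<union>m_inv G ` S"
 let ?L = "(%w. foldr (\<otimes>) w \<one>) ` lists ?S"
 have cl: "foldr (\<otimes>) w \<one>\<in>carrier G" if "w\<in>lists ?S" for w
  using that by (induction w) (use S in auto)
 have app: "foldr (\<otimes>) (u @ w) \<one> = foldr (\<otimes>) u \<one>\<otimes>foldr (\<otimes>) w \<one>"
  if "u\<in>lists ?S" "w\<in>lists ?S" for u w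
  using that(1)
 proof (induction u)
  case (Cons x u)
  then have "x\<in>carrier G" using S by auto
  then show ?case using Cons cl that(2) by (simp add: m_assoc)
 qed (use cl that in auto)
 have "x\<in>?L" if "x\<in>generate G S" for x
  using that
 proof (induction rule: generate.induct)
  case one
  show ?case by (auto intro!: image_eqI[of _ _ "[]"])
 next
  case (incl h)
  then show ?case using S by (intro image_eqI[of _ _ "[h]"]) auto
 next
  case (inv h)
  then show ?case using S by (intro image_eqI[of _ _ "[inv h]"]) auto
 next
  case (eng h1 h2)
  then obtain u w where "u\<in>lists ?S" "w\<in>lists ?S" "h1 = foldr (\<otimes>) u \<one>" "h2 = foldr (\<otimes>) w \<one>"
   by blast
  then show ?case using app[of u w] by (intro image_eqI[of _ _ "u @ w"]) auto
 qed
 then have "carrier G\<subseteq>?L" using S(3) by auto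
 moreover have "countable ?L" using S(1) by (intro countable_lists_closure) (auto intro: countable_finite)
 ultimately show ?thesis by (rule countable_subset)
qed

text \<open>A pair \<open>(e, True)\<close> is the edge \<open>e\<close>, and \<open>(e, False)\<close> is its reverse.\<close>

fun flip :: "'e\<times>bool => 'e\<times>bool" where "flip (e, b) = (e, \<not> b)"

lemma flip_simps [simp]: "fst (flip x) = fst x" "snd (flip x)\<longleftrightarrow>\<not> snd x" "flip (flip x) = x"
 "or_start X (flip x) = or_end X x" "or_end X (flip x) = or_start X x"
 by (cases x; simp)+

context gog_tree
begin

section \<open>Oriented edges and words along edge paths\<close>

definition Cx :: "'e\<times>bool => 'g set" where
 "Cx x = (if snd x then Ge (fst x) else \<phi> (fst x) ` Ge (fst x))"

definition tx :: "'e\<times>bool => ('v, 'e, 'g) gel" where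
 "tx x = (if snd x then st (fst x) else iv st (fst x))"

lemma or_verts [simp]: "fst x\<in>Ar ==> or_start X x\<in>Vs" "fst x\<in>Ar ==> or_end X x\<in>Vs"
 by (cases x; simp)+

lemma tx_closed [simp]: "fst x\<in>Ar ==> tx x\<in>\<P>" by (simp add: tx_def)

lemma tx_flip: "fst x\<in>Ar ==> tx (flip x) = iv tx x" by (simp add: tx_def)

lemma Cx_subgroup: "fst x\<in>Ar ==> subgroup (Cx x) (Gv (or_start X x))"
 using edge_subgroup image_subgroup by (cases x) (auto simp: Cx_def)

lemma tx_conj:
 assumes "fst x\<in>Ar" "c\<in>Cx x"
 shows "\<exists>c'\<in>Cx (flip x). tx x\<cdot>\<iota> (or_start X x) c = \<iota> (or_end X x) c'\<cdot>tx x"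
proof (cases "snd x")
 case True
 then show ?thesis
  using assms st_\<iota>[of "fst x" c] by (cases x) (auto simp: Cx_def tx_def)
next
 case False
 then obtain c' where c': "c'\<in>Ge (fst x)" "c = \<phi> (fst x) c'" using assms by (auto simp: Cx_def)
 have cc: "c'\<in>carrier (Gv (src (fst x)))" "\<phi> (fst x) c'\<in>carrier (Gv (tgt (fst x)))"
  using assms c' Ge_sub \<phi>_closed by auto
 have i: "\<iota> (src (fst x)) c'\<in>\<P>" "\<iota> (tgt (fst x)) (\<phi> (fst x) c')\<in>\<P>"
  "st (fst x)\<in>\<P>"
  using assms cc by auto
 have "iv st (fst x)\<cdot>(\<iota> (tgt (fst x)) (\<phi> (fst x) c')\<cdot>st (fst x)) =
   \<iota> (src (fst x)) c'"
  unfolding st_\<iota>[OF assms(1) c'(1), symmetric] using i by simp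
 then have "iv st (fst x)\<cdot>\<iota> (tgt (fst x)) (\<phi> (fst x) c') =
   \<iota> (src (fst x)) c'\<cdot>iv st (fst x)"
  using i by (metis G.inv_solve_right G.m_assoc G.inv_closed G.m_closed)
 then show ?thesis using False c' by (cases x) (auto simp: Cx_def tx_def)
qed

text \<open>Words are read from right to left: \<open>b 0\<close>, the letter of \<open>x 0\<close>,
  then \<open>b 1\<close> and so on; only indices up to \<open>n\<close> matter. The last condition
  is that of Britton's lemma: an edge immediately followed by its reverse must not enclose an
  element of the edge group.\<close>

definition rword :: "nat => (nat => 'v) => (nat => 'e\<times>bool) => (nat => 'g) => bool" where
 "rword n p x b\<longleftrightarrow>(\<forall>i\<le>n. p i\<in>Vs\<and>b i\<in>carrier (Gv (p i))) \<and>
   (\<forall>i < n. fst (x i)\<in>Ar\<and>or_start X (x i) = p i\<and>or_end X (x i) = p (Suc i)) \<and>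
   (\<forall>i. Suc i < n --> x (Suc i) = flip (x i) --> b (Suc i)\<notin>Cx (x (Suc i)))"

fun wval :: "nat => (nat => 'v) => (nat => 'e\<times>bool) => (nat => 'g) => ('v, 'e, 'g) gel" where
 "wval 0 p x b = \<iota> (p 0) (b 0)"
| "wval (Suc n) p x b = \<iota> (p (Suc n)) (b (Suc n))\<cdot>(tx (x n)\<cdot>wval n p x b)"

lemma wval_cong:
 "(!!i. i\<le>n ==> p i = p' i\<and>b i = b' i) ==> (!!i. i < n ==> x i = x' i) ==>
  wval n p x b = wval n p' x' b'"
 by (induction n) simp_all

lemma wval_closed: "rword n p x b ==> i\<le>n ==> wval i p x b\<in>\<P>"
 by (induction i) (auto simp: rword_def)

text \<open>Generators are multiplied from the left along the path groupoid. If a new stable letter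
  would create a pinch, it cancels against the last one, and the enclosed edge group element passes
  to the vertex element before.\<close>

lemma rword_exists:
 assumes "u\<in>Vs" "v\<in>Vs" "g\<in>\<P>"
 shows "\<exists>n p x b. rword n p x b\<and>p 0 = u\<and>p n = v\<and>wval n p x b = g"
proof -
 have left: "\<exists>n p x b. rword n p x b\<and>p 0 = u\<and>p n = w\<and>wval n p x b = \<iota> w a\<cdot>g"
  if w: "w\<in>Vs" "a\<in>carrier (Gv w)" and ex: "rword n p x b" "p 0 = u" "p n = w" "wval n p x b = g"
  for w a g n p x b
 proof -
  interpret A: group "Gv w" using w Gv_group by simp
  have bn: "b n\<in>carrier (Gv w)" using ex by (auto simp: rword_def)
  let ?b = "b(n := a \<otimes>\<^bsub>Gv w\<^esub> b n)"
  have "rword n p x ?b" using ex w bn by (auto simp: rword_def)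
  moreover have "wval n p x ?b = \<iota> w a\<cdot>g"
  proof (cases n)
   case 0
   then show ?thesis using ex w bn by (auto simp: \<iota>_mult)
  next
   case (Suc m)
   have "wval m p x ?b = wval m p x b" by (rule wval_cong) (use Suc in auto)
   moreover have "tx (x m)\<cdot>wval m p x b\<in>\<P>"
    using ex(1) Suc wval_closed[OF ex(1), of m] by (auto simp: rword_def)
   ultimately show ?thesis using Suc ex w bn by (simp add: \<iota>_mult G.m_assoc flip: ex(4))
  qed
  ultimately show ?thesis using ex by blast
 qed
 have push: "\<exists>n p x b. rword n p x b\<and>p 0 = u\<and>p n = or_end X y\<and>wval n p x b = tx y\<cdot>g"
  if y: "fst y\<in>Ar" and ex: "rword n p x b" "p 0 = u" "p n = or_start X y" "wval n p x b = g"
  for y g n p x b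
 proof (cases "\<exists>m. n = Suc m\<and>y = flip (x m)\<and>b n\<in>Cx y")
  case True
  then obtain m where m: "n = Suc m" "y = flip (x m)" "b n\<in>Cx y" by blast
  have r: "rword m p x b" using ex(1) m(1) by (auto simp: rword_def)
  have xm: "fst (x m)\<in>Ar" "or_start X (x m) = p m" "p (Suc m) = or_end X (x m)" "p m\<in>Vs"
   using ex(1) m(1) by (auto simp: rword_def)
  obtain c' where c': "c'\<in>Cx (x m)"
   "tx y\<cdot>\<iota> (or_start X y) (b n) = \<iota> (or_end X y) c'\<cdot>tx y"
   using tx_conj[OF y m(3)] m(2) by auto
  have c'2: "c'\<in>carrier (Gv (p m))" using c'(1) Cx_subgroup[OF xm(1)] xm(2) subgroup.mem_carrier by fastforce
  have wm: "wval m p x b\<in>\<P>" using wval_closed[OF r] by simp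
  have bn: "\<iota> (or_start X y) (b n)\<in>\<P>" using ex(1,3) by (auto simp: rword_def)
  have ic: "\<iota> (p m) c'\<in>\<P>" using c'2 xm by simp
  have "tx y\<cdot>g = (tx y\<cdot>\<iota> (or_start X y) (b n))\<cdot>(tx (x m)\<cdot>wval m p x b)"
   using ex(3,4) m(1) y bn wm xm by (auto simp: G.m_assoc)
  also have "\<dots> = \<iota> (p m) c'\<cdot>wval m p x b"
   using c'(2) m(2) ic wm xm y by (simp add: G.m_assoc tx_flip)
  finally have eq: "tx y\<cdot>g = \<iota> (p m) c'\<cdot>wval m p x b" .
  show ?thesis unfolding eq using left[OF xm(4) c'2 r ex(2) HOL.refl HOL.refl] m(2) xm by simp
 next
  case False
  let ?p = "p(Suc n := or_end X y)" and ?x = "x(n := y)" and ?b = "b(Suc n := \<one>\<^bsub>Gv (or_end X y)\<^esub>)"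
  interpret A: group "Gv (or_end X y)" using y Gv_group by simp
  have "rword (Suc n) ?p ?x ?b"
   using ex y False by (auto simp: rword_def less_Suc_eq le_Suc_eq)
  moreover have "wval n ?p ?x ?b = wval n p x b" by (rule wval_cong) auto
  moreover have "wval n p x b\<in>\<P>" using wval_closed[OF ex(1)] by simp
  ultimately have "rword (Suc n) ?p ?x ?b\<and>?p 0 = u\<and>?p (Suc n) = or_end X y \<and>
    wval (Suc n) ?p ?x ?b = tx y\<cdot>g"
   using ex y by auto
  then show ?thesis by blast
 qed
 show ?thesis
 proof (rule path_induct[OF assms(2,3,1), where Q = "%v g. \<exists>n p x b. rword n p x b\<and>p 0 = u\<and>p n = v\<and>wval n p x b = g"])
  interpret A: group "Gv u" using assms(1) Gv_group by simp
  have "rword 0 (%_. u) x (%_. \<one>\<^bsub>Gv u\<^esub>)" for x using assms(1) by (simp add: rword_def)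
  moreover have "wval 0 (%_. u) x (%_. \<one>\<^bsub>Gv u\<^esub>) = \<e>" for x using assms(1) by simp
  ultimately show "\<exists>n p x b. rword n p x b\<and>p 0 = u\<and>p n = u\<and>wval n p x b = \<e>" by blast
  show "\<exists>n p x b. rword n p x b\<and>p 0 = u\<and>p n = v\<and>wval n p x b = \<iota> v a\<cdot>g"
   if "v\<in>Vs" "a\<in>carrier (Gv v)" "\<exists>n p x b. rword n p x b\<and>p 0 = u\<and>p n = v\<and>wval n p x b = g" for v a g
   using left[OF that(1,2)] that(3) by blast
  show "\<exists>n p x b. rword n p x b\<and>p 0 = u\<and>p n = tgt e\<and>wval n p x b = st e\<cdot>g"
   if "e\<in>Ar" "\<exists>n p x b. rword n p x b\<and>p 0 = u\<and>p n = src e\<and>wval n p x b = g" for e g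
   using push[of "(e, True)"] that by (auto simp: tx_def)
  show "\<exists>n p x b. rword n p x b\<and>p 0 = u\<and>p n = src e\<and>wval n p x b = iv st e\<cdot>g"
   if "e\<in>Ar" "\<exists>n p x b. rword n p x b\<and>p 0 = u\<and>p n = tgt e\<and>wval n p x b = g" for e g
   using push[of "(e, False)"] that by (auto simp: tx_def)
 qed
qed

text \<open>A reduced word is traced through the layers of \<open>(\<Prod>v. Gv v)\<times>\<nat>\<close>: every stable letter is made
 to lead to a new layer, which is consistent exactly because the word is reduced.\<close>

definition LL :: "(('v => 'g)\<times>nat) set" where
 "LL = (PiE Vs (%v. carrier (Gv v)))\<times>UNIV"

text \<open>Only the coordinate \<open>v\<close> is translated, so every vertex group acts freely on
  the same set and preserves each layer.\<close>

definition lact :: "'v => 'g => ('v => 'g)\<times>nat => ('v => 'g)\<times>nat" where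
 "lact v a = (%(f, i). if f\<in>PiE Vs (%v. carrier (Gv v)) then (f(v := a \<otimes>\<^bsub>Gv v\<^esub> f v), i) else (f, i))"

lemma lact_snd [simp]: "snd (lact v a z) = snd z" by (auto simp: lact_def split: prod.splits)

lemma lact_hom: "v\<in>Vs ==> lact v\<in>hom (Gv v) (permgrp LL)"
proof (rule hom_permgrpI[OF Gv_group])
 assume v: "v\<in>Vs"
 interpret A: group "Gv v" using v by (rule Gv_group)
 show "lact v a z\<in>LL" if "a\<in>carrier (Gv v)" "z\<in>LL" for a z
  using that v by (auto simp: LL_def lact_def PiE_iff extensional_def)
 show "lact v a z = z" if "z\<notin>LL" for a z
  using that by (auto simp: LL_def lact_def split: prod.splits)
 show "lact v \<one>\<^bsub>Gv v\<^esub> z = z" if "z\<in>LL" for z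
  using that v by (auto simp: LL_def lact_def PiE_iff)
 show "lact v (a \<otimes>\<^bsub>Gv v\<^esub> b) z = lact v a (lact v b z)"
  if "a\<in>carrier (Gv v)" "b\<in>carrier (Gv v)" "z\<in>LL" for a b z
  using that v by (auto simp: LL_def lact_def PiE_iff A.m_assoc extensional_def)
qed

lemma lact_free:
 assumes "v\<in>Vs" "a\<in>carrier (Gv v)" "b\<in>carrier (Gv v)" "z\<in>LL" "lact v a z = lact v b z"
 shows "a = b"
proof -
 interpret A: group "Gv v" using assms Gv_group by simp
 obtain f i where z: "z = (f, i)" by (cases z)
 have f: "f\<in>PiE Vs (%v. carrier (Gv v))" using assms z by (auto simp: LL_def)
 then have "f v\<in>carrier (Gv v)" using assms by (auto simp: PiE_iff)
 moreover have "f(v := a \<otimes>\<^bsub>Gv v\<^esub> f v) = f(v := b \<otimes>\<^bsub>Gv v\<^esub> f v)" using assms f z by (simp add: lact_def)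
 then have "a \<otimes>\<^bsub>Gv v\<^esub> f v = b \<otimes>\<^bsub>Gv v\<^esub> f v" by (metis fun_upd_same)
 ultimately show ?thesis using assms by simp
qed

lemma \<phi>_inj: "e\<in>Ar ==> inj_on (\<phi> e) (Ge e)"
 using edge_iso by (auto simp: iso_def bij_betw_def)

lemma \<phi>_one: "e\<in>Ar ==> \<phi> e \<one>\<^bsub>Gv (src e)\<^esub> = \<one>\<^bsub>Gv (tgt e)\<^esub>"
 using hom_one[OF \<phi>_hom edge_group] Gv_group by simp

definition eact1 :: "('v => 'g => 'x) => 'e => 'g => 'x" where "eact1 \<alpha> e c = \<alpha> (src e) c"
definition eact2 :: "('v => 'g => 'x) => 'e => 'g => 'x" where "eact2 \<alpha> e c = \<alpha> (tgt e) (\<phi> e c)"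

lemma eact_hom:
 assumes e: "e\<in>Ar" and \<alpha>: "!!v. v\<in>Vs ==> \<alpha> v\<in>hom (Gv v) K"
 shows "eact1 \<alpha> e\<in>hom (Gv (src e)(|carrier := Ge e|)) K"
  "eact2 \<alpha> e\<in>hom (Gv (src e)(|carrier := Ge e|)) K"
 using \<alpha>[of "src e"] \<alpha>[of "tgt e"] e Ge_sub[OF e] \<phi>_closed[OF e] \<phi>_mult[OF e]
 by (auto simp: hom_def Pi_iff eact1_def eact2_def)

lemma compatI:
 assumes "!!v. v\<in>Vs ==> \<alpha> v\<in>hom (Gv v) (permgrp \<Omega>)" "!!e. e\<in>Ar ==> s e permutes \<Omega>"
  and "!!e c. e\<in>Ar ==> c\<in>Ge e ==> s e\<circ>eact1 \<alpha> e c = eact2 \<alpha> e c\<circ>s e"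
 shows "compat (permgrp \<Omega>) \<alpha> s"
 using assms by (auto simp: compat_def eact1_def eact2_def)

end

text \<open>Countability lets the edge orbits that remain after finitely many prescriptions be
  matched bijectively.\<close>

locale gog_countable = gog_tree +
 assumes countable_Gv: "v\<in>Vs ==> countable (carrier (Gv v))"
begin

lemma countable_LL: "countable LL"
 unfolding LL_def by (intro countable_SIGMA countable_PiE_finite) (auto simp: countable_Gv)

text \<open>This contains the normal form theorem. \<open>P i\<close> is a base point of layer
  \<open>i\<close> and \<open>Q i\<close> its image under the letter \<open>b i\<close>; the edge
  permutations are prescribed so that crossing \<open>x i\<close> takes \<open>Q i\<close> to
  \<open>P (Suc i)\<close>. The word then moves a point of layer 0 to layer \<open>n\<close>,
  whereas vertex groups never change the layer.\<close>

lemma reduced_word_layers: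
 assumes rw: "rword n p x b"
 shows "\<exists>\<rho> \<theta> z0. (\<forall>v\<in>Vs. \<theta> v permutes LL)\<and>z0\<in>LL \<and>
  (\<forall>v\<in>Vs. \<forall>a\<in>carrier (Gv v). \<forall>z. \<theta> v (\<rho> (\<iota> v a) z) = lact v a (\<theta> v z)) \<and>
  snd (\<theta> (p 0) z0) = 0\<and>snd (\<theta> (p n) (\<rho> (wval n p x b) z0)) = n"
proof -
 define P where "P i = ((\<lambda>v\<in>Vs. \<one>\<^bsub>Gv v\<^esub>), i :: nat)" for i
 define Q where "Q i = lact (p i) (b i) (P i)" for i
 have P: "P i\<in>LL" for i
  using Gv_group by (auto simp: P_def LL_def intro: monoid.one_closed group.is_monoid)
 have pb: "p i\<in>Vs" "b i\<in>carrier (Gv (p i))" if "i\<le>n" for i using rw that by (auto simp: rword_def)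
 have xi: "fst (x i)\<in>Ar" "or_start X (x i) = p i" "or_end X (x i) = p (Suc i)" if "i < n" for i
  using rw that by (auto simp: rword_def)
 have red: "b (Suc i)\<notin>Cx (x (Suc i))" if "Suc i < n" "x (Suc i) = flip (x i)" for i
  using rw that by (auto simp: rword_def)
 have lcl: "lact v a z\<in>LL" if "v\<in>Vs" "a\<in>carrier (Gv v)" "z\<in>LL" for v a z
 proof -
  have "lact v a permutes LL" using lact_hom[OF that(1)] that(2) by (auto simp: hom_def)
  then show ?thesis using that(3) by (simp add: permutes_in_image)
 qed
 have lmul: "lact v (a \<otimes>\<^bsub>Gv v\<^esub> c) z = lact v a (lact v c z)"
  if "v\<in>Vs" "a\<in>carrier (Gv v)" "c\<in>carrier (Gv v)" for v a c z
  using lact_hom[OF that(1)] that by (auto simp: hom_def)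
 have lone: "lact v \<one>\<^bsub>Gv v\<^esub> z = z" if "v\<in>Vs" for v z
  using hom_one[OF lact_hom[OF that] Gv_group[OF that] group_permgrp] by simp
 have Q: "Q i\<in>LL" if "i\<le>n" for i using that lcl pb P by (simp add: Q_def)
 have sP: "snd (P i) = i" "snd (Q i) = i" for i by (simp_all add: P_def Q_def)
 define pt where "pt o' i = (if snd (x i) = o' then Q i else P (Suc i))" for o' i
 have pt: "pt o' i\<in>LL" if "i < n" for o' i using that P Q by (simp add: pt_def)
 \<comment> \<open>Different prescribed points lie in different orbits of the edge group. They can
   share a layer only for consecutive crossings in opposite directions, and there a common orbit
   would put the letter \<open>b\<close> of the later index into the edge group, against
   reducedness.\<close>
 have key: "i = j\<and>d = \<one>\<^bsub>Gv (or_start X (e, o'))\<^esub>"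
  if ij: "i < n" "j < n" "fst (x i) = e" "fst (x j) = e" and d: "d\<in>Cx (e, o')"
   and eq: "pt o' i = lact (or_start X (e, o')) d (pt o' j)" for i j e d o'
 proof -
  let ?v = "or_start X (e, o')"
  have e: "e\<in>Ar" using xi(1) ij by auto
  have v: "?v\<in>Vs" using e or_verts(1)[of "(e, o')"] by (simp del: or_start.simps)
  interpret A: group "Gv ?v" using v by (rule Gv_group)
  interpret D: subgroup "Cx (e, o')" "Gv ?v" using Cx_subgroup[of "(e, o')"] e by (simp del: or_start.simps)
  have dc: "d\<in>carrier (Gv ?v)" by (rule D.mem_carrier[OF d])
  have le: "snd (pt o' i) = snd (pt o' j)" using eq by simp
  have xk: "x k = (e, o')" if "fst (x k) = e" "snd (x k) = o'" for k using that by (cases "x k") auto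
  consider (same) "snd (x i) = o'\<longleftrightarrow>snd (x j) = o'" | (ij) "snd (x i) = o'" "snd (x j) ~= o'"
   | (ji) "snd (x i) ~= o'" "snd (x j) = o'" by blast
  then show ?thesis
  proof cases
   case same
   then have "i = j" using le sP by (auto simp: pt_def split: if_splits)
   then have "lact ?v \<one>\<^bsub>Gv ?v\<^esub> (pt o' i) = lact ?v d (pt o' i)" using eq lone v by simp
   then have "\<one>\<^bsub>Gv ?v\<^esub> = d" by (rule lact_free[OF v A.one_closed dc pt[OF ij(1)]])
   then show ?thesis using \<open>i = j\<close> by metis
  next
   case ij
   then have i: "i = Suc j" using le sP by (auto simp: pt_def split: if_splits)
   have vi: "?v = p i" using xi(2)[OF \<open>i < n\<close>] xk[OF \<open>fst (x i) = e\<close> ij(1)] by simp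
   have "lact ?v (b i) (P i) = lact ?v d (P i)" using eq ij i vi by (simp add: pt_def Q_def)
   then have "b i = d" using lact_free[OF v _ dc P] pb[of i] \<open>i < n\<close> vi by simp
   moreover have "x i = flip (x j)" using ij \<open>fst (x i) = e\<close> \<open>fst (x j) = e\<close> by (simp add: prod_eq_iff)
   ultimately show ?thesis using red[of j] i \<open>i < n\<close> d xk[OF \<open>fst (x i) = e\<close> ij(1)] by simp
  next
   case ji
   then have j: "j = Suc i" using le sP by (auto simp: pt_def split: if_splits)
   have vj: "?v = p j" using xi(2)[OF \<open>j < n\<close>] xk[OF \<open>fst (x j) = e\<close> ji(2)] by simp
   have bj: "b j\<in>carrier (Gv ?v)" using pb[of j] \<open>j < n\<close> vj by simp
   have "lact ?v \<one>\<^bsub>Gv ?v\<^esub> (P j) = lact ?v (d \<otimes>\<^bsub>Gv ?v\<^esub> b j) (P j)"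
    using eq ji j vj v dc bj by (simp add: pt_def Q_def lmul lone)
   then have "\<one>\<^bsub>Gv ?v\<^esub> = d \<otimes>\<^bsub>Gv ?v\<^esub> b j" by (rule lact_free[OF v A.one_closed A.m_closed[OF dc bj] P])
   then have "b j = inv\<^bsub>Gv ?v\<^esub> d" using dc bj by (metis A.inv_equality A.inv_inv)
   then have "b j\<in>Cx (e, o')" using D.m_inv_closed[OF d] by metis
   moreover have "x j = flip (x i)" using ji \<open>fst (x i) = e\<close> \<open>fst (x j) = e\<close> by (simp add: prod_eq_iff)
   ultimately show ?thesis using red[of i] j \<open>j < n\<close> xk[OF \<open>fst (x j) = e\<close> ji(2)] by simp
  qed
 qed
 have "\<exists>t. t permutes LL\<and>(\<forall>i < n. fst (x i) = e --> t (pt True i) = pt False i) \<and>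
   (\<forall>c\<in>Ge e. t\<circ>eact1 lact e c = eact2 lact e c\<circ>t)" if e: "e\<in>Ar" for e
 proof -
  let ?C = "Gv (src e)(|carrier := Ge e|)"
  let ?I = "{i. i < n\<and>fst (x i) = e}"
  let ?D = "pt True ` ?I"
  have sv: "src e\<in>Vs" "tgt e\<in>Vs" using e by auto
  interpret A: group "Gv (src e)" using Gv_group sv by simp
  have c1: "\<one>\<^bsub>Gv (src e)\<^esub>\<in>Ge e" using edge_subgroup[OF e] subgroup.one_closed by blast
  have k1: "i = j\<and>c = \<one>\<^bsub>Gv (src e)\<^esub>"
   if "i\<in>?I" "j\<in>?I" "c\<in>Ge e" "pt True i = eact1 lact e c (pt True j)" for i j c
   using key[of i j e c True] that by (simp add: Cx_def eact1_def)
  have k2: "i = j\<and>c = \<one>\<^bsub>Gv (src e)\<^esub>"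
   if "i\<in>?I" "j\<in>?I" "c\<in>Ge e" "pt False i = eact2 lact e c (pt False j)" for i j c
   using key[of i j e "\<phi> e c" False] that \<phi>_one[OF e] \<phi>_inj[OF e] c1
   by (auto simp: Cx_def eact2_def inj_on_def)
  have inj: "inj_on (pt True) ?I"
  proof (rule inj_onI)
   fix i j assume "i\<in>?I" "j\<in>?I" "pt True i = pt True j"
   then show "i = j" using k1[of i j "\<one>\<^bsub>Gv (src e)\<^esub>"] c1 lone[OF sv(1)] by (simp add: eact1_def)
  qed
  define f where "f z = pt False (inv_into ?I (pt True) z)" for z
  have f: "f (pt True i) = pt False i" if "i\<in>?I" for i using that inj by (simp add: f_def)
  have one2: "eact1 lact e \<one>\<^bsub>Gv (src e)\<^esub> z = z" "eact2 lact e \<one>\<^bsub>Gv (src e)\<^esub> z = z" for z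
   using lone sv by (simp_all add: eact1_def eact2_def \<phi>_one[OF e])
  have lay: "snd (eact1 lact e c z) = snd z" "snd (eact2 lact e c z) = snd z" for c z
   by (simp_all add: eact1_def eact2_def)
  \<comment> \<open>The layers above \<open>n\<close> contain no prescribed point, so infinitely
    many orbits stay free on both sides.\<close>
  have inforb: "infinite {(%c. \<beta> c z) ` carrier ?C | z. z\<in>LL\<and>(%c. \<beta> c z) ` carrier ?C\<inter>D = {}}"
   if lay: "!!c z. snd (\<beta> c z) = snd z" and D: "!!z. z\<in>D ==> snd z\<le>n" for \<beta> D
  proof -
   have "infinite ((%i. (%c. \<beta> c (P i)) ` Ge e) ` {n<..})"
   proof
    assume "finite ((%i. (%c. \<beta> c (P i)) ` Ge e) ` {n<..})"
    moreover have "inj_on (%i. (%c. \<beta> c (P i)) ` Ge e) {n<..}"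
    proof (rule inj_onI)
     fix i j assume "(%c. \<beta> c (P i)) ` Ge e = (%c. \<beta> c (P j)) ` Ge e"
     then have "\<beta> \<one>\<^bsub>Gv (src e)\<^esub> (P i)\<in>(%c. \<beta> c (P j)) ` Ge e" using c1 by blast
     then show "i = j" using lay sP by (metis (mono_tags, lifting) imageE)
    qed
    ultimately show False using finite_imageD infinite_Ioi by blast
   qed
   moreover have "(%i. (%c. \<beta> c (P i)) ` Ge e) ` {n<..} \<subseteq>
     {(%c. \<beta> c z) ` carrier ?C | z. z\<in>LL\<and>(%c. \<beta> c z) ` carrier ?C\<inter>D = {}}"
   proof
    fix Z assume "Z\<in>(%i. (%c. \<beta> c (P i)) ` Ge e) ` {n<..}"
    then obtain i where i: "i > n" "Z = (%c. \<beta> c (P i)) ` Ge e" by auto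
    have "(%c. \<beta> c (P i)) ` carrier ?C\<inter>D = {}"
    proof (rule ccontr)
     assume "(%c. \<beta> c (P i)) ` carrier ?C\<inter>D ~= {}"
     then obtain c where "\<beta> c (P i)\<in>D" by blast
     from D[OF this] show False using lay sP(1)[of i] i by simp
    qed
    then show "Z\<in>{(%c. \<beta> c z) ` carrier ?C | z. z\<in>LL\<and>(%c. \<beta> c z) ` carrier ?C\<inter>D = {}}"
     using i P[of i] by (intro CollectI exI[of _ "P i"]) simp
   qed
   ultimately show ?thesis by (meson finite_subset)
  qed
  have ptl: "snd (pt o' i)\<le>n" if "i < n" for o' i using that sP by (simp add: pt_def)
  have "\<exists>t. t permutes LL\<and>(\<forall>p\<in>?D. t p = f p) \<and>
    (\<forall>c\<in>carrier ?C. t\<circ>eact1 lact e c = eact2 lact e c\<circ>t)"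
  proof (rule equivariant_extension[OF edge_group[OF e] eact_hom[OF e lact_hom]])
   show "eact1 lact e c z = z\<longleftrightarrow>eact2 lact e c z' = z'"
    if c: "c\<in>carrier ?C" and z: "z\<in>LL" "z'\<in>LL" for c z z'
   proof -
    have cc: "c\<in>Ge e" "c\<in>carrier (Gv (src e))" "\<phi> e c\<in>carrier (Gv (tgt e))"
     using c e Ge_sub \<phi>_closed by auto
    interpret B: group "Gv (tgt e)" using Gv_group sv by simp
    have "eact1 lact e c z = z\<longleftrightarrow>c = \<one>\<^bsub>Gv (src e)\<^esub>"
     using lact_free[OF sv(1) cc(2) A.one_closed z(1)] lone[OF sv(1), of z] unfolding eact1_def by metis
    moreover have "eact2 lact e c z' = z'\<longleftrightarrow>\<phi> e c = \<one>\<^bsub>Gv (tgt e)\<^esub>"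
     using lact_free[OF sv(2) cc(3) B.one_closed z(2)] lone[OF sv(2), of z'] unfolding eact2_def by metis
    moreover have "\<phi> e c = \<one>\<^bsub>Gv (tgt e)\<^esub>\<longleftrightarrow>c = \<one>\<^bsub>Gv (src e)\<^esub>"
     using \<phi>_one[OF e] \<phi>_inj[OF e] cc(1) c1 by (auto simp: inj_on_def)
    ultimately show ?thesis by simp
   qed
   show "?D\<subseteq>LL" using pt by auto
   show "f\<in>?D \<rightarrow> LL" using pt f by auto
   show "z = eact1 lact e c z'\<longleftrightarrow>f z = eact2 lact e c (f z')"
    if z: "z\<in>?D" "z'\<in>?D" "c\<in>carrier ?C" for z z' c
   proof -
    obtain i j where ij: "i\<in>?I" "z = pt True i" "j\<in>?I" "z' = pt True j" using z by auto
    have c: "c\<in>Ge e" using z by simp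
    show ?thesis using k1[OF ij(1,3) c] k2[OF ij(1,3) c] one2 f[OF ij(1)] f[OF ij(3)] ij(2,4)
     by metis
   qed
   show "finite LL\<or>countable LL \<and>
     infinite {(%c. eact1 lact e c z) ` carrier ?C |z. z\<in>LL\<and>(%c. eact1 lact e c z) ` carrier ?C\<inter>?D = {}} \<and>
     infinite {(%c. eact2 lact e c z) ` carrier ?C |z. z\<in>LL\<and>(%c. eact2 lact e c z) ` carrier ?C\<inter>f ` ?D = {}}"
   proof -
    have D1: "snd z\<le>n" if "z\<in>?D" for z using that ptl by blast
    have D2: "snd z\<le>n" if z: "z\<in>f ` ?D" for z
    proof -
     obtain i where "i\<in>?I" "z = f (pt True i)" using z by blast
     then show ?thesis using f ptl by simp
    qed
    show ?thesis
     by (rule disjI2, intro conjI countable_LL inforb[of "eact1 lact e" ?D, OF lay(1) D1]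
       inforb[of "eact2 lact e" "f ` ?D", OF lay(2) D2])
   qed
  qed
  then obtain t where t: "t permutes LL" "\<forall>p\<in>?D. t p = f p"
    "\<forall>c\<in>carrier ?C. t\<circ>eact1 lact e c = eact2 lact e c\<circ>t" by blast
  then show ?thesis using f by (intro exI[of _ t]) auto
 qed
 then obtain s where s: "!!e. e\<in>Ar ==> s e permutes LL"
  "!!e i. e\<in>Ar ==> i < n ==> fst (x i) = e ==> s e (pt True i) = pt False i"
  "!!e c. e\<in>Ar ==> c\<in>Ge e ==> s e\<circ>eact1 lact e c = eact2 lact e c\<circ>s e"
  by metis
 have "compat (permgrp LL) lact s" by (rule compatI) (use lact_hom s in auto)
 from transport[OF group_permgrp this] obtain \<rho> \<theta> where
  \<rho>: "\<rho>\<in>hom PG (permgrp LL)" and \<theta>: "!!v. v\<in>Vs ==> \<theta> v permutes LL"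
  and \<rho>\<iota>: "!!v a. v\<in>Vs ==> a\<in>carrier (Gv v) ==> \<theta> v\<circ>\<rho> (\<iota> v a) = lact v a\<circ>\<theta> v"
  and \<rho>s: "!!e. e\<in>Ar ==> \<theta> (tgt e)\<circ>\<rho> (st e) = s e\<circ>\<theta> (src e)"
  by (metis (no_types, lifting) permgrp_simps)
 have p0: "p 0\<in>Vs" using pb by simp
 have "P 0\<in>\<theta> (p 0) ` LL" using permutes_image[OF \<theta>[OF p0]] P by simp
 then obtain z0 where z0: "z0\<in>LL" "\<theta> (p 0) z0 = P 0" by auto
 have \<rho>m: "\<rho> (g\<cdot>h) z = \<rho> g (\<rho> h z)" if "g\<in>\<P>" "h\<in>\<P>" for g h z
  using \<rho> that by (auto simp: hom_def)
 have vert: "\<theta> v (\<rho> (\<iota> v a) z) = lact v a (\<theta> v z)" if "v\<in>Vs" "a\<in>carrier (Gv v)" for v a z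
  using fun_cong[OF \<rho>\<iota>[OF that], of z] by simp
 have edge: "\<theta> (tgt e) (\<rho> (st e) z) = s e (\<theta> (src e) z)" if "e\<in>Ar" for e z
  using fun_cong[OF \<rho>s[OF that], of z] by simp
 have track: "\<theta> (p i) (\<rho> (wval i p x b) z0) = Q i" if "i\<le>n" for i
  using that
 proof (induction i)
  case 0
  then show ?case using vert pb z0 by (simp add: Q_def)
 next
  case (Suc i)
  have i: "i < n" using Suc by simp
  let ?z = "\<rho> (wval i p x b) z0"
  have w: "wval i p x b\<in>\<P>" using wval_closed[OF rw] i by simp
  have e: "fst (x i)\<in>Ar" using xi i by simp
  have IH: "\<theta> (p i) ?z = Q i" using Suc by simp
  have "\<theta> (p (Suc i)) (\<rho> (tx (x i)) ?z) = P (Suc i)"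
  proof (cases "snd (x i)")
   case True
   have "p i = src (fst (x i))" "p (Suc i) = tgt (fst (x i))" using xi[OF i] True by (cases "x i"; simp)+
   then show ?thesis using edge[OF e] IH s(2)[OF e i HOL.refl] True by (simp add: tx_def pt_def)
  next
   case False
   have pp: "p i = tgt (fst (x i))" "p (Suc i) = src (fst (x i))" using xi[OF i] False by (cases "x i"; simp)+
   let ?y = "\<rho> (iv st (fst (x i))) ?z"
   have "\<rho> (st (fst (x i))) ?y = ?z"
    using e \<rho>m[of "st (fst (x i))" "iv st (fst (x i))" ?z]
     hom_one[OF \<rho> G.group_axioms group_permgrp] by simp
   then have "s (fst (x i)) (\<theta> (p (Suc i)) ?y) = Q i" using edge[OF e, of ?y] IH pp by simp
   also have "\<dots> = s (fst (x i)) (P (Suc i))" using s(2)[OF e i HOL.refl] False by (simp add: pt_def)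
   finally show ?thesis using permutes_inj[OF s(1)[OF e]] False by (auto simp: tx_def dest: injD)
  qed
  then show ?case using vert pb[OF Suc(2)] e w
   by (simp add: \<rho>m Q_def)
 qed
 show ?thesis
  by (intro exI[of _ \<rho>] exI[of _ \<theta>] exI[of _ z0]) (use z0 track[of n] sP \<theta> vert in auto)
qed

lemma reduced_word_not_vertex:
 assumes rw: "rword n p x b" and "n > 0" "p n = p 0" "a\<in>carrier (Gv (p 0))"
 shows "wval n p x b ~= \<iota> (p 0) a"
proof
 assume eq: "wval n p x b = \<iota> (p 0) a"
 obtain \<rho> \<theta> z0 where *: "\<forall>v\<in>Vs. \<forall>a\<in>carrier (Gv v). \<forall>z. \<theta> v (\<rho> (\<iota> v a) z) = lact v a (\<theta> v z)"
  "snd (\<theta> (p 0) z0) = 0" "snd (\<theta> (p n) (\<rho> (wval n p x b) z0)) = n" "z0\<in>LL"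
  using reduced_word_layers[OF rw] by blast
 have "p 0\<in>Vs" using rw by (auto simp: rword_def)
 then have "\<theta> (p 0) (\<rho> (\<iota> (p 0) a) z0) = lact (p 0) a (\<theta> (p 0) z0)"
  using *(1) assms(4) by blast
 then have "n = 0" using * eq assms(3) by (metis lact_snd)
 then show False using assms(2) by simp
qed


text \<open>Vertex groups act freely in every layer action; the reduced word of length 0 provides
  one.\<close>

lemma \<iota>_inj: "v\<in>Vs ==> inj_on (\<iota> v) (carrier (Gv v))"
proof (rule inj_onI)
 fix a b assume v: "v\<in>Vs" and ab: "a\<in>carrier (Gv v)" "b\<in>carrier (Gv v)" "\<iota> v a = \<iota> v b"
 interpret A: group "Gv v" using v by (rule Gv_group)
 have "rword 0 (%_. v) undefined (%_. \<one>\<^bsub>Gv v\<^esub>)" using v by (simp add: rword_def)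
 from reduced_word_layers[OF this]
 obtain \<rho> \<theta> z0 where \<theta>: "\<forall>w\<in>Vs. \<theta> w permutes LL" and z0: "z0\<in>LL"
  and *: "\<forall>w\<in>Vs. \<forall>a\<in>carrier (Gv w). \<forall>z. \<theta> w (\<rho> (\<iota> w a) z) = lact w a (\<theta> w z)"
  by blast
 have "lact v a (\<theta> v z0) = lact v b (\<theta> v z0)"
  using * v ab by metis
 then show "a = b" using lact_free[OF v ab(1,2)] \<theta> v z0 by (metis permutes_in_image)
qed

text \<open>Otherwise t a t^-1 would be a reduced word of length 2.\<close>

lemma edge_stabilizer:
 assumes x: "fst x\<in>Ar" and a: "a\<in>carrier (Gv (or_start X x))" and a': "a'\<in>carrier (Gv (or_end X x))"
  and eq: "tx x\<cdot>\<iota> (or_start X x) a\<cdot>iv tx x = \<iota> (or_end X x) a'"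
 shows "a\<in>Cx x"
proof (rule ccontr)
 assume na: "a\<notin>Cx x"
 interpret A: group "Gv (or_end X x)" using x Gv_group by simp
 let ?p = "%i::nat. if i = 1 then or_start X x else or_end X x"
 let ?x = "%i::nat. if i = 0 then flip x else x"
 let ?b = "%i::nat. if i = 1 then a else \<one>\<^bsub>Gv (or_end X x)\<^esub>"
 have "rword 2 ?p ?x ?b" using x a na by (auto simp: rword_def le_Suc_eq less_Suc_eq numeral_2_eq_2)
 from reduced_word_not_vertex[OF this, of a']
 have "wval 2 ?p ?x ?b ~= \<iota> (or_end X x) a'" using a' by simp
 moreover have "wval 2 ?p ?x ?b = \<iota> (or_end X x) a'"
  using x a a' eq by (simp add: numeral_2_eq_2 tx_flip G.m_assoc)
 ultimately show False by simp
qed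

text \<open>Suppose \<open>g\<close> is given by a reduced word of length n > 0, and let
  \<open>c\<close> lie outside the group of its first edge, by properness. Conjugating with
  \<open>g\<close> the element that becomes \<open>c\<close> after the initial letter gives a
  reduced word of length 2n with \<open>c\<close> in the middle, so this conjugate leaves the vertex
  group.\<close>

lemma vertex_group_self_normalizing:
 assumes proper: "!!x. fst x\<in>Ar ==> Cx x ~= carrier (Gv (or_start X x))"
  and v: "v\<in>Vs" and g: "g\<in>\<P>"
  and norm: "!!a. a\<in>carrier (Gv v) ==> g\<cdot>\<iota> v a\<cdot>iv g\<in>\<iota> v ` carrier (Gv v)"
 shows "g\<in>\<iota> v ` carrier (Gv v)"
proof (rule ccontr)
 assume ng: "g\<notin>\<iota> v ` carrier (Gv v)"
 obtain n p x b where w: "rword n p x b" "p 0 = v" "p n = v" "wval n p x b = g"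
  using rword_exists[OF v v g] by blast
 have pb: "p i\<in>Vs" "b i\<in>carrier (Gv (p i))" if "i\<le>n" for i using w that by (auto simp: rword_def)
 have xi: "fst (x i)\<in>Ar" "or_start X (x i) = p i" "or_end X (x i) = p (Suc i)" if "i < n" for i
  using w that by (auto simp: rword_def)
 have red: "b (Suc i)\<notin>Cx (x (Suc i))" if "Suc i < n" "x (Suc i) = flip (x i)" for i
  using w that by (auto simp: rword_def)
 have n: "n > 0"
 proof (rule ccontr)
  assume "\<not> n > 0"
  then have "g = \<iota> v (b 0)" using w by simp
  then show False using ng pb[of 0] w by auto
 qed
 interpret A: group "Gv v" using v by (rule Gv_group)
 interpret C: subgroup "Cx (x 0)" "Gv v" using Cx_subgroup[OF xi(1)[OF n]] xi(2)[OF n] w by simp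
 have b0: "b 0\<in>carrier (Gv v)" using pb[of 0] w by simp
 obtain c where c: "c\<in>carrier (Gv v)" "c\<notin>Cx (x 0)"
  using proper[OF xi(1)[OF n]] xi(2)[OF n] w C.subset by auto
 define a where "a = inv\<^bsub>Gv v\<^esub> b 0 \<otimes>\<^bsub>Gv v\<^esub> c \<otimes>\<^bsub>Gv v\<^esub> b 0"
 have a: "a\<in>carrier (Gv v)" "b 0 \<otimes>\<^bsub>Gv v\<^esub> a \<otimes>\<^bsub>Gv v\<^esub> inv\<^bsub>Gv v\<^esub> b 0 = c"
  using b0 c by (simp_all add: a_def A.m_assoc)
 text \<open>the reduced word of \<open>g a g\<inverse>\<close>\<close>
 define p' where "p' i = (if i\<le>n then p (n - i) else p (i - n))" for i
 define x' where "x' i = (if i < n then flip (x (n - 1 - i)) else x (i - n))" for i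
 define b' where "b' i = (if i < n then inv\<^bsub>Gv (p (n - i))\<^esub> b (n - i)
   else if i = n then c else b (i - n))" for i
 have binv: "inv\<^bsub>Gv (p i)\<^esub> b i\<in>carrier (Gv (p i))" if "i\<le>n" for i
  using pb[OF that] Gv_group by (simp add: group.inv_closed)
 have rw: "rword (2 * n) p' x' b'"
  unfolding rword_def
 proof (intro conjI allI impI)
  fix i assume i: "i\<le>2 * n"
  show "p' i\<in>Vs" using pb i by (simp add: p'_def)
  show "b' i\<in>carrier (Gv (p' i))" using pb binv i c w by (auto simp: p'_def b'_def)
 next
  fix i assume i: "i < 2 * n"
  show "fst (x' i)\<in>Ar" using xi i by (simp add: x'_def)
  show "or_start X (x' i) = p' i"
  proof (cases "i < n")
   case True
   then have "Suc (n - Suc i) = n - i" by simp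
   then show ?thesis using xi(3)[of "n - 1 - i"] True by (simp add: x'_def p'_def)
  next
   case False
   then show ?thesis using xi(2)[of "i - n"] i by (auto simp: x'_def p'_def)
  qed
  show "or_end X (x' i) = p' (Suc i)"
  proof (cases "i < n")
   case True
   then show ?thesis using xi(2)[of "n - 1 - i"] True by (simp add: x'_def p'_def)
  next
   case False
   then have "Suc (i - n) = Suc i - n" by simp
   then show ?thesis using xi(3)[of "i - n"] i False by (simp add: x'_def p'_def)
  qed
 next
  fix i assume i: "Suc i < 2 * n" and fl: "x' (Suc i) = flip (x' i)"
  consider "Suc i < n" | "Suc i = n" | "n\<le>i" by linarith
  then show "b' (Suc i)\<notin>Cx (x' (Suc i))"
  proof cases
   case 1
   \<comment> \<open>The first half runs through the word of \<open>g\<close> backwards, so its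
     junction \<open>Suc i\<close> is the junction \<open>Suc j\<close> of the original
     word.\<close>
   define j where "j = n - Suc (Suc i)"
   have j: "Suc j < n" "n - 1 - i = Suc j" "n - Suc i = Suc j" using 1 by (auto simp: j_def)
   have fj: "x (Suc j) = flip (x j)" using fl 1 j by (simp add: x'_def flip: j_def)
   have "b (Suc j)\<notin>Cx (x (Suc j))" using red[OF j(1) fj] .
   moreover have "Cx (x (Suc j)) = Cx (flip (x j))" using fj by simp
   moreover have sub: "subgroup (Cx (x (Suc j))) (Gv (p (Suc j)))"
    using Cx_subgroup[OF xi(1)[OF j(1)]] xi(2)[OF j(1)] by simp
   moreover have "inv\<^bsub>Gv (p (Suc j))\<^esub> b (Suc j)\<in>Cx (x (Suc j)) ==> b (Suc j)\<in>Cx (x (Suc j))"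
    using subgroup.m_inv_closed[OF sub] group.inv_inv[OF Gv_group] pb[of "Suc j"] j
    by (metis less_imp_le)
   ultimately have "inv\<^bsub>Gv (p (Suc j))\<^esub> b (Suc j)\<notin>Cx (flip (x j))" by metis
   then show ?thesis using 1 j by (simp add: b'_def x'_def flip: j_def)
  next
   case 2
   then show ?thesis using c by (simp add: b'_def x'_def)
  next
   case 3
   then have j: "Suc i - n = Suc (i - n)" "Suc (i - n) < n" using i by auto
   then have "x (Suc (i - n)) = flip (x (i - n))" using fl 3 by (simp add: x'_def)
   then show ?thesis using red[OF j(2)] 3 j by (simp add: b'_def x'_def)
  qed
 qed
 have wv: "wval i p x b\<in>\<P>" if "i\<le>n" for i using wval_closed[OF w(1) that] .
 have ib: "\<iota> (p i) (b i)\<in>\<P>" if "i\<le>n" for i using pb[OF that] by simp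
 have step: "tx (x' i)\<cdot>wval i p' x' b' = wval (n - 1 - i) p x b\<cdot>iv g" if "i < n" for i
  using that
 proof (induction i)
  case 0
  obtain m where m: "n = Suc m" using n by (cases n) auto
  have gm: "g = \<iota> (p n) (b n)\<cdot>(tx (x m)\<cdot>wval m p x b)" using w(4) m by simp
  have "wval m p x b\<cdot>iv g = iv tx (x m)\<cdot>iv \<iota> (p n) (b n)"
   unfolding gm using wv[of m] ib[of n] xi[of m] m by (simp add: G.inv_mult_group G.m_assoc)
  then show ?case using m xi[of m] pb[of n] by (simp add: x'_def b'_def p'_def tx_flip \<iota>_inv)
 next
  case (Suc i)
  define k where "k = n - Suc (Suc i)"
  have k: "n - 1 - i = Suc k" "n - Suc i = Suc k" "Suc k < n" using Suc(2) by (auto simp: k_def)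
  have "wval (Suc i) p' x' b' = \<iota> (p (Suc k)) (inv\<^bsub>Gv (p (Suc k))\<^esub> b (Suc k)) \<cdot>
    (wval (Suc k) p x b\<cdot>iv g)"
  proof -
   have "tx (x' i)\<cdot>wval i p' x' b' = wval (Suc k) p x b\<cdot>iv g"
    using Suc k(1) by simp
   moreover have "p' (Suc i) = p (Suc k)" "b' (Suc i) = inv\<^bsub>Gv (p (Suc k))\<^esub> b (Suc k)"
    using Suc(2) k by (simp_all add: p'_def b'_def)
   ultimately show ?thesis by (simp del: wval.simps add: wval.simps(2)[of i])
  qed
  also have "\<dots> = tx (x k)\<cdot>wval k p x b\<cdot>iv g"
   using wv[of k] ib[of "Suc k"] xi[of k] g k pb[of "Suc k"] by (simp add: \<iota>_inv G.m_assoc)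
  finally have "tx (x' (Suc i))\<cdot>wval (Suc i) p' x' b' = wval k p x b\<cdot>iv g"
   using wv[of k] xi[of k] g k Suc(2) by (simp add: x'_def tx_flip G.m_assoc flip: k_def)
  then show ?case by (simp add: k_def)
 qed
 have mid: "wval n p' x' b' = \<iota> v c\<cdot>(\<iota> v (b 0)\<cdot>iv g)"
 proof -
  obtain m where m: "n = Suc m" using n by (cases n) auto
  show ?thesis using step[of m] m w by (simp add: p'_def b'_def)
 qed
 have up: "wval (n + k) p' x' b' = wval k p x b\<cdot>\<iota> v a\<cdot>iv g" if "k\<le>n" for k
  using that
 proof (induction k)
  case 0
  have "c \<otimes>\<^bsub>Gv v\<^esub> b 0 = b 0 \<otimes>\<^bsub>Gv v\<^esub> a" using b0 c by (simp add: a_def A.m_assoc)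
  then have "\<iota> v c\<cdot>\<iota> v (b 0) = \<iota> v (b 0)\<cdot>\<iota> v a" using b0 c a v by (metis \<iota>_mult)
  then show ?case using mid b0 c a v g w(2) \<iota>_closed[OF v b0] \<iota>_closed[OF v c(1)] \<iota>_closed[OF v a(1)]
   by (simp flip: G.m_assoc)
 next
  case (Suc k)
  then show ?case using wv[of k] ib[of "Suc k"] xi[of k] g a v
   by (simp add: p'_def x'_def b'_def G.m_assoc)
 qed
 have "wval (2 * n) p' x' b' = g\<cdot>\<iota> v a\<cdot>iv g"
  using up[of n] w by (simp add: mult_2)
 moreover obtain a' where "a'\<in>carrier (Gv v)" "g\<cdot>\<iota> v a\<cdot>iv g = \<iota> v a'"
  using norm[OF a(1)] by auto
 moreover have "p' 0 = v" "p' (2 * n) = v" using w n by (auto simp: p'_def)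
 ultimately show False using reduced_word_not_vertex[OF rw, of a'] n by simp
qed

end

section \<open>Normal subgroups contained in the edge groups\<close>

lemma (in group) fidx_self: "subgroup H G ==> fidx G H H"
 by (rule fidxI[where \<kappa> = "%_. ()"]) (auto simp: subgroup.subset subgroup.m_closed subgroup.m_inv_closed)

lemma (in group) lower_central_series_subset: "lower_central_series G n\<subseteq>carrier G"
proof (induction n)
 case (Suc n)
 have "{g\<otimes>h\<otimes>inv g\<otimes>inv h | g h. g\<in>lower_central_series G n\<and>h\<in>carrier G}\<subseteq>carrier G"
  using Suc by auto
 then show ?case using generate_incl by simp
qed simp

text \<open>Going down from \<open>{1}\<close>, the closures of the terms of the lower central series lie in the
 image of \<open>A\<close>, because each of them normalizes it modulo the next one.\<close>

lemma (in group) nilpotent_self_normalizing_closed: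
 assumes RF: "residually_finite G" and A: "group A" "h\<in>hom A G" "nilpotent A"
  and norm: "!!g. g\<in>carrier G ==> (!!a. a\<in>carrier A ==> g\<otimes>h a\<otimes>inv g\<in>h ` carrier A) ==>
   g\<in>h ` carrier A"
  and g: "g\<in>carrier G" "g\<notin>h ` carrier A"
 shows "\<exists>U. fin_normal G U\<and>(\<forall>a\<in>carrier A. inv (h a)\<otimes>g\<notin>U)"
proof -
 interpret h: group_hom A G h using A by (simp add: group_hom_def group_hom_axioms_def group_axioms)
 \<comment> \<open>\<open>L i\<close> is the closure of the image of the i-th term in the profinite
   topology of \<open>G\<close>.\<close>
 define L where "L i = {g\<in>carrier G. \<forall>U. fin_normal G U -->
  (\<exists>b\<in>lower_central_series A i. inv (h b)\<otimes>g\<in>U)}" for i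
 obtain n where n: "lower_central_series A n = {\<one>\<^bsub>A\<^esub>}" using A(3) by (auto simp: nilpotent_def)
 have "L 0\<subseteq>h ` carrier A"
 proof (rule inc_induct[of 0 n])
  show "L n\<subseteq>h ` carrier A"
  proof
   fix x assume "x\<in>L n"
   then have x: "x\<in>carrier G" "!!U. fin_normal G U ==> x\<in>U" by (auto simp: L_def n)
   \<comment> \<open>Residual finiteness says that the trivial subgroup is closed.\<close>
   then have "x = \<one>" using RF residually_finite_alt[OF group_axioms] by blast
   then show "x\<in>h ` carrier A" by (auto intro!: image_eqI[of _ _ "\<one>\<^bsub>A\<^esub>"])
  qed
 next
  fix i assume IH: "L (Suc i)\<subseteq>h ` carrier A"
  show "L i\<subseteq>h ` carrier A"
  proof
   fix x assume "x\<in>L i"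
   then have x: "x\<in>carrier G"
    "!!U. fin_normal G U ==> \<exists>b\<in>lower_central_series A i. inv (h b)\<otimes>x\<in>U" by (auto simp: L_def)
   \<comment> \<open>It suffices that \<open>x\<close> normalizes the image, and this holds because
     its commutators with the image lie in the closure of the next term.\<close>
   show "x\<in>h ` carrier A"
   proof (rule norm[OF x(1)])
    fix a assume a: "a\<in>carrier A"
    let ?c = "x\<otimes>h a\<otimes>inv x\<otimes>inv (h a)"
    have "?c\<in>L (Suc i)"
     unfolding L_def
    proof (intro CollectI conjI allI impI)
     show "?c\<in>carrier G" using x a by simp
     fix U assume U: "fin_normal G U"
     then obtain b where b: "b\<in>lower_central_series A i" "inv (h b)\<otimes>x\<in>U" using x(2) by blast
     interpret U: normal U G using U by (simp add: fin_normal_def)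
     have bA: "b\<in>carrier A" using b h.G.lower_central_series_subset by blast
     \<comment> \<open>As \<open>h b\<close> approximates \<open>x\<close> modulo \<open>U\<close>,
       the image of \<open>?d\<close> approximates the commutator \<open>?c\<close>.\<close>
     let ?u = "inv (h b)\<otimes>x" and ?d = "b \<otimes>\<^bsub>A\<^esub> a \<otimes>\<^bsub>A\<^esub> inv\<^bsub>A\<^esub> b \<otimes>\<^bsub>A\<^esub> inv\<^bsub>A\<^esub> a"
     have "inv (h a)\<otimes>?u\<otimes>h a\<in>U" using U.inv_op_closed1[of "h a" ?u] a b by simp
     then have "inv (h a)\<otimes>?u\<otimes>h a\<otimes>inv ?u\<in>U" using b by simp
     then have "(h a\<otimes>h b)\<otimes>(inv (h a)\<otimes>?u\<otimes>h a\<otimes>inv ?u)\<otimes>inv (h a\<otimes>h b)\<in>U"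
      using U.inv_op_closed2[of "h a\<otimes>h b" "inv (h a)\<otimes>?u\<otimes>h a\<otimes>inv ?u"] a bA by simp
     moreover have "(h a\<otimes>h b)\<otimes>(inv (h a)\<otimes>?u\<otimes>h a\<otimes>inv ?u)\<otimes>inv (h a\<otimes>h b) = inv (h ?d)\<otimes>?c"
      using a bA x(1) by (simp add: m_assoc inv_mult_group)
     moreover have "?d\<in>lower_central_series A (Suc i)"
      using a b(1) by (auto intro!: generate.incl)
     ultimately show "\<exists>b\<in>lower_central_series A (Suc i). inv (h b)\<otimes>?c\<in>U" by metis
    qed
    then have "?c\<in>h ` carrier A" using IH by blast
    then obtain d where d: "d\<in>carrier A" "?c = h d" by blast
    have "x\<otimes>h a\<otimes>inv x = ?c\<otimes>h a" using x a by (simp add: m_assoc)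
    then have "x\<otimes>h a\<otimes>inv x = h (d \<otimes>\<^bsub>A\<^esub> a)" using a d by simp
    then show "x\<otimes>h a\<otimes>inv x\<in>h ` carrier A" using a d by (metis imageI h.G.m_closed)
   qed
  qed
 qed simp
 then have "g\<notin>L 0" using g(2) by blast
 then show ?thesis using g(1) by (auto simp: L_def)
qed

lemma (in gog_tree) transport_perm:
 assumes "compat (permgrp \<Omega>) \<alpha> s"
 shows "\<exists>\<rho> \<theta>. \<rho>\<in>hom PG (permgrp \<Omega>)\<and>\<theta> v0 = id\<and>(\<forall>v\<in>Vs. \<theta> v permutes \<Omega>) \<and>
  (\<forall>v\<in>Vs. \<forall>a\<in>carrier (Gv v). \<forall>z. \<theta> v (\<rho> (\<iota> v a) z) = \<alpha> v a (\<theta> v z)) \<and>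
  (\<forall>e\<in>Ar. \<forall>z. \<theta> (tgt e) (\<rho> (st e) z) = s e (\<theta> (src e) z))"
proof (rule transport[OF group_permgrp assms])
 fix \<rho> \<theta>
 assume \<rho>: "\<rho>\<in>hom PG (permgrp \<Omega>)" "!!v. v\<in>Vs ==> \<theta> v\<in>carrier (permgrp \<Omega>)" "\<theta> v0 = \<one>\<^bsub>permgrp \<Omega>\<^esub>"
  and v: "!!v a. v\<in>Vs ==> a\<in>carrier (Gv v) ==>
   \<theta> v \<otimes>\<^bsub>permgrp \<Omega>\<^esub> \<rho> (\<iota> v a) = \<alpha> v a \<otimes>\<^bsub>permgrp \<Omega>\<^esub> \<theta> v"
  and e: "!!e. e\<in>Ar ==> \<theta> (tgt e) \<otimes>\<^bsub>permgrp \<Omega>\<^esub> \<rho> (st e) = s e \<otimes>\<^bsub>permgrp \<Omega>\<^esub> \<theta> (src e)"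
 have "\<theta> w (\<rho> (\<iota> w a) z) = \<alpha> w a (\<theta> w z)" if "w\<in>Vs" "a\<in>carrier (Gv w)" for w a z
  using fun_cong[OF v[OF that], of z] by simp
 moreover have "\<theta> (tgt d) (\<rho> (st d) z) = s d (\<theta> (src d) z)" if "d\<in>Ar" for d z
  using fun_cong[OF e[OF that], of z] by simp
 ultimately show ?thesis using \<rho> by (intro exI[of _ \<rho>] exI[of _ \<theta>]) simp
qed

locale gog_nilp = gog_tree X Gv Ge \<phi> T
 for X :: "('v, 'e) pre_digraph"
  and Gv :: "'v => 'g monoid"
  and Ge :: "'e => 'g set"
  and \<phi> :: "'e => 'g => 'g"
  and T :: "('v, 'e) pre_digraph" +
 assumes vg: "v\<in>Vs ==> finitely_generated (Gv v)\<and>torsion_free (Gv v)\<and>nilpotent (Gv v)"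
  and src_idx: "e\<in>Ar ==> finite_index_subgroup (Ge e) (Gv (src e))\<and>Ge e ~= carrier (Gv (src e))"
  and tgt_idx: "e\<in>Ar ==>
   finite_index_subgroup (\<phi> e ` Ge e) (Gv (tgt e))\<and>\<phi> e ` Ge e ~= carrier (Gv (tgt e))"
begin

sublocale gog_countable
 by unfold_locales (simp add: group.finitely_generated_countable[OF Gv_group] vg)

abbreviation "\<iota>A v \<equiv> \<iota> v ` carrier (Gv v)"

lemma Cx_idx:
 "fst x\<in>Ar ==> fidx (Gv (or_start X x)) (carrier (Gv (or_start X x))) (Cx x) \<and>
  Cx x ~= carrier (Gv (or_start X x))"
 using src_idx[of "fst x"] tgt_idx[of "fst x"] Gv_group[of "src (fst x)"] Gv_group[of "tgt (fst x)"]
 by (cases x) (auto simp: Cx_def group.finite_index_subgroup_iff)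

lemma \<iota>A_subgroup: "v\<in>Vs ==> subgroup (\<iota>A v) PG"
 using group_hom.img_is_subgroup[OF \<iota>_group_hom] .

definition admissible :: "('v, 'e, 'g) gel set => bool" where
 "admissible J\<longleftrightarrow>J \<lhd> PG\<and>(\<forall>v\<in>Vs. J\<subseteq>\<iota>A v\<and>fidx PG (\<iota>A v) J) \<and>
   (\<forall>x. fst x\<in>Ar --> J\<subseteq>\<iota> (or_start X x) ` Cx x)"

lemma admissible_subset:
 assumes "admissible J" "J' \<lhd> PG" "J'\<subseteq>J" "fidx PG J J'"
 shows "admissible J'"
proof -
 have "fidx PG (\<iota>A v) J'" if "v\<in>Vs" for v
 proof (rule G.fidx_trans[of _ J])
  show "fidx PG (\<iota>A v) J" using assms(1) that by (simp add: admissible_def)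
  show "\<iota>A v\<subseteq>\<P>" using subgroup.subset[OF \<iota>A_subgroup[OF that]] .
  show "J'\<subseteq>\<P>" using subgroup.subset[OF normal_imp_subgroup[OF assms(2)]] .
 qed (rule assms(4))
 then show ?thesis using assms unfolding admissible_def by blast
qed

text \<open>By \<open>edge_stabilizer\<close>, the stable letter conjugates a coset representative
  outside an edge group out of the opposite vertex group. This group is closed, so a normal subgroup
  of finite index detects the fact. In the intersection \<open>U\<close> of the finitely many
  subgroups obtained in this way, a vertex element lies in every edge group at its vertex. Hence
  stable letters carry the intersections of \<open>U\<close> with the vertex groups into one
  another, and all of these coincide.\<close>

theorem residually_finite_admissible:
 assumes RF: "residually_finite PG"
 shows "\<exists>J. admissible J"
proof -
 have closed: "\<exists>U. fin_normal PG U\<and>(\<forall>a\<in>carrier (Gv v). iv (\<iota> v a)\<cdot>g\<notin>U)"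
  if "v\<in>Vs" "g\<in>\<P>" "g\<notin>\<iota>A v" for v g
 proof (rule G.nilpotent_self_normalizing_closed[OF RF Gv_group[OF that(1)] \<iota>_hom[OF that(1)] _ _ that(2,3)])
  show "nilpotent (Gv v)" using vg that by simp
  show "g\<in>\<iota>A v" if "g\<in>\<P>"
   "!!a. a\<in>carrier (Gv v) ==> g\<cdot>\<iota> v a\<cdot>iv g\<in>\<iota>A v" for g
   by (rule vertex_group_self_normalizing[OF _ \<open>v\<in>Vs\<close> that]) (use Cx_idx in auto)
 qed
 define S where "S x = (SOME S. finite S\<and>S\<subseteq>carrier (Gv (or_start X x)) \<and>
  (\<forall>a\<in>carrier (Gv (or_start X x)). \<exists>s\<in>S. inv\<^bsub>Gv (or_start X x)\<^esub> s \<otimes>\<^bsub>Gv (or_start X x)\<^esub> a\<in>Cx x))" for x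
 have S: "finite (S x)" "S x\<subseteq>carrier (Gv (or_start X x))"
  "!!a. a\<in>carrier (Gv (or_start X x)) ==>
   \<exists>s\<in>S x. inv\<^bsub>Gv (or_start X x)\<^esub> s \<otimes>\<^bsub>Gv (or_start X x)\<^esub> a\<in>Cx x" if "fst x\<in>Ar" for x
 proof -
  have "\<exists>S. finite S\<and>S\<subseteq>carrier (Gv (or_start X x)) \<and>
   (\<forall>a\<in>carrier (Gv (or_start X x)). \<exists>s\<in>S. inv\<^bsub>Gv (or_start X x)\<^esub> s \<otimes>\<^bsub>Gv (or_start X x)\<^esub> a\<in>Cx x)"
   using Cx_idx[OF that] by (simp add: fidx_def)
  from someI_ex[OF this, folded S_def]
  show "finite (S x)" "S x\<subseteq>carrier (Gv (or_start X x))"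
   "!!a. a\<in>carrier (Gv (or_start X x)) ==>
    \<exists>s\<in>S x. inv\<^bsub>Gv (or_start X x)\<^esub> s \<otimes>\<^bsub>Gv (or_start X x)\<^esub> a\<in>Cx x" by blast+
 qed
 define Or where "Or = {x :: 'e\<times>bool. fst x\<in>Ar}"
 have "finite Or" unfolding Or_def by (rule finite_subset[of _ "Ar\<times>UNIV"]) auto
 define P where "P = (SIGMA x : Or. {s\<in>S x. s\<notin>Cx x})"
 have finP: "finite P" unfolding P_def using \<open>finite Or\<close> S(1) by (auto simp: Or_def)
 define cj where "cj x s = tx x\<cdot>\<iota> (or_start X x) s\<cdot>iv tx x" for x s
 let ?sep = "%z U. fin_normal PG U\<and>(\<forall>a\<in>carrier (Gv (or_end X (fst z))).
   iv (\<iota> (or_end X (fst z)) a)\<cdot>cj (fst z) (snd z)\<notin>U)"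
 have "\<forall>z\<in>P. \<exists>U. ?sep z U"
 proof
  fix z assume z: "z\<in>P"
  have xs: "fst (fst z)\<in>Ar" "snd z\<in>carrier (Gv (or_start X (fst z)))" "snd z\<notin>Cx (fst z)"
   using z S(2)[of "fst z"] unfolding P_def Or_def mem_Sigma_iff by (auto simp del: or_start.simps)
  have "cj (fst z) (snd z)\<notin>\<iota>A (or_end X (fst z))"
   using edge_stabilizer[OF xs(1,2)] xs(3) by (auto simp: cj_def)
  then show "\<exists>U. ?sep z U" using closed[of "or_end X (fst z)" "cj (fst z) (snd z)"] xs by (simp add: cj_def)
 qed
 from bchoice[OF this] obtain UU where UU0: "\<forall>z\<in>P. ?sep z (UU z)" by blast
 have UU: "fin_normal PG (UU (x, s))"
  "!!a. a\<in>carrier (Gv (or_end X x)) ==> iv (\<iota> (or_end X x) a)\<cdot>cj x s\<notin>UU (x, s)"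
  if "(x, s)\<in>P" for x s
  using bspec[OF UU0 that] by simp_all
 define U where "U = \<Inter>(UU ` P)\<inter>\<P>"
 have "fin_normal PG U" unfolding U_def by (rule G.fin_normal_Inter) (use finP UU0 in auto)
 then have U: "U \<lhd> PG" "fidx PG (\<P>) U" by (auto simp: fin_normal_def)
 interpret U: normal U PG by (rule U(1))
 \<comment> \<open>With a = s c and c in the edge group, membership of \<open>a\<close> in
   \<open>U\<close> would put the conjugate of s into the coset of a vertex element modulo
   \<open>U\<close>, which the choice of \<open>U\<close> excludes.\<close>
 have inC: "a\<in>Cx x" if x: "fst x\<in>Ar" and a: "a\<in>carrier (Gv (or_start X x))" "\<iota> (or_start X x) a\<in>U" for x a
 proof (rule ccontr)
  assume na: "a\<notin>Cx x"
  let ?v = "or_start X x" and ?w = "or_end X x"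
  interpret A: group "Gv ?v" using x Gv_group by simp
  interpret B: group "Gv ?w" using x Gv_group by simp
  interpret C: subgroup "Cx x" "Gv ?v" using x by (rule Cx_subgroup)
  obtain s where s: "s\<in>S x" "inv\<^bsub>Gv ?v\<^esub> s \<otimes>\<^bsub>Gv ?v\<^esub> a\<in>Cx x" using S(3)[OF x a(1)] by blast
  have sc: "s\<in>carrier (Gv ?v)" using s S(2)[OF x] by blast
  define c where "c = inv\<^bsub>Gv ?v\<^esub> s \<otimes>\<^bsub>Gv ?v\<^esub> a"
  have c: "c\<in>Cx x" "a = s \<otimes>\<^bsub>Gv ?v\<^esub> c" "c\<in>carrier (Gv ?v)" using s sc a by (simp_all add: c_def)
  have "s\<notin>Cx x" using c na by auto
  then have sP: "(x, s)\<in>P" using s x by (auto simp: P_def Or_def)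
  obtain c' where c': "c'\<in>Cx (flip x)" "tx x\<cdot>\<iota> ?v c = \<iota> ?w c'\<cdot>tx x"
   using tx_conj[OF x c(1)] by blast
  have c'c: "c'\<in>carrier (Gv ?w)"
   using c'(1) Cx_subgroup[of "flip x"] x subgroup.mem_carrier by fastforce
  have cl: "\<iota> ?v s\<in>\<P>" "\<iota> ?v c\<in>\<P>" "\<iota> ?w c'\<in>\<P>" "tx x\<in>\<P>"
   "\<iota> ?v a\<in>\<P>"
   using x sc c c'c a by auto
  have "tx x\<cdot>\<iota> ?v a\<cdot>iv tx x\<in>U" using U.inv_op_closed2[OF cl(4) a(2)] .
  then have "\<iota> ?w c'\<cdot>(tx x\<cdot>\<iota> ?v a\<cdot>iv tx x)\<cdot>iv \<iota> ?w c'\<in>U"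
   using U.inv_op_closed2[OF cl(3)] by blast
  moreover have "tx x\<cdot>\<iota> ?v a\<cdot>iv tx x = cj x s\<cdot>\<iota> ?w c'"
  proof -
   have "tx x\<cdot>\<iota> ?v a\<cdot>iv tx x =
     tx x\<cdot>\<iota> ?v s\<cdot>iv tx x\<cdot>(tx x\<cdot>\<iota> ?v c)\<cdot>iv tx x"
    using c(2,3) sc x cl by (simp add: \<iota>_mult G.m_assoc)
   then show ?thesis using c'(2) cl by (simp add: cj_def G.m_assoc)
  qed
  ultimately have "iv \<iota> ?w (inv\<^bsub>Gv ?w\<^esub> c')\<cdot>cj x s\<in>U"
   using cl c'c x by (simp add: \<iota>_inv G.m_assoc cj_def)
  moreover have "U\<subseteq>UU (x, s)" using sP by (auto simp: U_def)
  ultimately show False using UU(2)[OF sP, of "inv\<^bsub>Gv ?w\<^esub> c'"] c'c by auto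
 qed
 define J where "J v = U\<inter>\<iota>A v" for v
 have edge: "tx x\<cdot>j\<cdot>iv tx x\<in>J (or_end X x)"
  if x: "fst x\<in>Ar" and j: "j\<in>J (or_start X x)" for x j
 proof -
  obtain a where a: "a\<in>carrier (Gv (or_start X x))" "j = \<iota> (or_start X x) a" "j\<in>U"
   using j by (auto simp: J_def)
  have "a\<in>Cx x" using inC[OF x a(1)] a by simp
  then obtain c' where c': "c'\<in>Cx (flip x)"
   "tx x\<cdot>j = \<iota> (or_end X x) c'\<cdot>tx x" using tx_conj[OF x] a by blast
  have c'c: "c'\<in>carrier (Gv (or_end X x))"
   using c'(1) Cx_subgroup[of "flip x"] x subgroup.mem_carrier by fastforce
  have "tx x\<cdot>j\<cdot>iv tx x = \<iota> (or_end X x) c'"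
   unfolding c'(2) using c'c x by (simp add: G.m_assoc)
  moreover have "tx x\<cdot>j\<cdot>iv tx x\<in>U"
   using U.inv_op_closed2[OF tx_closed[OF x] a(3)] .
  ultimately show ?thesis using c'c by (auto simp: J_def)
 qed
 have Jsub: "J v\<subseteq>\<P>" for v by (auto simp: J_def)
 \<comment> \<open>Conjugation by a tree letter is the identity, so \<open>edge\<close> gives
   inclusions in both directions.\<close>
 have tree: "J b = J a" if ab: "(a, b)\<in>uadj X (arcs T)" for a b
 proof -
  have *: "J (or_start X x)\<subseteq>J (or_end X x)" if "fst x\<in>arcs T" for x
  proof
   fix j assume j: "j\<in>J (or_start X x)"
   have x: "fst x\<in>Ar" "tx x = \<e>" using that T_props(1) st_tree by (auto simp: tx_def)
   have "j\<in>\<P>" using j Jsub by blast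
   then show "j\<in>J (or_end X x)" using edge[OF x(1) j] x(2) by simp
  qed
  obtain e where "e\<in>arcs T" "{a, b} = {src e, tgt e}" using ab by (auto simp: uadj_def)
  then have "J (src e) = J (tgt e)" using *[of "(e, True)"] *[of "(e, False)"] by (intro equalityI) simp_all
  then show ?thesis using \<open>{a, b} = {src e, tgt e}\<close> unfolding doubleton_eq_iff by metis
 qed
 define J0 where "J0 = J v0"
 have Jeq: "J v = J0" if "v\<in>Vs" for v
  unfolding J0_def using T_props(8)[OF v0 that]
 proof (induction rule: rtrancl_induct)
  case (step y z)
  then show ?case using tree[of y z] by metis
 qed (rule HOL.refl)
 have J0sub: "J0\<subseteq>\<P>" using Jsub by (simp add: J0_def)
 have Jn: "g\<cdot>j\<cdot>iv g\<in>J0" if "g\<in>\<P>" "j\<in>J0" for g j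
  using that
 proof (induction arbitrary: j rule: PG_induct)
  case one
  then have "j\<in>\<P>" using J0sub by blast
  then show ?case using one by simp
 next
  case (vert v a g)
  let ?k = "g\<cdot>j\<cdot>iv g"
  have k: "?k\<in>J v" using vert Jeq by auto
  interpret A: subgroup "\<iota>A v" PG using \<iota>A_subgroup vert by simp
  have "\<iota> v a\<in>\<iota>A v" using vert by simp
  then have "\<iota> v a\<cdot>?k\<cdot>iv \<iota> v a\<in>\<iota>A v" using k by (simp add: J_def)
  moreover have "\<iota> v a\<cdot>?k\<cdot>iv \<iota> v a\<in>U"
   using U.inv_op_closed2[of "\<iota> v a" ?k] vert k by (simp add: J_def)
  ultimately have "\<iota> v a\<cdot>?k\<cdot>iv \<iota> v a\<in>J0"
   unfolding Jeq[OF vert(1), symmetric] J_def by blast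
  moreover have "j\<in>\<P>" using vert J0sub by blast
  ultimately show ?case using vert by (simp add: G.inv_mult_group G.m_assoc)
 next
  case (st e g)
  then have "g\<cdot>j\<cdot>iv g\<in>J (src e)" using Jeq by simp
  from edge[of "(e, True)", simplified, OF st(1) this]
  have "st e\<cdot>(g\<cdot>j\<cdot>iv g)\<cdot>iv st e\<in>J0"
   using Jeq st by (simp add: tx_def)
  moreover have "j\<in>\<P>" using st J0sub by blast
  ultimately show ?case using st by (simp add: G.inv_mult_group G.m_assoc)
 next
  case (inv_st e g)
  then have "g\<cdot>j\<cdot>iv g\<in>J (tgt e)" using Jeq by simp
  from edge[of "(e, False)", simplified, OF inv_st(1) this]
  have "iv st e\<cdot>(g\<cdot>j\<cdot>iv g)\<cdot>st e\<in>J0"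
   using Jeq inv_st by (simp add: tx_def)
  moreover have "j\<in>\<P>" using inv_st J0sub by blast
  ultimately show ?case using inv_st by (simp add: G.inv_mult_group G.m_assoc)
 qed
 have Jg: "subgroup J0 PG"
  unfolding J0_def J_def using G.subgroups_Inter_pair[OF U.subgroup_axioms \<iota>A_subgroup[OF v0]] .
 have "admissible J0"
  unfolding admissible_def
 proof (intro conjI ballI allI impI)
  show "J0 \<lhd> PG" using Jg Jn by (intro G.normal_invI) auto
  fix v assume v: "v\<in>Vs"
  show "J0\<subseteq>\<iota>A v" unfolding Jeq[OF v, symmetric] J_def by blast
  have "fidx PG (\<iota>A v) U" by (rule fidx_mono[OF U(2)]) (use subgroup.subset[OF \<iota>A_subgroup[OF v]] in auto)
  moreover have "fidx PG (\<iota>A v) (\<iota>A v)"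
   by (rule G.fidx_self[OF \<iota>A_subgroup[OF v]])
  ultimately have "fidx PG (\<iota>A v) (U\<inter>\<iota>A v)"
   using subgroup.subset[OF \<iota>A_subgroup[OF v]] U.subgroup_axioms \<iota>A_subgroup[OF v] by (intro G.fidx_Int)
  then show "fidx PG (\<iota>A v) J0" unfolding Jeq[OF v, symmetric] J_def .
 next
  fix x :: "'e\<times>bool" assume x: "fst x\<in>Ar"
  show "J0\<subseteq>\<iota> (or_start X x) ` Cx x"
  proof
   fix j assume "j\<in>J0"
   then have "j\<in>J (or_start X x)" using Jeq x by simp
   then show "j\<in>\<iota> (or_start X x) ` Cx x" using inC[OF x] unfolding J_def by blast
  qed
 qed
 then show ?thesis by blast
qed

section \<open>Finite actions over an admissible subgroup\<close>

lemma admissible_edge: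
 assumes J: "admissible J" and e: "e\<in>Ar" and c: "c\<in>Ge e"
 shows "\<iota> (src e) c\<in>J\<longleftrightarrow>\<iota> (tgt e) (\<phi> e c)\<in>J"
proof -
 interpret J: normal J PG using J by (simp add: admissible_def)
 have i: "\<iota> (src e) c\<in>\<P>" using Ge_sub[OF e c] e by simp
 note conj = st_conj[OF e c]
 show ?thesis
 proof
  assume "\<iota> (src e) c\<in>J"
  then show "\<iota> (tgt e) (\<phi> e c)\<in>J" using J.inv_op_closed2[OF st_closed[OF e], of "\<iota> (src e) c"] conj by simp
 next
  assume "\<iota> (tgt e) (\<phi> e c)\<in>J"
  then have "iv st e\<cdot>(st e\<cdot>\<iota> (src e) c\<cdot>iv st e)\<cdot>st e\<in>J"
   using J.inv_op_closed1[OF st_closed[OF e], of "\<iota> (tgt e) (\<phi> e c)"] conj by simp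
  then show "\<iota> (src e) c\<in>J" using e i by (simp add: G.m_assoc)
 qed
qed

text \<open>The finite coset spaces of \<open>J\<close> in the vertex groups are multiplied
  together, so that all vertex groups act on one finite set with every stabilizer equal to
  \<open>J\<close>. By \<open>admissible_edge\<close> the two embeddings of an edge group then have
  the same stabilizers, and \<open>equivariant_extension\<close> supplies the edge
  permutations.\<close>

lemma admissible_finite_action:
 assumes J: "admissible J"
 obtains Y :: "('v => ('v, 'e, 'g) gel set) set" and \<rho>
 where "finite Y" "Y ~= {}" "\<rho>\<in>hom PG (permgrp Y)"
  "!!v a y. v\<in>Vs ==> a\<in>carrier (Gv v) ==> y\<in>Y ==> \<rho> (\<iota> v a) y = y\<longleftrightarrow>\<iota> v a\<in>J"
proof -
 interpret J: normal J PG using J by (simp add: admissible_def)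
 let ?B = "%v. (%a. \<iota> v a <#\<^bsub>PG\<^esub> J) ` carrier (Gv v)"
 define Y where "Y = PiE Vs ?B"
 have finB: "finite (?B v)" if v: "v\<in>Vs" for v
 proof -
  have "fidx PG (\<iota>A v) J" using J v by (simp add: admissible_def)
  then obtain S where S: "finite S" "S\<subseteq>\<P>" "\<forall>a\<in>\<iota>A v. \<exists>s\<in>S. iv s\<cdot>a\<in>J"
   by (auto simp: fidx_def)
  have "?B v\<subseteq>(%s. s <#\<^bsub>PG\<^esub> J) ` S"
  proof
   fix b assume "b\<in>?B v"
   then obtain a where a: "a\<in>carrier (Gv v)" "b = \<iota> v a <#\<^bsub>PG\<^esub> J" by auto
   then obtain s where "s\<in>S" "iv s\<cdot>\<iota> v a\<in>J" using S(3) by blast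
   then show "b\<in>(%s. s <#\<^bsub>PG\<^esub> J) ` S"
    using a v S(2) G.l_coset_eq_iff[OF J.subgroup_axioms, of "\<iota> v a" s] by auto
  qed
  then show ?thesis using S(1) finite_surj by blast
 qed
 have finY: "finite Y" unfolding Y_def using finB by (intro finite_PiE) auto
 have neY: "Y ~= {}"
 proof -
  have "?B v ~= {}" if "v\<in>Vs" for v using monoid.one_closed[OF group.is_monoid[OF Gv_group[OF that]]] by blast
  then show ?thesis unfolding Y_def by (simp add: PiE_eq_empty_iff)
 qed
 define ca where "ca v a f = (if f\<in>Y then f(v := \<iota> v a <#\<^bsub>PG\<^esub> f v) else f)" for v a f
 have fv: "\<exists>b\<in>carrier (Gv v). f v = \<iota> v b <#\<^bsub>PG\<^esub> J" if "f\<in>Y" "v\<in>Vs" for f v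
  using that by (auto simp: PiE_iff Y_def)
 have mulc: "\<iota> v a <#\<^bsub>PG\<^esub> (\<iota> v b <#\<^bsub>PG\<^esub> J) = \<iota> v (a \<otimes>\<^bsub>Gv v\<^esub> b) <#\<^bsub>PG\<^esub> J"
  if "v\<in>Vs" "a\<in>carrier (Gv v)" "b\<in>carrier (Gv v)" for v a b
  using that by (simp add: G.l_coset_mult[OF J.subgroup_axioms] \<iota>_mult)
 have ca_hom: "ca v\<in>hom (Gv v) (permgrp Y)" if v: "v\<in>Vs" for v
 proof (rule hom_permgrpI[OF Gv_group[OF v]])
  interpret A: group "Gv v" using v by (rule Gv_group)
  show cl: "ca v a f\<in>Y" if "a\<in>carrier (Gv v)" "f\<in>Y" for a f
  proof -
   have "\<iota> v a <#\<^bsub>PG\<^esub> f v\<in>?B v" using fv[OF that(2) v] mulc[OF v that(1)] that(1) by force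
   then show ?thesis using that v by (auto simp: ca_def Y_def PiE_iff extensional_def)
  qed
  show "ca v a f = f" if "f\<notin>Y" for a f using that by (simp add: ca_def)
  show "ca v \<one>\<^bsub>Gv v\<^esub> f = f" if f: "f\<in>Y" for f
  proof -
   obtain b where "b\<in>carrier (Gv v)" "f v = \<iota> v b <#\<^bsub>PG\<^esub> J" using fv[OF f v] by blast
   then have "\<iota> v \<one>\<^bsub>Gv v\<^esub> <#\<^bsub>PG\<^esub> f v = f v" using mulc[OF v A.one_closed] by simp
   then show ?thesis using f by (simp add: ca_def)
  qed
  show "ca v (a \<otimes>\<^bsub>Gv v\<^esub> c) f = ca v a (ca v c f)"
   if ac: "a\<in>carrier (Gv v)" "c\<in>carrier (Gv v)" and f: "f\<in>Y" for a c f
  proof -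
   obtain b where b: "b\<in>carrier (Gv v)" "f v = \<iota> v b <#\<^bsub>PG\<^esub> J" using fv[OF f v] by blast
   have "\<iota> v (a \<otimes>\<^bsub>Gv v\<^esub> c) <#\<^bsub>PG\<^esub> f v = \<iota> v a <#\<^bsub>PG\<^esub> (\<iota> v c <#\<^bsub>PG\<^esub> f v)"
    using b ac v by (simp add: mulc A.m_assoc)
   then show ?thesis using f cl[OF ac(2) f] by (simp add: ca_def)
  qed
 qed
 have ca_stab: "ca v a f = f\<longleftrightarrow>\<iota> v a\<in>J" if v: "v\<in>Vs" and a: "a\<in>carrier (Gv v)" and f: "f\<in>Y" for v a f
 proof -
  obtain b where b: "b\<in>carrier (Gv v)" "f v = \<iota> v b <#\<^bsub>PG\<^esub> J" using fv[OF f v] by blast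
  have ic: "\<iota> v a\<in>\<P>" "\<iota> v b\<in>\<P>" using a b v by auto
  have "ca v a f = f\<longleftrightarrow>\<iota> v a <#\<^bsub>PG\<^esub> f v = f v" using f by (auto simp: ca_def fun_upd_idem_iff)
  also have "\<dots>\<longleftrightarrow>iv \<iota> v b\<cdot>(\<iota> v a\<cdot>\<iota> v b)\<in>J"
   using ic b by (simp add: G.l_coset_mult[OF J.subgroup_axioms] G.l_coset_eq_iff[OF J.subgroup_axioms])
  also have "\<dots>\<longleftrightarrow>\<iota> v a\<in>J"
  proof
   assume "iv \<iota> v b\<cdot>(\<iota> v a\<cdot>\<iota> v b)\<in>J"
   from J.inv_op_closed2[OF ic(2) this] show "\<iota> v a\<in>J" using ic by (simp add: G.m_assoc)
  next
   assume "\<iota> v a\<in>J"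
   from J.inv_op_closed1[OF ic(2) this] show "iv \<iota> v b\<cdot>(\<iota> v a\<cdot>\<iota> v b)\<in>J"
    using ic by (simp add: G.m_assoc)
  qed
  finally show ?thesis .
 qed
 have "\<exists>t. t permutes Y\<and>(\<forall>p\<in>{}. t p = p) \<and>
   (\<forall>c\<in>carrier (Gv (src e)(|carrier := Ge e|)). t\<circ>eact1 ca e c = eact2 ca e c\<circ>t)" if e: "e\<in>Ar" for e
 proof (rule equivariant_extension[OF edge_group[OF e] eact_hom[OF e ca_hom]])
  show "eact1 ca e c p = p\<longleftrightarrow>eact2 ca e c q = q"
   if "c\<in>carrier (Gv (src e)(|carrier := Ge e|))" "p\<in>Y" "q\<in>Y" for c p q
   using that e ca_stab[of "src e" c p] ca_stab[of "tgt e" "\<phi> e c" q] Ge_sub[OF e] \<phi>_closed[OF e]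
    admissible_edge[OF J e] by (simp add: eact1_def eact2_def)
 qed (use finY in auto)
 then have "\<forall>e\<in>Ar. \<exists>t. t permutes Y\<and>(\<forall>c\<in>Ge e. t\<circ>eact1 ca e c = eact2 ca e c\<circ>t)"
  by simp
 from bchoice[OF this] obtain s where "\<forall>e\<in>Ar. s e permutes Y \<and>
   (\<forall>c\<in>Ge e. s e\<circ>eact1 ca e c = eact2 ca e c\<circ>s e)" by blast
 then have s: "s e permutes Y" "c\<in>Ge e ==> s e\<circ>eact1 ca e c = eact2 ca e c\<circ>s e"
  if "e\<in>Ar" for e c
  using that by blast+
 have "compat (permgrp Y) ca s" by (rule compatI) (use ca_hom s in auto)
 from transport_perm[OF this] obtain \<rho> \<theta> where
  \<rho>: "\<rho>\<in>hom PG (permgrp Y)" and \<theta>: "\<forall>v\<in>Vs. \<theta> v permutes Y"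
  and \<rho>\<iota>: "\<forall>v\<in>Vs. \<forall>a\<in>carrier (Gv v). \<forall>z. \<theta> v (\<rho> (\<iota> v a) z) = ca v a (\<theta> v z)"
  by blast
 show thesis
 proof (rule that[OF finY neY \<rho>])
  fix v a y assume va: "v\<in>Vs" "a\<in>carrier (Gv v)" "y\<in>Y"
  have "\<rho> (\<iota> v a) y = y\<longleftrightarrow>\<theta> v (\<rho> (\<iota> v a) y) = \<theta> v y"
   using permutes_inj[OF bspec[OF \<theta> va(1)]] by (metis injD)
  also have "\<dots>\<longleftrightarrow>ca v a (\<theta> v y) = \<theta> v y" using \<rho>\<iota> va by simp
  also have "\<dots>\<longleftrightarrow>\<iota> v a\<in>J"
   using ca_stab[OF va(1,2)] permutes_in_image[OF bspec[OF \<theta> va(1)]] va(3) by blast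
  finally show "\<rho> (\<iota> v a) y = y\<longleftrightarrow>\<iota> v a\<in>J" .
 qed
qed

end

section \<open>Reduced words in a group\<close>

definition reduced :: "'a word => bool" where
 "reduced w\<longleftrightarrow>successively (%x y. \<not> (fst x = fst y\<and>snd x ~= snd y)) w"

lemma reduced_Cons: "reduced (x # w)\<longleftrightarrow>reduced w\<and>(w ~= [] --> \<not> (fst x = fst (hd w)\<and>snd x ~= snd (hd w)))"
 by (cases w) (auto simp: reduced_def)

context group
begin

lemma weval_reduced:
 assumes f: "f\<in>S \<rightarrow> carrier G" and "w\<in>words S"
 shows "\<exists>w'. w'\<in>words S\<and>reduced w'\<and>weval G f w' = weval G f w"
 using assms(2)
proof (induction w)
 case Nil
 show ?case by (intro exI[of _ "[]"]) (simp add: reduced_def)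
next
 case (Cons x w)
 obtain a b where x: "x = (a, b)" by (cases x)
 then have aS: "a\<in>S" "w\<in>words S" using Cons.prems by auto
 then obtain w' where w': "w'\<in>words S" "reduced w'" "weval G f w' = weval G f w" using Cons.IH by blast
 have fa: "f a\<in>carrier G" using f aS by auto
 show ?case
 proof (cases "w' ~= []\<and>a = fst (hd w')\<and>b ~= snd (hd w')")
  case True
  then obtain w'' where w'': "w' = (a, \<not> b) # w''" by (cases w') auto
  have "weval G f w''\<in>carrier G" using w' w'' weval_closed[OF f] by simp
  then have "weval G f w'' = weval G f (x # w)" using w' w'' x fa by (auto simp flip: w'(3))
  then show ?thesis using w' w'' by (intro exI[of _ w'']) (auto simp: reduced_Cons)
 next
  case False
  then show ?thesis using w' x aS by (intro exI[of _ "x # w'"]) (auto simp: reduced_Cons)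
 qed
qed

text \<open>Normality allows the elements of \<open>J\<close> to be moved to the right past the
  letters.\<close>

lemma generate_normal_words:
 assumes J: "J \<lhd> G" and f: "f\<in>S \<rightarrow> carrier G" and g: "g\<in>generate G (J\<union>f ` S)"
 shows "\<exists>w j. w\<in>words S\<and>reduced w\<and>j\<in>J\<and>g = weval G f w\<otimes>j"
proof -
 interpret J: normal J G by (rule J)
 have ew: "\<exists>w j. w\<in>words S\<and>j\<in>J\<and>g = weval G f w\<otimes>j"
  using g
 proof (induction rule: generate.induct)
  case one
  show ?case by (intro exI[of _ "[]"] exI[of _ \<one>]) simp
 next
  case (incl h)
  then consider "h\<in>J" | a where "a\<in>S" "h = f a" by blast
  then show ?case
  proof cases
   case 1
   then show ?thesis by (intro exI[of _ "[]"] exI[of _ h]) simp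
  next
   case 2
   then have "f a\<in>carrier G" using f by auto
   then show ?thesis using 2 by (intro exI[of _ "[(a, True)]"] exI[of _ \<one>]) simp
  qed
 next
  case (inv h)
  then consider "h\<in>J" | a where "a\<in>S" "h = f a" by blast
  then show ?case
  proof cases
   case 1
   then show ?thesis by (intro exI[of _ "[]"] exI[of _ "inv h"]) simp
  next
   case 2
   then have "f a\<in>carrier G" using f by auto
   then show ?thesis using 2 by (intro exI[of _ "[(a, False)]"] exI[of _ \<one>]) simp
  qed
 next
  case (eng h1 h2)
  then obtain w1 j1 w2 j2 where w: "w1\<in>words S" "j1\<in>J" "h1 = weval G f w1\<otimes>j1"
   "w2\<in>words S" "j2\<in>J" "h2 = weval G f w2\<otimes>j2" by blast
  let ?u = "weval G f w2"
  have c: "weval G f w1\<in>carrier G" "?u\<in>carrier G" using w weval_closed[OF f] by auto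
  have "inv ?u\<otimes>j1\<otimes>?u\<in>J" using J.inv_op_closed1 c w by simp
  then have "(inv ?u\<otimes>j1\<otimes>?u)\<otimes>j2\<in>J" using w by simp
  moreover have "h1\<otimes>h2 = weval G f (w1 @ w2)\<otimes>((inv ?u\<otimes>j1\<otimes>?u)\<otimes>j2)"
   using w c by (simp add: weval_append[OF f] m_assoc)
  ultimately show ?case using w by (intro exI[of _ "w1 @ w2"] exI) auto
 qed
 then obtain w j where w: "w\<in>words S" "j\<in>J" "g = weval G f w\<otimes>j" by blast
 then obtain w' where "w'\<in>words S" "reduced w'" "weval G f w' = weval G f w"
  using weval_reduced[OF f] by blast
 then show ?thesis using w by metis
qed

end

section \<open>Two by two integer matrices\<close>

type_synonym m2 = "int\<times>int\<times>int\<times>int"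

fun mm :: "m2 => m2 => m2" where
 "mm (a, b, c, d) (a', b', c', d') = (a * a' + b * c', a * b' + b * d', c * a' + d * c', c * b' + d * d')"

fun mdet :: "m2 => int" where "mdet (a, b, c, d) = a * d - b * c"

fun mv :: "m2 => int\<times>int => int\<times>int" where
 "mv (a, b, c, d) (p, q) = (a * p + b * q, c * p + d * q)"

definition SL2 :: "m2 monoid" where
 "SL2 = (|carrier = {A. mdet A = 1}, monoid.mult = mm, monoid.one = (1, 0, 0, 1)|)"

lemma SL2_simps [simp]: "A\<in>carrier SL2\<longleftrightarrow>mdet A = 1" "A \<otimes>\<^bsub>SL2\<^esub> B = mm A B" "\<one>\<^bsub>SL2\<^esub> = (1, 0, 0, 1)"
 by (simp_all add: SL2_def)

lemma mdet_mm: "mdet (mm A B) = mdet A * mdet B"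
 by (cases A; cases B) (simp add: algebra_simps)

lemma mm_assoc: "mm (mm A B) C = mm A (mm B C)"
 by (cases A; cases B; cases C) (simp add: algebra_simps)

lemma mv_mm: "mv (mm A B) v = mv A (mv B v)"
 by (cases A; cases B; cases v) (simp add: algebra_simps)

lemma group_SL2: "group SL2"
proof (rule groupI)
 fix A assume A: "A\<in>carrier SL2"
 obtain a b c d where "A = (a, b, c, d)" by (cases A)
 with A show "\<exists>B\<in>carrier SL2. B \<otimes>\<^bsub>SL2\<^esub> A = \<one>\<^bsub>SL2\<^esub>"
  by (intro bexI[of _ "(d, - b, - c, a)"]) (auto simp: algebra_simps)
qed (auto simp: mdet_mm mm_assoc)

interpretation SL2: group SL2 by (rule group_SL2)

lemma SL2_inv: "mdet (a, b, c, d) = 1 ==> inv\<^bsub>SL2\<^esub> (a, b, c, d) = (d, - b, - c, a)"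
 by (rule SL2.inv_equality) (auto simp: algebra_simps)

lemma int_square_pos: "(x::int) ~= 0 ==> x * x > 0"
 by (cases "x > 0") (auto simp: zero_less_mult_iff)

text \<open>\<open>U\<^sup>i L U\<^sup>-\<^sup>i\<close> for the elementary matrices \<open>U = (1 2; 0 1)\<close> and \<open>L = (1 0; 2 1)\<close>.\<close>

definition conjL :: "nat => m2" where
 "conjL i = (1 + 4 * int i, - 8 * int i * int i, 2, 1 - 4 * int i)"

section \<open>Ping-pong and Sanov's theorem\<close>

lemma conjL_closed: "conjL\<in>S \<rightarrow> carrier SL2"
 by (auto simp: conjL_def algebra_simps)

text \<open>Ping-pong, with the vector written as U^i (p, q), where i is the index of the leftmost
  letter: in these coordinates the letter acts as L or its inverse. The region is 0 < |p| < |q|, and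
  the sign of p q records the exponent. With one matrix for every natural number, the family is free
  of any finite rank.\<close>

lemma conjL_free:
 assumes "reduced w" "w ~= []"
 shows "weval SL2 conjL w ~= (1, 0, 0, 1)"
proof -
 have "\<exists>p q. mv (weval SL2 conjL w) (1, 0) = (p + 2 * int (fst (hd w)) * q, q)\<and>\<bar>q\<bar> > \<bar>p\<bar>\<and>p ~= 0 \<and>
   (if snd (hd w) then p * q > 0 else p * q < 0)"
  using assms
 proof (induction w)
  case (Cons x w)
  obtain i b where x: "x = (i, b)" by (cases x)
  define e :: int where "e = (if b then 1 else -1)"
  have inv: "inv\<^bsub>SL2\<^esub> conjL i = (1 - 4 * int i, 8 * int i * int i, - 2, 1 + 4 * int i)"
   unfolding conjL_def by (subst SL2_inv) (auto simp: algebra_simps)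
  have M: "(if b then conjL i else inv\<^bsub>SL2\<^esub> conjL i) =
    (1 + 4 * e * int i, - 8 * e * int i * int i, 2 * e, 1 - 4 * e * int i)"
   by (simp add: inv e_def) (simp add: conjL_def)
  have step: "mv (weval SL2 conjL (x # w)) (1, 0) = (p + 2 * int i * q, q)"
   if "mv (weval SL2 conjL w) (1, 0) = (p0, q0)" "p = p0 - 2 * int i * q0" "q = q0 + 2 * e * p" for p0 q0 p q
   using that(1) M x by (simp add: mv_mm that(2,3) algebra_simps)
  have sgn: "if b then p * q > 0 else p * q < 0" if "e * (p * q) > 0" for p q
   using that by (auto simp: e_def split: if_splits)
  have e2: "e * e = 1" "\<bar>e\<bar> = 1" by (auto simp: e_def)
  show ?case
  proof (cases "w = []")
   case True
   have "mv (weval SL2 conjL (x # w)) (1, 0) = (1 + 2 * int i * (2 * e), 2 * e)"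
    by (rule step[of 1 0]) (simp_all add: True)
   then show ?thesis using x by (intro exI[of _ 1] exI[of _ "2 * e"]) (auto simp: e_def)
  next
   case False
   then obtain p' q' where IH: "mv (weval SL2 conjL w) (1, 0) = (p' + 2 * int (fst (hd w)) * q', q')"
    "\<bar>q'\<bar> > \<bar>p'\<bar>" "p' ~= 0" "if snd (hd w) then p' * q' > 0 else p' * q' < 0"
    using Cons by (auto simp: reduced_Cons)
   \<comment> \<open>Passing from the coordinates of index j to those of index i shifts
     \<open>p'\<close> by a multiple of \<open>q'\<close>; for different indices this makes
     \<open>p\<close> the larger entry before the new letter acts.\<close>
   define j where "j = fst (hd w)"
   define p where "p = p' + 2 * (int j - int i) * q'"
   define q where "q = q' + 2 * e * p"
   have st: "mv (weval SL2 conjL (x # w)) (1, 0) = (p + 2 * int i * q, q)"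
    by (rule step[OF IH(1)]) (simp_all add: p_def q_def j_def algebra_simps)
   have "\<bar>q\<bar> > \<bar>p\<bar>\<and>p ~= 0\<and>e * (p * q) > 0"
   proof (cases "i = j")
    case True
    then have pp: "p = p'" by (simp add: p_def)
    have "snd (hd w) = b" using Cons(2) False x True by (auto simp: reduced_Cons j_def)
    then have pos: "e * (p' * q') > 0" using IH(4) by (auto simp: e_def split: if_splits)
    have "e * (p * q) = e * (p' * q') + 2 * (e * e) * (p' * p')" by (simp add: q_def pp algebra_simps)
    moreover have "p' * p' > 0" using IH(3) by (rule int_square_pos)
    ultimately have "e * (p * q) > 0" using pos e2 by simp
    moreover have "\<bar>q\<bar> > \<bar>p\<bar>"
    proof (cases b)
     case True
     then show ?thesis using pos IH(2) by (auto simp: q_def pp e_def zero_less_mult_iff)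
    next
     case False
     then show ?thesis using pos IH(2) by (auto simp: q_def pp e_def mult_less_0_iff)
    qed
    ultimately show ?thesis using IH(3) pp by simp
   next
    case False
    have "\<bar>2 * (int j - int i) * q'\<bar>\<ge>2 * \<bar>q'\<bar>"
    proof -
     have "\<bar>int j - int i\<bar>\<ge>1" using False by auto
     then have "\<bar>int j - int i\<bar> * \<bar>q'\<bar>\<ge>1 * \<bar>q'\<bar>" by (intro mult_right_mono) auto
     then show ?thesis unfolding abs_mult by (simp add: mult.assoc)
    qed
    then have pq: "\<bar>p\<bar> > \<bar>q'\<bar>" using IH(2) unfolding p_def by linarith
    have ep: "\<bar>2 * e * p\<bar> = 2 * \<bar>p\<bar>" using e2 by (simp add: abs_mult)
    have 1: "\<bar>q\<bar> > \<bar>p\<bar>" using pq ep unfolding q_def by linarith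
    have "\<bar>p * q'\<bar>\<le>\<bar>p\<bar> * \<bar>p\<bar>" unfolding abs_mult by (rule mult_left_mono) (use pq in auto)
    moreover have "\<bar>p\<bar> * \<bar>p\<bar> = p * p" by (simp add: abs_mult_self_eq)
    moreover have "p * p > 0" using pq by (intro int_square_pos) auto
    moreover have "e * (p * q) = e * (p * q') + 2 * (p * p)"
    proof -
     have "e * (p * q) = e * (p * q') + 2 * ((e * e) * (p * p))" by (simp add: q_def algebra_simps)
     then show ?thesis using e2(1) by simp
    qed
    moreover have "\<bar>e * (p * q')\<bar> = \<bar>p * q'\<bar>" using e2 by (simp add: abs_mult)
    ultimately have "e * (p * q) > 0" by linarith
    then show ?thesis using 1 pq by auto
   qed
   then show ?thesis using st x sgn by (intro exI[of _ p] exI[of _ q]) auto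
  qed
 qed simp
 then obtain p q where "mv (weval SL2 conjL w) (1, 0) = (p + 2 * int (fst (hd w)) * q, q)" "\<bar>q\<bar> > \<bar>p\<bar>" by blast
 then show ?thesis by auto
qed

definition UL :: "nat => m2" where "UL k = (if k = 0 then (1, 2, 0, 1) else (1, 0, 2, 1))"

lemma UL_closed: "UL\<in>S \<rightarrow> carrier SL2" by (auto simp: UL_def)

text \<open>Ping-pong between the cones |p| > |q| and |q| > |p|. The starting vector is the axis
  moved by the rightmost letter, so that the first application already lands in the right
  cone.\<close>

lemma UL_free:
 assumes "reduced w" "w ~= []" "w\<in>words {0, 1}"
 shows "weval SL2 UL w ~= (1, 0, 0, 1)"
proof -
 let ?v = "if fst (last w) = 0 then (0, 1) else (1, 0)"
 have "\<exists>p q. mv (weval SL2 UL w) ?v = (p, q)\<and>(if fst (hd w) = 0 then \<bar>p\<bar> > \<bar>q\<bar> else \<bar>q\<bar> > \<bar>p\<bar>)\<and>p ~= 0\<and>q ~= 0 \<and>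
   (if snd (hd w) then p * q > 0 else p * q < 0)"
  using assms
 proof (induction w)
  case (Cons x w)
  obtain i b where x: "x = (i, b)" by (cases x)
  then have i: "i = 0\<or>i = 1" using Cons by auto
  define e :: int where "e = (if b then 1 else -1)"
  have e2: "e * e = 1" "\<bar>e\<bar> = 1" by (auto simp: e_def)
  have M: "(if b then UL i else inv\<^bsub>SL2\<^esub> UL i) = (if i = 0 then (1, 2 * e, 0, 1) else (1, 0, 2 * e, 1))"
   using i by (auto simp: UL_def e_def SL2_inv)
  have step: "mv (weval SL2 UL (x # w)) v = (if i = 0 then (p0 + 2 * e * q0, q0) else (p0, q0 + 2 * e * p0))"
   if "mv (weval SL2 UL w) v = (p0, q0)" for p0 q0 v
   using that M x i by (auto simp: mv_mm)
  have sgn: "if b then p * q > 0 else p * q < 0" if "e * (p * q) > 0" for p q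
   using that by (auto simp: e_def split: if_splits)
  show ?case
  proof (cases "w = []")
   case True
   show ?thesis
    using step[of "if i = 0 then (0, 1) else (1, 0)" "if i = 0 then 0 else 1" "if i = 0 then 1 else 0"] True x i
    by (auto simp: e_def)
  next
   case False
   let ?v' = "if fst (last w) = 0 then (0, 1) else (1, 0)"
   have rw: "reduced w" using Cons(2) by (simp add: reduced_Cons)
   have ww: "w\<in>words {0, 1}" using Cons(4) by (cases x) simp
   from Cons.IH[OF rw False ww] obtain p q where IH: "mv (weval SL2 UL w) ?v' = (p, q)"
    "if fst (hd w) = 0 then \<bar>p\<bar> > \<bar>q\<bar> else \<bar>q\<bar> > \<bar>p\<bar>" "p ~= 0" "q ~= 0"
    "if snd (hd w) then p * q > 0 else p * q < 0"
    by blast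
   have v: "(if fst (last (x # w)) = 0 then (0, 1) else (1, 0)) = ?v'" using False by simp
   have hw: "fst (hd w) = 0\<or>fst (hd w) = 1" using ww False by (cases w) auto
   have key: "\<bar>r\<bar> > \<bar>s\<bar>\<and>r ~= 0\<and>e * (r * s) > 0"
    if r: "r = r0 + 2 * e * s" and s: "s ~= 0" and c: "\<bar>s\<bar> > \<bar>r0\<bar>\<or>(\<bar>r0\<bar> > \<bar>s\<bar>\<and>e * (r0 * s) > 0)" for r r0 s
   proof -
    have ss: "s * s > 0" using s by (rule int_square_pos)
    have es: "\<bar>2 * e * s\<bar> = 2 * \<bar>s\<bar>" using e2 by (simp add: abs_mult)
    have ers: "e * (r * s) = e * (r0 * s) + 2 * (s * s)"
    proof -
     have "e * (r * s) = e * (r0 * s) + 2 * ((e * e) * (s * s))" by (simp add: r algebra_simps)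
     then show ?thesis using e2(1) by simp
    qed
    show ?thesis
     using c
    proof
     assume a: "\<bar>s\<bar> > \<bar>r0\<bar>"
     then have "\<bar>r\<bar> > \<bar>s\<bar>" using es unfolding r by linarith
     moreover have "\<bar>r0 * s\<bar>\<le>\<bar>s\<bar> * \<bar>s\<bar>" unfolding abs_mult by (rule mult_right_mono) (use a in auto)
     moreover have "\<bar>s\<bar> * \<bar>s\<bar> = s * s" by (simp add: abs_mult_self_eq)
     moreover have "\<bar>e * (r0 * s)\<bar> = \<bar>r0 * s\<bar>" using e2 by (simp add: abs_mult)
     ultimately show ?thesis using ers ss by auto
    next
     assume a: "\<bar>r0\<bar> > \<bar>s\<bar>\<and>e * (r0 * s) > 0"
     then have "\<bar>r\<bar> > \<bar>s\<bar>"
      unfolding r e_def by (cases b) (auto simp: zero_less_mult_iff mult_less_0_iff)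
     then show ?thesis using a ers ss by auto
    qed
   qed
   have same: "snd (hd w) = b" if "fst (hd w) = i" using Cons(2) False x that by (auto simp: reduced_Cons)
   have pos: "e * (p * q) > 0" if "fst (hd w) = i" using IH(5) same[OF that] by (auto simp: e_def split: if_splits)
   show ?thesis
   proof (cases "i = 0")
    case True
    let ?r = "p + 2 * e * q"
    have "\<bar>q\<bar> > \<bar>p\<bar>\<or>(\<bar>p\<bar> > \<bar>q\<bar>\<and>e * (p * q) > 0)" using IH(2) hw pos True by auto
    from key[OF HOL.refl IH(4) this] show ?thesis
     using step[OF IH(1)] True x sgn[of ?r q] IH(4) unfolding v by auto
   next
    case F: False
    let ?r = "q + 2 * e * p"
    have "\<bar>p\<bar> > \<bar>q\<bar>\<or>(\<bar>q\<bar> > \<bar>p\<bar>\<and>e * (q * p) > 0)" using IH(2) hw pos F i by (auto simp: mult.commute)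
    from key[OF HOL.refl IH(3) this] show ?thesis
     using step[OF IH(1)] F x sgn[of p ?r] IH(3) unfolding v by (auto simp: mult.commute)
   qed
  qed
 qed simp
 then obtain p q where "mv (weval SL2 UL w) ?v = (p, q)" "p ~= 0" "q ~= 0" by blast
 then show ?thesis by (auto split: if_splits)
qed

text \<open>Sanov's congruence description of the group generated by \<open>U\<close> and \<open>L\<close>.\<close>

definition sanov :: "m2 set" where
 "sanov = {(a, b, c, d). a * d - b * c = 1\<and>4 dvd a - 1\<and>4 dvd d - 1\<and>even b\<and>even c}"

lemma sanov_subgroup: "subgroup sanov SL2"
proof (rule SL2.subgroupI)
 show "sanov\<subseteq>carrier SL2" by (auto simp: sanov_def)
 have "(1, 0, 0, 1)\<in>sanov" by (simp add: sanov_def)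
 then show "sanov ~= {}" by blast
 show "inv\<^bsub>SL2\<^esub> A\<in>sanov" if A: "A\<in>sanov" for A
 proof -
  obtain a b c d where "A = (a, b, c, d)" by (cases A)
  then show ?thesis using A by (auto simp: sanov_def SL2_inv algebra_simps)
 qed
 show "A \<otimes>\<^bsub>SL2\<^esub> B\<in>sanov" if AB: "A\<in>sanov" "B\<in>sanov" for A B
 proof -
  obtain a b c d where A: "A = (a, b, c, d)" by (cases A)
  obtain a' b' c' d' where B: "B = (a', b', c', d')" by (cases B)
  have "mdet (mm A B) = 1" using AB by (simp add: mdet_mm) (simp add: A B sanov_def)
  moreover have *: "4 dvd x * x' + y * y' - 1" if "4 dvd x - 1" "4 dvd x' - 1" "even y" "even y'" for x x' y y' :: int
  proof -
   obtain k k' l l' where "x = 4 * k + 1" "x' = 4 * k' + 1" "y = 2 * l" "y' = 2 * l'"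
    using \<open>4 dvd x - 1\<close> \<open>4 dvd x' - 1\<close> \<open>even y\<close> \<open>even y'\<close> by (auto elim!: dvdE simp: algebra_simps eq_diff_eq)
   then have "x * x' + y * y' - 1 = 4 * (4 * k * k' + k + k' + l * l')" by (simp add: algebra_simps)
   then show ?thesis by simp
  qed
  moreover have "4 dvd a * a' + b * c' - 1" "4 dvd d * d' + c * b' - 1"
   using AB by (auto simp: A B sanov_def intro!: *)
  moreover have "even (a * b' + b * d')" "even (c * a' + d * c')" using AB by (auto simp: A B sanov_def)
  ultimately show ?thesis by (simp add: A B sanov_def add.commute)
 qed
qed

text \<open>Euclid's algorithm on the first column: one of U, L or their inverses, multiplied from
  the left, decreases |a| + |c|. These absolute values are never equal because \<open>a\<close> is
  odd and \<open>c\<close> even, and at c = 0 the condition modulo 4 excludes the diagonal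
  -1.\<close>

lemma sanov_generated: "generate SL2 (UL ` {0, 1}) = sanov"
proof
 have "UL ` {0, 1}\<subseteq>sanov" by (auto simp: UL_def sanov_def)
 then show "generate SL2 (UL ` {0, 1})\<subseteq>sanov" using SL2.generate_subgroup_incl sanov_subgroup by blast
 let ?G = "generate SL2 (UL ` {0, 1})"
 interpret S: subgroup sanov SL2 by (rule sanov_subgroup)
 have sub: "subgroup ?G SL2" by (rule SL2.generate_is_subgroup) (auto simp: UL_def)
 interpret G: subgroup ?G SL2 by (rule sub)
 have U: "(1, 2, 0, 1)\<in>?G" and L: "(1, 0, 2, 1)\<in>?G"
  using generate.incl[of "UL 0" "UL ` {0, 1}" SL2] generate.incl[of "UL 1" "UL ` {0, 1}" SL2]
  by (auto simp: UL_def)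
 have U': "(1, -2, 0, 1)\<in>?G" and L': "(1, 0, -2, 1)\<in>?G"
  using G.m_inv_closed[OF U] G.m_inv_closed[OF L] by (simp_all add: SL2_inv)
 have Un: "(1, 2 * int n, 0, 1)\<in>?G" "(1, - 2 * int n, 0, 1)\<in>?G" for n
 proof (induction n)
  case 0
  { case 1 show ?case using G.one_closed by simp
  next case 2 show ?case using G.one_closed by simp }
 next
  case (Suc n)
  { case 1 show ?case using G.m_closed[OF U Suc(1)] by (simp add: algebra_simps)
  next case 2 show ?case using G.m_closed[OF U' Suc(2)] by (simp add: algebra_simps) }
 qed
 have "A\<in>?G" if "A\<in>sanov" for A
  using that
 proof (induction "nat (\<bar>fst A\<bar> + \<bar>fst (snd (snd A))\<bar>)" arbitrary: A rule: less_induct)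
  case less
  obtain a b c d where A: "A = (a, b, c, d)" by (cases A)
  have s: "a * d - b * c = 1" "4 dvd a - 1" "4 dvd d - 1" "even b" "even c"
   using less.prems by (auto simp: A sanov_def)
  have a_odd: "odd a" using s(2) by presburger
  show ?case
  proof (cases "c = 0")
   case True
   then have "a * d = 1" using s by simp
   then have "a = 1\<and>d = 1\<or>a = -1\<and>d = -1" by (simp add: zmult_eq_1_iff)
   then have ad: "a = 1" "d = 1" using s(2) by auto
   obtain k where k: "b = 2 * k" using s(4) by blast
   show ?thesis
   proof (cases "k\<ge>0")
    case True
    then show ?thesis using Un(1)[of "nat k"] \<open>c = 0\<close> ad k by (simp add: A)
   next
    case False
    then show ?thesis using Un(2)[of "nat (- k)"] \<open>c = 0\<close> ad k by (simp add: A)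
   qed
  next
   case c0: False
   have ne: "\<bar>a\<bar> ~= \<bar>c\<bar>" using a_odd s(5) by (metis even_abs_add_iff even_add abs_eq_iff dvd_minus_iff)
   have red: "A\<in>?G"
    if M: "M\<in>?G" "M'\<in>?G" "mm M' M = (1, 0, 0, 1)"
     and lt: "\<bar>fst (mm M A)\<bar> + \<bar>fst (snd (snd (mm M A)))\<bar> < \<bar>a\<bar> + \<bar>c\<bar>" for M M'
   proof -
    have "M\<in>sanov" using M(1) \<open>?G\<subseteq>sanov\<close> by blast
    then have "mm M A\<in>sanov" using S.m_closed[OF _ less.prems] by simp
    moreover have "nat (\<bar>fst (mm M A)\<bar> + \<bar>fst (snd (snd (mm M A)))\<bar>) < nat (\<bar>fst A\<bar> + \<bar>fst (snd (snd A))\<bar>)"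
     using lt by (simp add: A)
    ultimately have "mm M A\<in>?G" using less.hyps by blast
    then have "mm M' (mm M A)\<in>?G" using G.m_closed[OF M(2)] by simp
    moreover have "mm M' (mm M A) = A" using M(3) by (simp add: A flip: mm_assoc)
    ultimately show ?thesis by simp
   qed
   show ?thesis
   proof (cases "\<bar>a\<bar> < \<bar>c\<bar>")
    case True
    show ?thesis
    proof (cases "a * c > 0")
     case pos: True
     have "\<bar>c - 2 * a\<bar> < \<bar>c\<bar>" using pos True by (auto simp: zero_less_mult_iff)
     then show ?thesis by (intro red[OF L' L]) (simp_all add: A)
    next
     case neg: False
     moreover have "a ~= 0" using a_odd by auto
     ultimately have "\<bar>c + 2 * a\<bar> < \<bar>c\<bar>" using True c0 by (auto simp: zero_less_mult_iff not_less)
     then show ?thesis by (intro red[OF L L']) (simp_all add: A)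
    qed
   next
    case F: False
    then have lt: "\<bar>c\<bar> < \<bar>a\<bar>" using ne by simp
    show ?thesis
    proof (cases "a * c > 0")
     case pos: True
     have "\<bar>a - 2 * c\<bar> < \<bar>a\<bar>" using pos lt by (auto simp: zero_less_mult_iff)
     then show ?thesis by (intro red[OF U' U]) (simp_all add: A)
    next
     case neg: False
     then have "\<bar>a + 2 * c\<bar> < \<bar>a\<bar>" using lt c0 by (auto simp: zero_less_mult_iff not_less)
     then show ?thesis by (intro red[OF U U']) (simp_all add: A)
    qed
   qed
  qed
 qed
 then show "sanov\<subseteq>?G" by blast
qed

text \<open>Conjugation by \<open>diag(1, 3)\<close>, a virtual endomorphism of Sanov's group.\<close>

fun con3 :: "m2 => m2" where "con3 (a, b, c, d) = (a, b div 3, 3 * c, d)"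

lemma con3_mult:
 assumes "3 dvd fst (snd A)" "3 dvd fst (snd B)"
 shows "con3 (mm A B) = mm (con3 A) (con3 B)" "3 dvd fst (snd (mm A B))"
 using assms by (cases A; cases B; auto simp: algebra_simps elim!: dvdE)+

lemma con3_sanov: "A\<in>sanov ==> 3 dvd fst (snd A) ==> con3 A\<in>sanov"
proof -
 assume A: "A\<in>sanov" "3 dvd fst (snd A)"
 obtain a b c d where A': "A = (a, b, c, d)" by (cases A)
 obtain k where "b = 3 * k" using A A' by auto
 then show ?thesis using A A' by (auto simp: sanov_def algebra_simps)
qed

text \<open>\<open>con3\<close> divides the upper right entry by 3 and can be iterated inside
  \<open>K\<close>, so this entry is divisible by all powers of 3.\<close>

lemma con3_core_upper:
 assumes K: "!!A. A\<in>K ==> 3 dvd fst (snd A)\<and>con3 A\<in>K" and A: "(a, b, c, d)\<in>K"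
 shows "b = 0"
proof -
 have "(3::int) ^ n dvd b" if "(a, b, c, d)\<in>K" for n a b c d
  using that
 proof (induction n arbitrary: a b c d)
  case (Suc n)
  have "3 dvd b" using K[OF Suc(2)] by simp
  then obtain k where k: "b = 3 * k" by blast
  then have "(a, k, 3 * c, d)\<in>K" using K[OF Suc(2)] by simp
  from Suc(1)[OF this] show ?case using k by simp
 qed simp
 then have *: "(3::int) ^ n dvd b" for n using A by blast
 show ?thesis
 proof (rule ccontr)
  assume "b ~= 0"
  then have "\<bar>3 ^ nat \<bar>b\<bar>\<bar>\<le>\<bar>b\<bar>" using *[of "nat \<bar>b\<bar>"] dvd_imp_le_int by blast
  moreover have "int (nat \<bar>b\<bar>) < 3 ^ nat \<bar>b\<bar>"
  proof -
   have "nat \<bar>b\<bar> < 3 ^ nat \<bar>b\<bar>" by (rule less_le_trans[OF less_exp power_mono]) auto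
   then have "int (nat \<bar>b\<bar>) < int (3 ^ nat \<bar>b\<bar>)" by (simp only: of_nat_less_iff)
   then show ?thesis by simp
  qed
  ultimately show False by simp
 qed
qed

lemma con3_sanov_core:
 assumes K: "K\<subseteq>sanov" "!!A. A\<in>K ==> 3 dvd fst (snd A)\<and>con3 A\<in>K"
  and conj: "!!A B. A\<in>sanov ==> B\<in>K ==> mm (mm A B) (inv\<^bsub>SL2\<^esub> A)\<in>K"
  and A: "A\<in>K"
 shows "A = (1, 0, 0, 1)"
proof -
 obtain a b c d where A': "A = (a, b, c, d)" by (cases A)
 have b: "b = 0" using con3_core_upper[OF K(2)] A A' by blast
 have s: "a * d = 1" "4 dvd a - 1" using A A' K(1) b by (auto simp: sanov_def)
 then have "a = 1\<and>d = 1\<or>a = -1\<and>d = -1" by (simp add: zmult_eq_1_iff)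
 then have ad: "a = 1" "d = 1" using s(2) by auto
 \<comment> \<open>Conjugation by U brings the lower left entry into the upper right corner, where
   it must vanish too.\<close>
 have "(1, 2, 0, 1)\<in>sanov" by (simp add: sanov_def)
 from conj[OF this A] have "(1 + 2 * c, - 4 * c, c, 1 - 2 * c)\<in>K"
  using A' b ad by (simp add: SL2_inv algebra_simps)
 from con3_core_upper[OF K(2) this] show ?thesis using A' b ad by simp
qed

section \<open>The Heisenberg group\<close>

text \<open>In these coordinates on the Heisenberg group the \<open>k\<close>-th power is multiplication by \<open>k\<close>, and
 \<open>SL\<^sub>2(\<int>)\<close> acts on the first two coordinates.\<close>

type_synonym hh = "int\<times>int\<times>int"

fun hm :: "hh => hh => hh" where
 "hm (x, y, z) (x', y', z') = (x + x', y + y', z + z' + x * y' - y * x')"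

fun hs :: "int => hh => hh" where "hs k (x, y, z) = (k * x, k * y, k * z)"

definition HH :: "hh monoid" where
 "HH = (|carrier = UNIV, monoid.mult = hm, monoid.one = (0, 0, 0)|)"

lemma HH_simps [simp]: "carrier HH = UNIV" "A \<otimes>\<^bsub>HH\<^esub> B = hm A B" "\<one>\<^bsub>HH\<^esub> = (0, 0, 0)"
 by (simp_all add: HH_def)

lemma group_HH: "group HH"
proof (rule groupI)
 fix A B C
 show "A \<otimes>\<^bsub>HH\<^esub> B \<otimes>\<^bsub>HH\<^esub> C = A \<otimes>\<^bsub>HH\<^esub> (B \<otimes>\<^bsub>HH\<^esub> C)"
  by (cases A; cases B; cases C) (simp add: algebra_simps)
 obtain x y z where A: "A = (x, y, z)" by (cases A)
 show "\<exists>B\<in>carrier HH. B \<otimes>\<^bsub>HH\<^esub> A = \<one>\<^bsub>HH\<^esub>"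
  by (rule bexI[of _ "hs (-1) A"]) (simp_all add: A)
 show "\<one>\<^bsub>HH\<^esub> \<otimes>\<^bsub>HH\<^esub> A = A" by (simp add: A)
qed simp_all

interpretation HH: group HH by (rule group_HH)

lemma HH_inv: "inv\<^bsub>HH\<^esub> (x, y, z) = (- x, - y, - z)"
 by (rule HH.inv_equality) auto

lemma HH_pow: "A [^]\<^bsub>HH\<^esub> (n::nat) = hs (int n) A"
proof (induction n)
 case (Suc n)
 obtain x y z where "A = (x, y, z)" by (cases A)
 then show ?case using Suc by (simp add: algebra_simps)
qed (cases A; simp)

lemma HH_int_pow: "A [^]\<^bsub>HH\<^esub> (n::int) = hs n A"
 by (cases A) (simp add: int_pow_def2 HH_pow HH_inv)

lemma HH_subgroup_hs: "subgroup N HH ==> A\<in>N ==> hs n A\<in>N"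
 using HH.subgroup_int_pow_closed[of N A n] by (simp add: HH_int_pow)

definition cong0 :: "int => hh set" where "cong0 k = {(x, y, z). k dvd x\<and>k dvd y\<and>k dvd z}"

lemma cong0_hs: "A\<in>cong0 k\<longleftrightarrow>(\<exists>B. A = hs k B)"
proof
 assume "A\<in>cong0 k"
 then obtain x y z where "A = (k * x, k * y, k * z)" by (auto simp: cong0_def elim!: dvdE)
 then show "\<exists>B. A = hs k B" by (metis hs.simps)
qed (auto simp: cong0_def)

lemma cong0_normal: "cong0 k \<lhd> HH"
proof (rule HH.normal_invI)
 show "subgroup (cong0 k) HH"
 proof (rule HH.subgroupI)
  show "cong0 k ~= {}" by (auto simp: cong0_def intro!: exI[of _ 0])
  show "inv\<^bsub>HH\<^esub> A\<in>cong0 k" if "A\<in>cong0 k" for A using that by (cases A) (auto simp: cong0_def HH_inv)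
  show "A \<otimes>\<^bsub>HH\<^esub> B\<in>cong0 k" if "A\<in>cong0 k" "B\<in>cong0 k" for A B
   using that by (cases A; cases B) (auto simp: cong0_def)
 qed simp
 show "A \<otimes>\<^bsub>HH\<^esub> B \<otimes>\<^bsub>HH\<^esub> inv\<^bsub>HH\<^esub> A\<in>cong0 k" if "B\<in>cong0 k" for A B
  using that by (cases A; cases B) (auto simp: cong0_def HH_inv algebra_simps)
qed

lemma cong0_subgroup: "subgroup (cong0 k) HH"
 using cong0_normal by (rule normal_imp_subgroup)

lemma cong0_same_residues:
 assumes "x mod k = x' mod k" "y mod k = y' mod k" "z mod k = z' mod k"
 shows "hm (inv\<^bsub>HH\<^esub> (x', y', z')) (x, y, z)\<in>cong0 k"
proof -
 obtain p q r where "x = x' + k * p" "y = y' + k * q" "z = z' + k * r"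
  using assms by (metis mod_eq_dvd_iff dvdE add.commute diff_add_cancel)
 then show ?thesis by (simp add: HH_inv cong0_def algebra_simps)
qed

subsection \<open>Separability of subgroups\<close>

lemma int_subgroup_generator:
 fixes A :: "int set"
 assumes "0\<in>A" "!!x y. x\<in>A ==> y\<in>A ==> x - y\<in>A"
 obtains u where "u\<ge>0" "u\<in>A" "!!x. x\<in>A ==> u dvd x"
proof (cases "\<exists>x\<in>A. x ~= 0")
 case False
 then show ?thesis using that[of 0] assms(1) by auto
next
 case True
 have neg: "- x\<in>A" if "x\<in>A" for x using assms(2)[OF assms(1) that] by simp
 have add: "x + y\<in>A" if "x\<in>A" "y\<in>A" for x y using assms(2)[OF that(1) neg[OF that(2)]] by simp
 have mul: "k * x\<in>A" if x: "x\<in>A" for k x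
 proof -
  have n: "int n * x\<in>A" for n by (induction n) (use x assms(1) add in \<open>auto simp: algebra_simps\<close>)
  show ?thesis using n[of "nat k"] neg[OF n[of "nat (- k)"]] by (cases "k\<ge>0") auto
 qed
 obtain x where "x\<in>A" "x ~= 0" using True by blast
 then have ex: "\<exists>n::nat. n > 0\<and>int n\<in>A"
  using neg by (intro exI[of _ "nat \<bar>x\<bar>"]) (auto simp: abs_if)
 define n where "n = (LEAST n::nat. n > 0\<and>int n\<in>A)"
 have n: "n > 0" "int n\<in>A" using LeastI_ex[OF ex] by (auto simp: n_def)
 have "int n dvd x" if x: "x\<in>A" for x
 proof -
  have "x mod int n = x - (x div int n) * int n" by (simp add: minus_div_mult_eq_mod)
  then have r: "x mod int n\<in>A" using assms(2)[OF x mul[OF n(2)]] by simp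
  have "\<not> x mod int n > 0"
  proof
   assume p: "x mod int n > 0"
   then have "nat (x mod int n) > 0\<and>int (nat (x mod int n))\<in>A" using r by simp
   then have "n\<le>nat (x mod int n)" unfolding n_def by (rule Least_le)
   moreover have "x mod int n < int n" using n(1) by simp
   ultimately show False using p by linarith
  qed
  then have "x mod int n = 0" using n(1) by (metis pos_mod_sign of_nat_0_less_iff order_le_less)
  then show ?thesis by auto
 qed
 then show ?thesis using that[of "int n"] n by simp
qed

text \<open>Every subgroup inside \<open>P\<close> is closed relative to \<open>P\<close> in the
  topology given by the normal subgroups \<open>cong0 D\<close>.\<close>

definition HH_sep :: "hh set => bool" where
 "HH_sep P\<longleftrightarrow>(\<forall>N n. subgroup N HH --> N\<subseteq>P --> n\<in>P --> n\<notin>N -->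
   (\<exists>D > 0. \<forall>m\<in>N. \<forall>c\<in>cong0 D. n ~= hm m c))"

text \<open>Extension along a homomorphism \<chi> to the integers. With \<chi>(N) generated by u,
  either \<chi>(n) is separated from it modulo an integer, or n is moved into the kernel of \<chi>
  by an element of N and separated there modulo d. In the second case the modulus u d, for nonzero
  u, lets an error c be compensated by an element of N that is itself trivial modulo d.\<close>

lemma HH_sep_step:
 assumes P: "subgroup P HH" and add: "!!A B. A\<in>P ==> B\<in>P ==> \<chi> (hm A B) = \<chi> A + \<chi> B"
  and div: "!!A k. A\<in>cong0 k ==> k dvd \<chi> A" and sep: "HH_sep {A\<in>P. \<chi> A = (0::int)}"
 shows "HH_sep P"
 unfolding HH_sep_def
proof (intro allI impI)
 interpret P: subgroup P HH by (rule P)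
 fix N n assume N: "subgroup N HH" "N\<subseteq>P" and n: "n\<in>P" "n\<notin>N"
 interpret N: subgroup N HH by (rule N(1))
 have Nm: "hm A B\<in>N" if "A\<in>N" "B\<in>N" for A B using N.m_closed[OF that] by simp
 have Pm: "hm A B\<in>P" if "A\<in>P" "B\<in>P" for A B using P.m_closed[OF that] by simp
 have as: "hm (hm A B) C = hm A (hm B C)" for A B C using HH.m_assoc[of A B C] by simp
 have ca: "hm (inv\<^bsub>HH\<^esub> A) (hm A B) = B" "hm A (hm (inv\<^bsub>HH\<^esub> A) B) = B" for A B
  using HH.inv_cancel_left[of A B] by simp_all
 have \<chi>0: "\<chi> (0, 0, 0) = 0" using add[OF P.one_closed P.one_closed] by simp
 have \<chi>inv: "\<chi> (inv\<^bsub>HH\<^esub> A) = - \<chi> A" if "A\<in>P" for A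
  using add[OF P.m_inv_closed[OF that] that] \<chi>0 HH.l_inv[of A] by simp
 have sub: "x - y\<in>\<chi> ` N" if xy: "x\<in>\<chi> ` N" "y\<in>\<chi> ` N" for x y
 proof -
  obtain A B where AB: "A\<in>N" "B\<in>N" "x = \<chi> A" "y = \<chi> B" using xy by auto
  have "\<chi> (hm A (inv\<^bsub>HH\<^esub> B)) = x - y"
  proof -
   have P: "A\<in>P" "B\<in>P" using AB N(2) by auto
   show ?thesis unfolding add[OF P(1) P.m_inv_closed[OF P(2)]] \<chi>inv[OF P(2)] AB by simp
  qed
  then show ?thesis using Nm[OF AB(1) N.m_inv_closed[OF AB(2)]] by (metis imageI)
 qed
 have z: "0\<in>\<chi> ` N" using \<chi>0 N.one_closed by (metis HH_simps(3) imageI)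
 obtain u where u: "u\<ge>0" "u\<in>\<chi> ` N" "!!x. x\<in>\<chi> ` N ==> u dvd x"
  using int_subgroup_generator[OF z sub] by blast
 have hsx: "\<chi> (hs j p) = j * \<chi> p" if p: "p\<in>N" for j p
 proof -
  have hn: "\<chi> (hs (int i) p) = int i * \<chi> p" for i
  proof (induction i)
   case 0
   then show ?case using \<chi>0 by (cases p) simp
  next
   case (Suc i)
   have P: "hs (int i) p\<in>P" "p\<in>P" using HH_subgroup_hs[OF N(1) p] p N(2) by auto
   have e: "hs (int (Suc i)) p = hm (hs (int i) p) p"
    using HH.nat_pow_Suc[of p i] by (simp only: HH_pow HH_simps)
   show ?case unfolding e add[OF P] Suc by (simp add: algebra_simps)
  qed
  show ?thesis
  proof (cases "j\<ge>0")
   case True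
   then show ?thesis using hn[of "nat j"] by simp
  next
   case False
   have P: "hs (- j) p\<in>P" using HH_subgroup_hs[OF N(1) p] N(2) by auto
   have "hs j p = inv\<^bsub>HH\<^esub> (hs (- j) p)" by (cases p) (simp add: HH_inv)
   then have "\<chi> (hs j p) = - \<chi> (hs (- j) p)" using \<chi>inv[OF P] by simp
   then show ?thesis using hn[of "nat (- j)"] False by simp
  qed
 qed
 show "\<exists>D > 0. \<forall>m\<in>N. \<forall>c\<in>cong0 D. n ~= hm m c"
 proof (cases "\<chi> n\<in>\<chi> ` N")
  case False
  \<comment> \<open>For u = 0 any modulus larger than |\<chi>(n)| separates \<chi>(n) from
    0.\<close>
  define D where "D = (if u = 0 then \<bar>\<chi> n\<bar> + 1 else u)"
  have nu: "\<not> u dvd \<chi> n"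
  proof
   assume "u dvd \<chi> n"
   then obtain k where k: "\<chi> n = u * k" by blast
   obtain p where p: "p\<in>N" "u = \<chi> p" using u(2) by blast
   have "\<chi> n = \<chi> (hs k p)" using hsx[OF p(1)] k p(2) by (simp add: mult.commute)
   then have "\<chi> n\<in>\<chi> ` N" using HH_subgroup_hs[OF N(1) p(1)] by (metis imageI)
   then show False using False by simp
  qed
  have D: "D > 0" using u(1) by (auto simp: D_def)
  have nD: "\<not> (\<exists>x\<in>\<chi> ` N. D dvd \<chi> n - x)"
  proof
   assume "\<exists>x\<in>\<chi> ` N. D dvd \<chi> n - x"
   then obtain x where x: "x\<in>\<chi> ` N" "D dvd \<chi> n - x" by blast
   have ux: "u dvd x" using u(3) x(1) .
   show False
   proof (cases "u = 0")
    case True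
    then have "x = 0" using ux by simp
    then have "D dvd \<chi> n" using x by simp
    moreover have "\<chi> n ~= 0" using nu by auto
    ultimately have "\<bar>D\<bar>\<le>\<bar>\<chi> n\<bar>" by (rule dvd_imp_le_int[rotated])
    then show False using True by (simp add: D_def)
   next
    case False
    then have "u dvd \<chi> n - x" using x(2) by (simp add: D_def)
    then show False using ux nu by (metis dvd_diff_commute dvd_diff_left_iff)
   qed
  qed
  have "n ~= hm m c" if m: "m\<in>N" "c\<in>cong0 D" for m c
  proof
   assume e: "n = hm m c"
   have "c = hm (inv\<^bsub>HH\<^esub> m) n" using e ca by simp
   moreover have mP: "m\<in>P" using m(1) N(2) by blast
   ultimately have cP: "c\<in>P" using Pm[OF P.m_inv_closed[OF mP] n(1)] by simp
   have "\<chi> n - \<chi> m = \<chi> c" using add[OF mP cP] e by simp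
   then show False using nD div[OF m(2)] m(1) by auto
  qed
  then show ?thesis using D by blast
 next
  case True
  then obtain n2 where n2: "n2\<in>N" "\<chi> n2 = \<chi> n" by auto
  define n' where "n' = hm (inv\<^bsub>HH\<^esub> n2) n"
  have n2P: "n2\<in>P" using n2 N(2) by auto
  have n'P: "n'\<in>P" unfolding n'_def by (rule Pm[OF P.m_inv_closed[OF n2P] n(1)])
  have n'0: "\<chi> n' = 0"
   unfolding n'_def add[OF P.m_inv_closed[OF n2P] n(1)] \<chi>inv[OF n2P] n2 by simp
  have n'N: "n'\<notin>N"
  proof
   assume "n'\<in>N"
   then have "hm n2 n'\<in>N" using Nm n2 by blast
   then show False using n(2) ca by (simp add: n'_def)
  qed
  define N0 where "N0 = N\<inter>{A\<in>P. \<chi> A = 0}"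
  have N0: "subgroup N0 HH"
  proof (rule HH.subgroupI)
   show "N0 ~= {}" using N.one_closed P.one_closed \<chi>0 by (auto simp: N0_def)
   show "inv\<^bsub>HH\<^esub> A\<in>N0" if "A\<in>N0" for A
    using that N.m_inv_closed[of A] P.m_inv_closed[of A] \<chi>inv[of A] by (simp add: N0_def)
   show "A \<otimes>\<^bsub>HH\<^esub> B\<in>N0" if "A\<in>N0" "B\<in>N0" for A B
    using that Nm[of A B] Pm[of A B] add[of A B] by (simp add: N0_def)
  qed simp
  obtain d where d: "d > 0" "!!m c. m\<in>N0 ==> c\<in>cong0 d ==> n' ~= hm m c"
  proof -
   have "N0\<subseteq>{A\<in>P. \<chi> A = 0}" "n'\<in>{A\<in>P. \<chi> A = 0}" "n'\<notin>N0"
    using n'P n'0 n'N by (auto simp only: N0_def)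
   then have "\<exists>D > 0. \<forall>m\<in>N0. \<forall>c\<in>cong0 D. n' ~= hm m c"
    using sep N0 unfolding HH_sep_def by blast
   then show ?thesis using that by blast
  qed
  define D where "D = (if u = 0 then d else u * d)"
  have "n ~= hm m c" if m: "m\<in>N" "c\<in>cong0 D" for m c
  proof
   assume e: "n = hm m c"
   define m' where "m' = hm (inv\<^bsub>HH\<^esub> n2) m"
   have m': "m'\<in>N" using Nm N.m_inv_closed n2 m by (simp add: m'_def)
   have e': "n' = hm m' c" by (simp add: n'_def m'_def e as)
   have cP: "c\<in>P"
   proof -
    have "c = hm (inv\<^bsub>HH\<^esub> m') n'" using e' ca by simp
    moreover have "m'\<in>P" using m' N(2) by blast
    ultimately show ?thesis using Pm[OF P.m_inv_closed n'P, of m'] by simp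
   qed
   have sum: "\<chi> m' + \<chi> c = 0" 
   proof -
    have "m'\<in>P" using m' N(2) by blast
    from add[OF this cP] show ?thesis using e' n'0 by simp
   qed
   show False
   proof (cases "u = 0")
    case True
    then have "\<chi> m' = 0" using u(3) m' by fastforce
    then have "m'\<in>N0" using m' N(2) by (auto simp: N0_def)
    then show False using d(2)[of m' c] e' m(2) True by (simp add: D_def)
   next
    case False
    then have "u * d dvd \<chi> c" using div[OF m(2)] by (simp add: D_def)
    then have "u * d dvd \<chi> m'" using sum by (metis add_eq_0_iff dvd_minus_iff)
    then obtain k where k: "\<chi> m' = u * d * k" by blast
    obtain p where p: "p\<in>N" "u = \<chi> p" using u(2) by blast
    \<comment> \<open>A power of \<open>p\<close> with the same value of \<chi> as
      \<open>m'\<close>; its exponent is a multiple of d, so it is trivial modulo d.\<close>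
    define q where "q = hs (d * k) p"
    have qN: "q\<in>N" using HH_subgroup_hs[OF N(1) p(1)] by (simp add: q_def)
    have \<chi>q: "\<chi> q = \<chi> m'" using k p(2) hsx[OF p(1)] by (simp add: q_def)
    have qd: "q\<in>cong0 d" by (cases p) (auto simp: q_def cong0_def)
    define m0 where "m0 = hm (inv\<^bsub>HH\<^esub> q) m'"
    have m0: "m0\<in>N0"
    proof -
     have P: "q\<in>P" "m'\<in>P" using qN m' N(2) by auto
     have "\<chi> m0 = 0" unfolding m0_def add[OF P.m_inv_closed[OF P(1)] P(2)] \<chi>inv[OF P(1)] \<chi>q by simp
     moreover have "m0\<in>N" unfolding m0_def by (rule Nm[OF N.m_inv_closed[OF qN] m'])
     ultimately show ?thesis using N(2) by (auto simp: N0_def)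
    qed
    interpret C: normal "cong0 d" HH by (rule cong0_normal)
    have c: "c\<in>cong0 d" using m(2) False by (auto simp: D_def cong0_def elim: dvd_mult_right)
    have "hm (hm (inv\<^bsub>HH\<^esub> m0) q) m0\<in>cong0 d" using C.inv_op_closed1[OF _ qd, of m0] by simp
    then have "hm (hm (hm (inv\<^bsub>HH\<^esub> m0) q) m0) c\<in>cong0 d" using C.m_closed[OF _ c] by simp
    moreover have "n' = hm m0 (hm (hm (hm (inv\<^bsub>HH\<^esub> m0) q) m0) c)"
     by (simp only: as ca e') (simp only: m0_def as ca)
    ultimately show False using d(2)[OF m0] by blast
   qed
  qed
  moreover have "D > 0" using d u(1) by (auto simp: D_def)
  ultimately show ?thesis by blast
 qed
qed

text \<open>Three applications of the step, to the centre, to the subgroup x = 0 and to the whole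
  group; on these the coordinates z, y and x respectively are additive.\<close>

lemma HH_separable:
 assumes "subgroup N HH" "n\<notin>N"
 shows "\<exists>D > 0. \<forall>m\<in>N. \<forall>c\<in>cong0 D. n ~= hm m c"
proof -
 have co: "fst (hm A B) = fst A + fst B" "fst (snd (hm A B)) = fst (snd A) + fst (snd B)"
  "fst A = 0 ==> fst (snd A) = 0 ==> snd (snd (hm A B)) = snd (snd A) + snd (snd B)" for A B
  by (cases A; cases B; simp)+
 have ci: "fst (inv\<^bsub>HH\<^esub> A) = - fst A" "fst (snd (inv\<^bsub>HH\<^esub> A)) = - fst (snd A)" for A
  by (cases A; simp add: HH_inv)+
 have cc: "k dvd fst A" "k dvd fst (snd A)" "k dvd snd (snd A)" if "A\<in>cong0 k" for A k
  using that by (auto simp: cong0_def)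
 define P1 where "P1 = {A :: hh. fst A = 0}"
 define P2 where "P2 = {A :: hh. fst A = 0\<and>fst (snd A) = 0}"
 have P1: "subgroup P1 HH"
 proof (rule HH.subgroupI)
  have "(0, 0, 0)\<in>P1" by (simp add: P1_def)
  then show "P1 ~= {}" by blast
 qed (simp_all add: P1_def co ci)
 have P2: "subgroup P2 HH"
 proof (rule HH.subgroupI)
  have "(0, 0, 0)\<in>P2" by (simp add: P2_def)
  then show "P2 ~= {}" by blast
 qed (simp_all add: P2_def co ci)
 have "N = {(0, 0, 0)}" if "subgroup N HH" "N\<subseteq>{(0, 0, 0)}" for N
  using subgroup.one_closed[OF that(1)] that(2) by auto
 then have 0: "HH_sep {(0, 0, 0)}" unfolding HH_sep_def by blast
 have "{A\<in>P2. snd (snd A) = 0} = {(0, 0, 0)}" by (auto simp: P2_def)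
 then have "HH_sep P2"
  using 0 by (rule_tac HH_sep_step[OF P2, where \<chi> = "%A. snd (snd A)"]) (simp_all add: P2_def co cc)
 moreover have "{A\<in>P1. fst (snd A) = 0} = P2" by (simp add: P1_def P2_def)
 ultimately have "HH_sep P1"
  by (rule_tac HH_sep_step[OF P1, where \<chi> = "%A. fst (snd A)"]) (simp_all add: co cc)
 moreover have "{A\<in>UNIV. fst A = 0} = P1" by (simp add: P1_def)
 ultimately have "HH_sep UNIV"
  using HH.subgroup_self by (rule_tac HH_sep_step[where \<chi> = fst]) (simp_all add: co cc)
 then show ?thesis using assms unfolding HH_sep_def by blast
qed

section \<open>Conjugation on a normal Heisenberg subgroup\<close>

lemma hs_cong0: "hs k B\<in>cong0 k" by (cases B) (simp add: cong0_def)

lemma (in group) power_subgroup_normal: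
 assumes "N \<lhd> G" shows "generate G ((%j. j [^] (n::nat)) ` N) \<lhd> G"
proof (rule normal_generateI)
 interpret N: normal N G by (rule assms)
 show "(%j. j [^] n) ` N\<subseteq>carrier G" by auto
 fix h g assume "h\<in>(%j. j [^] n) ` N" and g: "g\<in>carrier G"
 then obtain j where j: "j\<in>N" "h = j [^] n" by blast
 have "g\<otimes>h\<otimes>inv g = (g\<otimes>j\<otimes>inv g) [^] n" using j g by (simp add: conj_pow)
 then show "g\<otimes>h\<otimes>inv g\<in>(%j. j [^] n) ` N" using N.inv_op_closed2[OF g j(1)] by blast
qed

fun ma :: "m2 => hh => hh" where "ma (a, b, c, d) (x, y, z) = (a * x + b * y, c * x + d * y, z)"

lemma ma_mm: "ma (mm A B) v = ma A (ma B v)"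
 by (cases A; cases B; cases v) (simp add: algebra_simps)

lemma ma_one: "ma (1, 0, 0, 1) v = v" by (cases v) simp

text \<open>The term x y' - y x' is a determinant and is multiplied by det A.\<close>

lemma ma_hm: "mdet A = 1 ==> ma A (hm v w) = hm (ma A v) (ma A w)"
proof (cases A; cases v; cases w)
 fix a b c d x y z x' y' z' assume A: "mdet A = 1" "A = (a, b, c, d)" "v = (x, y, z)" "w = (x', y', z')"
 have "(a * x + b * y) * (c * x' + d * y') - (c * x + d * y) * (a * x' + b * y') = (a * d - b * c) * (x * y' - y * x')"
  by (simp add: algebra_simps)
 also have "\<dots> = x * y' - y * x'" using A by simp
 finally have "z + z' + x * y' - y * x' =
  z + z' + (a * x + b * y) * (c * x' + d * y') - (c * x + d * y) * (a * x' + b * y')" by simp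
 then show "ma A (hm v w) = hm (ma A v) (ma A w)" unfolding A by (simp add: distrib_left)
qed

locale heis_subgroup = group G for G (structure) +
 fixes J :: "'a set" and \<zeta> :: "'a => hh"
 assumes J_sub: "subgroup J G" and \<zeta>_m: "i\<in>J ==> j\<in>J ==> \<zeta> (i\<otimes>j) = hm (\<zeta> i) (\<zeta> j)"
begin

interpretation J: subgroup J G by (rule J_sub)

lemma \<zeta>_one: "\<zeta> \<one> = (0, 0, 0)"
 using \<zeta>_m[OF J.one_closed J.one_closed] by (cases "\<zeta> \<one>") simp

lemma \<zeta>_inv: "j\<in>J ==> \<zeta> (inv j) = inv\<^bsub>HH\<^esub> \<zeta> j"
 using \<zeta>_m[of "inv j" j] \<zeta>_one HH.inv_equality[of "\<zeta> (inv j)" "\<zeta> j"] by simp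

lemma J_pow: "j\<in>J ==> j [^] (n::nat)\<in>J" by (induction n) auto

lemma J_int_pow: "j\<in>J ==> j [^] (n::int)\<in>J"
 using subgroup_int_pow_closed[OF J.subgroup_axioms] .

lemma \<zeta>_pow: "j\<in>J ==> \<zeta> (j [^] (n::nat)) = hs (int n) (\<zeta> j)"
proof (induction n)
 case 0
 then show ?case by (cases "\<zeta> j") (simp add: \<zeta>_one)
next
 case (Suc n)
 then show ?case by (cases "\<zeta> j") (simp add: \<zeta>_m J_pow algebra_simps)
qed

lemma \<zeta>_int_pow: "j\<in>J ==> \<zeta> (j [^] (n::int)) = hs n (\<zeta> j)"
proof (cases n rule: int_cases2)
 case (nonneg m)
 assume "j\<in>J"
 then show ?thesis by (simp add: nonneg int_pow_int \<zeta>_pow)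
next
 case (nonpos m)
 assume "j\<in>J"
 then show ?thesis by (cases "\<zeta> j") (simp add: nonpos int_pow_neg int_pow_int \<zeta>_inv J_pow \<zeta>_pow HH_inv)
qed

lemma finite_residues: "fidx G J {j\<in>J. \<zeta> j\<in>cong0 (int k)}" if "k > 0"
proof (rule fidxI[where \<kappa> = "%j. case \<zeta> j of (x, y, z) => (x mod int k, y mod int k, z mod int k)"])
 let ?R = "{0..<int k}"
 have "(%j. case \<zeta> j of (x, y, z) => (x mod int k, y mod int k, z mod int k)) ` J\<subseteq>?R\<times>?R\<times>?R"
  using that by (auto split: prod.splits)
 then show "finite ((%j. case \<zeta> j of (x, y, z) => (x mod int k, y mod int k, z mod int k)) ` J)"
  by (rule finite_subset) auto
next
 fix a b assume ab: "a\<in>J" "b\<in>J" and e: "(case \<zeta> a of (x, y, z) => (x mod int k, y mod int k, z mod int k)) =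
  (case \<zeta> b of (x, y, z) => (x mod int k, y mod int k, z mod int k))"
 have "hm (inv\<^bsub>HH\<^esub> \<zeta> b) (\<zeta> a)\<in>cong0 (int k)"
  using e by (cases "\<zeta> a"; cases "\<zeta> b") (simp del: hm.simps add: cong0_same_residues)
 then show "inv b\<otimes>a\<in>{j\<in>J. \<zeta> j\<in>cong0 (int k)}" using ab by (simp add: \<zeta>_m \<zeta>_inv)
qed (rule J.subset)

end

text \<open>The condition on \<open>M\<close> replaces finite index of the image of
  \<open>J\<close>: all M-th powers of the Heisenberg group are realized in \<open>J\<close>, which
  provides test elements and roots with known coordinates.\<close>

locale heis_normal = heis_subgroup G J \<zeta> for G (structure) and J :: "'a set" and \<zeta> :: "'a => hh" +
 fixes M :: int
 assumes J: "J \<lhd> G" and \<zeta>_inj: "inj_on \<zeta> J" and M_pos: "M > 0" and \<zeta>_img: "cong0 M\<subseteq>\<zeta> ` J"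
begin

sublocale J: normal J G by (rule J)

lemma \<zeta>_eq: "i\<in>J ==> j\<in>J ==> \<zeta> i = \<zeta> j ==> i = j" using \<zeta>_inj by (rule inj_onD) auto

definition pre :: "hh => 'a" where "pre A = inv_into J \<zeta> A"

lemma pre: "A\<in>cong0 M ==> pre A\<in>J" "A\<in>cong0 M ==> \<zeta> (pre A) = A"
 unfolding pre_def using \<zeta>_img by (auto intro: inv_into_into f_inv_into_f)

text \<open>An element whose coordinates are divisible by n M is the n-th power of an element of
  \<open>J\<close>, as its n-th root has coordinates in \<open>cong0 M\<close>. So \<open>P\<close>
  contains a congruence subgroup, which has finite index.\<close>

lemma power_subgroup:
 assumes "n > 0"
 defines "P \<equiv> generate G ((%j. j [^] (n::nat)) ` J)"
 shows "P \<lhd> G" "P\<subseteq>J" "fidx G J P" "\<zeta> ` P\<subseteq>cong0 (int n)"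
proof -
 show N: "P \<lhd> G" unfolding P_def by (rule power_subgroup_normal[OF J])
 have s: "(%j. j [^] n) ` J\<subseteq>J" using J_pow by blast
 show PJ: "P\<subseteq>J" unfolding P_def by (rule generate_subgroup_incl[OF s J.subgroup_axioms])
 have "subgroup {j\<in>J. \<zeta> j\<in>cong0 (int n)} G"
 proof (rule subgroupI)
  have "\<one>\<in>{j\<in>J. \<zeta> j\<in>cong0 (int n)}" by (simp add: \<zeta>_one cong0_def)
  then show "{j\<in>J. \<zeta> j\<in>cong0 (int n)} ~= {}" by blast
  show "inv a\<in>{j\<in>J. \<zeta> j\<in>cong0 (int n)}" if "a\<in>{j\<in>J. \<zeta> j\<in>cong0 (int n)}" for a
   using that subgroup.m_inv_closed[OF cong0_subgroup] by (simp add: \<zeta>_inv)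
  show "a\<otimes>b\<in>{j\<in>J. \<zeta> j\<in>cong0 (int n)}"
   if "a\<in>{j\<in>J. \<zeta> j\<in>cong0 (int n)}" "b\<in>{j\<in>J. \<zeta> j\<in>cong0 (int n)}" for a b
   using that subgroup.m_closed[OF cong0_subgroup[of "int n"], of "\<zeta> a" "\<zeta> b"] by (simp add: \<zeta>_m)
 qed auto
 moreover have "(%j. j [^] n) ` J\<subseteq>{j\<in>J. \<zeta> j\<in>cong0 (int n)}"
  by (simp add: image_subset_iff J_pow \<zeta>_pow hs_cong0)
 ultimately have "P\<subseteq>{j\<in>J. \<zeta> j\<in>cong0 (int n)}"
  unfolding P_def by (intro generate_subgroup_incl)
 then show "\<zeta> ` P\<subseteq>cong0 (int n)" by auto
 have "{j\<in>J. \<zeta> j\<in>cong0 (int (n * nat M))}\<subseteq>P"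
 proof
  fix j assume "j\<in>{j\<in>J. \<zeta> j\<in>cong0 (int (n * nat M))}"
  then have "j\<in>J" "\<zeta> j\<in>cong0 (int n * M)" using M_pos by auto
  then obtain B where j: "j\<in>J" "\<zeta> j = hs (int n * M) B" unfolding cong0_hs by blast
  define i where "i = pre (hs M B)"
  have i: "i\<in>J" "\<zeta> i = hs M B" using pre[OF hs_cong0] by (simp_all add: i_def)
  have "\<zeta> (i [^] n) = \<zeta> j" using i j by (cases B) (simp add: \<zeta>_pow algebra_simps)
  then have "j = i [^] n" using \<zeta>_eq[OF j(1) J_pow[OF i(1)]] by simp
  then show "j\<in>P" unfolding P_def using i(1) by (auto intro: generate.incl)
 qed
 then show "fidx G J P"
  using fidx_mono[OF finite_residues[of "n * nat M"] order.refl] assms(1) M_pos by simp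
qed

section \<open>Conjugation in Heisenberg coordinates\<close>

lemma conj_J: "g\<in>carrier G ==> j\<in>J ==> g\<otimes>j\<otimes>inv g\<in>J" by (rule J.inv_op_closed2)

lemma conj_mult: "g\<in>carrier G ==> i\<in>carrier G ==> j\<in>carrier G ==>
  g\<otimes>(i\<otimes>j)\<otimes>inv g = (g\<otimes>i\<otimes>inv g)\<otimes>(g\<otimes>j\<otimes>inv g)"
 by (simp add: m_assoc)

lemma \<zeta>_conj_m: "g\<in>carrier G ==> i\<in>J ==> j\<in>J ==>
  \<zeta> (g\<otimes>(i\<otimes>j)\<otimes>inv g) = hm (\<zeta> (g\<otimes>i\<otimes>inv g)) (\<zeta> (g\<otimes>j\<otimes>inv g))"
 by (simp add: conj_mult \<zeta>_m conj_J del: hm.simps)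

lemma conj_int_pow:
 assumes "g\<in>carrier G" "j\<in>carrier G"
 shows "g\<otimes>j [^] (n::int)\<otimes>inv g = (g\<otimes>j\<otimes>inv g) [^] n"
proof -
 have "(%x. g\<otimes>x\<otimes>inv g)\<in>hom G G" using assms(1) by (auto intro!: homI simp: m_assoc)
 from hom_int_pow[OF this assms(2) group_axioms group_axioms] show ?thesis .
qed

lemma \<zeta>_conj_pow: "g\<in>carrier G ==> j\<in>J ==>
  \<zeta> (g\<otimes>j [^] (n::int)\<otimes>inv g) = hs n (\<zeta> (g\<otimes>j\<otimes>inv g))"
 by (simp add: conj_int_pow \<zeta>_int_pow conj_J)

subsection \<open>Elements acting through \<open>SL\<^sub>2(\<int>)\<close>\<close>

text \<open>An automorphism of the Heisenberg group over \<open>A\<close> can still add a linear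
  form in x and y to the third coordinate; here this form is required to vanish.\<close>

definition lin :: "'a => m2 => bool" where
 "lin g A\<longleftrightarrow>g\<in>carrier G\<and>mdet A = 1\<and>(\<forall>j\<in>J. \<zeta> (g\<otimes>j\<otimes>inv g) = ma A (\<zeta> j))"

definition Lin :: "'a set" where "Lin = {g. \<exists>A. lin g A}"

definition mat_of :: "'a => m2" where "mat_of g = (SOME A. lin g A)"

lemma lin_one: "lin \<one> (1, 0, 0, 1)" by (simp add: lin_def ma_one)

lemma lin_mult: "lin g A ==> lin h B ==> lin (g\<otimes>h) (mm A B)"
proof -
 assume A: "lin g A" "lin h B"
 then have gh: "g\<in>carrier G" "h\<in>carrier G" by (auto simp: lin_def)
 have "\<zeta> (g\<otimes>h\<otimes>j\<otimes>inv (g\<otimes>h)) = ma (mm A B) (\<zeta> j)" if j: "j\<in>J" for j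
 proof -
  have "g\<otimes>h\<otimes>j\<otimes>inv (g\<otimes>h) = g\<otimes>(h\<otimes>j\<otimes>inv h)\<otimes>inv g"
   using gh j by (simp add: m_assoc inv_mult_group)
  then show ?thesis using A conj_J[OF gh(2) j] j by (simp add: lin_def ma_mm)
 qed
 then show ?thesis using A by (simp add: lin_def mdet_mm)
qed

lemma lin_inv: "lin g A ==> lin (inv g) (inv\<^bsub>SL2\<^esub> A)"
proof -
 assume A: "lin g A"
 then have g: "g\<in>carrier G" and dA: "mdet A = 1" by (auto simp: lin_def)
 have i: "mm (inv\<^bsub>SL2\<^esub> A) A = (1, 0, 0, 1)" using SL2.l_inv[of A] dA by simp
 have "\<zeta> (inv g\<otimes>j\<otimes>inv (inv g)) = ma (inv\<^bsub>SL2\<^esub> A) (\<zeta> j)" if j: "j\<in>J" for j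
 proof -
  have ij: "inv g\<otimes>j\<otimes>g\<in>J" using J.inv_op_closed1[OF g j] .
  have "\<zeta> j = \<zeta> (g\<otimes>(inv g\<otimes>j\<otimes>g)\<otimes>inv g)" using g j by (simp add: m_assoc)
  also have "\<dots> = ma A (\<zeta> (inv g\<otimes>j\<otimes>g))" using A ij by (simp add: lin_def)
  finally have "ma (inv\<^bsub>SL2\<^esub> A) (\<zeta> j) = ma (mm (inv\<^bsub>SL2\<^esub> A) A) (\<zeta> (inv g\<otimes>j\<otimes>g))" by (simp add: ma_mm)
  then show ?thesis using g by (simp add: i ma_one)
 qed
 then show ?thesis using g SL2.inv_closed[of A] dA by (simp add: lin_def)
qed

lemma lin_unique: assumes "lin g A" "lin g B" shows "A = B"
proof -
 have e: "ma A v = ma B v" if "v\<in>cong0 M" for v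
  using assms pre[OF that] unfolding lin_def by metis
 obtain a b c d where A: "A = (a, b, c, d)" by (cases A)
 obtain a' b' c' d' where B: "B = (a', b', c', d')" by (cases B)
 show ?thesis using e[of "(M, 0, 0)"] e[of "(0, M, 0)"] M_pos by (simp add: A B cong0_def)
qed

lemma mat_of_eq: "lin g A ==> mat_of g = A"
 unfolding mat_of_def using lin_unique by (metis someI)

lemma lin_mat_of: "g\<in>Lin ==> lin g (mat_of g)"
 using mat_of_eq by (auto simp: Lin_def)

lemma Lin_subgroup: "subgroup Lin G"
proof (rule subgroupI)
 show "Lin ~= {}" using lin_one unfolding Lin_def by blast
 show "Lin\<subseteq>carrier G" by (auto simp: Lin_def lin_def)
 show "inv a\<in>Lin" if "a\<in>Lin" for a using that lin_inv unfolding Lin_def by blast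
 show "a\<otimes>b\<in>Lin" if "a\<in>Lin" "b\<in>Lin" for a b using that lin_mult unfolding Lin_def by blast
qed

lemma mat_of_mult: "g\<in>Lin ==> h\<in>Lin ==> mat_of (g\<otimes>h) = mm (mat_of g) (mat_of h)"
 by (intro mat_of_eq lin_mult lin_mat_of)

definition JLin :: "'a set" where "JLin = {g\<in>carrier G. \<exists>u\<in>J. u\<otimes>g\<in>Lin}"

lemma JLin_subgroup: "subgroup JLin G"
proof (rule subgroupI)
 have "\<one>\<otimes>\<one>\<in>Lin" using subgroup.one_closed[OF Lin_subgroup] by simp
 then have "\<one>\<in>JLin" using J.one_closed unfolding JLin_def by blast
 then show "JLin ~= {}" by blast
 show "JLin\<subseteq>carrier G" by (auto simp: JLin_def)
 show "inv a\<in>JLin" if a: "a\<in>JLin" for a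
 proof -
  obtain u where u: "u\<in>J" "u\<otimes>a\<in>Lin" "a\<in>carrier G" using a by (auto simp: JLin_def)
  have "inv (u\<otimes>a)\<in>Lin" using subgroup.m_inv_closed[OF Lin_subgroup u(2)] .
  moreover have "inv (u\<otimes>a) = (inv a\<otimes>inv u\<otimes>a)\<otimes>inv a" using u by (simp add: inv_mult_group m_assoc)
  moreover have "inv a\<otimes>inv u\<otimes>a\<in>J" using J.inv_op_closed1[OF u(3)] u(1) by simp
  ultimately show ?thesis using u(3) by (auto simp: JLin_def)
 qed
 show "a\<otimes>b\<in>JLin" if ab: "a\<in>JLin" "b\<in>JLin" for a b
 proof -
  obtain u where u: "u\<in>J" "u\<otimes>a\<in>Lin" "a\<in>carrier G" using ab(1) by (auto simp: JLin_def)
  obtain v where v: "v\<in>J" "v\<otimes>b\<in>Lin" "b\<in>carrier G" using ab(2) by (auto simp: JLin_def)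
  have "(u\<otimes>a)\<otimes>(v\<otimes>b)\<in>Lin" using subgroup.m_closed[OF Lin_subgroup u(2) v(2)] .
  moreover have "(u\<otimes>a)\<otimes>(v\<otimes>b) = (u\<otimes>(a\<otimes>v\<otimes>inv a))\<otimes>(a\<otimes>b)" using u v by (simp add: m_assoc)
  moreover have "u\<otimes>(a\<otimes>v\<otimes>inv a)\<in>J" using u v conj_J by simp
  ultimately show ?thesis using u(3) v(3) by (auto simp: JLin_def)
 qed
qed

text \<open>The action of \<open>k\<close> on \<open>J\<close> is congruent to the identity modulo \<open>4M\<close>.\<close>

definition near :: "'a => int => int => int => int => int => int => bool" where
 "near k p q r p' q' r'\<longleftrightarrow>k\<in>carrier G \<and>
  \<zeta> (k\<otimes>pre (M, 0, 0)\<otimes>inv k) = (M * (1 + 4 * M * p), 4 * M\<^sup>2 * q, 4 * M\<^sup>2 * r) \<and>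
  \<zeta> (k\<otimes>pre (0, M, 0)\<otimes>inv k) = (4 * M\<^sup>2 * p', M * (1 + 4 * M * q'), 4 * M\<^sup>2 * r')"

lemma pre_e: "pre (M, 0, 0)\<in>J" "\<zeta> (pre (M, 0, 0)) = (M, 0, 0)" "pre (0, M, 0)\<in>J"
 "\<zeta> (pre (0, M, 0)) = (0, M, 0)" "pre (0, 0, M)\<in>J" "\<zeta> (pre (0, 0, M)) = (0, 0, M)"
 by (auto intro!: pre simp: cong0_def)

text \<open>Up to finite index the centre consists of commutators, so the action on it is determined
  by that on the other two test elements, through the determinant.\<close>

lemma near_center:
 assumes "near k p q r p' q' r'"
 shows "\<zeta> (k\<otimes>pre (0, 0, M)\<otimes>inv k) = (0, 0, M * ((1 + 4 * M * p) * (1 + 4 * M * q') - 16 * M\<^sup>2 * p' * q))"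
proof -
 have k: "k\<in>carrier G" using assms by (simp add: near_def)
 let ?e1 = "pre (M, 0, 0)" and ?e2 = "pre (0, M, 0)" and ?e3 = "pre (0, 0, M)"
 \<comment> \<open>The commutator of (M, 0, 0) and (0, M, 0) is (0, 0, 2 M^2), the power of (0, 0,
   M) with exponent 2 M.\<close>
 have "\<zeta> (?e1\<otimes>?e2) = \<zeta> (?e2\<otimes>?e1\<otimes>?e3 [^] (2 * M))"
  by (simp add: \<zeta>_m \<zeta>_int_pow J_int_pow pre_e power2_eq_square)
 then have "?e1\<otimes>?e2 = ?e2\<otimes>?e1\<otimes>?e3 [^] (2 * M)" by (rule \<zeta>_eq[rotated 2]) (simp_all add: pre_e J_int_pow)
 then have "\<zeta> (k\<otimes>(?e1\<otimes>?e2)\<otimes>inv k) = \<zeta> (k\<otimes>(?e2\<otimes>?e1\<otimes>?e3 [^] (2 * M))\<otimes>inv k)" by simp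
 then have e: "hm (\<zeta> (k\<otimes>?e1\<otimes>inv k)) (\<zeta> (k\<otimes>?e2\<otimes>inv k)) =
   hm (hm (\<zeta> (k\<otimes>?e2\<otimes>inv k)) (\<zeta> (k\<otimes>?e1\<otimes>inv k))) (hs (2 * M) (\<zeta> (k\<otimes>?e3\<otimes>inv k)))"
  using k by (simp only: \<zeta>_conj_m \<zeta>_conj_pow pre_e J_int_pow J.m_closed)
 obtain x y z where xyz: "\<zeta> (k\<otimes>?e3\<otimes>inv k) = (x, y, z)" by (cases "\<zeta> (k\<otimes>?e3\<otimes>inv k)")
 define a where "a = 1 + 4 * M * p"
 define d where "d = 1 + 4 * M * q'"
 define c where "c = 4 * M * q"
 define b where "b = 4 * M * p'"
 have 1: "\<zeta> (k\<otimes>?e1\<otimes>inv k) = (M * a, M * c, 4 * M\<^sup>2 * r)" "\<zeta> (k\<otimes>?e2\<otimes>inv k) = (M * b, M * d, 4 * M\<^sup>2 * r')"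
  using assms by (simp_all add: near_def a_def b_def c_def d_def power2_eq_square)
 have "x = 0" "y = 0" using e M_pos unfolding 1 xyz by auto
 moreover have "2 * M * z = 2 * M * (M * (a * d - c * b))"
  using e unfolding 1 xyz by (simp add: \<open>x = 0\<close> \<open>y = 0\<close> algebra_simps)
 then have "z = M * (a * d - c * b)" using M_pos by simp
 moreover have "a * d - c * b = (1 + 4 * M * p) * (1 + 4 * M * q') - 16 * M\<^sup>2 * p' * q"
  by (simp add: a_def b_def c_def d_def power2_eq_square)
 ultimately show ?thesis using xyz by simp
qed

text \<open>On the centre both \<open>k\<close> and its inverse multiply by integers, so the
  determinant is 1 or -1, and the factor 4 in \<open>near\<close> excludes -1. Besides the matrix
  there remains a linear form in the third coordinate; it is divisible by 4 M and can therefore be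
  cancelled by an inner automorphism from \<open>J\<close>.\<close>

lemma near_JLin:
 assumes "near k p q r p' q' r'" and i: "near (inv k) p2 q2 r2 p2' q2' r2'"
 shows "k\<in>JLin"
proof -
 have k: "k\<in>carrier G" using assms by (simp add: near_def)
 define a where "a = 1 + 4 * M * p"
 define d where "d = 1 + 4 * M * q'"
 define c where "c = 4 * M * q"
 define b where "b = 4 * M * p'"
 let ?e1 = "pre (M, 0, 0)" and ?e2 = "pre (0, M, 0)" and ?e3 = "pre (0, 0, M)"
 have 1: "\<zeta> (k\<otimes>?e1\<otimes>inv k) = (M * a, M * c, 4 * M\<^sup>2 * r)" "\<zeta> (k\<otimes>?e2\<otimes>inv k) = (M * b, M * d, 4 * M\<^sup>2 * r')"
  using assms by (simp_all add: near_def a_def b_def c_def d_def power2_eq_square)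
 have \<delta>: "a * d - b * c = 1 + (4 * M) * (p + q' + 4 * M * (p * q') - 4 * M * (p' * q))"
  by (simp add: a_def b_def c_def d_def algebra_simps)
 define \<delta> where "\<delta> = a * d - b * c"
 have 3: "\<zeta> (k\<otimes>?e3\<otimes>inv k) = (0, 0, M * \<delta>)"
  unfolding near_center[OF assms(1)] by (simp add: \<delta>_def a_def b_def c_def d_def power2_eq_square algebra_simps)
 obtain \<epsilon> where 4: "\<zeta> (inv k\<otimes>?e3\<otimes>inv (inv k)) = (0, 0, M * \<epsilon>)"
  using near_center[OF i] by blast
 have "\<zeta> (k\<otimes>?e3\<otimes>inv k) = \<zeta> (?e3 [^] \<delta>)" unfolding 3 by (simp add: \<zeta>_int_pow pre_e)
 then have e3: "k\<otimes>?e3\<otimes>inv k = ?e3 [^] \<delta>" by (rule \<zeta>_eq[rotated 2]) (simp_all add: conj_J k pre_e J_int_pow)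
 have "?e3 = inv k\<otimes>(k\<otimes>?e3\<otimes>inv k)\<otimes>inv (inv k)" using k pre_e(5) by (simp add: m_assoc)
 then have "\<zeta> ?e3 = hs \<delta> (0, 0, M * \<epsilon>)"
  unfolding e3 using \<zeta>_conj_pow[of "inv k" ?e3 \<delta>] k pre_e(5) 4 by simp
 then have "\<delta> * \<epsilon> = 1" using M_pos by (simp add: pre_e)
 then have "\<delta> = 1\<or>\<delta> = - 1" by (metis zmult_eq_1_iff)
 moreover have "\<delta> ~= - 1"
 proof
  assume "\<delta> = - 1"
  then have "4 * M * (p + q' + 4 * M * (p * q') - 4 * M * (p' * q)) = - 2" using \<delta> by (simp add: \<delta>_def)
  then have "4 dvd (- 2 :: int)" by (metis dvd_triv_left mult.assoc)
  then show False by simp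
 qed
 ultimately have det: "a * d - b * c = 1" by (simp add: \<delta>_def)
 have conj: "\<zeta> (k\<otimes>j\<otimes>inv k) = (a * x + b * y, c * x + d * y, z + 4 * M * (x * r + y * r'))"
  if j: "j\<in>J" "\<zeta> j = (x, y, z)" for j x y z
 proof -
  \<comment> \<open>Only the images of the three test elements are known. The M-th power of
    \<open>j\<close> is a product of their powers, and M-th roots are unique in these
    coordinates.\<close>
  let ?w = "?e1 [^] x\<otimes>?e2 [^] y\<otimes>?e3 [^] (z - M * x * y)"
  have "\<zeta> (j [^] M) = \<zeta> ?w"
   by (simp add: \<zeta>_m \<zeta>_int_pow J_int_pow pre_e j algebra_simps)
  then have "j [^] M = ?w" by (rule \<zeta>_eq[rotated 2]) (simp_all add: pre_e J_int_pow j)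
  then have "\<zeta> (k\<otimes>j [^] M\<otimes>inv k) = \<zeta> (k\<otimes>?w\<otimes>inv k)" by simp
  then have "hs M (\<zeta> (k\<otimes>j\<otimes>inv k)) = hm (hm (hs x (\<zeta> (k\<otimes>?e1\<otimes>inv k))) (hs y (\<zeta> (k\<otimes>?e2\<otimes>inv k))))
    (hs (z - M * x * y) (\<zeta> (k\<otimes>?e3\<otimes>inv k)))"
   using k j(1) by (simp only: \<zeta>_conj_m \<zeta>_conj_pow pre_e J_int_pow J.m_closed)
  also have "\<dots> = (M * (a * x + b * y), M * (c * x + d * y),
    4 * M\<^sup>2 * (x * r + y * r') + M\<^sup>2 * x * y * (a * d - b * c) + (z - M * x * y) * (M * \<delta>))"
   unfolding 1 3 by (simp add: algebra_simps power2_eq_square)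
  also have "\<dots> = hs M (a * x + b * y, c * x + d * y, z + 4 * M * (x * r + y * r'))"
   unfolding \<delta>_def det by (simp add: algebra_simps power2_eq_square)
  finally show ?thesis using M_pos by (cases "\<zeta> (k\<otimes>j\<otimes>inv k)") simp
 qed
 \<comment> \<open>Conjugation by (s, t, 0) adds 2 (s Y - t X) to the third coordinate of (X, Y, Z).
   These s and t solve the system cancelling the linear form, which has determinant 1, and are
   divisible by M.\<close>
 define s where "s = 2 * M * (b * r - a * r')"
 define t where "t = 2 * M * (d * r - c * r')"
 define u where "u = pre (s, t, 0)"
 have u: "u\<in>J" "\<zeta> u = (s, t, 0)" using pre[of "(s, t, 0)"] by (auto simp: u_def cong0_def s_def t_def)
 have "lin (u\<otimes>k) (a, b, c, d)"
  unfolding lin_def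
 proof (intro conjI ballI)
  show "u\<otimes>k\<in>carrier G" using u k by simp
  show "mdet (a, b, c, d) = 1" using det by simp
  fix j assume j: "j\<in>J"
  obtain x y z where xyz: "\<zeta> j = (x, y, z)" by (cases "\<zeta> j")
  have "u\<otimes>k\<otimes>j\<otimes>inv (u\<otimes>k) = u\<otimes>(k\<otimes>j\<otimes>inv k)\<otimes>inv u"
   using u k j by (simp add: inv_mult_group m_assoc)
  then have "\<zeta> (u\<otimes>k\<otimes>j\<otimes>inv (u\<otimes>k)) = hm (hm (s, t, 0) (\<zeta> (k\<otimes>j\<otimes>inv k))) (inv\<^bsub>HH\<^esub> (s, t, 0))"
   using u conj_J[OF k j] by (simp add: \<zeta>_m \<zeta>_inv del: hm.simps)
  also have "\<dots> = (a * x + b * y, c * x + d * y,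
    z + 4 * M * (x * r + y * r') + 2 * (s * (c * x + d * y) - t * (a * x + b * y)))"
   unfolding conj[OF j xyz] HH_inv by (simp add: algebra_simps)
  also have "4 * M * (x * r + y * r') + 2 * (s * (c * x + d * y) - t * (a * x + b * y)) =
    4 * M * (x * r + y * r') * (1 - (a * d - b * c))"
   by (simp add: s_def t_def algebra_simps)
  then have "z + 4 * M * (x * r + y * r') + 2 * (s * (c * x + d * y) - t * (a * x + b * y)) = z"
   unfolding det by simp
  finally show "\<zeta> (u\<otimes>k\<otimes>j\<otimes>inv (u\<otimes>k)) = ma (a, b, c, d) (\<zeta> j)" by (simp add: xyz)
 qed
 then show ?thesis using u(1) k unfolding JLin_def Lin_def by blast
qed

text \<open>Two elements with the same residues modulo 4 M^3 on the test elements differ by one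
  close to the identity: a difference divisible by 4 M^3 is the power with exponent 4 M^2 of an
  element of \<open>J\<close>, and this form survives conjugation. The argument is symmetric, so it
  also gives the inverse that \<open>near_JLin\<close> asks for.\<close>

lemma JLin_fidx: "fidx G (carrier G) JLin"
proof -
 define R where "R = (%(x :: int, y :: int, z :: int). (x mod (4 * M ^ 3), y mod (4 * M ^ 3), z mod (4 * M ^ 3)))"
 define \<kappa> where "\<kappa> g = (R (\<zeta> (g\<otimes>pre (M, 0, 0)\<otimes>inv g)), R (\<zeta> (g\<otimes>pre (0, M, 0)\<otimes>inv g)))" for g
 have step: "\<exists>C. \<zeta> (inv g\<otimes>h\<otimes>e\<otimes>inv (inv g\<otimes>h)) = hm (\<zeta> e) (hs (4 * M\<^sup>2) C)"
  if gh: "g\<in>carrier G" "h\<in>carrier G" and e: "e\<in>J"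
   and r: "R (\<zeta> (g\<otimes>e\<otimes>inv g)) = R (\<zeta> (h\<otimes>e\<otimes>inv h))" for g h e
 proof -
  let ?E = "hm (inv\<^bsub>HH\<^esub> \<zeta> (g\<otimes>e\<otimes>inv g)) (\<zeta> (h\<otimes>e\<otimes>inv h))"
  have "?E\<in>cong0 (4 * M ^ 3)"
   using r by (cases "\<zeta> (g\<otimes>e\<otimes>inv g)"; cases "\<zeta> (h\<otimes>e\<otimes>inv h)")
    (simp del: hm.simps add: cong0_same_residues R_def)
  then obtain B where B: "?E = hs (4 * M ^ 3) B" unfolding cong0_hs by blast
  define c where "c = pre (hs M B)"
  have c: "c\<in>J" "\<zeta> c = hs M B" using pre[OF hs_cong0] by (simp_all add: c_def)
  have "\<zeta> (h\<otimes>e\<otimes>inv h) = hm (\<zeta> (g\<otimes>e\<otimes>inv g)) ?E"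
   using HH.inv_cancel_left(2)[of "\<zeta> (g\<otimes>e\<otimes>inv g)" "\<zeta> (h\<otimes>e\<otimes>inv h)"] by simp
  also have "?E = \<zeta> (c [^] (4 * M\<^sup>2))"
   unfolding B by (cases B) (simp add: \<zeta>_int_pow c power2_eq_square power3_eq_cube)
  finally have "\<zeta> (h\<otimes>e\<otimes>inv h) = \<zeta> ((g\<otimes>e\<otimes>inv g)\<otimes>c [^] (4 * M\<^sup>2))"
   using gh e c by (simp add: \<zeta>_m conj_J J_int_pow del: hm.simps)
  then have he: "h\<otimes>e\<otimes>inv h = (g\<otimes>e\<otimes>inv g)\<otimes>c [^] (4 * M\<^sup>2)"
   by (rule \<zeta>_eq[rotated 2]) (use gh e c in \<open>simp_all add: conj_J J_int_pow\<close>)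
  have "inv g\<otimes>h\<otimes>e\<otimes>inv (inv g\<otimes>h) = inv g\<otimes>(h\<otimes>e\<otimes>inv h)\<otimes>inv (inv g)"
   using gh e by (simp add: inv_mult_group m_assoc)
  also have "\<dots> = e\<otimes>(inv g\<otimes>c [^] (4 * M\<^sup>2)\<otimes>inv (inv g))"
   unfolding he using gh e c by (simp add: m_assoc)
  finally have "\<zeta> (inv g\<otimes>h\<otimes>e\<otimes>inv (inv g\<otimes>h)) = hm (\<zeta> e) (hs (4 * M\<^sup>2) (\<zeta> (inv g\<otimes>c\<otimes>inv (inv g))))"
   using gh e c \<zeta>_m[OF e conj_J[OF inv_closed[OF gh(1)] J_int_pow[OF c(1)]]] by (simp only: \<zeta>_conj_pow inv_closed)
  then show ?thesis by blast
 qed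
 have near: "\<exists>p q r p' q' r'. near (inv g\<otimes>h) p q r p' q' r'"
  if gh: "g\<in>carrier G" "h\<in>carrier G" and k: "\<kappa> g = \<kappa> h" for g h
 proof -
  obtain p q r where 1: "\<zeta> (inv g\<otimes>h\<otimes>pre (M, 0, 0)\<otimes>inv (inv g\<otimes>h)) = hm (M, 0, 0) (hs (4 * M\<^sup>2) (p, q, r))"
   using step[OF gh pre_e(1)] k by (auto simp: \<kappa>_def pre_e simp del: hm.simps hs.simps)
  obtain p' q' r' where 2: "\<zeta> (inv g\<otimes>h\<otimes>pre (0, M, 0)\<otimes>inv (inv g\<otimes>h)) = hm (0, M, 0) (hs (4 * M\<^sup>2) (p', q', r'))"
   using step[OF gh pre_e(3)] k by (auto simp: \<kappa>_def pre_e simp del: hm.simps hs.simps)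
  \<comment> \<open>The shifts \<open>M * q\<close> and \<open>M * p'\<close> come from the
    commutator term in the product with (M, 0, 0) or (0, M, 0).\<close>
  have "near (inv g\<otimes>h) p q (r + M * q) p' q' (r' - M * p')"
   unfolding near_def 1 2 using gh by (simp add: algebra_simps power2_eq_square)
  then show ?thesis by blast
 qed
 show ?thesis
 proof (rule fidxI[where \<kappa> = \<kappa>])
  define I where "I = {0..<4 * M ^ 3}\<times>{0..<4 * M ^ 3}\<times>{0..<4 * M ^ 3}"
  have "R v\<in>I" for v using M_pos by (cases v) (simp add: R_def I_def)
  then have "\<kappa> g\<in>I\<times>I" for g unfolding \<kappa>_def by blast
  then have "\<kappa> ` carrier G\<subseteq>I\<times>I" by blast
  moreover have "finite (I\<times>I)" by (simp add: I_def)
  ultimately show "finite (\<kappa> ` carrier G)" by (rule finite_subset)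
  fix a b assume ab: "a\<in>carrier G" "b\<in>carrier G" "\<kappa> a = \<kappa> b"
  obtain p q r p' q' r' where 1: "near (inv b\<otimes>a) p q r p' q' r'" using near[OF ab(2,1)] ab(3) by auto
  obtain p2 q2 r2 p2' q2' r2' where 2: "near (inv a\<otimes>b) p2 q2 r2 p2' q2' r2'" using near[OF ab] by blast
  have "inv a\<otimes>b = inv (inv b\<otimes>a)" using ab by (simp add: inv_mult_group)
  then show "inv b\<otimes>a\<in>JLin" using near_JLin[OF 1] 2 by simp
 qed auto
qed

end

subsection \<open>The presentation\<close>

abbreviation "HG \<equiv> heisenberg_group"

lemma (in group) int_pow_intertwine:
 assumes c: "x\<in>carrier G" "w\<in>carrier G" "y\<in>carrier G" and e: "y\<otimes>x = w\<otimes>y"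
 shows "y\<otimes>x [^] (n::int) = w [^] n\<otimes>y"
proof -
 have nat: "y\<otimes>x [^] (n::nat) = w [^] n\<otimes>y" for n
 proof (induction n)
  case (Suc n)
  have "y\<otimes>(x [^] n\<otimes>x) = (y\<otimes>x [^] n)\<otimes>x" using c by (simp add: m_assoc)
  also have "\<dots> = w [^] n\<otimes>(w\<otimes>y)" unfolding Suc using c by (simp add: m_assoc e)
  finally show ?case using c by (simp add: m_assoc)
 qed (use c in simp)
 have inv: "y\<otimes>inv p = inv q\<otimes>y" if "p\<in>carrier G" "q\<in>carrier G" "y\<otimes>p = q\<otimes>y" for p q
 proof -
  have "y\<otimes>inv p = inv q\<otimes>(q\<otimes>y)\<otimes>inv p" using that(1,2) c by (simp add: m_assoc)
  also have "\<dots> = inv q\<otimes>y" unfolding that(3)[symmetric] using that(1,2) c by (simp add: m_assoc)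
  finally show ?thesis .
 qed
 show ?thesis
 proof (cases "n\<ge>0")
  case True
  then obtain m where n: "n = int m" by (rule nonneg_int_cases)
  show ?thesis unfolding n int_pow_int by (rule nat)
 next
  case False
  then obtain m where n: "n = - int m" by (metis int_cases2 of_nat_0_le_iff)
  show ?thesis unfolding n int_pow_neg_int[OF c(1)] int_pow_neg_int[OF c(2)]
   by (rule inv[OF nat_pow_closed[OF c(1)] nat_pow_closed[OF c(2)] nat])
 qed
qed

lemma (in group) int_pow_commute:
 assumes "x\<in>carrier G" "y\<in>carrier G" "x\<otimes>y = y\<otimes>x"
 shows "x [^] (n::int)\<otimes>y = y\<otimes>x [^] n"
 using int_pow_intertwine[OF assms(1,1,2)] assms(3) by simp

text \<open>Every element has a normal form X^a Y^b Z^d, and its coordinates (a, b, 2 d + a b)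
  determine the exponents. The image is thus the set of triples with z congruent to x y modulo 2,
  which contains \<open>cong0 2\<close>.\<close>

lemma heisenberg_embedding:
 obtains \<chi> where "\<chi>\<in>hom HG HH" "inj_on \<chi> (carrier HG)"
  "cong0 2\<subseteq>\<chi> ` carrier HG"
proof -
 let ?x = "[(HX, True)]" and ?y = "[(HY, True)]"
 define R where "R = {word_comm (word_comm ?x ?y) ?x, word_comm (word_comm ?x ?y) ?y}"
 have R: "word_comm (word_comm ?x ?y) ?x\<in>R" "word_comm (word_comm ?x ?y) ?y\<in>R" by (simp_all add: R_def)
 have G: "heisenberg_group = presented_group UNIV R" by (simp add: heisenberg_group_def R_def Let_def)
 have wU: "w\<in>words UNIV" for w :: "heisenberg_gen word" by (auto simp: words_def)
 interpret H: group heisenberg_group unfolding G by (rule group_presented_group)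
 define f where "f a = (case a of HX => ((1, 0, 0) :: hh) | HY => (0, 1, 0))" for a
 have "weval HH f r = \<one>\<^bsub>HH\<^esub>" if "r\<in>R" for r
  using that by (auto simp: R_def word_comm_def word_inv_def f_def HH_inv)
 then obtain \<chi> where \<chi>: "\<chi>\<in>hom (presented_group UNIV R) HH" "!!a. \<chi> (pgen UNIV R a) = f a"
  using presented_group_hom[OF group_HH, of f UNIV R] by auto
 interpret h: group_hom HG HH \<chi>
  using \<chi>(1) by (simp add: group_hom_def group_hom_axioms_def G group_presented_group group_HH)
 define X where "X = pgen UNIV R HX"
 define Y where "Y = pgen UNIV R HY"
 have c: "X\<in>carrier HG" "Y\<in>carrier HG"
  by (simp_all add: X_def Y_def G pgen_closed)
 let ?m = "%a b. a \<otimes>\<^bsub>HG\<^esub> b" and ?i = "%a. inv\<^bsub>HG\<^esub> a"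
 define Z where "Z = ?m X (?m Y (?m (?i X) (?i Y)))"
 have cZ: "Z\<in>carrier HG" using c by (simp add: Z_def)
 have rel: "weval heisenberg_group (pgen UNIV R) r = \<one>\<^bsub>HG\<^esub>" if "r\<in>R" for r
  unfolding G using weval_relator[OF that wU] .
 have ZX: "?m Z X = ?m X Z" "?m Z Y = ?m Y Z"
 proof -
  have "?m (?m Z X) (?i (?m X Z)) = \<one>\<^bsub>HG\<^esub>"
   using rel[OF R(1)] c
   by (simp add: word_comm_def word_inv_def Z_def H.m_assoc H.inv_mult_group flip: X_def Y_def)
  then show "?m Z X = ?m X Z" using c cZ by (metis H.inv_equality H.inv_inv H.inv_closed H.m_closed)
  have "?m (?m Z Y) (?i (?m Y Z)) = \<one>\<^bsub>HG\<^esub>"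
   using rel[OF R(2)] c
   by (simp add: word_comm_def word_inv_def Z_def H.m_assoc H.inv_mult_group flip: X_def Y_def)
  then show "?m Z Y = ?m Y Z" using c cZ by (metis H.inv_equality H.inv_inv H.inv_closed H.m_closed)
 qed
 have \<chi>XYZ: "\<chi> X = (1, 0, 0)" "\<chi> Y = (0, 1, 0)" using \<chi>(2) by (simp_all add: X_def Y_def f_def)
 have \<chi>Z: "\<chi> Z = (0, 0, 2)" using c \<chi>XYZ by (simp add: Z_def h.hom_inv HH_inv)
 let ?N = "%(a::int) (b::int) (d::int). ?m (X [^]\<^bsub>HG\<^esub> a)
  (?m (Y [^]\<^bsub>HG\<^esub> b) (Z [^]\<^bsub>HG\<^esub> d))"
 have \<chi>N: "\<chi> (?N a b d) = (a, b, 2 * d + a * b)" for a b d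
  using c cZ by (simp add: h.hom_int_pow[unfolded HH_int_pow] \<chi>XYZ \<chi>Z)
 note comm = H.int_pow_commute[OF cZ]
 have YX: "?m Y X = ?m (?i Z) (?m X Y)"
  using c by (simp add: Z_def H.m_assoc H.inv_mult_group)
 have cX: "?m X (?i Z) = ?m (?i Z) X"
  using comm[OF c(1) ZX(1), of "-1"] cZ c by (simp add: H.int_pow_neg)
 \<comment> \<open>Y conjugates X to X Z^-1, and X commutes with Z, so all powers of X are treated
   at once.\<close>
 have YXa: "?m Y (X [^]\<^bsub>HG\<^esub> (a::int)) =
   ?m (X [^]\<^bsub>HG\<^esub> a) (?m Y (Z [^]\<^bsub>HG\<^esub> (- a)))" for a
 proof -
  define W where "W = ?m X (?i Z)"
  have cW: "W\<in>carrier HG" using c cZ by (simp add: W_def)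
  have YXW: "?m Y X = ?m W Y" using YX cX c cZ by (simp add: W_def flip: H.m_assoc)
  have "?m Y (X [^]\<^bsub>HG\<^esub> a) = ?m (W [^]\<^bsub>HG\<^esub> a) Y"
   by (rule H.int_pow_intertwine) (use c cW YXW in auto)
  moreover have "W [^]\<^bsub>HG\<^esub> a = ?m (X [^]\<^bsub>HG\<^esub> a) (Z [^]\<^bsub>HG\<^esub> (- a))"
   using H.int_pow_mult_distrib[of X "?i Z" a] cX c cZ by (simp add: W_def H.int_pow_inv H.int_pow_neg)
  ultimately show ?thesis using comm[OF c(2) ZX(2), of "- a"] c cZ by (simp add: H.m_assoc)
 qed
 have one: "X [^]\<^bsub>HG\<^esub> (k + l) = ?m (X [^]\<^bsub>HG\<^esub> k) (X [^]\<^bsub>HG\<^esub> l)"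
  "Y [^]\<^bsub>HG\<^esub> (k + l) = ?m (Y [^]\<^bsub>HG\<^esub> k) (Y [^]\<^bsub>HG\<^esub> l)"
  "Z [^]\<^bsub>HG\<^esub> (k + l) = ?m (Z [^]\<^bsub>HG\<^esub> k) (Z [^]\<^bsub>HG\<^esub> l)" for k l :: int
  using H.int_pow_mult c cZ by auto
 have Xs: "?m X (?N a b d) = ?N (1 + a) b d" for a b d
  using c cZ by (simp add: one(1) H.m_assoc)
 have Xi: "?m (?i X) (?N a b d) = ?N (- 1 + a) b d" for a b d
 proof -
  have "?N a b d = ?m X (?N (- 1 + a) b d)" by (simp add: Xs)
  then show ?thesis using c cZ by simp
 qed
 have ZY: "?m (Z [^]\<^bsub>HG\<^esub> k) (?m (Y [^]\<^bsub>HG\<^esub> b) g) =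
   ?m (Y [^]\<^bsub>HG\<^esub> b) (?m (Z [^]\<^bsub>HG\<^esub> k) g)"
  if "g\<in>carrier HG" for k b :: int and g
 proof -
  have "?m (Y [^]\<^bsub>HG\<^esub> b) (Z [^]\<^bsub>HG\<^esub> k) =
    ?m (Z [^]\<^bsub>HG\<^esub> k) (Y [^]\<^bsub>HG\<^esub> b)"
   by (rule H.int_pow_commute) (use c cZ comm[OF c(2) ZX(2)] in auto)
  then show ?thesis using that c cZ by (simp flip: H.m_assoc)
 qed
 have Y1: "?m Y g = ?m (Y [^]\<^bsub>HG\<^esub> (1::int)) g" for g using c by simp
 have Ys: "?m Y (?N a b d) = ?N a (1 + b) (- a + d)" for a b d
 proof -
  have "?m Y (?N a b d) = ?m (?m Y (X [^]\<^bsub>HG\<^esub> a)) (?m (Y [^]\<^bsub>HG\<^esub> b) (Z [^]\<^bsub>HG\<^esub> d))"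
   using c cZ by (simp add: H.m_assoc)
  also have "\<dots> = ?N a (1 + b) (- a + d)"
   unfolding YXa using c cZ by (simp add: H.m_assoc ZY one(2) flip: one(3))
  finally show ?thesis .
 qed
 have Yi: "?m (?i Y) (?N a b d) = ?N a (- 1 + b) (a + d)" for a b d
 proof -
  have "?N a b d = ?m Y (?N a (- 1 + b) (a + d))" by (simp add: Ys)
  then show ?thesis using c cZ by simp
 qed
 have nf: "\<exists>a b d. g = ?N a b d" if "g\<in>carrier HG" for g
  using that unfolding G
 proof (induction rule: presented_group_induct)
  case one
  then show ?case by (intro exI[of _ 0]) (simp flip: G)
 next
  case (gen s g)
  then obtain a b d where "g = ?N a b d" unfolding G by blast
  then show ?case using Xs[of a b d] Ys[of a b d] unfolding G X_def Y_def by (cases s) metis+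
 next
  case (inv s g)
  then obtain a b d where "g = ?N a b d" unfolding G by blast
  then show ?case using Xi[of a b d] Yi[of a b d] unfolding G X_def Y_def by (cases s) metis+
 qed
 show thesis
 proof (rule that[of \<chi>])
  show "\<chi>\<in>hom HG HH" by (rule h.homh)
  show "inj_on \<chi> (carrier HG)"
  proof (rule inj_onI)
   fix g h assume gh: "g\<in>carrier HG" "h\<in>carrier HG" "\<chi> g = \<chi> h"
   obtain a b d where g: "g = ?N a b d" using nf gh by blast
   obtain a' b' d' where h: "h = ?N a' b' d'" using nf gh by blast
   have "a = a'" "b = b'" "d = d'" using gh(3) unfolding g h \<chi>N by auto
   then show "g = h" unfolding g h by simp
  qed
  show "cong0 2\<subseteq>\<chi> ` carrier HG"
  proof
   fix A assume "A\<in>cong0 2"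
   then obtain x y z where A: "A = (2 * x, 2 * y, 2 * z)" by (auto simp: cong0_def elim!: dvdE)
   \<comment> \<open>The exponent of Z compensates the term a b = 4 x y.\<close>
   have "\<chi> (?N (2 * x) (2 * y) (z - 2 * x * y)) = A" unfolding \<chi>N A by (simp add: algebra_simps)
   then show "A\<in>\<chi> ` carrier HG" using c cZ by (metis H.int_pow_closed H.m_closed imageI)
  qed
 qed
qed

text \<open>The subgroup \<open>K\<close> carries the coordinates but need not be normal. The
  subgroup generated by the m-th powers of \<open>N\<close> is normal in \<open>G\<close> and, for a
  suitable m, contained in \<open>K\<close>.\<close>

lemma (in group) heis_normal_exists:
 assumes N: "N \<lhd> G" and K: "subgroup K G" "fidx G N K" "fidx G K N"
  and \<psi>: "!!a b. a\<in>K ==> b\<in>K ==> \<psi> (a\<otimes>b) = hm (\<psi> a) (\<psi> b)" "inj_on \<psi> K"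
  and k: "k > 0" "cong0 (int k)\<subseteq>\<psi> ` K"
 shows "\<exists>J M. J\<subseteq>N\<and>fidx G N J\<and>heis_normal G J \<psi> M"
proof -
 interpret N: normal N G by (rule N)
 interpret K: heis_subgroup G K \<psi>
  by (rule heis_subgroup.intro[OF group_axioms heis_subgroup_axioms.intro[OF K(1) \<psi>(1)]])
 obtain m :: nat where m: "m > 0" "!!a. a\<in>N ==> a [^] m\<in>K"
  using fidx_pow[OF K(2,1) N.subgroup_axioms] by blast
 obtain d :: nat where d: "d > 0" "!!a. a\<in>K ==> a [^] d\<in>N"
  using fidx_pow[OF K(3) N.subgroup_axioms K(1)] by blast
 define J where "J = generate G ((%j. j [^] m) ` N)"
 have JN: "J \<lhd> G" unfolding J_def by (rule power_subgroup_normal[OF N])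
 have N_pow: "a [^] n\<in>N" if "a\<in>N" for a and n :: nat
  using that by (induction n) auto
 have J: "J\<subseteq>N" "J\<subseteq>K"
  unfolding J_def by (rule generate_subgroup_incl; use N_pow m N.subgroup_axioms K(1) in auto)+
 \<comment> \<open>The exponent d brings elements of \<open>K\<close> into \<open>N\<close>, and m
   brings these on into \<open>J\<close>.\<close>
 define M where "M = k * (d * m)"
 have img: "cong0 (int M)\<subseteq>\<psi> ` J"
 proof
  fix A assume "A\<in>cong0 (int M)"
  then obtain B where A: "A = hs (int M) B" unfolding cong0_hs by blast
  obtain a where a: "a\<in>K" "\<psi> a = hs (int k) B" using k(2) hs_cong0 by (metis imageE subsetD)
  have "a [^] (d * m) = (a [^] d) [^] m" using a K.J_sub subgroup.mem_carrier by (metis nat_pow_pow)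
  then have "a [^] (d * m)\<in>J" unfolding J_def using d(2)[OF a(1)] by (auto intro: generate.incl)
  moreover have "\<psi> (a [^] (d * m)) = A" unfolding K.\<zeta>_pow[OF a(1)] a(2) A by (cases B) (simp add: M_def)
  ultimately show "A\<in>\<psi> ` J" by blast
 qed
 have Mp: "M > 0" using k d m by (simp add: M_def)
 have "{j\<in>K. \<psi> j\<in>cong0 (int M)}\<subseteq>J"
  using img J(2) \<psi>(2) by (auto dest: inj_onD)
 then have "fidx G K J" using fidx_mono[OF K.finite_residues[OF Mp] order.refl] by blast
 then have "fidx G N J"
  using fidx_trans[OF K(2)] N.subset subgroup.subset[OF normal_imp_subgroup[OF JN]] by blast
 moreover have "heis_normal G J \<psi> (int M)"
 proof (rule heis_normal.intro)
  show "heis_subgroup G J \<psi>"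
   by (rule heis_subgroup.intro[OF group_axioms heis_subgroup_axioms.intro[OF normal_imp_subgroup[OF JN]]])
    (use J(2) \<psi>(1) in blast)
  show "heis_normal_axioms G J \<psi> (int M)"
   by (rule heis_normal_axioms.intro) (use JN img Mp inj_on_subset[OF \<psi>(2) J(2)] in auto)
 qed
 ultimately show ?thesis using J(1) by blast
qed

section \<open>Heisenberg coordinates on an admissible subgroup\<close>

context gog_nilp
begin

lemma admissible_vertex: "admissible J ==> v\<in>Vs ==> j\<in>J ==> \<exists>a\<in>carrier (Gv v). j = \<iota> v a"
 unfolding admissible_def by (metis imageE subsetD)

lemma admissible_idx: "admissible J ==> v\<in>Vs ==> fidx PG (\<iota>A v) J"
 by (simp add: admissible_def)

lemma admissible_edge_subset:
 assumes "admissible J" "e\<in>Ar" shows "J\<subseteq>\<iota> (src e) ` Ge e"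
 using conjunct2[OF conjunct2[OF assms(1)[unfolded admissible_def]], rule_format, of "(e, True)"] assms(2)
 by (simp add: Cx_def)

lemma fidx_\<iota>:
 assumes "v\<in>Vs" "A\<subseteq>carrier (Gv v)" "B\<subseteq>carrier (Gv v)" "fidx (Gv v) A B"
 shows "fidx PG (\<iota> v ` A) (\<iota> v ` B)"
proof -
 interpret A: group "Gv v" using assms by (simp add: Gv_group)
 obtain S where S: "finite S" "S\<subseteq>carrier (Gv v)" "!!a. a\<in>A ==> \<exists>s\<in>S. inv\<^bsub>Gv v\<^esub> s \<otimes>\<^bsub>Gv v\<^esub> a\<in>B"
  using assms(4) by (auto simp: fidx_def)
 have "\<exists>s\<in>\<iota> v ` S. iv s\<cdot>a\<in>\<iota> v ` B" if a: "a\<in>\<iota> v ` A" for a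
 proof -
  obtain a' where a': "a'\<in>A" "a = \<iota> v a'" using a by blast
  obtain s where s: "s\<in>S" "inv\<^bsub>Gv v\<^esub> s \<otimes>\<^bsub>Gv v\<^esub> a'\<in>B" using S(3)[OF a'(1)] by blast
  have "iv \<iota> v s\<cdot>a = \<iota> v (inv\<^bsub>Gv v\<^esub> s \<otimes>\<^bsub>Gv v\<^esub> a')"
   using a' s(1) S(2) assms by (simp add: \<iota>_inv \<iota>_mult subset_eq)
  then show ?thesis using s by blast
 qed
 moreover have "finite (\<iota> v ` S)" "\<iota> v ` S\<subseteq>\<P>" using S assms by auto
 ultimately show ?thesis unfolding fidx_def by blast
qed

text \<open>Commensurability gives coordinates only on a finite index subgroup of one edge group;
  they are carried into the fundamental group through the inverse of \<iota>, and
  \<open>heis_normal_exists\<close> then shrinks an admissible subgroup into their domain.\<close>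

theorem heis_admissible:
 assumes RF: "residually_finite PG" and e: "e\<in>Ar"
  and com: "commensurable (Gv (src e)(|carrier := Ge e|)) heisenberg_group"
 shows "\<exists>J \<zeta> M. admissible J\<and>heis_normal PG J \<zeta> M"
proof -
 obtain N where N: "admissible N" using residually_finite_admissible[OF RF] by blast
 interpret N: normal N PG using N by (simp add: admissible_def)
 let ?v = "src e" and ?C = "Gv (src e)(|carrier := Ge e|)"
 have v: "?v\<in>Vs" using e by simp
 interpret A: group "Gv ?v" using v by (rule Gv_group)
 interpret C: group ?C using edge_group[OF e] .
 interpret H: group heisenberg_group by (simp add: heisenberg_group_def Let_def group_presented_group)
 obtain K L where KL: "finite_index_subgroup K ?C" "finite_index_subgroup L heisenberg_group"
  "?C(|carrier := K|) \<cong> heisenberg_group(|carrier := L|)" using com unfolding commensurable_def by blast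
 have K: "subgroup K ?C" "fidx ?C (Ge e) K" using KL(1) unfolding C.finite_index_subgroup_iff by auto
 have L: "subgroup L heisenberg_group" "fidx heisenberg_group (carrier HG) L"
  using KL(2) unfolding H.finite_index_subgroup_iff by auto
 have KC: "K\<subseteq>Ge e" using subgroup.subset[OF K(1)] by simp
 have CA: "Ge e\<subseteq>carrier (Gv ?v)" using Ge_sub[OF e] by blast
 have KA: "subgroup K (Gv ?v)"
  using A.incl_subgroup[of "Ge e" K] edge_subgroup[OF e] K(1) by simp
 obtain f where f: "f\<in>iso (?C(|carrier := K|)) (heisenberg_group(|carrier := L|))"
  using KL(3) unfolding is_iso_def by blast
 obtain \<chi> where \<chi>: "\<chi>\<in>hom HG HH" "inj_on \<chi> (carrier HG)"
  "cong0 2\<subseteq>\<chi> ` carrier HG" by (rule heisenberg_embedding)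
 define \<psi> where "\<psi> g = \<chi> (f (inv_into (carrier (Gv ?v)) (\<iota> ?v) g))" for g
 have \<psi>\<iota>: "\<psi> (\<iota> ?v a) = \<chi> (f a)" if "a\<in>carrier (Gv ?v)" for a
  using that \<iota>_inj[OF v] by (simp add: \<psi>_def)
 have fL: "f ` K = L" "inj_on f K" "!!a b. a\<in>K ==> b\<in>K ==> f (a \<otimes>\<^bsub>Gv ?v\<^esub> b) = f a \<otimes>\<^bsub>HG\<^esub> f b"
  using f by (auto simp: iso_def bij_betw_def hom_def)
 have LH: "L\<subseteq>carrier HG" using L(1) by (rule subgroup.subset)
 let ?K = "\<iota> ?v ` K"
 obtain d :: nat where d: "d > 0" "!!a. a\<in>carrier HG ==> a [^]\<^bsub>HG\<^esub> d\<in>L"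
  using H.fidx_pow[OF L(2,1) H.subgroup_self] by blast
 have f1: "fidx PG N ?K"
 proof (rule fidx_mono[OF fidx_\<iota>[OF v CA _ _] _ order.refl])
  show "K\<subseteq>carrier (Gv ?v)" using KC CA by blast
  show "fidx (Gv ?v) (Ge e) K"
   using K(2) CA A.m_inv_consistent[OF edge_subgroup[OF e]] unfolding fidx_def
   by (simp add: subset_eq) metis
  show "N\<subseteq>\<iota> ?v ` Ge e" by (rule admissible_edge_subset[OF N e])
 qed
 have f2: "fidx PG ?K N"
  by (rule fidx_mono[OF admissible_idx[OF N v] _ order.refl]) (use KC CA in auto)
 have f3: "subgroup ?K PG"
  using group_hom.subgroup_img_is_subgroup[OF \<iota>_group_hom[OF v] KA] .
 have f4: "\<psi> (a\<cdot>b) = hm (\<psi> a) (\<psi> b)" if ab: "a\<in>?K" "b\<in>?K" for a b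
 proof -
  obtain a' b' where a': "a'\<in>K" "b'\<in>K" "a = \<iota> ?v a'" "b = \<iota> ?v b'" using ab by blast
  have c: "a'\<in>carrier (Gv ?v)" "b'\<in>carrier (Gv ?v)" using a' KC CA by auto
  have "f a'\<in>carrier HG" "f b'\<in>carrier HG" using a' fL(1) LH by auto
  then have "\<chi> (f a' \<otimes>\<^bsub>HG\<^esub> f b') = hm (\<chi> (f a')) (\<chi> (f b'))"
   using \<chi>(1) by (simp add: hom_def del: hm.simps)
  then show ?thesis using a' c fL(3)[OF a'(1,2)] v by (simp add: \<psi>\<iota> flip: \<iota>_mult)
 qed
 have f5: "inj_on \<psi> ?K"
 proof (rule inj_onI)
  fix a b assume ab: "a\<in>?K" "b\<in>?K" "\<psi> a = \<psi> b"
  then obtain a' b' where a': "a'\<in>K" "b'\<in>K" "a = \<iota> ?v a'" "b = \<iota> ?v b'" by blast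
  have c: "a'\<in>carrier (Gv ?v)" "b'\<in>carrier (Gv ?v)" using a' KC CA by auto
  have "f a'\<in>carrier HG" "f b'\<in>carrier HG" using a' fL(1) LH by auto
  moreover have "\<chi> (f a') = \<chi> (f b')" using ab(3) a' c by (simp add: \<psi>\<iota>)
  ultimately have "f a' = f b'" using \<chi>(2) by (auto dest: inj_onD)
  then show "a = b" using a' fL(2) by (auto dest: inj_onD)
 qed
 \<comment> \<open>The factor 2 comes from \<open>heisenberg_embedding\<close>, the factor d from
   passing to \<open>L\<close>.\<close>
 have f6: "cong0 (int (d * 2))\<subseteq>\<psi> ` ?K"
 proof
  fix A assume "A\<in>cong0 (int (d * 2))"
  then obtain B where A: "A = hs (int (d * 2)) B" unfolding cong0_hs by blast
  obtain h where h: "h\<in>carrier HG" "hs 2 B = \<chi> h"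
   using subsetD[OF \<chi>(3) hs_cong0[of 2 B]] by blast
  obtain a where a: "a\<in>K" "h [^]\<^bsub>HG\<^esub> d = f a" using d(2)[OF h(1)] unfolding fL(1)[symmetric] by blast
  have ac: "a\<in>carrier (Gv ?v)" using a KC CA by blast
  have "\<chi> (h [^]\<^bsub>HG\<^esub> d) = hs (int d) (hs 2 B)"
   using hom_nat_pow[OF \<chi>(1) h(1) H.group_axioms group_HH] by (simp only: HH_pow h(2))
  then have "\<psi> (\<iota> ?v a) = hs (int d) (hs 2 B)" by (simp only: \<psi>\<iota>[OF ac] a(2))
  then have "\<psi> (\<iota> ?v a) = A" by (cases B) (simp add: A)
  then show "A\<in>\<psi> ` ?K" using a(1) by blast
 qed
 have f7: "d * 2 > 0" using d by simp
 obtain J M where J: "J\<subseteq>N" "fidx PG N J" "heis_normal PG J \<psi> M"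
  using G.heis_normal_exists[OF N.normal_axioms f3 f1 f2 f4 f5 f7 f6] by blast
 then have "admissible J" using admissible_subset[OF N] heis_normal.J by blast
 then show ?thesis using J(3) by blast
qed

section \<open>Subgroup separability\<close>

text \<open>Only finitely many cosets of \<open>H\<close> matter for the generators of \<open>H\<close> and for \<open>g\<close>. The action on
 these cosets is completed to a finite action by letting each vertex group act on the finite set of
 translates and extending the edge isomorphisms; the second factor makes all stabilizers equal to \<open>J\<close>.\<close>

theorem separate_over_admissible:
 assumes J: "admissible J" and S: "finite S" "S\<subseteq>\<P>"
  and g: "g\<in>\<P>" "g\<notin>generate PG (J\<union>S)"
 shows "\<exists>N. fin_normal PG N\<and>(\<forall>h\<in>generate PG (J\<union>S). iv h\<cdot>g\<notin>N)"
proof -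
 interpret J: normal J PG using J by (simp add: admissible_def)
 define H where "H = generate PG (J\<union>S)"
 have JS: "J\<union>S\<subseteq>\<P>" using S by auto
 have H: "subgroup H PG" unfolding H_def by (rule G.generate_is_subgroup[OF JS])
 have JH: "J\<subseteq>H" "S\<subseteq>H" unfolding H_def by (auto intro: generate.incl)
 obtain Y :: "('v => ('v, 'e, 'g) gel set) set" and act
  where Y: "finite Y" "Y ~= {}" "act\<in>hom PG (permgrp Y)"
   "!!v a y. v\<in>Vs ==> a\<in>carrier (Gv v) ==> y\<in>Y ==> act (\<iota> v a) y = y\<longleftrightarrow>\<iota> v a\<in>J"
  using admissible_finite_action[OF J] by blast
 have actm: "act (k\<cdot>l) y = act k (act l y)" if "k\<in>\<P>" "l\<in>\<P>" for k l y
  using Y(3) that by (simp add: hom_def)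
 have actY: "act k y\<in>Y\<longleftrightarrow>y\<in>Y" if "k\<in>\<P>" for k y
  using permutes_in_image[of "act k" Y] hom_in_carrier[OF Y(3) that] by simp
 have act1: "act \<e> y = y" for y using hom_one[OF Y(3) G.group_axioms group_permgrp] by simp
 define co where "co k = k <#\<^bsub>PG\<^esub> H" for k
 have co_mult: "k <#\<^bsub>PG\<^esub> co l = co (k\<cdot>l)" if "k\<in>\<P>" "l\<in>\<P>" for k l
  using G.l_coset_mult[OF H that] by (simp add: co_def)
 have co_eq: "co k = co l\<longleftrightarrow>iv l\<cdot>k\<in>H" if "k\<in>\<P>" "l\<in>\<P>" for k l
  using G.l_coset_eq_iff[OF H that] by (simp add: co_def)
 have coJ: "co (j\<cdot>k) = co k" if "j\<in>J" "k\<in>\<P>" for j k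
  using co_eq[of "j\<cdot>k" k] that J.inv_op_closed1[OF that(2,1)] JH(1) by (auto simp: G.m_assoc)
 \<comment> \<open>The action still to be built can agree with left translation only while all
   cosets involved lie in a finite set \<open>B\<close>. These local rules are isolated first, so
   that \<open>path\<close> can tell how large \<open>B\<close> must be.\<close>
 define ok where "ok B Act\<longleftrightarrow>(\<forall>y\<in>Y. Act v0 \<e> (H, y) = (co \<e>, y)) \<and>
  (\<forall>v\<in>Vs. \<forall>a\<in>carrier (Gv v). \<forall>k\<in>\<P>. \<forall>y\<in>Y. \<forall>l\<in>\<P>. \<forall>y'. co l\<in>B -->
    Act v k (H, y) = (co l, y') --> Act v (\<iota> v a\<cdot>k) (H, y) = (co (\<iota> v a\<cdot>l), act (\<iota> v a) y')) \<and>
  (\<forall>e\<in>Ar. \<forall>k\<in>\<P>. \<forall>y\<in>Y. \<forall>l\<in>\<P>. \<forall>y'\<in>Y. co l\<in>B --> co (st e\<cdot>l)\<in>B -->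
    (Act (src e) k (H, y) = (co l, y') \<longleftrightarrow>
    Act (tgt e) (st e\<cdot>k) (H, y) = (co (st e\<cdot>l), act (st e) y')))"
  for B and Act :: "'v => ('v, 'e, 'g) gel => ('v, 'e, 'g) gel set \<times>
   ('v => ('v, 'e, 'g) gel set) => ('v, 'e, 'g) gel set \<times>
   ('v => ('v, 'e, 'g) gel set)"
 \<comment> \<open>The finitely many cosets met along a path representing \<open>k\<close> force the
   action of \<open>k\<close> at the coset \<open>H\<close>.\<close>
 have path: "\<exists>P. finite P\<and>P\<subseteq>\<P>\<and>(\<forall>B Act. co ` P\<subseteq>B --> ok B Act -->
   (\<forall>y\<in>Y. Act v k (H, y) = (co k, act k y)))" (is "?Q v k") if "v\<in>Vs" "k\<in>\<P>" for v k
 proof (rule path_induct[OF that, of v0 ?Q])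
  show "?Q v0 \<e>" by (rule exI[of _ "{}"]) (auto simp: ok_def act1)
 next
  fix v a g assume h: "v\<in>Vs" "a\<in>carrier (Gv v)" "g\<in>\<P>" "?Q v g"
  then obtain P where P: "finite P" "P\<subseteq>\<P>" "!!B Act. co ` P\<subseteq>B ==> ok B Act ==>
   (\<forall>y\<in>Y. Act v g (H, y) = (co g, act g y))" by blast
  have "\<forall>y\<in>Y. Act v (\<iota> v a\<cdot>g) (H, y) = (co (\<iota> v a\<cdot>g), act (\<iota> v a\<cdot>g) y)"
   if B: "co ` insert g P\<subseteq>B" "ok B Act" for B Act
  proof
   fix y assume y: "y\<in>Y"
   have "Act v g (H, y) = (co g, act g y)" using P(3)[of B Act] B y by auto
   then show "Act v (\<iota> v a\<cdot>g) (H, y) = (co (\<iota> v a\<cdot>g), act (\<iota> v a\<cdot>g) y)"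
    using B h y unfolding ok_def by (simp add: actm)
  qed
  then show "?Q v (\<iota> v a\<cdot>g)" using P h by (intro exI[of _ "insert g P"]) auto
 next
  fix e g assume h: "e\<in>Ar" "g\<in>\<P>" "?Q (src e) g"
  then obtain P where P: "finite P" "P\<subseteq>\<P>" "!!B Act. co ` P\<subseteq>B ==> ok B Act ==>
   (\<forall>y\<in>Y. Act (src e) g (H, y) = (co g, act g y))" by blast
  have "\<forall>y\<in>Y. Act (tgt e) (st e\<cdot>g) (H, y) = (co (st e\<cdot>g), act (st e\<cdot>g) y)"
   if B: "co ` insert g (insert (st e\<cdot>g) P)\<subseteq>B" "ok B Act" for B Act
  proof
   fix y assume y: "y\<in>Y"
   have "Act (src e) g (H, y) = (co g, act g y)" using P(3)[of B Act] B y by auto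
   then show "Act (tgt e) (st e\<cdot>g) (H, y) = (co (st e\<cdot>g), act (st e\<cdot>g) y)"
    using B h y unfolding ok_def by (simp add: actm actY)
  qed
  then show "?Q (tgt e) (st e\<cdot>g)" using P h
   by (intro exI[of _ "insert g (insert (st e\<cdot>g) P)"]) auto
 next
  fix e g assume h: "e\<in>Ar" "g\<in>\<P>" "?Q (tgt e) g"
  then obtain P where P: "finite P" "P\<subseteq>\<P>" "!!B Act. co ` P\<subseteq>B ==> ok B Act ==>
   (\<forall>y\<in>Y. Act (tgt e) g (H, y) = (co g, act g y))" by blast
  let ?g = "iv st e\<cdot>g"
  have e: "st e\<in>\<P>" using h by simp
  have "\<forall>y\<in>Y. Act (src e) ?g (H, y) = (co ?g, act ?g y)"
   if B: "co ` insert g (insert ?g P)\<subseteq>B" "ok B Act" for B Act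
  proof
   fix y assume y: "y\<in>Y"
   have "Act (tgt e) g (H, y) = (co g, act g y)" using P(3)[of B Act] B y by auto
   then have "Act (tgt e) (st e\<cdot>?g) (H, y) = (co (st e\<cdot>?g), act (st e) (act ?g y))"
    using e h actm[of "st e" ?g y] by simp
   moreover have "?g\<in>\<P>" "act ?g y\<in>Y" "co ?g\<in>B" "co (st e\<cdot>?g)\<in>B"
    using e h y B actY[of ?g y] by auto
   ultimately show "Act (src e) ?g (H, y) = (co ?g, act ?g y)"
    using B(2) h(1) y unfolding ok_def by blast
  qed
  then show "?Q (src e) ?g" using P h e by (intro exI[of _ "insert g (insert ?g P)"]) auto
 qed (use v0 in auto)
 have "\<forall>k\<in>insert g S. \<exists>P. finite P\<and>P\<subseteq>\<P>\<and>(\<forall>B Act. co ` P\<subseteq>B --> ok B Act -->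
   (\<forall>y\<in>Y. Act v0 k (H, y) = (co k, act k y)))"
  using path[OF v0] S g by blast
 from bchoice[OF this] obtain Pf where Pf: "\<forall>k\<in>insert g S. finite (Pf k)\<and>Pf k\<subseteq>\<P> \<and>
  (\<forall>B Act. co ` Pf k\<subseteq>B --> ok B Act --> (\<forall>y\<in>Y. Act v0 k (H, y) = (co k, act k y)))" by blast
 define P where "P = insert \<e> (\<Union>(Pf ` insert g S))"
 have P: "finite P" "P\<subseteq>\<P>" using Pf S(1) by (auto simp: P_def)
 \<comment> \<open>The translates of \<open>P\<close> by a vertex group represent finitely many
   cosets, since the normal subgroup \<open>J\<close> fixes every coset of \<open>H\<close>.\<close>
 define Q where "Q v = {\<iota> v a\<cdot>p | a p. a\<in>carrier (Gv v)\<and>p\<in>P}" for v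
 have Qc: "Q v\<subseteq>\<P>" if "v\<in>Vs" for v using P(2) that by (auto simp: Q_def)
 have coP: "co ` P\<subseteq>co ` Q v" if v: "v\<in>Vs" for v
 proof -
  interpret A: group "Gv v" using v by (rule Gv_group)
  have "p = \<iota> v \<one>\<^bsub>Gv v\<^esub>\<cdot>p" if "p\<in>P" for p using that P(2) v by (auto simp: \<iota>_one)
  then show ?thesis unfolding Q_def using A.one_closed by blast
 qed
 have finQ: "finite (co ` Q v)" if v: "v\<in>Vs" for v
 proof -
  interpret A: group "Gv v" using v by (rule Gv_group)
  obtain R where R: "finite R" "R\<subseteq>\<P>" "!!a. a\<in>\<iota>A v ==> \<exists>s\<in>R. iv s\<cdot>a\<in>J"
   using admissible_idx[OF J v] unfolding fidx_def by blast
  have "co q\<in>(%(s, p). co (s\<cdot>p)) ` (R\<times>P)" if q: "q\<in>Q v" for q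
  proof -
   obtain a p where ap: "a\<in>carrier (Gv v)" "p\<in>P" "q = \<iota> v a\<cdot>p" using q by (auto simp: Q_def)
   obtain s where s: "s\<in>R" "iv s\<cdot>\<iota> v a\<in>J" using R(3)[of "\<iota> v a"] ap(1) by blast
   have c: "s\<in>\<P>" "\<iota> v a\<in>\<P>" "p\<in>\<P>" using s ap R(2) P(2) v by auto
   have "s\<cdot>(iv s\<cdot>\<iota> v a)\<cdot>iv s\<in>J" using J.inv_op_closed2[OF c(1) s(2)] .
   then have "co (\<iota> v a\<cdot>iv s\<cdot>(s\<cdot>p)) = co (s\<cdot>p)"
    using c by (intro coJ) (simp_all add: G.m_assoc)
   then have "co q = co (s\<cdot>p)" using c ap(3) by (simp add: G.m_assoc)
   then show ?thesis using s(1) ap(2) by auto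
  qed
  then have "co ` Q v\<subseteq>(%(s, p). co (s\<cdot>p)) ` (R\<times>P)" by blast
  then show ?thesis by (rule finite_subset) (use R P in auto)
 qed
 define \<Omega> where "\<Omega> = (\<Union>v\<in>Vs. co ` Q v)\<times>Y"
 have fin\<Omega>: "finite \<Omega>" unfolding \<Omega>_def using finQ Y(1) by auto
 \<comment> \<open>Outside its own cosets a vertex group leaves the first coordinate fixed; the
   action on \<open>Y\<close> keeps the stabilizer equal to \<open>J\<close>.\<close>
 define \<alpha> where "\<alpha> v a z = (if z\<in>\<Omega> then (if fst z\<in>co ` Q v then \<iota> v a <#\<^bsub>PG\<^esub> fst z else fst z, act (\<iota> v a) (snd z)) else z)"
  for v a and z :: "('v, 'e, 'g) gel set\<times>('v => ('v, 'e, 'g) gel set)"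
 have \<alpha>co: "\<alpha> v a (co q, y) = (co (\<iota> v a\<cdot>q), act (\<iota> v a) y)"
  if "v\<in>Vs" "a\<in>carrier (Gv v)" "q\<in>\<P>" "co q\<in>co ` Q v" "y\<in>Y" for v a q y
  using that by (auto simp: \<alpha>_def \<Omega>_def co_mult)
 have Qm: "co (\<iota> v a\<cdot>q)\<in>co ` Q v" if h: "v\<in>Vs" "a\<in>carrier (Gv v)" "q\<in>Q v" for v a q
 proof -
  interpret A: group "Gv v" using h by (simp add: Gv_group)
  obtain b p where b: "b\<in>carrier (Gv v)" "p\<in>P" "q = \<iota> v b\<cdot>p" using h(3) by (auto simp: Q_def)
  have "\<iota> v a\<cdot>q = \<iota> v (a \<otimes>\<^bsub>Gv v\<^esub> b)\<cdot>p" using h b P(2) by (auto simp: \<iota>_mult G.m_assoc)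
  then have "\<iota> v a\<cdot>q\<in>Q v" using h b unfolding Q_def by blast
  then show ?thesis by blast
 qed
 have \<alpha>hom: "\<alpha> v\<in>hom (Gv v) (permgrp \<Omega>)" if v: "v\<in>Vs" for v
 proof (rule hom_permgrpI)
  interpret A: group "Gv v" using v by (rule Gv_group)
  show "group (Gv v)" by (rule A.group_axioms)
  show "\<alpha> v a z\<in>\<Omega>" if h: "a\<in>carrier (Gv v)" "z\<in>\<Omega>" for a z
  proof (cases "fst z\<in>co ` Q v")
   case True
   then obtain q where q: "q\<in>Q v" "fst z = co q" by blast
   have "\<alpha> v a z = (co (\<iota> v a\<cdot>q), act (\<iota> v a) (snd z))"
    using h q v Qc[OF v] by (auto simp: \<alpha>_def co_mult subset_eq)
   then show ?thesis using h v Qm[OF v h(1) q(1)] actY[of "\<iota> v a" "snd z"] by (auto simp: \<Omega>_def)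
  next
   case False
   then show ?thesis using h v actY[of "\<iota> v a" "snd z"] by (cases z) (auto simp: \<alpha>_def \<Omega>_def)
  qed
  show "\<alpha> v a z = z" if "z\<notin>\<Omega>" for a z using that by (simp add: \<alpha>_def)
  show "\<alpha> v \<one>\<^bsub>Gv v\<^esub> z = z" if h: "z\<in>\<Omega>" for z
  proof (cases "fst z\<in>co ` Q v")
   case True
   then obtain q where q: "q\<in>Q v" "fst z = co q" by blast
   then show ?thesis using h v Qc[OF v] \<alpha>co[OF v A.one_closed, of q "snd z"]
    by (cases z) (auto simp: \<iota>_one act1 \<Omega>_def)
  next
   case False
   then show ?thesis using h v by (cases z) (auto simp: \<alpha>_def \<iota>_one act1)
  qed
  show "\<alpha> v (a \<otimes>\<^bsub>Gv v\<^esub> b) z = \<alpha> v a (\<alpha> v b z)" if h: "a\<in>carrier (Gv v)" "b\<in>carrier (Gv v)" "z\<in>\<Omega>" for a b z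
  proof -
   have ic: "\<iota> v a\<in>\<P>" "\<iota> v b\<in>\<P>" using h v by auto
   have y: "snd z\<in>Y" "act (\<iota> v b) (snd z)\<in>Y" using h(3) actY[OF ic(2)] by (simp_all add: \<Omega>_def mem_Times_iff)
   show ?thesis
   proof (cases "fst z\<in>co ` Q v")
    case True
    then obtain q where q: "q\<in>Q v" "fst z = co q" by blast
    have qc: "q\<in>\<P>" using q Qc[OF v] by blast
    have z: "z = (co q, snd z)" using q by (cases z) simp
    have 1: "\<alpha> v b z = (co (\<iota> v b\<cdot>q), act (\<iota> v b) (snd z))"
     by (subst z) (use \<alpha>co[OF v h(2) qc _ y(1)] q in auto)
    have "\<alpha> v (a \<otimes>\<^bsub>Gv v\<^esub> b) z = (co (\<iota> v (a \<otimes>\<^bsub>Gv v\<^esub> b)\<cdot>q), act (\<iota> v (a \<otimes>\<^bsub>Gv v\<^esub> b)) (snd z))"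
     by (subst z) (use \<alpha>co[OF v A.m_closed[OF h(1,2)] qc _ y(1)] q in auto)
    also have "\<dots> = (co (\<iota> v a\<cdot>(\<iota> v b\<cdot>q)), act (\<iota> v a) (act (\<iota> v b) (snd z)))"
     using h v ic qc by (simp add: \<iota>_mult actm G.m_assoc)
    also have "\<dots> = \<alpha> v a (\<alpha> v b z)"
     unfolding 1 using \<alpha>co[OF v h(1) _ Qm[OF v h(2) q(1)] y(2)] ic qc by simp
    finally show ?thesis .
   next
    case False
    have "(fst z, act (\<iota> v b) (snd z))\<in>\<Omega>" using h(3) y by (simp add: \<Omega>_def mem_Times_iff)
    then show ?thesis using False h v ic by (simp add: \<alpha>_def \<iota>_mult actm)
   qed
  qed
 qed
 have \<alpha>stab: "\<alpha> v a z = z\<longleftrightarrow>\<iota> v a\<in>J" if h: "v\<in>Vs" "a\<in>carrier (Gv v)" "z\<in>\<Omega>" for v a z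
 proof
  have y: "snd z\<in>Y" using h(3) by (simp add: \<Omega>_def mem_Times_iff)
  assume "\<alpha> v a z = z"
  then have "act (\<iota> v a) (snd z) = snd z" using h(3) by (metis \<alpha>_def snd_conv)
  then show "\<iota> v a\<in>J" using Y(4)[OF h(1,2) y] by simp
 next
  have y: "snd z\<in>Y" using h(3) by (simp add: \<Omega>_def mem_Times_iff)
  assume j: "\<iota> v a\<in>J"
  have "\<iota> v a <#\<^bsub>PG\<^esub> fst z = fst z" if cq: "fst z\<in>co ` Q v"
  proof -
   obtain q where q: "q\<in>Q v" "fst z = co q" using cq by blast
   then show ?thesis using coJ[OF j] co_mult[of "\<iota> v a" q] Qc[OF h(1)] h by auto
  qed
  then show "\<alpha> v a z = z" using Y(4)[OF h(1,2) y] j h(3) by (cases z) (simp add: \<alpha>_def)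
 qed
 \<comment> \<open>The edge letter is prescribed where both a coset and its translate are among
   those of \<open>P\<close>.\<close>
 define D where "D e = {(co p, y) | p y. p\<in>P\<and>y\<in>Y\<and>co (st e\<cdot>p)\<in>co ` P}" for e
 define fe where "fe e z = (st e <#\<^bsub>PG\<^esub> fst z, act (st e) (snd z))"
  for e and z :: "('v, 'e, 'g) gel set\<times>('v => ('v, 'e, 'g) gel set)"
 have fe: "fe e (co p, y) = (co (st e\<cdot>p), act (st e) y)" if "e\<in>Ar" "p\<in>\<P>" for e p y
  using that by (simp add: fe_def co_mult)
 have "\<exists>t. t permutes \<Omega>\<and>(\<forall>z\<in>D e. t z = fe e z) \<and>
   (\<forall>c\<in>carrier (Gv (src e)(|carrier := Ge e|)). t\<circ>eact1 \<alpha> e c = eact2 \<alpha> e c\<circ>t)" if e: "e\<in>Ar" for e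
 proof (rule equivariant_extension[OF edge_group[OF e] eact_hom[OF e \<alpha>hom]])
  have sv: "src e\<in>Vs" "tgt e\<in>Vs" using e by auto
  show "eact1 \<alpha> e c p = p\<longleftrightarrow>eact2 \<alpha> e c q = q"
   if "c\<in>carrier (Gv (src e)(|carrier := Ge e|))" "p\<in>\<Omega>" "q\<in>\<Omega>" for c p q
   using that e \<alpha>stab[of "src e" c p] \<alpha>stab[of "tgt e" "\<phi> e c" q] Ge_sub[OF e] \<phi>_closed[OF e]
    admissible_edge[OF J e] by (simp add: eact1_def eact2_def)
  have P\<Omega>: "(co p, y)\<in>\<Omega>" if "p\<in>P" "y\<in>Y" for p y
   unfolding \<Omega>_def by (intro SigmaI UN_I[OF sv(1)] subsetD[OF coP[OF sv(1)]] imageI that)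
  then show "D e\<subseteq>\<Omega>" by (auto simp: D_def)
  show "fe e\<in>D e \<rightarrow> \<Omega>"
  proof
   fix z assume "z\<in>D e"
   then obtain p y where z: "z = (co p, y)" "p\<in>P" "y\<in>Y" "co (st e\<cdot>p)\<in>co ` P" by (auto simp: D_def)
   then obtain p' where p': "p'\<in>P" "co (st e\<cdot>p) = co p'" by blast
   have "fe e z = (co p', act (st e) y)" using fe[OF e, of p y] z p' P(2) by auto
   then show "fe e z\<in>\<Omega>" using P\<Omega>[OF p'(1)] actY[of "st e" y] z e by simp
  qed
  show "z = eact1 \<alpha> e c w\<longleftrightarrow>fe e z = eact2 \<alpha> e c (fe e w)"
   if zw: "z\<in>D e" "w\<in>D e" and c: "c\<in>carrier (Gv (src e)(|carrier := Ge e|))" for z w c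
  proof -
   obtain p y where z: "z = (co p, y)" "p\<in>P" "y\<in>Y" using zw(1) by (auto simp: D_def)
   obtain q x where w: "w = (co q, x)" "q\<in>P" "x\<in>Y" "co (st e\<cdot>q)\<in>co ` P"
    using zw(2) by (auto simp: D_def)
   have c: "c\<in>Ge e" using c by simp
   have cc: "p\<in>\<P>" "q\<in>\<P>" "\<iota> (src e) c\<in>\<P>" "st e\<in>\<P>"
    "\<iota> (tgt e) (\<phi> e c)\<in>\<P>" "c\<in>carrier (Gv (src e))" "\<phi> e c\<in>carrier (Gv (tgt e))"
    using z w P(2) e c Ge_sub[OF e] \<phi>_closed[OF e] by auto
   have 1: "eact1 \<alpha> e c w = (co (\<iota> (src e) c\<cdot>q), act (\<iota> (src e) c) x)"
    unfolding eact1_def w(1) by (rule \<alpha>co) (use sv cc w coP[OF sv(1)] in auto)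
   have sx: "act (st e) x\<in>Y" using actY[OF cc(4)] w by simp
   have "eact2 \<alpha> e c (fe e w) = (co (\<iota> (tgt e) (\<phi> e c)\<cdot>(st e\<cdot>q)), act (\<iota> (tgt e) (\<phi> e c)) (act (st e) x))"
    unfolding eact2_def w(1) fe[OF e cc(2)]
    by (rule \<alpha>co) (use sv cc sx in simp_all, use w(4) coP[OF sv(2)] in blast)
   also have "\<dots> = (co (st e\<cdot>(\<iota> (src e) c\<cdot>q)), act (st e) (act (\<iota> (src e) c) x))"
    using st_\<iota>[OF e c] cc by (simp flip: actm G.m_assoc)
   finally have 2: "eact2 \<alpha> e c (fe e w) = (co (st e\<cdot>(\<iota> (src e) c\<cdot>q)), act (st e) (act (\<iota> (src e) c) x))" .
   have ic: "\<iota> (src e) c\<cdot>q\<in>\<P>" using cc by simp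
   have "inj (act (st e))" using hom_in_carrier[OF Y(3) cc(4)] permutes_inj[of "act (st e)" Y] by simp
   then have "act (st e) y = act (st e) (act (\<iota> (src e) c) x)\<longleftrightarrow>y = act (\<iota> (src e) c) x" by (auto dest: injD)
   moreover have "co (st e\<cdot>p) = co (st e\<cdot>(\<iota> (src e) c\<cdot>q))\<longleftrightarrow>co p = co (\<iota> (src e) c\<cdot>q)"
    using cc ic by (simp add: co_eq G.inv_mult_group G.m_assoc)
   ultimately show ?thesis unfolding 1 2 z(1) fe[OF e cc(1)] by auto
  qed
 qed (use fin\<Omega> in auto)
 then have "\<forall>e\<in>Ar. \<exists>t. t permutes \<Omega>\<and>(\<forall>z\<in>D e. t z = fe e z) \<and>
   (\<forall>c\<in>Ge e. t\<circ>eact1 \<alpha> e c = eact2 \<alpha> e c\<circ>t)" by simp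
 from bchoice[OF this] obtain s where s0: "\<forall>e\<in>Ar. s e permutes \<Omega>\<and>(\<forall>z\<in>D e. s e z = fe e z) \<and>
   (\<forall>c\<in>Ge e. s e\<circ>eact1 \<alpha> e c = eact2 \<alpha> e c\<circ>s e)" by blast
 have "compat (permgrp \<Omega>) \<alpha> s" by (rule compatI) (use \<alpha>hom s0 in auto)
 from transport_perm[OF this] obtain \<rho> \<theta> where
  \<rho>: "\<rho>\<in>hom PG (permgrp \<Omega>)" and \<theta>0: "\<theta> v0 = id" and \<theta>: "\<forall>v\<in>Vs. \<theta> v permutes \<Omega>"
  and \<rho>\<iota>: "\<forall>v\<in>Vs. \<forall>a\<in>carrier (Gv v). \<forall>z. \<theta> v (\<rho> (\<iota> v a) z) = \<alpha> v a (\<theta> v z)"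
  and \<rho>s: "\<forall>e\<in>Ar. \<forall>z. \<theta> (tgt e) (\<rho> (st e) z) = s e (\<theta> (src e) z)"
  by blast
 have \<rho>m: "\<rho> (k\<cdot>l) z = \<rho> k (\<rho> l z)" if "k\<in>\<P>" "l\<in>\<P>" for k l z
  using \<rho> that by (simp add: hom_def)
 have \<rho>1: "\<rho> \<e> z = z" for z using hom_one[OF \<rho> G.group_axioms group_permgrp] by simp
 have \<rho>\<iota>': "\<theta> v (\<rho> (\<iota> v a) z) = \<alpha> v a (\<theta> v z)" if "v\<in>Vs" "a\<in>carrier (Gv v)" for v a z
  using \<rho>\<iota> that by blast
 have \<rho>s': "\<theta> (tgt e) (\<rho> (st e) z) = s e (\<theta> (src e) z)" if "e\<in>Ar" for e z using \<rho>s that by blast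
 have co1: "co \<e> = H" unfolding co_def using G.lcos_mult_one subgroup.subset[OF H] by blast
 have P1: "\<e>\<in>P" by (simp add: P_def)
 have H\<Omega>: "(H, y)\<in>\<Omega>" if "y\<in>Y" for y
  unfolding \<Omega>_def co1[symmetric] by (intro SigmaI UN_I[OF v0] subsetD[OF coP[OF v0]] imageI P1 that)
 define Act where "Act v k z = \<theta> v (\<rho> k z)" for v k z
 have Act\<Omega>: "Act v k z\<in>\<Omega>\<longleftrightarrow>z\<in>\<Omega>" if "v\<in>Vs" "k\<in>\<P>" for v k z
  using \<theta> hom_in_carrier[OF \<rho> that(2)] that permutes_in_image[of "\<theta> v" \<Omega>] permutes_in_image[of "\<rho> k" \<Omega>] by (simp add: Act_def)
 have ok: "ok (co ` P) Act"
  unfolding ok_def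
 proof (intro conjI ballI allI impI)
  fix y assume y: "y\<in>Y"
  show "Act v0 \<e> (H, y) = (co \<e>, y)" by (simp add: Act_def \<theta>0 \<rho>1 co1)
  fix k assume k: "k\<in>\<P>"
  fix l assume l: "l\<in>\<P>"
  {
   fix v a y' assume h: "v\<in>Vs" "a\<in>carrier (Gv v)" "co l\<in>co ` P" "Act v k (H, y) = (co l, y')"
   have y': "y'\<in>Y" using Act\<Omega>[OF h(1) k, of "(H, y)"] H\<Omega>[OF y] h(4) by (simp add: \<Omega>_def)
   have "Act v (\<iota> v a\<cdot>k) (H, y) = \<alpha> v a (co l, y')"
    using \<rho>\<iota>'[OF h(1,2)] h k by (simp add: Act_def \<rho>m)
   also have "\<dots> = (co (\<iota> v a\<cdot>l), act (\<iota> v a) y')"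
    using \<alpha>co[OF h(1,2) l _ y'] h(3) coP[OF h(1)] by blast
   finally show "Act v (\<iota> v a\<cdot>k) (H, y) = (co (\<iota> v a\<cdot>l), act (\<iota> v a) y')" .
  }
  fix e y' assume h: "e\<in>Ar" "y'\<in>Y" "co l\<in>co ` P" "co (st e\<cdot>l)\<in>co ` P"
  obtain p where p: "p\<in>P" "co l = co p" using h(3) by blast
  have pc: "p\<in>\<P>" using p P(2) by blast
  have e: "st e\<in>\<P>" using h by simp
  have "co (st e\<cdot>p) = co (st e\<cdot>l)" using co_mult[OF e l] co_mult[OF e pc] p(2) by simp
  then have "(co l, y')\<in>D e" using p h by (auto simp: D_def)
  then have "s e (co l, y') = (co (st e\<cdot>l), act (st e) y')" using s0 h(1) fe[OF h(1) l] by simp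
  moreover have "Act (tgt e) (st e\<cdot>k) (H, y) = s e (Act (src e) k (H, y))"
   using \<rho>s'[OF h(1)] h(1) k e by (simp add: Act_def \<rho>m)
  moreover have "inj (s e)" using s0 h(1) permutes_inj by blast
  ultimately show "Act (src e) k (H, y) = (co l, y') \<longleftrightarrow>
    Act (tgt e) (st e\<cdot>k) (H, y) = (co (st e\<cdot>l), act (st e) y')"
   by (metis injD)
 qed
 have val: "\<rho> k (H, y) = (co k, act k y)" if k: "k\<in>insert g S" and y: "y\<in>Y" for k y
 proof -
  have "co ` Pf k\<subseteq>co ` P" using k unfolding P_def by blast
  then have "Act v0 k (H, y) = (co k, act k y)" using Pf k ok y by blast
  then show ?thesis by (simp add: Act_def \<theta>0)
 qed
 \<comment> \<open>\<open>H\<close> stabilizes {H} x Y as a set because its generators do, whereas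
   \<open>g\<close> takes these points into another coset.\<close>
 define St where "St = {k\<in>\<P>. \<rho> k ` ({H}\<times>Y) = {H}\<times>Y}"
 have \<rho>perm: "\<rho> k permutes \<Omega>" if "k\<in>\<P>" for k using hom_in_carrier[OF \<rho> that] by simp
 have StI: "k\<in>St" if k: "k\<in>\<P>" "!!y. y\<in>Y ==> \<rho> k (H, y) = (H, act k y)" for k
 proof -
  have "\<rho> k ` ({H}\<times>Y)\<subseteq>{H}\<times>Y" using k actY by auto
  moreover have "finite ({H}\<times>Y)" using Y(1) by simp
  moreover have "inj_on (\<rho> k) ({H}\<times>Y)" using permutes_inj[OF \<rho>perm[OF k(1)]] by (rule inj_on_subset) simp
  ultimately show ?thesis using k(1) by (simp add: St_def endo_inj_surj)
 qed
 have "subgroup St PG"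
 proof (rule G.subgroupI)
  have "\<e>\<in>St" by (rule StI) (auto simp: \<rho>1 act1)
  then show "St ~= {}" by blast
  show "iv a\<in>St" if a: "a\<in>St" for a
  proof -
   have ac: "a\<in>\<P>" "\<rho> a ` ({H}\<times>Y) = {H}\<times>Y" using a by (auto simp: St_def)
   have "\<rho> (iv a) ` (\<rho> a ` ({H}\<times>Y)) = {H}\<times>Y"
    using ac(1) by (simp add: image_image \<rho>1 flip: \<rho>m)
   then show ?thesis using ac by (simp add: St_def)
  qed
  show "a\<cdot>b\<in>St" if ab: "a\<in>St" "b\<in>St" for a b
  proof -
   have ac: "a\<in>\<P>" "b\<in>\<P>" "\<rho> a ` ({H}\<times>Y) = {H}\<times>Y" "\<rho> b ` ({H}\<times>Y) = {H}\<times>Y"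
    using ab by (auto simp: St_def)
   have "\<rho> (a\<cdot>b) ` ({H}\<times>Y) = \<rho> a ` (\<rho> b ` ({H}\<times>Y))"
    using ac(1,2) by (simp add: image_image \<rho>m)
   then show ?thesis using ac by (simp add: St_def)
  qed
 qed (auto simp: St_def)
 moreover have "J\<union>S\<subseteq>St"
 proof
  fix k assume k: "k\<in>J\<union>S"
  show "k\<in>St"
  proof (rule StI)
   show "k\<in>\<P>" using k JS by blast
   fix y assume y: "y\<in>Y"
   show "\<rho> k (H, y) = (H, act k y)"
   proof (cases "k\<in>S")
    case True
    then have "co k = H" using JH(2) co_eq[of k "\<e>"] S(2) by (auto simp: co1)
    then show ?thesis using val[of k y] True y by simp
   next
    case False
    then have kJ: "k\<in>J" using k by blast
    then obtain a where a: "a\<in>carrier (Gv v0)" "k = \<iota> v0 a" using admissible_vertex[OF J v0 kJ] by blast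
    have "\<rho> k (H, y) = \<alpha> v0 a (H, y)" using \<rho>\<iota>'[OF v0 a(1)] by (simp add: \<theta>0 a(2))
    also have "\<dots> = (co (\<iota> v0 a\<cdot>\<e>), act (\<iota> v0 a) y)"
     using \<alpha>co[OF v0 a(1) G.one_closed _ y] P1 coP[OF v0] by (auto simp: co1)
    also have "\<dots> = (H, act k y)" using coJ[OF kJ G.one_closed] by (simp add: a(2) co1)
    finally show ?thesis .
   qed
  qed
 qed
 ultimately have HSt: "H\<subseteq>St" unfolding H_def by (intro G.generate_subgroup_incl)
 define N where "N = kernel PG (permgrp \<Omega>) \<rho>"
 have "\<rho> ` \<P>\<subseteq>carrier (permgrp \<Omega>)" using hom_in_carrier[OF \<rho>] by blast
 then have "finite (\<rho> ` \<P>)" by (rule finite_subset[OF _ finite_permgrp[OF fin\<Omega>]])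
 then have N: "fin_normal PG N" unfolding N_def by (intro G.hom_kernel_fin_normal[OF group_permgrp \<rho>])
 have "iv h\<cdot>g\<notin>N" if h: "h\<in>H" for h
 proof
  assume n: "iv h\<cdot>g\<in>N"
  have hc: "h\<in>\<P>" using h H subgroup.mem_carrier by metis
  obtain y where y: "y\<in>Y" using Y(2) by blast
  have "\<rho> (iv h\<cdot>g) = id" using n by (simp add: N_def kernel_def)
  then have "\<rho> h (H, y) = \<rho> h (\<rho> (iv h\<cdot>g) (H, y))" by simp
  also have "\<dots> = \<rho> g (H, y)" using hc g(1) by (simp flip: \<rho>m)
  also have "\<dots> = (co g, act g y)" using val y by simp
  finally have "\<rho> h (H, y) = (co g, act g y)" .
  moreover have "\<rho> h (H, y)\<in>{H}\<times>Y" using HSt h y unfolding St_def by blast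
  ultimately have "co g = co \<e>" by (simp add: co1)
  then have "g\<in>H" using co_eq[OF g(1) G.one_closed] g(1) by simp
  then show False using g(2) by (simp add: H_def)
 qed
 then show ?thesis using N unfolding H_def by blast
qed

lemma generate_normal_union:
 assumes "J \<lhd> PG" "S\<subseteq>\<P>"
 shows "generate PG (J\<union>S) = {h\<cdot>j | h j. h\<in>generate PG S\<and>j\<in>J}"
proof
 interpret J: normal J PG by (rule assms(1))
 interpret H: subgroup "generate PG S" PG by (rule G.generate_is_subgroup[OF assms(2)])
 have "subgroup {h\<cdot>j | h j. h\<in>generate PG S\<and>j\<in>J} PG"
 proof (rule G.subgroupI)
  show "{h\<cdot>j | h j. h\<in>generate PG S\<and>j\<in>J} ~= {}" using H.one_closed J.one_closed by blast
  show "iv x\<in>{h\<cdot>j | h j. h\<in>generate PG S\<and>j\<in>J}"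
   if x: "x\<in>{h\<cdot>j | h j. h\<in>generate PG S\<and>j\<in>J}" for x
  proof -
   obtain h j where h: "h\<in>generate PG S" "j\<in>J" "x = h\<cdot>j" using x by blast
   have "iv x = iv h\<cdot>(h\<cdot>iv j\<cdot>iv h)"
    using h by (simp add: G.inv_mult_group G.m_assoc)
   moreover have "iv h\<in>generate PG S" using h(1) by (rule H.m_inv_closed)
   moreover have "h\<cdot>iv j\<cdot>iv h\<in>J" using h J.inv_op_closed2[of h "iv j"] by simp
   ultimately show ?thesis by blast
  qed
  show "x\<cdot>y\<in>{h\<cdot>j | h j. h\<in>generate PG S\<and>j\<in>J}"
   if xy: "x\<in>{h\<cdot>j | h j. h\<in>generate PG S\<and>j\<in>J}"
    "y\<in>{h\<cdot>j | h j. h\<in>generate PG S\<and>j\<in>J}" for x y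
  proof -
   obtain h j where h: "h\<in>generate PG S" "j\<in>J" "x = h\<cdot>j" using xy(1) by blast
   obtain k i where k: "k\<in>generate PG S" "i\<in>J" "y = k\<cdot>i" using xy(2) by blast
   have "x\<cdot>y = (h\<cdot>k)\<cdot>((iv k\<cdot>j\<cdot>k)\<cdot>i)"
    using h k by (simp add: G.m_assoc)
   moreover have "iv k\<cdot>j\<cdot>k\<cdot>i\<in>J" using J.inv_op_closed1[of k j] h k by simp
   moreover have "h\<cdot>k\<in>generate PG S" using h(1) k(1) by (rule H.m_closed)
   ultimately show ?thesis by blast
  qed
 qed auto
 moreover have "J\<union>S\<subseteq>{h\<cdot>j | h j. h\<in>generate PG S\<and>j\<in>J}"
 proof
  fix x assume x: "x\<in>J\<union>S"
  show "x\<in>{h\<cdot>j | h j. h\<in>generate PG S\<and>j\<in>J}"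
  proof (cases "x\<in>J")
   case True
   then have "x = \<e>\<cdot>x" by simp
   then show ?thesis using True H.one_closed by blast
  next
   case False
   then have "x\<in>generate PG S" "x = x\<cdot>\<e>" using x assms(2) by (auto intro: generate.incl)
   then show ?thesis using J.one_closed by blast
  qed
 qed
 ultimately show "generate PG (J\<union>S)\<subseteq>{h\<cdot>j | h j. h\<in>generate PG S\<and>j\<in>J}"
  by (intro G.generate_subgroup_incl)
 interpret U: subgroup "generate PG (J\<union>S)" PG by (rule G.generate_is_subgroup) (use assms(2) in auto)
 have "generate PG S\<subseteq>generate PG (J\<union>S)" by (rule G.mono_generate) auto
 then show "{h\<cdot>j | h j. h\<in>generate PG S\<and>j\<in>J}\<subseteq>generate PG (J\<union>S)"
  by (auto intro!: U.m_closed intro: generate.incl)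
qed

text \<open>If g = h n lies in H J, then n is separated from the intersection of H and J modulo some
  D. Replacing \<open>J\<close> by the subgroup generated by its D-th powers excludes
  \<open>g\<close>, and the new subgroup is still admissible. Separating points from finitely
  generated subgroups is enough, because of two different subgroups one has an element outside the
  other.\<close>

theorem subgroup_separableI:
 assumes adm: "admissible J" and "heis_normal PG J \<zeta> M"
 shows "subgroup_separable PG"
proof -
 interpret heis_normal PG J \<zeta> M by fact
 have sep: "\<exists>N. fin_normal PG N\<and>(\<forall>h\<in>H. iv h\<cdot>g\<notin>N)"
  if H: "subgroup H PG" "finitely_generated (PG(|carrier := H|))" and g: "g\<in>\<P>" "g\<notin>H" for H g
 proof -
  interpret H: subgroup H PG by (rule H(1))
  obtain S where S: "finite S" "S\<subseteq>H" "generate (PG(|carrier := H|)) S = H"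
   using H(2) by (auto simp: finitely_generated_def)
  have SH: "generate PG S = H" using G.generate_consistent[OF S(2) H(1)] S(3) by simp
  have Sc: "S\<subseteq>\<P>" using S(2) H.subset by blast
  have "\<exists>J'. admissible J'\<and>g\<notin>generate PG (J'\<union>S)"
  proof (cases "g\<in>generate PG (J\<union>S)")
   case False
   then show ?thesis using adm by blast
  next
   case True
   then obtain h n where hn: "h\<in>H" "n\<in>J" "g = h\<cdot>n"
    unfolding generate_normal_union[OF J.normal_axioms Sc] SH by blast
   have nH: "n\<notin>H" using hn g(2) by auto
   have N: "subgroup (\<zeta> ` (H\<inter>J)) HH"
   proof (rule HH.subgroupI)
    show "\<zeta> ` (H\<inter>J) ~= {}" using H.one_closed J.one_closed by blast
    show "inv\<^bsub>HH\<^esub> A\<in>\<zeta> ` (H\<inter>J)" if "A\<in>\<zeta> ` (H\<inter>J)" for A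
     using that by (auto simp flip: \<zeta>_inv)
    show "A \<otimes>\<^bsub>HH\<^esub> B\<in>\<zeta> ` (H\<inter>J)" if "A\<in>\<zeta> ` (H\<inter>J)" "B\<in>\<zeta> ` (H\<inter>J)" for A B
     using that by (auto simp del: hm.simps simp flip: \<zeta>_m)
   qed simp
   have "\<zeta> n\<notin>\<zeta> ` (H\<inter>J)" using nH hn(2) \<zeta>_eq by blast
   from HH_separable[OF N this] obtain D where D: "D > 0"
    "!!m c. m\<in>\<zeta> ` (H\<inter>J) ==> c\<in>cong0 D ==> \<zeta> n ~= hm m c" by blast
   define J' where "J' = generate PG ((%j. j [^]\<^bsub>PG\<^esub> nat D) ` J)"
   have J': "J' \<lhd> PG" "J'\<subseteq>J" "fidx PG J J'" "\<zeta> ` J'\<subseteq>cong0 D"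
    using power_subgroup[of "nat D"] D(1) by (simp_all add: J'_def)
   have "g\<notin>generate PG (J'\<union>S)"
   proof
    assume "g\<in>generate PG (J'\<union>S)"
    then obtain h' j where hj: "h'\<in>H" "j\<in>J'" "g = h'\<cdot>j"
     unfolding generate_normal_union[OF J'(1) Sc] SH by blast
    have jJ: "j\<in>J" using hj J'(2) by blast
    define m where "m = iv h\<cdot>h'"
    have "n = iv h\<cdot>g" using hn by simp
    then have e: "n = m\<cdot>j" using hj hn(1) jJ by (simp add: m_def G.m_assoc)
    have mH: "m\<in>H" using hn hj by (simp add: m_def)
    have "m = n\<cdot>iv j" using e mH jJ by (simp add: G.m_assoc)
    then have mJ: "m\<in>J" using hn(2) jJ by simp
    have "\<zeta> n = hm (\<zeta> m) (\<zeta> j)" using e \<zeta>_m[OF mJ jJ] by simp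
    then show False using D(2)[of "\<zeta> m" "\<zeta> j"] mH mJ J'(4) hj(2) by blast
   qed
   then show ?thesis using admissible_subset[OF adm J'(1-3)] by blast
  qed
  then obtain J' where J': "admissible J'" "g\<notin>generate PG (J'\<union>S)" by blast
  have "H\<subseteq>generate PG (J'\<union>S)" unfolding SH[symmetric] by (rule G.mono_generate) auto
  then show ?thesis using separate_over_admissible[OF J'(1) S(1) Sc g(1) J'(2)] by blast
 qed
 have diff: "\<exists>N. N \<lhd> PG\<and>finite (carrier (PG Mod N))\<and>(%g. N #>\<^bsub>PG\<^esub> g) ` H ~= (%g. N #>\<^bsub>PG\<^esub> g) ` K"
  if HK: "subgroup H PG" "finitely_generated (PG(|carrier := H|))" "subgroup K PG" "g\<in>K" "g\<notin>H" for H K g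
 proof -
  have gc: "g\<in>\<P>" using HK subgroup.mem_carrier by metis
  obtain N where N: "fin_normal PG N" "!!h. h\<in>H ==> iv h\<cdot>g\<notin>N"
   using sep[OF HK(1,2) gc HK(5)] by blast
  have NN: "N \<lhd> PG" "finite (carrier (PG Mod N))" using N(1) G.finite_Mod_iff by (auto simp: fin_normal_def)
  interpret N: normal N PG by (rule NN(1))
  have "N #>\<^bsub>PG\<^esub> g ~= N #>\<^bsub>PG\<^esub> h" if h: "h\<in>H" for h
  proof
   assume e: "N #>\<^bsub>PG\<^esub> g = N #>\<^bsub>PG\<^esub> h"
   have hc: "h\<in>\<P>" using h HK(1) subgroup.mem_carrier by metis
   have "g\<in>N #>\<^bsub>PG\<^esub> h" using G.rcos_self[OF gc N.subgroup_axioms] e by simp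
   then obtain n where n: "n\<in>N" "g = n\<cdot>h" by (auto simp: r_coset_def)
   have "iv h\<cdot>n\<cdot>h\<in>N" using N.inv_op_closed1[OF hc n(1)] .
   then show False using N(2)[OF h] n hc by (simp add: G.m_assoc)
  qed
  then show ?thesis using NN HK(4) by blast
 qed
 show ?thesis
  unfolding subgroup_separable_def
 proof (intro allI impI)
  fix H K assume h: "subgroup H PG\<and>finitely_generated (PG(|carrier := H|)) \<and>
   subgroup K PG\<and>finitely_generated (PG(|carrier := K|))\<and>H ~= K"
  then consider g where "g\<in>K" "g\<notin>H" | g where "g\<in>H" "g\<notin>K" by blast
  then show "\<exists>N. N \<lhd> PG\<and>finite (carrier (PG Mod N))\<and>(%g. N #>\<^bsub>PG\<^esub> g) ` H ~= (%g. N #>\<^bsub>PG\<^esub> g) ` K"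
  proof cases
   case 1
   then show ?thesis using diff[of H K] h by blast
  next
   case 2
   then have "\<exists>N. N \<lhd> PG\<and>finite (carrier (PG Mod N))\<and>(%g. N #>\<^bsub>PG\<^esub> g) ` K ~= (%g. N #>\<^bsub>PG\<^esub> g) ` H"
    using diff[of K H] h by blast
   then show ?thesis by metis
  qed
 qed
qed

end

section \<open>Free complements\<close>

context gog_nilp
begin

text \<open>\<open>L\<close> is the cocycle of the finite action that multiplies by \<open>lam (e, D)\<close> when the edge \<open>e\<close> is
 crossed at the orbit \<open>D\<close> of its edge group.\<close>

definition eorb :: "(('v, 'e, 'g) gel => 'y => 'y) => 'e => 'y => 'y set" where
 "eorb act e y = (%c. act (\<iota> (src e) c) y) ` Ge e"

definition labelling :: "('k, 'm) monoid_scheme => (('v, 'e, 'g) gel => 'y => 'y) => 'y =>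
  ('e\<times>'y set => 'k) => ('v => ('v, 'e, 'g) gel => 'k) => bool" where
 "labelling K act y0 lam L\<longleftrightarrow>L v0 \<e> = \<one>\<^bsub>K\<^esub> \<and>
   (\<forall>v\<in>Vs. \<forall>k\<in>\<P>. L v k\<in>carrier K) \<and>
   (\<forall>v\<in>Vs. \<forall>a\<in>carrier (Gv v). \<forall>k\<in>\<P>. L v (\<iota> v a\<cdot>k) = L v k) \<and>
   (\<forall>e\<in>Ar. \<forall>k\<in>\<P>.
    L (tgt e) (st e\<cdot>k) = lam (e, eorb act e (act k y0)) \<otimes>\<^bsub>K\<^esub> L (src e) k)"

text \<open>The finite action is extended to Y x K, an edge multiplying the second factor on the
  left by its label. The label is constant on orbits of the edge group, so the edge relations
  persist; the labelling is the second coordinate of the image of (y0, 1).\<close>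

lemma labelling_exists:
 assumes K: "group K" and act: "act\<in>hom PG (permgrp Y)" and y0: "y0\<in>Y"
  and lam: "!!x. lam x\<in>carrier K"
 shows "\<exists>L. labelling K act y0 lam L"
proof -
 interpret K: group K by (rule K)
 have actm: "act (k\<cdot>l) y = act k (act l y)" if "k\<in>\<P>" "l\<in>\<P>" for k l y
  using act that by (simp add: hom_def)
 have actp: "act k permutes Y" if "k\<in>\<P>" for k using hom_in_carrier[OF act that] by simp
 have actY: "act k y\<in>Y\<longleftrightarrow>y\<in>Y" if "k\<in>\<P>" for k y using permutes_in_image[OF actp[OF that]] .
 have act1: "act \<e> y = y" for y using hom_one[OF act G.group_axioms group_permgrp] by simp
 define \<Omega> where "\<Omega> = Y\<times>carrier K"
 define \<alpha> where "\<alpha> v a z = (if z\<in>\<Omega> then (act (\<iota> v a) (fst z), snd z) else z)" for v a z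
 define s where "s e z = (if z\<in>\<Omega> then (act (st e) (fst z), lam (e, eorb act e (fst z)) \<otimes>\<^bsub>K\<^esub> snd z) else z)" for e z
 have \<alpha>hom: "\<alpha> v\<in>hom (Gv v) (permgrp \<Omega>)" if v: "v\<in>Vs" for v
 proof (rule hom_permgrpI)
  interpret A: group "Gv v" using v by (rule Gv_group)
  show "group (Gv v)" by (rule A.group_axioms)
  show cl: "\<alpha> v a z\<in>\<Omega>" if "a\<in>carrier (Gv v)" "z\<in>\<Omega>" for a z
   using that v actY[of "\<iota> v a" "fst z"] by (auto simp: \<alpha>_def \<Omega>_def)
  show "\<alpha> v a z = z" if "z\<notin>\<Omega>" for a z using that by (simp add: \<alpha>_def)
  show "\<alpha> v \<one>\<^bsub>Gv v\<^esub> z = z" if "z\<in>\<Omega>" for z using that v by (simp add: \<alpha>_def \<iota>_one act1)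
  show "\<alpha> v (a \<otimes>\<^bsub>Gv v\<^esub> b) z = \<alpha> v a (\<alpha> v b z)"
   if h: "a\<in>carrier (Gv v)" "b\<in>carrier (Gv v)" "z\<in>\<Omega>" for a b z
  proof -
   have "\<alpha> v b z\<in>\<Omega>" using cl h by blast
   then show ?thesis using h v by (simp add: \<alpha>_def \<iota>_mult actm)
  qed
 qed
 have sp: "s e permutes \<Omega>" if e: "e\<in>Ar" for e
 proof (rule bij_imp_permutes)
  have ec: "st e\<in>\<P>" "iv st e\<in>\<P>" using e by auto
  have ai: "act (iv st e) (act (st e) y) = y" "act (st e) (act (iv st e) y) = y" for y
   using ec by (simp_all add: act1 flip: actm)
  define t where "t z = (act (iv st e) (fst z),
   inv\<^bsub>K\<^esub> lam (e, eorb act e (act (iv st e) (fst z))) \<otimes>\<^bsub>K\<^esub> snd z)" for z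
  show "bij_betw (s e) \<Omega> \<Omega>"
  proof (rule bij_betwI[where g = t])
   show "s e\<in>\<Omega> \<rightarrow> \<Omega>" using lam actY[OF ec(1)] by (auto simp: s_def \<Omega>_def)
   show "t\<in>\<Omega> \<rightarrow> \<Omega>" using lam actY[OF ec(2)] by (auto simp: t_def \<Omega>_def)
   show "t (s e z) = z" if "z\<in>\<Omega>" for z
    using that lam by (cases z) (auto simp: s_def t_def \<Omega>_def ai simp flip: K.m_assoc)
   show "s e (t z) = z" if "z\<in>\<Omega>" for z
    using that lam actY[OF ec(2)] by (cases z) (auto simp: s_def t_def \<Omega>_def ai simp flip: K.m_assoc)
  qed
  show "s e z = z" if "z\<notin>\<Omega>" for z using that by (simp add: s_def)
 qed
 have "s e\<circ>eact1 \<alpha> e c = eact2 \<alpha> e c\<circ>s e" if e: "e\<in>Ar" and c: "c\<in>Ge e" for e c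
 proof
  fix z
  have sv: "src e\<in>Vs" "tgt e\<in>Vs" "st e\<in>\<P>" using e by auto
  have cc: "c\<in>carrier (Gv (src e))" "\<phi> e c\<in>carrier (Gv (tgt e))" "\<iota> (src e) c\<in>\<P>"
   "\<iota> (tgt e) (\<phi> e c)\<in>\<P>" using sv Ge_sub[OF e c] \<phi>_closed[OF e c] by auto
  interpret C: subgroup "Ge e" "Gv (src e)" by (rule edge_subgroup[OF e])
  interpret A: group "Gv (src e)" by (rule Gv_group[OF sv(1)])
  show "(s e\<circ>eact1 \<alpha> e c) z = (eact2 \<alpha> e c\<circ>s e) z"
  proof (cases "z\<in>\<Omega>")
   case True
   have 1: "\<alpha> (src e) c z\<in>\<Omega>" "s e z\<in>\<Omega>"
    using True cc(3) actY[of "\<iota> (src e) c" "fst z"] permutes_in_image[OF sp[OF e]] by (auto simp: \<alpha>_def \<Omega>_def)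
   have orb: "eorb act e (act (\<iota> (src e) c) y) = eorb act e y" for y
   proof (rule Set.set_eqI)
    fix w
    have "w\<in>eorb act e (act (\<iota> (src e) c) y)\<longleftrightarrow>(\<exists>d\<in>Ge e. w = act (\<iota> (src e) (d \<otimes>\<^bsub>Gv (src e)\<^esub> c)) y)"
     using sv cc by (auto simp: eorb_def \<iota>_mult actm)
    also have "\<dots>\<longleftrightarrow>(\<exists>d\<in>Ge e. w = act (\<iota> (src e) d) y)"
    proof
     assume "\<exists>d\<in>Ge e. w = act (\<iota> (src e) (d \<otimes>\<^bsub>Gv (src e)\<^esub> c)) y"
     then show "\<exists>d\<in>Ge e. w = act (\<iota> (src e) d) y" using C.m_closed[OF _ c] by blast
    next
     assume "\<exists>d\<in>Ge e. w = act (\<iota> (src e) d) y"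
     then obtain d where d: "d\<in>Ge e" "w = act (\<iota> (src e) d) y" by blast
     have "d = (d \<otimes>\<^bsub>Gv (src e)\<^esub> inv\<^bsub>Gv (src e)\<^esub> c) \<otimes>\<^bsub>Gv (src e)\<^esub> c"
      using d(1) c by (simp add: A.m_assoc)
     then show "\<exists>d\<in>Ge e. w = act (\<iota> (src e) (d \<otimes>\<^bsub>Gv (src e)\<^esub> c)) y"
      using d C.m_closed[OF d(1) C.m_inv_closed[OF c]] by metis
    qed
    finally show "w\<in>eorb act e (act (\<iota> (src e) c) y)\<longleftrightarrow>w\<in>eorb act e y" by (auto simp: eorb_def)
   qed
   have "act (st e) (act (\<iota> (src e) c) y) = act (\<iota> (tgt e) (\<phi> e c)) (act (st e) y)" for y
    using st_\<iota>[OF e c] sv cc by (simp flip: actm)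
   then show ?thesis using 1 True by (simp add: eact1_def eact2_def s_def \<alpha>_def orb)
  next
   case False
   then show ?thesis by (simp add: eact1_def eact2_def s_def \<alpha>_def)
  qed
 qed
 then have "compat (permgrp \<Omega>) \<alpha> s" by (intro compatI) (use \<alpha>hom sp in auto)
 from transport_perm[OF this] obtain \<rho> \<theta> where
  \<rho>: "\<rho>\<in>hom PG (permgrp \<Omega>)" and \<theta>0: "\<theta> v0 = id" and \<theta>: "\<forall>v\<in>Vs. \<theta> v permutes \<Omega>"
  and \<rho>\<iota>: "\<forall>v\<in>Vs. \<forall>a\<in>carrier (Gv v). \<forall>z. \<theta> v (\<rho> (\<iota> v a) z) = \<alpha> v a (\<theta> v z)"
  and \<rho>s: "\<forall>e\<in>Ar. \<forall>z. \<theta> (tgt e) (\<rho> (st e) z) = s e (\<theta> (src e) z)"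
  by blast
 have \<rho>m: "\<rho> (k\<cdot>l) z = \<rho> k (\<rho> l z)" if "k\<in>\<P>" "l\<in>\<P>" for k l z
  using \<rho> that by (simp add: hom_def)
 have \<rho>1: "\<rho> \<e> z = z" for z using hom_one[OF \<rho> G.group_axioms group_permgrp] by simp
 have \<rho>\<iota>': "\<theta> v (\<rho> (\<iota> v a) z) = \<alpha> v a (\<theta> v z)" if "v\<in>Vs" "a\<in>carrier (Gv v)" for v a z
  using \<rho>\<iota> that by blast
 have \<rho>s': "\<theta> (tgt e) (\<rho> (st e) z) = s e (\<theta> (src e) z)" if "e\<in>Ar" for e z using \<rho>s that by blast
 define W where "W v k = \<theta> v (\<rho> k (y0, \<one>\<^bsub>K\<^esub>))" for v k
 have W\<Omega>: "W v k\<in>\<Omega>" if "v\<in>Vs" "k\<in>\<P>" for v k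
  using \<theta> hom_in_carrier[OF \<rho> that(2)] that(1) permutes_in_image[of "\<theta> v" \<Omega>] permutes_in_image[of "\<rho> k" \<Omega>] y0
  by (simp add: W_def \<Omega>_def)
 have Wv: "W v (\<iota> v a\<cdot>k) = (act (\<iota> v a) (fst (W v k)), snd (W v k))"
  if "v\<in>Vs" "a\<in>carrier (Gv v)" "k\<in>\<P>" for v a k
  using W\<Omega>[OF that(1,3)] that by (simp add: W_def \<rho>m \<rho>\<iota>' \<alpha>_def)
 have We: "W (tgt e) (st e\<cdot>k) =
   (act (st e) (fst (W (src e) k)), lam (e, eorb act e (fst (W (src e) k))) \<otimes>\<^bsub>K\<^esub> snd (W (src e) k))"
  if "e\<in>Ar" "k\<in>\<P>" for e k
  using W\<Omega>[OF _ that(2), of "src e"] that by (simp add: W_def \<rho>m \<rho>s' s_def)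
 have fst: "fst (W v k) = act k y0" if "v\<in>Vs" "k\<in>\<P>" for v k
 proof (rule path_induct[OF that v0, of "%v k. fst (W v k) = act k y0"])
  show "fst (W v0 \<e>) = act \<e> y0" by (simp add: W_def \<theta>0 \<rho>1 act1)
 next
  fix e g assume h: "e\<in>Ar" "g\<in>\<P>" "fst (W (tgt e) g) = act g y0"
  let ?g = "iv st e\<cdot>g"
  have g: "?g\<in>\<P>" "st e\<in>\<P>" "st e\<cdot>?g = g" using h by auto
  have "act (st e) (fst (W (src e) ?g)) = act (st e) (act ?g y0)"
   using We[OF h(1) g(1)] h(3) actm[OF g(2,1)] g(3) by simp
  then show "fst (W (src e) ?g) = act ?g y0" using permutes_inj[OF actp[OF g(2)]] by (auto dest: injD)
 qed (use Wv We actm in auto)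
 have "labelling K act y0 lam (%v k. snd (W v k))"
  unfolding labelling_def
 proof (intro conjI ballI)
  show "snd (W v0 \<e>) = \<one>\<^bsub>K\<^esub>" by (simp add: W_def \<theta>0 \<rho>1)
  show "snd (W v k)\<in>carrier K" if "v\<in>Vs" "k\<in>\<P>" for v k
   using W\<Omega>[OF that] by (auto simp: \<Omega>_def)
 qed (use Wv We fst in auto)
 then show ?thesis by blast
qed

text \<open>Right translation by the label of a loop commutes with the left multiplications that
  build up labels. On the stabilizer of \<open>y0\<close> the labelling is therefore a
  homomorphism.\<close>

lemma labelling_mult:
 assumes K: "group K" and act: "act\<in>hom PG (permgrp Y)" and L: "labelling K act y0 lam L"
  and lam: "!!x. lam x\<in>carrier K" and f: "f\<in>\<P>" "act f y0 = y0" and v: "v\<in>Vs" "k\<in>\<P>"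
 shows "L v (k\<cdot>f) = L v k \<otimes>\<^bsub>K\<^esub> L v0 f"
proof -
 interpret K: group K by (rule K)
 have actm: "act (k\<cdot>l) y = act k (act l y)" if "k\<in>\<P>" "l\<in>\<P>" for k l y
  using act that by (simp add: hom_def)
 have L1: "L v0 \<e> = \<one>\<^bsub>K\<^esub>"
  and Lc: "!!v k. v\<in>Vs ==> k\<in>\<P> ==> L v k\<in>carrier K"
  and Lv: "!!v a k. v\<in>Vs ==> a\<in>carrier (Gv v) ==> k\<in>\<P> ==> L v (\<iota> v a\<cdot>k) = L v k"
  and Le: "!!e k. e\<in>Ar ==> k\<in>\<P> ==>
   L (tgt e) (st e\<cdot>k) = lam (e, eorb act e (act k y0)) \<otimes>\<^bsub>K\<^esub> L (src e) k"
  using L unfolding labelling_def by blast+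
 show ?thesis
 proof (rule path_induct[OF v v0, of "%v k. L v (k\<cdot>f) = L v k \<otimes>\<^bsub>K\<^esub> L v0 f"])
  show "L v0 (\<e>\<cdot>f) = L v0 \<e> \<otimes>\<^bsub>K\<^esub> L v0 f" using Lc[OF v0 f(1)] f(1) by (simp add: L1)
 next
  fix v a g assume "v\<in>Vs" "a\<in>carrier (Gv v)" "g\<in>\<P>" "L v (g\<cdot>f) = L v g \<otimes>\<^bsub>K\<^esub> L v0 f"
  then show "L v (\<iota> v a\<cdot>g\<cdot>f) = L v (\<iota> v a\<cdot>g) \<otimes>\<^bsub>K\<^esub> L v0 f"
   using f(1) by (simp add: G.m_assoc Lv)
 next
  fix e g assume h: "e\<in>Ar" "g\<in>\<P>" "L (src e) (g\<cdot>f) = L (src e) g \<otimes>\<^bsub>K\<^esub> L v0 f"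
  then show "L (tgt e) (st e\<cdot>g\<cdot>f) = L (tgt e) (st e\<cdot>g) \<otimes>\<^bsub>K\<^esub> L v0 f"
   using f lam Lc[OF v0 f(1)] Lc[of "src e" g] by (simp add: G.m_assoc Le actm K.m_assoc)
 next
  fix e g assume h: "e\<in>Ar" "g\<in>\<P>" "L (tgt e) (g\<cdot>f) = L (tgt e) g \<otimes>\<^bsub>K\<^esub> L v0 f"
  let ?g = "iv st e\<cdot>g"
  have g: "?g\<in>\<P>" "st e\<in>\<P>" "st e\<cdot>?g = g"
   "?g\<cdot>f\<in>\<P>" "st e\<cdot>(?g\<cdot>f) = g\<cdot>f"
   using h f by (auto simp flip: G.m_assoc)
  let ?l = "lam (e, eorb act e (act ?g y0))"
  have "?l \<otimes>\<^bsub>K\<^esub> L (src e) (?g\<cdot>f) = ?l \<otimes>\<^bsub>K\<^esub> (L (src e) ?g \<otimes>\<^bsub>K\<^esub> L v0 f)"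
   using Le[OF h(1) g(1)] Le[OF h(1) g(4)] h(3) f g(1,3,5) lam Lc[OF v0 f(1)] Lc[of "src e" ?g] h(1)
   by (simp add: actm K.m_assoc)
  then show "L (src e) (?g\<cdot>f) = L (src e) ?g \<otimes>\<^bsub>K\<^esub> L v0 f"
   using lam Lc[OF v0 f(1)] Lc[of "src e" ?g] Lc[of "src e" "?g\<cdot>f"] h(1) g by simp
 qed
qed

text \<open>\<open>\<Xi>\<close> and \<open>\<T>\<close> are the vertices, with chosen lifts, and the edges of a tree in the finite graph
 whose vertices are the orbits of the vertex groups; the labels off a maximal such tree are free.\<close>

definition grown :: "('k, 'm) monoid_scheme => (('v, 'e, 'g) gel => 'y => 'y) => 'y =>
  ('v\<times>('v, 'e, 'g) gel) set => ('e\<times>'y set) set => bool" where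
 "grown K act y0 \<Xi> \<T>\<longleftrightarrow>\<Xi>\<subseteq>Vs\<times>\<P>\<and>(v0, \<e>)\<in>\<Xi> \<and>
   (\<forall>v h h'. (v, h)\<in>\<Xi> --> (v, h')\<in>\<Xi> --> (\<exists>a\<in>\<iota>A v. act h' y0 = act a (act h y0)) --> h = h') \<and>
   (\<forall>v h lam L. (v, h)\<in>\<Xi> --> (\<forall>x. lam x\<in>carrier K) --> (\<forall>x\<in>\<T>. lam x = \<one>\<^bsub>K\<^esub>) -->
    labelling K act y0 lam L --> L v h = \<one>\<^bsub>K\<^esub>) \<and>
   (\<forall>e D. (e, D)\<in>\<T> --> e\<in>Ar\<and>(\<exists>h h'. \<exists>a\<in>\<iota>A (src e). \<exists>a'\<in>\<iota>A (tgt e). (src e, h)\<in>\<Xi>\<and>(tgt e, h')\<in>\<Xi> \<and>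
    D = eorb act e (act (a\<cdot>h) y0)\<and>st e\<cdot>(a\<cdot>h) = a'\<cdot>h'))"

lemmas grownD = grown_def[THEN iffD1, THEN conjunct1]
 grown_def[THEN iffD1, THEN conjunct2, THEN conjunct1]
 grown_def[THEN iffD1, THEN conjunct2, THEN conjunct2, THEN conjunct1]
 grown_def[THEN iffD1, THEN conjunct2, THEN conjunct2, THEN conjunct2, THEN conjunct1]
 grown_def[THEN iffD1, THEN conjunct2, THEN conjunct2, THEN conjunct2, THEN conjunct2]

text \<open>The trees inject into Vs x Y and so have bounded size; hence it is enough that a tree
  missing some orbit can be enlarged by one vertex.\<close>

lemma grown_maximal:
 assumes K: "group K" and Y: "finite Y" "y0\<in>Y" and act: "act\<in>hom PG (permgrp Y)"
 shows "\<exists>\<Xi> \<T>. grown K act y0 \<Xi> \<T> \<and>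
  (\<forall>v\<in>Vs. \<forall>k\<in>\<P>. \<exists>h. \<exists>a\<in>\<iota>A v. (v, h)\<in>\<Xi>\<and>act k y0 = act a (act h y0))"
proof (rule ccontr)
 interpret K: group K by (rule K)
 let ?cov = "%\<Xi> v k. \<exists>h. \<exists>a\<in>\<iota>A v. (v, h)\<in>\<Xi>\<and>act k y0 = act a (act h y0)"
 assume no: "\<not> (\<exists>\<Xi> \<T>. grown K act y0 \<Xi> \<T>\<and>(\<forall>v\<in>Vs. \<forall>k\<in>\<P>. ?cov \<Xi> v k))"
 have actm: "act (k\<cdot>l) y = act k (act l y)" if "k\<in>\<P>" "l\<in>\<P>" for k l y
  using act that by (simp add: hom_def)
 have actp: "act k permutes Y" if "k\<in>\<P>" for k using hom_in_carrier[OF act that] by simp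
 have actY: "act k y\<in>Y\<longleftrightarrow>y\<in>Y" if "k\<in>\<P>" for k y using permutes_in_image[OF actp[OF that]] .
 have act1: "act \<e> y = y" for y using hom_one[OF act G.group_axioms group_permgrp] by simp
 have \<iota>1: "\<e>\<in>\<iota>A v" if "v\<in>Vs" for v using subgroup.one_closed[OF \<iota>A_subgroup[OF that]] .
 have \<iota>c: "a\<in>\<P>" if "v\<in>Vs" "a\<in>\<iota>A v" for v a using subgroup.mem_carrier[OF \<iota>A_subgroup[OF that(1)] that(2)] .
 \<comment> \<open>The new lift is joined to an old one by the edge \<open>e\<close>; declaring this
   edge orbit a tree edge gives it label 1, so labels stay trivial on all lifts.\<close>
 have add: "\<exists>\<T>'. grown K act y0 (insert (w, k) \<Xi>) \<T>'"
  if g: "grown K act y0 \<Xi> \<T>" and w: "w\<in>Vs" "k\<in>\<P>" "\<not> ?cov \<Xi> w k"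
   and e: "e\<in>Ar" "a\<in>\<iota>A (src e)" "h\<in>\<P>" "a'\<in>\<iota>A (tgt e)" "h'\<in>\<P>"
    "st e\<cdot>(a\<cdot>h) = a'\<cdot>h'"
    "(src e, h)\<in>\<Xi>\<and>(tgt e, h') = (w, k)\<or>(tgt e, h')\<in>\<Xi>\<and>(src e, h) = (w, k)"
  for \<Xi> \<T> w k e a h a' h'
 proof -
  define \<T>' where "\<T>' = insert (e, eorb act e (act (a\<cdot>h) y0)) \<T>"
  have dist: "h = h'" if "(v, h)\<in>\<Xi>" "(v, h')\<in>\<Xi>" "\<exists>a\<in>\<iota>A v. act h' y0 = act a (act h y0)" for v h h'
   using grownD(3)[OF g] that by blast
  have lab: "L v h = \<one>\<^bsub>K\<^esub>" if "(v, h)\<in>\<Xi>" "\<forall>x. lam x\<in>carrier K" "\<forall>x\<in>\<T>. lam x = \<one>\<^bsub>K\<^esub>"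
   "labelling K act y0 lam L" for v h lam L
   by (rule grownD(4)[OF g, rule_format]) (use that in auto)
  note sub = grownD(1)[OF g] and b = grownD(2)[OF g] and real = grownD(5)[OF g, rule_format]
  have sv: "src e\<in>Vs" "tgt e\<in>Vs" using e by auto
  have "grown K act y0 (insert (w, k) \<Xi>) \<T>'"
   unfolding grown_def
  proof (intro conjI allI impI)
   show "insert (w, k) \<Xi>\<subseteq>Vs\<times>\<P>" using sub w by auto
   show "(v0, \<e>)\<in>insert (w, k) \<Xi>" using b by simp
  next
   fix v h h' assume h: "(v, h)\<in>insert (w, k) \<Xi>" "(v, h')\<in>insert (w, k) \<Xi>"
    "\<exists>a\<in>\<iota>A v. act h' y0 = act a (act h y0)"
   obtain a where a: "a\<in>\<iota>A v" "act h' y0 = act a (act h y0)" using h(3) by blast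
   have v: "v\<in>Vs" using h sub w by auto
   have ac: "a\<in>\<P>" using \<iota>c[OF v a(1)] .
   have "act h y0 = act (iv a) (act h' y0)" unfolding a(2) using ac by (simp add: act1 flip: actm)
   moreover have "iv a\<in>\<iota>A v" using subgroup.m_inv_closed[OF \<iota>A_subgroup[OF v] a(1)] .
   ultimately have s: "\<exists>a\<in>\<iota>A v. act h y0 = act a (act h' y0)" by blast
   show "h = h'"
   proof (cases "(v, h)\<in>\<Xi>")
    case True
    show ?thesis
    proof (cases "(v, h')\<in>\<Xi>")
     case True
     then show ?thesis using dist[OF \<open>(v, h)\<in>\<Xi>\<close> True h(3)] by simp
    next
     case False
     then have "(v, h') = (w, k)" using h(2) by simp
     then show ?thesis using w(3) True h(3) by blast
    qed
   next
    case False
    then have 1: "(v, h) = (w, k)" using h(1) by simp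
    show ?thesis
    proof (cases "(v, h')\<in>\<Xi>")
     case True
     then show ?thesis using w(3) 1 s by blast
    next
     case False
     then show ?thesis using 1 h(2) by simp
    qed
   qed
  next
   fix v x lam L assume x: "(v, x)\<in>insert (w, k) \<Xi>" and lam: "\<forall>x. lam x\<in>carrier K"
    and tr: "\<forall>x\<in>\<T>'. lam x = \<one>\<^bsub>K\<^esub>" and L: "labelling K act y0 lam L"
   have old: "L v x = \<one>\<^bsub>K\<^esub>" if "(v, x)\<in>\<Xi>" for v x using lab[OF that lam _ L] tr by (simp add: \<T>'_def)
   obtain b where b: "b\<in>carrier (Gv (src e))" "a = \<iota> (src e) b" using e(2) by blast
   obtain b' where b': "b'\<in>carrier (Gv (tgt e))" "a' = \<iota> (tgt e) b'" using e(4) by blast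
   have "L (tgt e) (st e\<cdot>(a\<cdot>h)) =
     lam (e, eorb act e (act (a\<cdot>h) y0)) \<otimes>\<^bsub>K\<^esub> L (src e) (a\<cdot>h)"
    using L e(1,3) \<iota>c[OF sv(1) e(2)] unfolding labelling_def by simp
   moreover have "L (src e) (a\<cdot>h) = L (src e) h" "L (tgt e) (a'\<cdot>h') = L (tgt e) h'"
    "L (src e) h\<in>carrier K"
    using L e(3,5) b b' sv unfolding labelling_def by blast+
   moreover have "lam (e, eorb act e (act (a\<cdot>h) y0)) = \<one>\<^bsub>K\<^esub>" using tr by (simp add: \<T>'_def)
   ultimately have eq: "L (tgt e) h' = L (src e) h" by (simp add: e(6))
   have "L w k = \<one>\<^bsub>K\<^esub>"
    using e(7)
   proof
    assume h: "(src e, h)\<in>\<Xi>\<and>(tgt e, h') = (w, k)"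
    then have "L w k = L (src e) h" using eq by simp
    then show ?thesis using old h by simp
   next
    assume h: "(tgt e, h')\<in>\<Xi>\<and>(src e, h) = (w, k)"
    then have "L w k = L (tgt e) h'" using eq by simp
    then show ?thesis using old h by simp
   qed
   then show "L v x = \<one>\<^bsub>K\<^esub>" using x old by auto
  next
   fix d D assume d: "(d, D)\<in>\<T>'"
   then show "d\<in>Ar" using real e(1) unfolding \<T>'_def by blast
   show "\<exists>h h'. \<exists>a\<in>\<iota>A (src d). \<exists>a'\<in>\<iota>A (tgt d). (src d, h)\<in>insert (w, k) \<Xi>\<and>(tgt d, h')\<in>insert (w, k) \<Xi> \<and>
    D = eorb act d (act (a\<cdot>h) y0)\<and>st d\<cdot>(a\<cdot>h) = a'\<cdot>h'"
   proof (cases "(d, D)\<in>\<T>")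
    case True
    then show ?thesis using real[OF True] by blast
   next
    case False
    then have "d = e" "D = eorb act e (act (a\<cdot>h) y0)" using d by (auto simp: \<T>'_def)
    moreover have "(src e, h)\<in>insert (w, k) \<Xi>" "(tgt e, h')\<in>insert (w, k) \<Xi>" using e(7) by auto
    ultimately show ?thesis using e(2,4,6) by blast
   qed
  qed
  then show ?thesis by blast
 qed
 have step: "\<exists>\<Xi>' \<T>'. grown K act y0 \<Xi>' \<T>'\<and>(\<exists>x. x\<notin>\<Xi>\<and>\<Xi>' = insert x \<Xi>)"
  if g: "grown K act y0 \<Xi> \<T>" for \<Xi> \<T>
 proof (rule ccontr)
  assume st: "\<not> (\<exists>\<Xi>' \<T>'. grown K act y0 \<Xi>' \<T>'\<and>(\<exists>x. x\<notin>\<Xi>\<and>\<Xi>' = insert x \<Xi>))"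
  note sub = grownD(1)[OF g] and b = grownD(2)[OF g]
  have new: "(w, k)\<notin>\<Xi>" if "w\<in>Vs" "k\<in>\<P>" "\<not> ?cov \<Xi> w k" for w k
  proof
   assume m: "(w, k)\<in>\<Xi>"
   have "act k y0 = act \<e> (act k y0)" by (simp add: act1)
   then show False using that(3) m \<iota>1[OF that(1)] by blast
  qed
  \<comment> \<open>If no orbit next to the tree could be added, being covered would propagate along
    every path from the base vertex.\<close>
  have "?cov \<Xi> v k" if "v\<in>Vs" "k\<in>\<P>" for v k
  proof (rule path_induct[OF that v0, of "?cov \<Xi>"])
   show "?cov \<Xi> v0 \<e>"
    using b \<iota>1[OF v0] by (intro exI[of _ "\<e>"] bexI[of _ "\<e>"]) (simp_all add: act1)
  next
   fix v a g assume h: "v\<in>Vs" "a\<in>carrier (Gv v)" "g\<in>\<P>" "?cov \<Xi> v g"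
   then obtain x b where x: "b\<in>\<iota>A v" "(v, x)\<in>\<Xi>" "act g y0 = act b (act x y0)" by blast
   have "act (\<iota> v a\<cdot>g) y0 = act (\<iota> v a\<cdot>b) (act x y0)"
    using h x \<iota>c[OF h(1) x(1)] by (simp add: actm)
   moreover have "\<iota> v a\<cdot>b\<in>\<iota>A v" using subgroup.m_closed[OF \<iota>A_subgroup[OF h(1)] _ x(1)] h(2) by blast
   ultimately show "?cov \<Xi> v (\<iota> v a\<cdot>g)" using x(2) by blast
  next
   fix e k assume h: "e\<in>Ar" "k\<in>\<P>" "?cov \<Xi> (src e) k"
   have sv: "src e\<in>Vs" "tgt e\<in>Vs" "st e\<in>\<P>" using h by auto
   obtain x a where x: "a\<in>\<iota>A (src e)" "(src e, x)\<in>\<Xi>" "act k y0 = act a (act x y0)" using h(3) by blast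
   have c: "a\<in>\<P>" "x\<in>\<P>" using \<iota>c[OF sv(1) x(1)] x(2) sub by auto
   define w where "w = st e\<cdot>(a\<cdot>x)"
   have w: "w\<in>\<P>" "act w y0 = act (st e\<cdot>k) y0" using c sv h(2) x(3) by (simp_all add: w_def actm)
   have "?cov \<Xi> (tgt e) w"
   proof (rule ccontr)
    assume n: "\<not> ?cov \<Xi> (tgt e) w"
    have "\<exists>\<T>'. grown K act y0 (insert (tgt e, w) \<Xi>) \<T>'"
     by (rule add[OF g sv(2) w(1) n h(1) x(1) c(2) \<iota>1[OF sv(2)] w(1)]) (use x(2) w(1) in \<open>simp_all add: w_def\<close>)
    then show False using st new[OF sv(2) w(1) n] by blast
   qed
   then show "?cov \<Xi> (tgt e) (st e\<cdot>k)" by (simp add: w(2))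
  next
   fix e k assume h: "e\<in>Ar" "k\<in>\<P>" "?cov \<Xi> (tgt e) k"
   have sv: "src e\<in>Vs" "tgt e\<in>Vs" "st e\<in>\<P>" using h by auto
   obtain x a where x: "a\<in>\<iota>A (tgt e)" "(tgt e, x)\<in>\<Xi>" "act k y0 = act a (act x y0)" using h(3) by blast
   have c: "a\<in>\<P>" "x\<in>\<P>" using \<iota>c[OF sv(2) x(1)] x(2) sub by auto
   define w where "w = iv st e\<cdot>(a\<cdot>x)"
   have w: "w\<in>\<P>" "act w y0 = act (iv st e\<cdot>k) y0" using c sv h(2) x(3) by (simp_all add: w_def actm)
   have sw: "st e\<cdot>(\<e>\<cdot>w) = a\<cdot>x" using c sv by (simp add: w_def)
   have "?cov \<Xi> (src e) w"
   proof (rule ccontr)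
    assume n: "\<not> ?cov \<Xi> (src e) w"
    have "\<exists>\<T>'. grown K act y0 (insert (src e, w) \<Xi>) \<T>'"
     by (rule add[OF g sv(1) w(1) n h(1) \<iota>1[OF sv(1)] w(1) x(1) c(2) sw]) (use x(2) in simp)
    then show False using st new[OF sv(1) w(1) n] by blast
   qed
   then show "?cov \<Xi> (src e) (iv st e\<cdot>k)" by (simp add: w(2))
  qed
  then show False using no g by blast
 qed
 have fin: "finite \<Xi>\<and>card \<Xi>\<le>card (Vs\<times>Y)" if g: "grown K act y0 \<Xi> \<T>" for \<Xi> \<T>
 proof -
  note sub = grownD(1)[OF g]
  have dist: "h = h'" if "(v, h)\<in>\<Xi>" "(v, h')\<in>\<Xi>" "\<exists>a\<in>\<iota>A v. act h' y0 = act a (act h y0)" for v h h'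
   using grownD(3)[OF g] that by blast
  let ?f = "%(v, h). (v, act h y0)"
  have "inj_on ?f \<Xi>"
  proof (rule inj_onI)
   fix x y assume xy: "x\<in>\<Xi>" "y\<in>\<Xi>" "?f x = ?f y"
   obtain v h h' where vh: "x = (v, h)" "y = (v, h')" "act h' y0 = act h y0"
    using xy(3) by (cases x; cases y) auto
   have v: "v\<in>Vs" using sub xy(1) vh by auto
   have "act h' y0 = act \<e> (act h y0)" by (simp add: act1 vh(3))
   then have "h = h'" using dist[of v h h'] xy vh \<iota>1[OF v] by blast
   then show "x = y" by (simp add: vh)
  qed
  moreover have "?f ` \<Xi>\<subseteq>Vs\<times>Y" using sub actY Y(2) by auto
  moreover have "finite (Vs\<times>Y)" using Y(1) by simp
  ultimately show ?thesis using inj_on_finite card_inj_on_le by metis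
 qed
 have "\<exists>\<Xi> \<T>. grown K act y0 \<Xi> \<T>\<and>card \<Xi>\<ge>n" for n
 proof (induction n)
  case 0
  have "grown K act y0 {(v0, \<e>)} {}" unfolding grown_def labelling_def using v0 by simp
  then show ?case by blast
 next
  case (Suc n)
  then obtain \<Xi> \<T> where g: "grown K act y0 \<Xi> \<T>" "card \<Xi>\<ge>n" by blast
  obtain x \<Xi>' \<T>' where x: "grown K act y0 \<Xi>' \<T>'" "x\<notin>\<Xi>" "\<Xi>' = insert x \<Xi>" using step[OF g(1)] by blast
  then have "card \<Xi>'\<ge>Suc n" using fin[OF g(1)] g(2) by simp
  then show ?case using x(1) by blast
 qed
 from this[of "Suc (card (Vs\<times>Y))"] show False using fin by fastforce
qed

text \<open>This is the fundamental group of a finite graph: its vertices are orbits of vertex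
  groups on \<open>Y\<close>, its edges orbits of edge groups. An edge together with the tree lifts
  of its ends closes to a loop, an element of the stabilizer of \<open>y0\<close>. Modulo
  \<open>J\<close> the loops of the edges outside the tree generate, and labelling these edges
  arbitrarily gives the homomorphism back. The loops are chosen after \<open>K\<close>, so all
  targets wanted for the same generators must be factors of one group.\<close>

theorem free_complement:
 fixes K :: "('k, 'm) monoid_scheme" and act :: "('v, 'e, 'g) gel => 'y => 'y"
 assumes J: "admissible J" and K: "group K" and Y: "finite Y" "y0\<in>Y" and act: "act\<in>hom PG (permgrp Y)"
  and stab: "!!v a y. v\<in>Vs ==> a\<in>carrier (Gv v) ==> y\<in>Y ==> act (\<iota> v a) y = y\<longleftrightarrow>\<iota> v a\<in>J"
 defines "F \<equiv> {g\<in>\<P>. act g y0 = y0}"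
 shows "\<exists>r (\<gamma> :: nat => _). \<gamma>\<in>{..<r} \<rightarrow> F\<and>F = generate PG (J\<union>\<gamma> ` {..<r}) \<and>
  (\<forall>lam\<in>{..<r} \<rightarrow> carrier K. \<exists>\<sigma>\<in>hom (PG(|carrier := F|)) K. (\<forall>j\<in>J. \<sigma> j = \<one>\<^bsub>K\<^esub>)\<and>(\<forall>i < r. \<sigma> (\<gamma> i) = lam i))"
proof -
 interpret K: group K by (rule K)
 interpret J: normal J PG using J by (simp add: admissible_def)
 have actm: "act (k\<cdot>l) y = act k (act l y)" if "k\<in>\<P>" "l\<in>\<P>" for k l y
  using act that by (simp add: hom_def)
 have actp: "act k permutes Y" if "k\<in>\<P>" for k using hom_in_carrier[OF act that] by simp
 have actY: "act k y\<in>Y\<longleftrightarrow>y\<in>Y" if "k\<in>\<P>" for k y using permutes_in_image[OF actp[OF that]] .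
 have act1: "act \<e> y = y" for y using hom_one[OF act G.group_axioms group_permgrp] by simp
 have \<iota>c: "a\<in>\<P>" if "v\<in>Vs" "a\<in>\<iota>A v" for v a using subgroup.mem_carrier[OF \<iota>A_subgroup[OF that(1)] that(2)] .
 have stabA: "a\<in>J" if "v\<in>Vs" "a\<in>\<iota>A v" "y\<in>Y" "act a y = y" for v a y using stab that by blast
 have actJ: "act j y = y" if jy: "j\<in>J" "y\<in>Y" for j y
 proof -
  obtain a where "a\<in>carrier (Gv v0)" "j = \<iota> v0 a" using admissible_vertex[OF J v0 jy(1)] by blast
  then show ?thesis using stab[OF v0 _ jy(2)] jy(1) by blast
 qed
 obtain \<Xi> \<T> where g: "grown K act y0 \<Xi> \<T>"
  and cov: "!!v k. v\<in>Vs ==> k\<in>\<P> ==> \<exists>h. \<exists>a\<in>\<iota>A v. (v, h)\<in>\<Xi>\<and>act k y0 = act a (act h y0)"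
  using grown_maximal[OF K Y act] by blast
 have sub: "v\<in>Vs\<and>h\<in>\<P>" if "(v, h)\<in>\<Xi>" for v h using grownD(1)[OF g] that by blast
 have dist: "h = h'" if "(v, h)\<in>\<Xi>" "(v, h')\<in>\<Xi>" "\<exists>a\<in>\<iota>A v. act h' y0 = act a (act h y0)" for v h h'
  using grownD(3)[OF g] that by blast
 have lab: "L v h = \<one>\<^bsub>K\<^esub>" if "(v, h)\<in>\<Xi>" "!!x. lam x\<in>carrier K" "!!x. x\<in>\<T> ==> lam x = \<one>\<^bsub>K\<^esub>"
  "labelling K act y0 lam L" for v h lam L
  by (rule grownD(4)[OF g, rule_format]) (use that in auto)
 note b = grownD(2)[OF g] and real = grownD(5)[OF g, rule_format]
 have F: "subgroup F PG"
 proof (rule G.subgroupI)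
  show "F ~= {}" using act1 unfolding F_def by blast
  show "iv a\<in>F" if a: "a\<in>F" for a
  proof -
   have ac: "a\<in>\<P>" "act a y0 = y0" using a by (auto simp: F_def)
   have "act (iv a) (act a y0) = y0" using ac(1) by (simp add: act1 flip: actm)
   then show ?thesis using ac by (simp add: F_def)
  qed
  show "F\<subseteq>\<P>" by (auto simp only: F_def)
  show "a\<cdot>b\<in>F" if "a\<in>F" "b\<in>F" for a b using that by (simp add: F_def actm)
 qed
 have FD: "act f y0 = y0" if "f\<in>F" for f using that by (simp add: F_def)
 have FI: "f\<in>F" if "f\<in>\<P>" "act f y0 = y0" for f using that by (simp add: F_def)
 interpret F: subgroup F PG by (rule F)
 have JF: "J\<subseteq>F" using FI[OF J.mem_carrier actJ[OF _ Y(2)]] by blast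
 define E where "E = {(e, eorb act e y) | e y. e\<in>Ar\<and>y\<in>(%k. act k y0) ` \<P>}"
 have "E\<subseteq>(%(e, y). (e, eorb act e y)) ` (Ar\<times>Y)" using actY Y(2) by (auto simp: E_def)
 then have finE: "finite E" by (rule finite_subset) (use Y(1) in auto)
 \<comment> \<open>Lifts of the two ends of an edge orbit; for a tree edge they are chosen so that
   its loop is trivial.\<close>
 let ?R = "%x (h, a, h', a'). (src (fst x), h)\<in>\<Xi>\<and>(tgt (fst x), h')\<in>\<Xi>\<and>a\<in>\<iota>A (src (fst x))\<and>a'\<in>\<iota>A (tgt (fst x)) \<and>
  snd x = eorb act (fst x) (act (a\<cdot>h) y0) \<and>
  act (st (fst x)\<cdot>(a\<cdot>h)) y0 = act (a'\<cdot>h') y0 \<and>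
  (x\<in>\<T> --> st (fst x)\<cdot>(a\<cdot>h) = a'\<cdot>h')"
 have "\<forall>x\<in>E. \<exists>q. ?R x q"
 proof
  fix x assume x: "x\<in>E"
  show "\<exists>q. ?R x q"
  proof (cases "x\<in>\<T>")
   case True
   obtain e D where eO: "x = (e, D)" by (cases x)
   obtain h h' a a' where "a\<in>\<iota>A (src e)" "a'\<in>\<iota>A (tgt e)" "(src e, h)\<in>\<Xi>" "(tgt e, h')\<in>\<Xi>"
    "D = eorb act e (act (a\<cdot>h) y0)" "st e\<cdot>(a\<cdot>h) = a'\<cdot>h'"
    using real[of e D] True eO by blast
   then show ?thesis by (intro exI[of _ "(h, a, h', a')"]) (simp add: eO)
  next
   case False
   obtain e k where ek: "x = (e, eorb act e (act k y0))" "e\<in>Ar" "k\<in>\<P>" using x by (auto simp: E_def)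
   have sv: "src e\<in>Vs" "tgt e\<in>Vs" "st e\<in>\<P>" using ek by auto
   obtain h a where h: "a\<in>\<iota>A (src e)" "(src e, h)\<in>\<Xi>" "act k y0 = act a (act h y0)" using cov[OF sv(1) ek(3)] by blast
   have c: "a\<in>\<P>" "h\<in>\<P>" using \<iota>c[OF sv(1) h(1)] sub[OF h(2)] by auto
   obtain h' a' where h': "a'\<in>\<iota>A (tgt e)" "(tgt e, h')\<in>\<Xi>" "act (st e\<cdot>k) y0 = act a' (act h' y0)"
    using cov[OF sv(2), of "st e\<cdot>k"] sv ek(3) by auto
   have c': "a'\<in>\<P>" "h'\<in>\<P>" using \<iota>c[OF sv(2) h'(1)] sub[OF h'(2)] by auto
   have "act (a\<cdot>h) y0 = act k y0" "act (a'\<cdot>h') y0 = act (st e\<cdot>k) y0"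
    using c c' h(3) h'(3) by (simp_all add: actm)
   then show ?thesis using h h' False c sv ek by (intro exI[of _ "(h, a, h', a')"]) (simp add: actm)
  qed
 qed
 from bchoice[OF this] obtain q where q: "\<forall>x\<in>E. ?R x (q x)" by blast
 define qh where "qh x = fst (q x)" for x
 define qa where "qa x = fst (snd (q x))" for x
 define qh' where "qh' x = fst (snd (snd (q x)))" for x
 define qa' where "qa' x = snd (snd (snd (q x)))" for x
 have Q: "(src (fst x), qh x)\<in>\<Xi>" "(tgt (fst x), qh' x)\<in>\<Xi>" "qa x\<in>\<iota>A (src (fst x))" "qa' x\<in>\<iota>A (tgt (fst x))"
  "snd x = eorb act (fst x) (act (qa x\<cdot>qh x) y0)"
  "act (st (fst x)\<cdot>(qa x\<cdot>qh x)) y0 = act (qa' x\<cdot>qh' x) y0"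
  "x\<in>\<T> ==> st (fst x)\<cdot>(qa x\<cdot>qh x) = qa' x\<cdot>qh' x" if "x\<in>E" for x
  using bspec[OF q that] by (simp_all add: qh_def qa_def qh'_def qa'_def split: prod.splits)
 have EA: "fst x\<in>Ar" if "x\<in>E" for x using that by (auto simp: E_def)
 have Qc: "qh x\<in>\<P>" "qa x\<in>\<P>" "qh' x\<in>\<P>" "qa' x\<in>\<P>" "st (fst x)\<in>\<P>"
  if "x\<in>E" for x
  using sub[OF Q(1)[OF that]] sub[OF Q(2)[OF that]] Q(3,4)[OF that] \<iota>c EA[OF that] by auto
 define l where "l x = iv (qa' x\<cdot>qh' x)\<cdot>(st (fst x)\<cdot>(qa x\<cdot>qh x))" for x
 have l: "l x\<in>F" "st (fst x)\<cdot>(qa x\<cdot>qh x) = qa' x\<cdot>qh' x\<cdot>l x"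
  "x\<in>\<T> ==> l x = \<e>" if x: "x\<in>E" for x
 proof -
  define w where "w = qa' x\<cdot>qh' x"
  define u where "u = st (fst x)\<cdot>(qa x\<cdot>qh x)"
  have wu: "w\<in>\<P>" "u\<in>\<P>" "act u y0 = act w y0"
   using Qc[OF x] Q(6)[OF x] by (simp_all add: w_def u_def)
  have "act (iv w) (act w y0) = y0"
   using actm[OF G.inv_closed[OF wu(1)] wu(1), of y0] wu(1) by (simp add: act1)
  then have "act (iv w\<cdot>u) y0 = y0" using actm[OF G.inv_closed[OF wu(1)] wu(2), of y0] wu(3) by simp
  moreover have "l x = iv w\<cdot>u" by (simp only: l_def w_def u_def)
  ultimately show "l x\<in>F" using wu(1,2) FI[of "l x"] by simp
  show "st (fst x)\<cdot>(qa x\<cdot>qh x) = qa' x\<cdot>qh' x\<cdot>l x"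
   using Qc[OF x] by (simp add: l_def)
  show "l x = \<e>" if "x\<in>\<T>" using Q(7)[OF x that] Qc[OF x] by (simp add: l_def)
 qed
 obtain \<epsilon> where \<epsilon>: "bij_betw \<epsilon> {..<card (E - \<T>)} (E - \<T>)"
  using ex_bij_betw_nat_finite[of "E - \<T>"] finE by (auto simp: atLeast0LessThan)
 define r where "r = card (E - \<T>)"
 define \<gamma> where "\<gamma> i = l (\<epsilon> i)" for i
 have \<epsilon>E: "\<epsilon> i\<in>E" "\<epsilon> i\<notin>\<T>" if "i < r" for i using bij_betwE[OF \<epsilon>] that by (auto simp: r_def)
 have img: "\<gamma> ` {..<r} = l ` (E - \<T>)"
  using \<epsilon> by (simp add: \<gamma>_def r_def bij_betw_def image_image[symmetric] del: image_image)
 have \<gamma>F: "\<gamma> i\<in>F" if "i\<in>{..<r}" for i unfolding \<gamma>_def by (rule l(1)[OF \<epsilon>E(1)]) (use that in simp)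
 define \<Gamma> where "\<Gamma> = generate PG (J\<union>\<gamma> ` {..<r})"
 have genF: "J\<union>\<gamma> ` {..<r}\<subseteq>F" using JF \<gamma>F by blast
 have \<Gamma>F: "\<Gamma>\<subseteq>F" unfolding \<Gamma>_def by (rule G.generate_subgroup_incl[OF genF F])
 have \<Gamma>: "subgroup \<Gamma> PG" unfolding \<Gamma>_def by (rule G.generate_is_subgroup) (use genF F.subset in blast)
 interpret \<Gamma>: subgroup \<Gamma> PG by (rule \<Gamma>)
 have J\<Gamma>: "j\<in>\<Gamma>" if "j\<in>J" for j unfolding \<Gamma>_def using that by (auto intro: generate.incl)
 have l\<Gamma>: "l x\<in>\<Gamma>" if "x\<in>E" for x
 proof (cases "x\<in>\<T>")
  case True
  then show ?thesis using l(3)[OF that] by simp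
 next
  case False
  then have "l x\<in>\<gamma> ` {..<r}" unfolding img using that by blast
  then show ?thesis unfolding \<Gamma>_def by (auto intro: generate.incl)
 qed
 text \<open>Two elements of the same coset that move \<open>h y\<^sub>0\<close> in the same way differ by an element of \<open>J\<close>.\<close>
 have modJ: "\<exists>j\<in>J. a1\<cdot>h1 = a\<cdot>h\<cdot>j"
  if h: "(v, h)\<in>\<Xi>" "(v, h1)\<in>\<Xi>" "a\<in>\<iota>A v" "a1\<in>\<iota>A v" "act (a1\<cdot>h1) y0 = act (a\<cdot>h) y0" for v h h1 a a1
 proof -
  have v: "v\<in>Vs" and hc: "h\<in>\<P>" "h1\<in>\<P>" using sub[OF h(1)] sub[OF h(2)] by auto
  interpret V: subgroup "\<iota>A v" PG by (rule \<iota>A_subgroup[OF v])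
  have ac: "a\<in>\<P>" "a1\<in>\<P>" using h(3,4) V.subset by auto
  have i: "iv a\<cdot>a1\<in>\<iota>A v" using h(3,4) by simp
  have "act (iv a\<cdot>a1) (act h1 y0) = act (iv a) (act (a1\<cdot>h1) y0)"
   using ac hc by (simp add: actm)
  also have "\<dots> = act h y0" unfolding h(5) using ac hc by (simp add: act1 flip: actm)
  finally have e: "act (iv a\<cdot>a1) (act h1 y0) = act h y0" .
  have hh: "h1 = h" using dist[OF h(2,1)] e i by metis
  have "act h y0\<in>Y" using actY[OF hc(1)] Y(2) by simp
  then have j: "iv a\<cdot>a1\<in>J" using stabA[OF v i] e hh by simp
  have "iv h\<cdot>(iv a\<cdot>a1)\<cdot>h\<in>J" using J.inv_op_closed1[OF hc(1) j] .
  moreover have "a1\<cdot>h1 = a\<cdot>h\<cdot>(iv h\<cdot>(iv a\<cdot>a1)\<cdot>h)"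
   using ac hc by (simp add: hh G.m_assoc)
  ultimately show ?thesis by blast
 qed
 \<comment> \<open>Any representative of an edge orbit can be exchanged for the chosen one at the
   cost of an edge group element and an element of \<open>J\<close>.\<close>
 have edge: "\<exists>x c j. x\<in>E\<and>fst x = e\<and>c\<in>Ge e\<and>j\<in>J\<and>qa x\<cdot>qh x = \<iota> (src e) c\<cdot>k\<cdot>j"
  if e: "e\<in>Ar" and k: "k = a\<cdot>h" "a\<in>\<iota>A (src e)" "(src e, h)\<in>\<Xi>" for e k a h
 proof -
  have sv: "src e\<in>Vs" using e by simp
  have c: "a\<in>\<P>" "h\<in>\<P>" using \<iota>c[OF sv k(2)] sub[OF k(3)] by auto
  then have kc: "k\<in>\<P>" by (simp add: k(1))
  define x where "x = (e, eorb act e (act k y0))"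
  have x: "x\<in>E" using e kc by (auto simp: E_def x_def)
  interpret C: subgroup "Ge e" "Gv (src e)" by (rule edge_subgroup[OF e])
  have "act (qa x\<cdot>qh x) y0\<in>eorb act e (act (qa x\<cdot>qh x) y0)"
   unfolding eorb_def using C.one_closed sv by (intro image_eqI[of _ _ "\<one>\<^bsub>Gv (src e)\<^esub>"]) (simp_all add: \<iota>_one act1)
  then have "act (qa x\<cdot>qh x) y0\<in>eorb act e (act k y0)" using Q(5)[OF x] by (simp add: x_def)
  then obtain d where d: "d\<in>Ge e" "act (qa x\<cdot>qh x) y0 = act (\<iota> (src e) d) (act k y0)" by (auto simp: eorb_def)
  have dc: "d\<in>carrier (Gv (src e))" "\<iota> (src e) d\<in>\<P>" using Ge_sub[OF e d(1)] sv by auto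
  have "\<iota> (src e) d\<cdot>a\<in>\<iota>A (src e)" using subgroup.m_closed[OF \<iota>A_subgroup[OF sv] _ k(2)] dc by blast
  moreover have "act (qa x\<cdot>qh x) y0 = act (\<iota> (src e) d\<cdot>a\<cdot>h) y0"
   using d(2) dc c by (simp add: k(1) actm G.m_assoc)
  ultimately obtain j where "j\<in>J" "qa x\<cdot>qh x = \<iota> (src e) d\<cdot>a\<cdot>h\<cdot>j"
   using modJ[OF k(3), of "qh x" "\<iota> (src e) d\<cdot>a" "qa x"] Q(1,3)[OF x] by (auto simp: x_def)
  then show ?thesis using x d(1) dc c by (intro exI[of _ x] exI[of _ d] exI[of _ j]) (simp add: x_def k(1) G.m_assoc)
 qed
 let ?P = "%v g. \<exists>h a f. (v, h)\<in>\<Xi>\<and>a\<in>\<iota>A v\<and>f\<in>\<Gamma>\<and>g = a\<cdot>h\<cdot>f"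
 have main: "?P v g" if "v\<in>Vs" "g\<in>\<P>" for v g
 proof (rule path_induct[OF that v0, of ?P])
  show "?P v0 \<e>" using b subgroup.one_closed[OF \<iota>A_subgroup[OF v0]]
   by (intro exI[of _ "\<e>"]) simp
 next
  fix v a g assume h: "v\<in>Vs" "a\<in>carrier (Gv v)" "g\<in>\<P>" "?P v g"
  then obtain x b f where x: "(v, x)\<in>\<Xi>" "b\<in>\<iota>A v" "f\<in>\<Gamma>" "g = b\<cdot>x\<cdot>f" by blast
  have "\<iota> v a\<cdot>g = (\<iota> v a\<cdot>b)\<cdot>x\<cdot>f"
   using x h \<iota>c[OF h(1) x(2)] sub[OF x(1)] by (simp add: G.m_assoc)
  moreover have "\<iota> v a\<cdot>b\<in>\<iota>A v" using subgroup.m_closed[OF \<iota>A_subgroup[OF h(1)] _ x(2)] h(2) by blast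
  ultimately show "?P v (\<iota> v a\<cdot>g)" using x by blast
 next
  fix e g assume h: "e\<in>Ar" "g\<in>\<P>" "?P (src e) g"
  then obtain y a f where y: "(src e, y)\<in>\<Xi>" "a\<in>\<iota>A (src e)" "f\<in>\<Gamma>" "g = a\<cdot>y\<cdot>f" by blast
  have sv: "src e\<in>Vs" "tgt e\<in>Vs" "st e\<in>\<P>" using h by auto
  define k where "k = a\<cdot>y"
  have kc: "k\<in>\<P>" using \<iota>c[OF sv(1) y(2)] sub[OF y(1)] by (simp add: k_def)
  obtain x c j where x: "x\<in>E" "fst x = e" "c\<in>Ge e" "j\<in>J" "qa x\<cdot>qh x = \<iota> (src e) c\<cdot>k\<cdot>j"
   using edge[OF h(1) k_def y(2,1)] by blast
  have cc: "c\<in>carrier (Gv (src e))" "\<iota> (src e) c\<in>\<P>" "\<phi> e c\<in>carrier (Gv (tgt e))" "\<iota> (tgt e) (\<phi> e c)\<in>\<P>"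
   using Ge_sub[OF h(1) x(3)] \<phi>_closed[OF h(1) x(3)] sv by auto
  have lc: "l x\<in>\<P>" using l(1)[OF x(1)] by simp
  have "\<iota> (tgt e) (\<phi> e c)\<cdot>(st e\<cdot>k\<cdot>j) = st e\<cdot>(\<iota> (src e) c\<cdot>k\<cdot>j)"
   using st_\<iota>[OF h(1) x(3)] cc kc sv x(4) by (simp flip: G.m_assoc)
  also have "\<dots> = qa' x\<cdot>qh' x\<cdot>l x" using l(2)[OF x(1)] x(2,5) by simp
  finally have "st e\<cdot>k\<cdot>j = iv \<iota> (tgt e) (\<phi> e c)\<cdot>(qa' x\<cdot>qh' x\<cdot>l x)"
   using cc kc sv x(4) lc Qc[OF x(1)] by (metis G.inv_solve_left G.m_closed J.mem_carrier)
  then have "st e\<cdot>k = iv \<iota> (tgt e) (\<phi> e c)\<cdot>(qa' x\<cdot>qh' x\<cdot>l x)\<cdot>iv j"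
   using cc kc sv x(4) lc Qc[OF x(1)] by (metis G.inv_solve_right G.m_closed G.inv_closed J.mem_carrier)
  then have "st e\<cdot>g = (iv \<iota> (tgt e) (\<phi> e c)\<cdot>qa' x)\<cdot>qh' x\<cdot>(l x\<cdot>iv j\<cdot>f)"
   using cc kc sv x(4) lc Qc[OF x(1)] y(3) unfolding y(4) k_def[symmetric] by (simp add: G.m_assoc[symmetric])
  moreover have "iv \<iota> (tgt e) (\<phi> e c)\<cdot>qa' x\<in>\<iota>A (tgt e)"
   using subgroup.m_closed[OF \<iota>A_subgroup[OF sv(2)] subgroup.m_inv_closed[OF \<iota>A_subgroup[OF sv(2)]]] cc(3) Q(4)[OF x(1)] x(2) by blast
  moreover have "l x\<cdot>iv j\<cdot>f\<in>\<Gamma>" using l\<Gamma>[OF x(1)] J\<Gamma>[OF x(4)] y(3) by simp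
  moreover have "(tgt e, qh' x)\<in>\<Xi>" using Q(2)[OF x(1)] x(2) by simp
  ultimately show "?P (tgt e) (st e\<cdot>g)" by blast
 next
  fix e g assume h: "e\<in>Ar" "g\<in>\<P>" "?P (tgt e) g"
  then obtain y a f where y: "(tgt e, y)\<in>\<Xi>" "a\<in>\<iota>A (tgt e)" "f\<in>\<Gamma>" "g = a\<cdot>y\<cdot>f" by blast
  have sv: "src e\<in>Vs" "tgt e\<in>Vs" "st e\<in>\<P>" using h by auto
  have c0: "a\<in>\<P>" "y\<in>\<P>" using \<iota>c[OF sv(2) y(2)] sub[OF y(1)] by auto
  define k0 where "k0 = iv st e\<cdot>(a\<cdot>y)"
  have k0c: "k0\<in>\<P>" using c0 sv by (simp add: k0_def)
  obtain y1 b where y1: "b\<in>\<iota>A (src e)" "(src e, y1)\<in>\<Xi>" "act k0 y0 = act b (act y1 y0)" using cov[OF sv(1) k0c] by blast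
  have c1: "b\<in>\<P>" "y1\<in>\<P>" using \<iota>c[OF sv(1) y1(1)] sub[OF y1(2)] by auto
  obtain x c j where x: "x\<in>E" "fst x = e" "c\<in>Ge e" "j\<in>J"
   "qa x\<cdot>qh x = \<iota> (src e) c\<cdot>(b\<cdot>y1)\<cdot>j"
   using edge[OF h(1) HOL.refl y1(1,2)] by blast
  have cc: "c\<in>carrier (Gv (src e))" "\<iota> (src e) c\<in>\<P>" "\<phi> e c\<in>carrier (Gv (tgt e))" "\<iota> (tgt e) (\<phi> e c)\<in>\<P>"
   using Ge_sub[OF h(1) x(3)] \<phi>_closed[OF h(1) x(3)] sv by auto
  have lc: "l x\<in>\<P>" using l(1)[OF x(1)] by simp
  have "act (qa x\<cdot>qh x) y0 = act (\<iota> (src e) c) (act k0 y0)"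
   unfolding x(5) y1(3) using cc c1 x(4) actJ[OF x(4) Y(2)] by (simp add: actm)
  then have "act (qa' x\<cdot>qh' x) y0 = act (st e\<cdot>\<iota> (src e) c\<cdot>k0) y0"
   using Q(6)[OF x(1)] x(2) sv cc k0c Qc[OF x(1)] by (simp add: actm)
  also have "st e\<cdot>\<iota> (src e) c\<cdot>k0 = \<iota> (tgt e) (\<phi> e c)\<cdot>a\<cdot>y"
   using st_\<iota>[OF h(1) x(3)] cc sv c0 by (simp add: k0_def G.m_assoc)
  finally have A: "act (qa' x\<cdot>qh' x) y0 = act (\<iota> (tgt e) (\<phi> e c)\<cdot>a\<cdot>y) y0" .
  have "\<iota> (tgt e) (\<phi> e c)\<cdot>a\<in>\<iota>A (tgt e)" using subgroup.m_closed[OF \<iota>A_subgroup[OF sv(2)] _ y(2)] cc(3) by blast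
  then obtain i where i: "i\<in>J" "qa' x\<cdot>qh' x = \<iota> (tgt e) (\<phi> e c)\<cdot>a\<cdot>y\<cdot>i"
   using modJ[OF y(1) _ _ _ A] Q(2,4)[OF x(1)] x(2) by auto
  have "st e\<cdot>(qa x\<cdot>qh x) = \<iota> (tgt e) (\<phi> e c)\<cdot>a\<cdot>y\<cdot>i\<cdot>l x"
   using l(2)[OF x(1)] x(2) i(2) by simp
  also have "\<dots> = st e\<cdot>(\<iota> (src e) c\<cdot>(k0\<cdot>i\<cdot>l x))"
   using st_\<iota>[OF h(1) x(3)] cc sv c0 i(1) lc by (simp add: k0_def flip: G.m_assoc) (simp add: G.m_assoc)
  finally have "qa x\<cdot>qh x = \<iota> (src e) c\<cdot>(k0\<cdot>i\<cdot>l x)"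
   using sv cc k0c i(1) lc Qc[OF x(1)] by simp
  then have "k0\<cdot>i\<cdot>l x = iv \<iota> (src e) c\<cdot>(qa x\<cdot>qh x)"
   using cc k0c i(1) lc by simp
  then have "iv \<iota> (src e) c\<cdot>(qa x\<cdot>qh x)\<cdot>(iv l x\<cdot>iv i) =
    k0\<cdot>i\<cdot>l x\<cdot>(iv l x\<cdot>iv i)" by simp
  also have "\<dots> = k0" using k0c i(1) lc by (simp add: G.m_assoc)
  finally have k0: "k0 = iv \<iota> (src e) c\<cdot>(qa x\<cdot>qh x)\<cdot>(iv l x\<cdot>iv i)" by simp
  have "iv st e\<cdot>g = k0\<cdot>f" using c0 sv y(3) by (simp add: k0_def y(4) G.m_assoc)
  also have "\<dots> = (iv \<iota> (src e) c\<cdot>qa x)\<cdot>qh x\<cdot>(iv l x\<cdot>iv i\<cdot>f)"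
   unfolding k0 using cc i(1) lc Qc[OF x(1)] y(3) by (simp add: G.m_assoc)
  finally have "iv st e\<cdot>g = (iv \<iota> (src e) c\<cdot>qa x)\<cdot>qh x\<cdot>(iv l x\<cdot>iv i\<cdot>f)" .
  moreover have "iv \<iota> (src e) c\<cdot>qa x\<in>\<iota>A (src e)"
   using subgroup.m_closed[OF \<iota>A_subgroup[OF sv(1)] subgroup.m_inv_closed[OF \<iota>A_subgroup[OF sv(1)]]] cc(1) Q(3)[OF x(1)] x(2) by blast
  moreover have "iv l x\<cdot>iv i\<cdot>f\<in>\<Gamma>" using l\<Gamma>[OF x(1)] J\<Gamma>[OF i(1)] y(3) by simp
  moreover have "(src e, qh x)\<in>\<Xi>" using Q(1)[OF x(1)] x(2) by simp
  ultimately show "?P (src e) (iv st e\<cdot>g)" by blast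
 qed
 \<comment> \<open>For \<open>g\<close> fixing \<open>y0\<close>, the product of vertex element and
   tree lift given by \<open>main\<close> fixes \<open>y0\<close> too, so \<open>modJ\<close>
   reduces it to an element of \<open>J\<close>.\<close>
 have "F\<subseteq>\<Gamma>"
 proof
  fix g assume g: "g\<in>F"
  obtain h a f where h: "(v0, h)\<in>\<Xi>" "a\<in>\<iota>A v0" "f\<in>\<Gamma>" "g = a\<cdot>h\<cdot>f"
   using main[OF v0 F.mem_carrier[OF g]] by blast
  have c: "a\<in>\<P>" "h\<in>\<P>" "f\<in>\<P>" using \<iota>c[OF v0 h(2)] sub[OF h(1)] h(3) by auto
  have "act f y0 = y0" using h(3) \<Gamma>F FD by blast
  then have "act (a\<cdot>h) y0 = act g y0" using c by (simp add: h(4) actm)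
  then have "act (a\<cdot>h) y0 = act (\<e>\<cdot>\<e>) y0" using FD[OF g] by (simp add: act1)
  then obtain j where "j\<in>J" "a\<cdot>h = \<e>\<cdot>\<e>\<cdot>j"
   using modJ[OF b h(1) subgroup.one_closed[OF \<iota>A_subgroup[OF v0]] h(2)] by blast
  then show "g\<in>\<Gamma>" using h J\<Gamma> by simp
 qed
 then have F\<Gamma>: "F = \<Gamma>" using \<Gamma>F by blast
 have "\<exists>\<sigma>\<in>hom (PG(|carrier := F|)) K. (\<forall>j\<in>J. \<sigma> j = \<one>\<^bsub>K\<^esub>)\<and>(\<forall>i < r. \<sigma> (\<gamma> i) = lam i)"
  if lam: "lam\<in>{..<r} \<rightarrow> carrier K" for lam
 proof -
  \<comment> \<open>Tree edges get label 1, which makes the labels of all tree lifts trivial; each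
    remaining edge carries the value prescribed for its loop.\<close>
  define lam' where "lam' x = (if x\<in>E - \<T> then lam (inv_into {..<r} \<epsilon> x) else \<one>\<^bsub>K\<^esub>)" for x
  have lam': "lam' x\<in>carrier K" for x
  proof (cases "x\<in>E - \<T>")
   case True
   then have "inv_into {..<r} \<epsilon> x\<in>{..<r}" using \<epsilon> by (intro inv_into_into) (simp add: r_def bij_betw_def)
   then show ?thesis using lam True unfolding lam'_def by (metis PiE)
  qed (auto simp: lam'_def)
  obtain L where L: "labelling K act y0 lam' L" using labelling_exists[OF K act Y(2)] lam' by blast
  have Lc: "!!v k. v\<in>Vs ==> k\<in>\<P> ==> L v k\<in>carrier K"
   and Lv: "!!v a k. v\<in>Vs ==> a\<in>carrier (Gv v) ==> k\<in>\<P> ==> L v (\<iota> v a\<cdot>k) = L v k"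
   and Le: "!!e k. e\<in>Ar ==> k\<in>\<P> ==>
    L (tgt e) (st e\<cdot>k) = lam' (e, eorb act e (act k y0)) \<otimes>\<^bsub>K\<^esub> L (src e) k"
   and L1: "L v0 \<e> = \<one>\<^bsub>K\<^esub>"
   using L unfolding labelling_def by blast+
  have L\<Xi>: "L v h = \<one>\<^bsub>K\<^esub>" if "(v, h)\<in>\<Xi>" for v h by (rule lab[OF that lam' _ L]) (simp add: lam'_def)
  have "L v0\<in>hom (PG(|carrier := F|)) K"
   by (rule homI)
    (use labelling_mult[OF K act L lam' F.mem_carrier FD v0 F.mem_carrier] Lc[OF v0 F.mem_carrier] in simp_all)
  moreover have "L v0 j = \<one>\<^bsub>K\<^esub>" if j: "j\<in>J" for j
  proof -
   obtain a where "a\<in>carrier (Gv v0)" "j = \<iota> v0 a" using admissible_vertex[OF J v0 j] by blast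
   then show ?thesis using Lv[OF v0 _ G.one_closed, of a] L1 v0 by simp
  qed
  moreover have "L v0 (\<gamma> i) = lam i" if i: "i < r" for i
  proof -
   define x where "x = \<epsilon> i"
   have x: "x\<in>E" "x\<notin>\<T>" using \<epsilon>E[OF i] by (simp_all add: x_def)
   have lx: "lam' x = lam i" using i \<epsilon> x by (simp add: lam'_def x_def r_def bij_betw_inv_into_left)
   have sv: "src (fst x)\<in>Vs" "tgt (fst x)\<in>Vs" "fst x\<in>Ar" using EA[OF x(1)] by auto
   have aL: "L v (a\<cdot>h) = \<one>\<^bsub>K\<^esub>" if va: "(v, h)\<in>\<Xi>" "a\<in>\<iota>A v" for v h a
   proof -
    obtain b where b: "b\<in>carrier (Gv v)" "a = \<iota> v b" using va(2) by blast
    show ?thesis unfolding b(2) using Lv[OF _ b(1)] sub[OF va(1)] L\<Xi>[OF va(1)] by simp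
   qed
   have "L (tgt (fst x)) (st (fst x)\<cdot>(qa x\<cdot>qh x)) = lam' x \<otimes>\<^bsub>K\<^esub> L (src (fst x)) (qa x\<cdot>qh x)"
    using Le[OF sv(3), of "qa x\<cdot>qh x"] Qc[OF x(1)] Q(5)[OF x(1)] by (metis G.m_closed prod.collapse)
   also have "\<dots> = lam i" using aL[OF Q(1,3)[OF x(1)]] lam'[of x] lx by simp
   finally have 1: "L (tgt (fst x)) (qa' x\<cdot>qh' x\<cdot>l x) = lam i" by (simp add: l(2)[OF x(1)])
   have lf: "l x\<in>\<P>" "act (l x) y0 = y0" using F.mem_carrier[OF l(1)[OF x(1)]] FD[OF l(1)[OF x(1)]] .
   have "L (tgt (fst x)) (qa' x\<cdot>qh' x\<cdot>l x) = L (tgt (fst x)) (qa' x\<cdot>qh' x) \<otimes>\<^bsub>K\<^esub> L v0 (l x)"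
    by (rule labelling_mult[OF K act L lam' lf sv(2)]) (use Qc[OF x(1)] in simp)
   then show ?thesis using 1 aL[OF Q(2,4)[OF x(1)]] Lc[OF v0 lf(1)] by (simp add: \<gamma>_def x_def)
  qed
  ultimately show ?thesis by blast
 qed
 moreover have "\<gamma>\<in>{..<r} \<rightarrow> F" using \<gamma>F by blast
 ultimately show ?thesis using F\<Gamma> unfolding \<Gamma>_def by (intro exI[of _ r] exI[of _ \<gamma>]) blast
qed

end

section \<open>Self-similarity from virtual endomorphisms\<close>

fun tree_act :: "('a => nat => nat) => ('a => nat => 'a) => 'a => nat list => nat list" where
 "tree_act \<sigma> \<tau> g [] = []"
| "tree_act \<sigma> \<tau> g (i # w) = \<sigma> g i # tree_act \<sigma> \<tau> (\<tau> g i) w"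

lemma tree_act_snoc: "\<exists>j. tree_act \<sigma> \<tau> g (u @ [i]) = tree_act \<sigma> \<tau> g u @ [j]"
 by (induction u arbitrary: g) auto

lemma tree_verts_simps [simp]:
 "[]\<in>tree_verts m" "i # w\<in>tree_verts m\<longleftrightarrow>i < m\<and>w\<in>tree_verts m"
 by (auto simp: tree_verts_def)

text \<open>The wreath recursion given by \<sigma> and \<tau> defines an action on words. Its kernel
  is normal, fixes the first level and is closed under taking states, so \<open>core\<close> makes
  the action faithful.\<close>

lemma (in group) self_similar_wreath:
 fixes \<sigma> :: "'a => nat => nat" and \<tau> :: "'a => nat => 'a"
 assumes m: "m\<ge>2"
  and \<sigma>: "!!g i. g\<in>carrier G ==> i < m ==> \<sigma> g i < m" "!!i. i < m ==> \<sigma> \<one> i = i"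
   "!!g h i. g\<in>carrier G ==> h\<in>carrier G ==> i < m ==> \<sigma> (g\<otimes>h) i = \<sigma> g (\<sigma> h i)"
  and \<tau>: "!!g i. g\<in>carrier G ==> i < m ==> \<tau> g i\<in>carrier G"
   "!!g h i. g\<in>carrier G ==> h\<in>carrier G ==> i < m ==> \<tau> (g\<otimes>h) i = \<tau> g (\<sigma> h i)\<otimes>\<tau> h i"
  and core: "!!K. K \<lhd> G ==> (!!k i. k\<in>K ==> i < m ==> \<sigma> k i = i\<and>\<tau> k i\<in>K) ==> K = {\<one>}"
 shows "self_similar G"
proof -
 let ?a = "tree_act \<sigma> \<tau>"
 have cl: "?a g w\<in>tree_verts m" if "g\<in>carrier G" "w\<in>tree_verts m" for g w
  using that by (induction w arbitrary: g) (auto simp: \<sigma> \<tau>)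
 have mult: "?a (g\<otimes>h) w = ?a g (?a h w)" if "g\<in>carrier G" "h\<in>carrier G" "w\<in>tree_verts m" for g h w
  using that by (induction w arbitrary: g h) (auto simp: \<sigma> \<tau>)
 have \<tau>1: "\<tau> \<one> i = \<one>" if "i < m" for i
  using \<tau>(2)[of \<one> \<one> i] \<tau>(1)[of \<one> i] that \<sigma>(2) by simp
 have one: "?a \<one> w = w" if "w\<in>tree_verts m" for w
  using that by (induction w) (auto simp: \<sigma> \<tau>1)
 have inv1: "?a (inv g) (?a g w) = w" "?a g (?a (inv g) w) = w" if "g\<in>carrier G" "w\<in>tree_verts m" for g w
  using that by (simp_all flip: mult add: one)
 define \<phi> where "\<phi> g = (\<lambda>w\<in>tree_verts m. ?a g w)" for g
 have bij: "\<phi> g\<in>Bij (tree_verts m)" if g: "g\<in>carrier G" for g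
 proof -
  have "bij_betw (?a g) (tree_verts m) (tree_verts m)"
   by (rule bij_betwI[where g = "?a (inv g)"]) (use g cl inv1 in auto)
  then have "bij_betw (\<phi> g) (tree_verts m) (tree_verts m)"
   by (rule bij_betw_cong[THEN iffD1, rotated]) (simp add: \<phi>_def)
  then show ?thesis by (simp add: Bij_def \<phi>_def)
 qed
 have "\<phi>\<in>hom G (BijGroup (tree_verts m))"
 proof (rule homI)
  fix g h assume gh: "g\<in>carrier G" "h\<in>carrier G"
  have "\<phi> (g\<otimes>h) = compose (tree_verts m) (\<phi> g) (\<phi> h)"
   by (rule ext) (use gh cl mult in \<open>auto simp: \<phi>_def compose_def\<close>)
  then show "\<phi> (g\<otimes>h) = \<phi> g \<otimes>\<^bsub>BijGroup (tree_verts m)\<^esub> \<phi> h"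
   using bij gh by (simp add: BijGroup_def)
 qed (use bij in \<open>simp add: BijGroup_def\<close>)
 then have gact: "group_action G (tree_verts m) \<phi>"
  by (simp add: group_action_def group_hom_def group_hom_axioms_def group_axioms group_BijGroup)
 define K where "K = {g\<in>carrier G. \<forall>w\<in>tree_verts m. ?a g w = w}"
 have "K = {\<one>}"
 proof (rule core)
  show "K \<lhd> G"
  proof (rule normal_invI)
   show "subgroup K G"
   proof (rule subgroupI)
    show "K ~= {}" using one by (auto simp: K_def)
    show "inv g\<in>K" if "g\<in>K" for g
     using that inv1(1)[of g] by (auto simp: K_def)
   qed (auto simp: K_def mult)
   show "x\<otimes>k\<otimes>inv x\<in>K" if "k\<in>K" "x\<in>carrier G" for x k
    using that cl inv1(2) by (auto simp: K_def mult)
  qed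
  fix k i assume k: "k\<in>K" "i < m"
  have kk: "?a k w = w" if "w\<in>tree_verts m" for w using k(1) that by (simp add: K_def)
  have "?a k (i # w) = i # w" if "w\<in>tree_verts m" for w by (rule kk) (use k(2) that in simp)
  then have "\<sigma> k i = i" "w\<in>tree_verts m ==> ?a (\<tau> k i) w = w" for w
   using tree_verts_simps(1)[of m] unfolding tree_act.simps by blast+
  then show "\<sigma> k i = i\<and>\<tau> k i\<in>K" using k \<tau>(1) by (simp add: K_def)
 qed
 have "inj_on \<phi> (carrier G)"
 proof (rule inj_onI)
  fix g h assume gh: "g\<in>carrier G" "h\<in>carrier G" "\<phi> g = \<phi> h"
  have "?a g w = ?a h w" if "w\<in>tree_verts m" for w
   using fun_cong[OF gh(3), of w] that by (simp add: \<phi>_def)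
  then have "inv h\<otimes>g\<in>K" using gh inv1(1) by (simp add: K_def mult)
  then show "g = h" using gh \<open>K = {\<one>}\<close> by (metis inv_cancel_left(2) r_one singletonD)
 qed
 with gact have "faithful_action G (tree_verts m) \<phi>"
  by (simp add: faithful_action_def faithful_action_axioms_def)
 moreover have "\<phi> g\<in>tree_aut m" if g: "g\<in>carrier G" for g
 proof -
  have *: "is_child (?a g u) (?a g v)" if "is_child u v" for g u v
  proof -
   obtain i where "v = u @ [i]" using \<open>is_child u v\<close> by (auto simp: is_child_def)
   then show ?thesis using tree_act_snoc[of \<sigma> \<tau> g u i] by (simp add: is_child_def)
  qed
  have "is_child u v\<longleftrightarrow>is_child (?a g u) (?a g v)" if "u\<in>tree_verts m" "v\<in>tree_verts m" for u v
   using *[of u v g] *[of "?a g u" "?a g v" "inv g"] inv1(1)[OF g] that by auto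
  then show ?thesis using bij[OF g] by (simp add: tree_aut_def) (simp add: \<phi>_def)
 qed
 moreover have "tree_state m (\<phi> g) i\<in>\<phi> ` carrier G" if "g\<in>carrier G" "i < m" for g i
 proof (rule image_eqI)
  show "tree_state m (\<phi> g) i = \<phi> (\<tau> g i)"
   by (rule ext) (use that in \<open>simp add: tree_state_def \<phi>_def restrict_def\<close>)
 qed (use that \<tau> in auto)
 ultimately show ?thesis unfolding self_similar_def using m by blast
qed

text \<open>The first level consists of the cosets of the domains, doubled so that \<open>m\<ge>2\<close>.\<close>

lemma (in group) self_similar_virtual_endos:
 fixes H :: "'i => 'a set" and f :: "'i => 'a => 'a"
 assumes I: "finite I" "I ~= {}"
  and H: "!!i. i\<in>I ==> subgroup (H i) G" "!!i. i\<in>I ==> fidx G (carrier G) (H i)"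
  and f: "!!i. i\<in>I ==> f i\<in>hom (G(|carrier := H i|)) G"
  and core: "!!K. K \<lhd> G ==> (!!i. i\<in>I ==> K\<subseteq>H i\<and>f i ` K\<subseteq>K) ==> K = {\<one>}"
 shows "self_similar G"
proof -
 define C where "C i = (%g. g <# H i) ` carrier G" for i
 define B where "B = (SIGMA i : I. C i\<times>(UNIV :: bool set))"
 have finC: "finite (C i)" if i: "i\<in>I" for i
 proof -
  obtain S where S: "finite S" "S\<subseteq>carrier G" "\<forall>a\<in>carrier G. \<exists>s\<in>S. inv s\<otimes>a\<in>H i"
   using H(2)[OF i] by (auto simp: fidx_def)
  have "C i\<subseteq>(%s. s <# H i) ` S"
  proof
   fix c assume "c\<in>C i"
   then obtain a where a: "a\<in>carrier G" "c = a <# H i" by (auto simp: C_def)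
   then obtain s where "s\<in>S" "inv s\<otimes>a\<in>H i" using S by blast
   then show "c\<in>(%s. s <# H i) ` S" using a S l_coset_eq_iff[OF H(1)[OF i], of a s] by auto
  qed
  then show ?thesis using S(1) finite_surj by blast
 qed
 have finB: "finite B" unfolding B_def using I finC by auto
 define m where "m = card B"
 obtain e where e: "bij_betw e {..<m} B"
  using ex_bij_betw_nat_finite[OF finB] by (auto simp: m_def atLeast0LessThan)
 define e' where "e' = inv_into {..<m} e"
 have e1: "e' x < m" "e (e' x) = x" if "x\<in>B" for x
  using that e bij_betw_inv_into_right[OF e] inv_into_into[of x e "{..<m}"]
  by (auto simp: e'_def bij_betw_def)
 have e2: "e j\<in>B" "e' (e j) = j" if "j < m" for j
  using that e bij_betw_inv_into_left[OF e] by (auto simp: e'_def bij_betw_def)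
 have HC: "H i\<in>C i" if "i\<in>I" for i
 proof -
  have "\<one> <# H i = H i" using subgroup.subset[OF H(1)[OF that]] by (force simp: l_coset_def)
  then show ?thesis unfolding C_def by (metis imageI one_closed)
 qed
 \<comment> \<open>The coset \<open>H i\<close> itself is represented by 1; at a letter of this
   coset the state of an element of \<open>H i\<close> is then simply its image under
   \<open>f i\<close>.\<close>
 define r where "r i c = (if \<one>\<in>c then \<one> else SOME x. x\<in>c)" for i :: 'i and c
 have r: "r i c\<in>carrier G" "r i c <# H i = c" if i: "i\<in>I" and c: "c\<in>C i" for i c
 proof -
  interpret S: subgroup "H i" G using H(1)[OF i] .
  obtain a where a: "a\<in>carrier G" "c = a <# H i" using c by (auto simp: C_def)
  have "a\<in>c" using a by (force simp: l_coset_def)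
  then have rc: "r i c\<in>c" by (auto simp: r_def intro: someI)
  then obtain k where k: "k\<in>H i" "r i c = a\<otimes>k" using a by (auto simp: l_coset_def)
  then show "r i c\<in>carrier G" using a by simp
  then show "r i c <# H i = c" using a k l_coset_eq_iff[OF H(1)[OF i], of "r i c" a] by simp
 qed
 have rH: "r i (H i) = \<one>" if "i\<in>I" for i
  using subgroup.one_closed[OF H(1)[OF that]] by (simp add: r_def)
 have gC: "g <# c\<in>C i" "(g\<otimes>h) <# c = g <# (h <# c)" "\<one> <# c = c"
  if ic: "i\<in>I" "c\<in>C i" and gh: "g\<in>carrier G" "h\<in>carrier G" for i c g h
 proof -
  obtain a where a: "a\<in>carrier G" "c = a <# H i" using ic by (auto simp: C_def)
  show "g <# c\<in>C i" "(g\<otimes>h) <# c = g <# (h <# c)" "\<one> <# c = c"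
   using a ic gh by (auto simp: C_def l_coset_mult[OF H(1)] m_assoc)
 qed
 \<comment> \<open>The Schreier cocycle of the coset representatives.\<close>
 define st where "st g i c = inv (r i (g <# c))\<otimes>g\<otimes>r i c" for g i c
 have stH: "st g i c\<in>H i" if "i\<in>I" "c\<in>C i" "g\<in>carrier G" for g i c
 proof -
  have "(g\<otimes>r i c) <# H i = r i (g <# c) <# H i"
   using r[OF that(1,2)] r(2)[OF that(1) gC(1)[OF that(1,2,3,3)]] that
   by (simp flip: l_coset_mult[OF H(1)[OF that(1)]])
  then show ?thesis
   using r[OF that(1,2)] r(1)[OF that(1) gC(1)[OF that(1,2,3,3)]] that
   by (simp add: st_def l_coset_eq_iff[OF H(1)] m_assoc)
 qed
 have stm: "st (g\<otimes>h) i c = st g i (h <# c)\<otimes>st h i c"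
  if "i\<in>I" "c\<in>C i" "g\<in>carrier G" "h\<in>carrier G" for g h i c
  using that r(1)[OF that(1,2)] r(1)[OF that(1) gC(1)[OF that(1,2,4,4)]]
   r(1)[OF that(1) gC(1)[OF that(1) gC(1)[OF that(1,2,4,4)] that(3,3)]] gC(2)[OF that]
  by (simp add: st_def m_assoc)
 define \<sigma>' where "\<sigma>' g = (%(i :: 'i, c :: 'a set, b :: bool). (i, g <# c, b))" for g :: 'a
 define \<tau>' where "\<tau>' g = (%(i :: 'i, c :: 'a set, b :: bool). f i (st g i c))" for g :: 'a
 have fcl: "f i x\<in>carrier G" if "i\<in>I" "x\<in>H i" for i x using f[OF that(1)] that(2) by (auto simp: hom_def)
 have fm: "f i (x\<otimes>y) = f i x\<otimes>f i y" if "i\<in>I" "x\<in>H i" "y\<in>H i" for i x y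
  using f[OF that(1)] that(2,3) by (auto simp: hom_def)
 show ?thesis
 proof (rule self_similar_wreath[where m = m and \<sigma> = "%g j. e' (\<sigma>' g (e j))" and \<tau> = "%g j. \<tau>' g (e j)"])
  obtain i where i: "i\<in>I" using I by blast
  have "{(i, H i, True), (i, H i, False)}\<subseteq>B" using i HC by (auto simp: B_def)
  from card_mono[OF finB this] show "m\<ge>2" by (simp add: m_def)
  have \<sigma>B: "\<sigma>' g x\<in>B" if "g\<in>carrier G" "x\<in>B" for g x
   using that gC(1) by (auto simp: \<sigma>'_def B_def)
  show "e' (\<sigma>' g (e j)) < m" if "g\<in>carrier G" "j < m" for g j
   using that \<sigma>B e1 e2 by simp
  show "e' (\<sigma>' \<one> (e j)) = j" if "j < m" for j
  proof -
   have "\<sigma>' \<one> (e j) = e j"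
    using e2(1)[OF that] gC(3)[OF _ _ one_closed one_closed] by (auto simp: \<sigma>'_def B_def simp del: set_eq_iff)
   then show ?thesis using e2(2)[OF that] by simp
  qed
  show "e' (\<sigma>' (g\<otimes>h) (e j)) = e' (\<sigma>' g (e (e' (\<sigma>' h (e j)))))"
   if "g\<in>carrier G" "h\<in>carrier G" "j < m" for g h j
  proof -
   have "\<sigma>' (g\<otimes>h) (e j) = \<sigma>' g (\<sigma>' h (e j))"
    using e2(1)[OF that(3)] that gC(2) by (auto simp: \<sigma>'_def B_def split: prod.splits)
   then show ?thesis using e1(2) \<sigma>B that e2(1) by simp
  qed
  show "\<tau>' g (e j)\<in>carrier G" if "g\<in>carrier G" "j < m" for g j
   using e2(1)[OF that(2)] that(1) stH fcl by (auto simp: \<tau>'_def B_def split: prod.splits)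
  show "\<tau>' (g\<otimes>h) (e j) = \<tau>' g (e (e' (\<sigma>' h (e j))))\<otimes>\<tau>' h (e j)"
   if gh: "g\<in>carrier G" "h\<in>carrier G" "j < m" for g h j
  proof -
   obtain i c b where x: "e j = (i, c, b)" "i\<in>I" "c\<in>C i" using e2(1)[OF gh(3)] by (auto simp: B_def)
   have "\<tau>' (g\<otimes>h) (e j) = f i (st g i (h <# c))\<otimes>f i (st h i c)"
    using x gh stm stH gC(1) by (simp add: \<tau>'_def fm)
   moreover have "e (e' (\<sigma>' h (e j))) = (i, h <# c, b)"
    using e1(2)[OF \<sigma>B[OF gh(2) e2(1)[OF gh(3)]]] by (simp add: x(1) \<sigma>'_def)
   ultimately show ?thesis using x by (simp add: \<tau>'_def)
  qed
  fix K assume K: "K \<lhd> G"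
   and inv: "!!k j. k\<in>K ==> j < m ==> e' (\<sigma>' k (e j)) = j\<and>\<tau>' k (e j)\<in>K"
  have Kc: "K\<subseteq>carrier G" using normal_imp_subgroup[OF K] subgroup.subset by blast
  show "K = {\<one>}"
  proof (rule core[OF K])
   fix i assume i: "i\<in>I"
   have "k\<in>H i\<and>f i k\<in>K" if k: "k\<in>K" for k
   proof -
    let ?x = "(i, H i, True)"
    have x: "?x\<in>B" using i HC by (auto simp: B_def)
    have kc: "k\<in>carrier G" using k Kc by auto
    have "e' (\<sigma>' k ?x) = e' ?x" "\<tau>' k ?x\<in>K" using inv[OF k e1(1)[OF x]] e1(2)[OF x] by auto
    then have "\<sigma>' k ?x = ?x" using e1(2)[OF x] e1(2)[OF \<sigma>B[OF kc x]] by metis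
    then have kH: "k <# H i = H i" by (simp add: \<sigma>'_def)
    have "\<one> <# H i = H i" using gC(3)[OF i HC[OF i] one_closed one_closed] .
    then have "k <# H i = \<one> <# H i" using kH by simp
    then have "k\<in>H i" using l_coset_eq_iff[OF H(1)[OF i] kc one_closed] kc by simp
    moreover have "st k i (H i) = k" using kH rH[OF i] kc by (simp add: st_def)
    ultimately show ?thesis using \<open>\<tau>' k ?x\<in>K\<close> by (simp add: \<tau>'_def)
   qed
   then show "K\<subseteq>H i\<and>f i ` K\<subseteq>K" by blast
  qed
 qed
qed

section \<open>Integral representations\<close>

text \<open>Matrices are indexed by an arbitrary finite set, so that an induced representation can
  use pairs of a coset and an old index.\<close>

definition int_rep :: "('a, 'b) monoid_scheme => 'i set => ('a => 'i => 'i => int) => bool" where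
 "int_rep G I M\<longleftrightarrow>finite I \<and>
   (\<forall>g\<in>carrier G. \<forall>h\<in>carrier G. \<forall>i\<in>I. \<forall>j\<in>I.
    M (g \<otimes>\<^bsub>G\<^esub> h) i j = (\<Sum>k\<in>I. M g i k * M h k j)) \<and>
   (\<forall>i\<in>I. \<forall>j\<in>I. M \<one>\<^bsub>G\<^esub> i j = of_bool (i = j))"

definition faithful_rep :: "('a, 'b) monoid_scheme => 'i set => ('a => 'i => 'i => int) => bool" where
 "faithful_rep G I M\<longleftrightarrow>int_rep G I M \<and>
   (\<forall>g\<in>carrier G. (\<forall>i\<in>I. \<forall>j\<in>I. M g i j = of_bool (i = j)) --> g = \<one>\<^bsub>G\<^esub>)"

lemma (in group) faithful_rep_linear:
 assumes "faithful_rep G I M"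
 shows "linear_over_int G"
proof -
 have fin: "finite I" and mult: "!!g h i j. g\<in>carrier G ==> h\<in>carrier G ==> i\<in>I ==> j\<in>I ==>
    M (g\<otimes>h) i j = (\<Sum>k\<in>I. M g i k * M h k j)"
  and one: "!!i j. i\<in>I ==> j\<in>I ==> M \<one> i j = of_bool (i = j)"
  and faith: "!!g. g\<in>carrier G ==> (!!i j. i\<in>I ==> j\<in>I ==> M g i j = of_bool (i = j)) ==> g = \<one>"
  using assms by (auto simp: faithful_rep_def int_rep_def)
 define k where "k = card I"
 obtain e where e: "bij_betw e {..<k} I"
  using ex_bij_betw_nat_finite[OF fin] by (auto simp: k_def atLeast0LessThan)
 have eI: "e i\<in>I" if "i < k" for i using e that by (auto simp: bij_betw_def)
 have einj: "e i = e j\<longleftrightarrow>i = j" if "i < k" "j < k" for i j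
  using e that by (auto simp: bij_betw_def inj_on_def)
 define F where "F g = mat k k (%(i, j). M g (e i) (e j))" for g
 have Fc: "F g\<in>carrier_mat k k" for g by (simp add: F_def)
 have F1: "F \<one> = 1\<^sub>m k" by (rule eq_matI) (auto simp: F_def one eI einj)
 have Fm: "F (g\<otimes>h) = F g * F h" if "g\<in>carrier G" "h\<in>carrier G" for g h
 proof (rule eq_matI)
  fix i j assume ij: "i < dim_row (F g * F h)" "j < dim_col (F g * F h)"
  then have ij: "i < k" "j < k" by (simp_all add: F_def)
  have "F (g\<otimes>h) $$ (i, j) = (\<Sum>l\<in>I. M g (e i) l * M h l (e j))"
   using ij that by (simp add: F_def mult eI)
  also have "\<dots> = (\<Sum>l < k. M g (e i) (e l) * M h (e l) (e j))"
   by (rule sum.reindex_bij_betw[OF e, symmetric])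
  also have "\<dots> = (F g * F h) $$ (i, j)"
   using ij by (simp add: F_def scalar_prod_def atLeast0LessThan)
  finally show "F (g\<otimes>h) $$ (i, j) = (F g * F h) $$ (i, j)" .
 qed (simp_all add: F_def)
 have U: "F g\<in>Units (ring_mat TYPE(int) k ())" if g: "g\<in>carrier G" for g
 proof -
  have "F (inv g) * F g = 1\<^sub>m k" "F g * F (inv g) = 1\<^sub>m k" using g F1 by (simp_all flip: Fm)
  then show ?thesis using Fc by (auto simp: Units_def ring_mat_def)
 qed
 have "F\<in>hom G (GL_int k)"
  by (intro homI) (simp_all add: units_of_carrier units_of_mult U Fm ring_mat_simps)
 moreover have "inj_on F (carrier G)"
 proof (rule inj_onI)
  fix g h assume gh: "g\<in>carrier G" "h\<in>carrier G" "F g = F h"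
  have "F (inv h\<otimes>g) = F (inv h\<otimes>h)" using gh by (metis Fm inv_closed)
  then have F: "F (inv h\<otimes>g) = 1\<^sub>m k" using gh F1 by simp
  have "inv h\<otimes>g = \<one>"
  proof (rule faith)
   fix i j assume "i\<in>I" "j\<in>I"
   then obtain a b where ab: "a < k" "b < k" "i = e a" "j = e b" using e by (auto simp: bij_betw_def)
   have "M (inv h\<otimes>g) i j = F (inv h\<otimes>g) $$ (a, b)" using ab by (simp add: F_def)
   then show "M (inv h\<otimes>g) i j = of_bool (i = j)" using ab F einj by simp
  qed (use gh in simp)
  then show "g = h" using gh by (metis inv_cancel_left(2) r_one)
 qed
 ultimately show ?thesis unfolding linear_over_int_def mon_def by blast
qed

text \<open>The induced representation consists of block monomial matrices. An element acting
  trivially fixes the trivial coset, and its block there is the original representation at a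
  conjugate of this element.\<close>

lemma (in group) faithful_rep_induced:
 assumes \<Gamma>: "subgroup \<Gamma> G" "fidx G (carrier G) \<Gamma>" and rep: "faithful_rep (G(|carrier := \<Gamma>|)) I M" and "I ~= {}"
 shows "\<exists>M'. faithful_rep G ((%g. g <# \<Gamma>) ` carrier G\<times>I) M'"
proof -
 interpret \<Gamma>: subgroup \<Gamma> G by fact
 have fin: "finite I" and mult: "!!g h i j. g\<in>\<Gamma> ==> h\<in>\<Gamma> ==> i\<in>I ==> j\<in>I ==>
    M (g\<otimes>h) i j = (\<Sum>k\<in>I. M g i k * M h k j)"
  and one: "!!i j. i\<in>I ==> j\<in>I ==> M \<one> i j = of_bool (i = j)"
  and faith: "!!g. g\<in>\<Gamma> ==> (!!i j. i\<in>I ==> j\<in>I ==> M g i j = of_bool (i = j)) ==> g = \<one>"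
  using rep by (auto simp: faithful_rep_def int_rep_def)
 define C where "C = (%g. g <# \<Gamma>) ` carrier G"
 have finC: "finite C"
 proof -
  obtain S where S: "finite S" "S\<subseteq>carrier G" "\<forall>a\<in>carrier G. \<exists>s\<in>S. inv s\<otimes>a\<in>\<Gamma>"
   using \<Gamma>(2) by (auto simp: fidx_def)
  have "C\<subseteq>(%s. s <# \<Gamma>) ` S"
  proof
   fix c assume "c\<in>C"
   then obtain a where a: "a\<in>carrier G" "c = a <# \<Gamma>" by (auto simp: C_def)
   then obtain s where "s\<in>S" "inv s\<otimes>a\<in>\<Gamma>" using S by blast
   then show "c\<in>(%s. s <# \<Gamma>) ` S" using a S l_coset_eq_iff[OF \<Gamma>(1), of a s] by auto
  qed
  then show ?thesis using S(1) finite_surj by blast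
 qed
 define r where "r c = (SOME x. x\<in>carrier G\<and>x <# \<Gamma> = c)" for c
 have r: "r c\<in>carrier G" "r c <# \<Gamma> = c" if "c\<in>C" for c
 proof -
  have "\<exists>x. x\<in>carrier G\<and>x <# \<Gamma> = c" using that by (auto simp: C_def)
  from someI_ex[OF this] show "r c\<in>carrier G" "r c <# \<Gamma> = c" by (simp_all add: r_def)
 qed
 have gC: "g <# c\<in>C" "(g\<otimes>h) <# c = g <# (h <# c)" "\<one> <# c = c"
  if c: "c\<in>C" and gh: "g\<in>carrier G" "h\<in>carrier G" for c g h
 proof -
  obtain a where a: "a\<in>carrier G" "c = a <# \<Gamma>" using c by (auto simp: C_def)
  show "g <# c\<in>C" "(g\<otimes>h) <# c = g <# (h <# c)" "\<one> <# c = c"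
   using a gh by (auto simp: C_def l_coset_mult[OF \<Gamma>(1)] m_assoc)
 qed
 define st where "st g c = inv (r (g <# c))\<otimes>g\<otimes>r c" for g c
 have st\<Gamma>: "st g c\<in>\<Gamma>" if "c\<in>C" "g\<in>carrier G" for g c
 proof -
  have "(g\<otimes>r c) <# \<Gamma> = r (g <# c) <# \<Gamma>"
   using r[OF that(1)] r(2)[OF gC(1)[OF that(1,2,2)]] that by (simp flip: l_coset_mult[OF \<Gamma>(1)])
  then show ?thesis
   using r[OF that(1)] r(1)[OF gC(1)[OF that(1,2,2)]] that
   by (simp add: st_def l_coset_eq_iff[OF \<Gamma>(1)] m_assoc)
 qed
 have stm: "st (g\<otimes>h) c = st g (h <# c)\<otimes>st h c" if "c\<in>C" "g\<in>carrier G" "h\<in>carrier G" for g h c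
  using that r(1)[OF that(1)] r(1)[OF gC(1)[OF that(1,3,3)]]
   r(1)[OF gC(1)[OF gC(1)[OF that(1,3,3)] that(2,2)]] gC(2)[OF that]
  by (simp add: st_def m_assoc)
 have st1: "st \<one> c = \<one>" if "c\<in>C" for c using gC(3)[OF that one_closed one_closed] r(1)[OF that] by (simp add: st_def)
 define M' where "M' g x y = (if fst x = g <# fst y then M (st g (fst y)) (snd x) (snd y) else 0)" for g x y
 have "int_rep G (C\<times>I) M'"
  unfolding int_rep_def
 proof (intro conjI ballI)
  fix g h x y assume gh: "g\<in>carrier G" "h\<in>carrier G" and xy: "x\<in>C\<times>I" "y\<in>C\<times>I"
  obtain c i where x: "x = (c, i)" "c\<in>C" "i\<in>I" using xy by auto
  obtain d j where y: "y = (d, j)" "d\<in>C" "j\<in>I" using xy by auto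
  have hd: "h <# d\<in>C" using gC(1)[OF y(2) gh(2,2)] .
  have "(\<Sum>z\<in>C\<times>I. M' g x z * M' h z y) = (\<Sum>b\<in>C. \<Sum>k\<in>I. M' g x (b, k) * M' h (b, k) y)"
   by (simp add: sum.cartesian_product)
  also have "\<dots> = (\<Sum>b\<in>C. if b = h <# d then \<Sum>k\<in>I. M' g x (b, k) * M' h (b, k) y else 0)"
   by (rule sum.cong) (auto simp: M'_def y)
  also have "\<dots> = (\<Sum>k\<in>I. M' g x (h <# d, k) * M' h (h <# d, k) y)"
   using finC hd by simp
  also have "\<dots> = M' (g\<otimes>h) x y"
   using x y gh gC(2)[OF y(2) gh] stm[OF y(2) gh] mult[OF st\<Gamma>[OF hd gh(1)] st\<Gamma>[OF y(2) gh(2)] x(3) y(3)]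
   by (auto simp: M'_def)
  finally show "M' (g\<otimes>h) x y = (\<Sum>z\<in>C\<times>I. M' g x z * M' h z y)" by simp
 next
  fix x y assume "x\<in>C\<times>I" "y\<in>C\<times>I"
  then show "M' \<one> x y = of_bool (x = y)"
   using gC(3)[OF _ one_closed one_closed] st1 one by (auto simp: M'_def)
 qed (use finC fin in simp)
 moreover have "g = \<one>" if g: "g\<in>carrier G"
  and id: "!!x y. x\<in>C\<times>I ==> y\<in>C\<times>I ==> M' g x y = of_bool (x = y)" for g
 proof -
  define c where "c = \<one> <# \<Gamma>"
  have c: "c\<in>C" by (auto simp: c_def C_def)
  obtain i where i: "i\<in>I" using \<open>I ~= {}\<close> by blast
  have "M' g (c, i) (c, i) = 1" using id[of "(c, i)" "(c, i)"] c i by simp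
  then have gc: "g <# c = c" by (auto simp: M'_def split: if_splits)
  have "st g c = \<one>"
  proof (rule faith[OF st\<Gamma>[OF c g]])
   fix i j assume "i\<in>I" "j\<in>I"
   then show "M (st g c) i j = of_bool (i = j)" using id[of "(c, i)" "(c, j)"] c gc by (auto simp: M'_def)
  qed
  then have "inv (r c)\<otimes>g\<otimes>r c = \<one>" using gc by (simp add: st_def)
  then have "r c\<otimes>(inv (r c)\<otimes>g\<otimes>r c)\<otimes>inv (r c) = \<one>" using r(1)[OF c] by simp
  then show "g = \<one>" using r(1)[OF c] g by (simp add: m_assoc)
 qed
 ultimately have "faithful_rep G (C\<times>I) M'" unfolding faithful_rep_def by (metis (mono_tags))
 then show ?thesis unfolding C_def by blast
qed

section \<open>Residual finiteness\<close>

lemma (in group) fin_normalI: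
 assumes "subgroup N G" "!!x n. x\<in>carrier G ==> n\<in>N ==> x\<otimes>n\<otimes>inv x\<in>N"
  and "finite (\<kappa> ` carrier G)"
  and "!!g h. g\<in>carrier G ==> h\<in>carrier G ==> \<kappa> g = \<kappa> h ==> inv h\<otimes>g\<in>N"
 shows "fin_normal G N"
 unfolding fin_normal_def
proof
 show "N \<lhd> G" by (rule normal_invI[OF assms(1)]) (use assms(2) in blast)
 show "fidx G (carrier G) N" by (rule fidxI[OF _ assms(3,4)]) auto
qed

text \<open>Congruence kernels: an entry differing from that of the identity matrix still differs
  modulo any integer larger than the difference.\<close>

lemma (in group) linear_residually_finite:
 assumes "linear_over_int G"
 shows "residually_finite G"
 unfolding residually_finite_alt[OF group_axioms]
proof (intro ballI impI)
 fix g assume g: "g\<in>carrier G" "g ~= \<one>"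
 obtain k \<mu> where \<mu>: "\<mu>\<in>hom G (GL_int k)" "inj_on \<mu> (carrier G)"
  using assms by (auto simp: linear_over_int_def mon_def)
 have mc: "\<mu> x\<in>carrier_mat k k" if "x\<in>carrier G" for x
  using \<mu>(1) that by (auto simp: hom_def units_of_def Units_def ring_mat_def)
 have mm: "\<mu> (x\<otimes>y) = \<mu> x * \<mu> y" if "x\<in>carrier G" "y\<in>carrier G" for x y
  using \<mu>(1) that by (auto simp: hom_def units_of_def ring_mat_def)
 have m1: "\<mu> \<one> = 1\<^sub>m k"
 proof -
  have "ring (ring_mat TYPE(int) k ())" by (rule ring_mat)
  then have "group (GL_int k)" using monoid.units_group ring.is_monoid by blast
  from hom_one[OF \<mu>(1) group_axioms this] show ?thesis by (simp add: units_of_def ring_mat_def)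
 qed
 have "\<mu> g ~= 1\<^sub>m k" using \<mu>(2) g m1 by (metis inj_onD one_closed)
 then obtain i j where ij: "i < k" "j < k" "\<mu> g $$ (i, j) ~= 1\<^sub>m k $$ (i, j)"
  using mc[OF g(1)] by (metis carrier_matD eq_matI index_one_mat(2,3))
 define n where "n = \<bar>\<mu> g $$ (i, j) - 1\<^sub>m k $$ (i, j)\<bar> + 1"
 have n: "n > 0" by (simp add: n_def)
 define cg where "cg A B\<longleftrightarrow>(\<forall>i < k. \<forall>j < k. A $$ (i, j) mod n = B $$ (i, j) mod n)" for A B :: "int mat"
 have cgm: "cg (A * C) (B * D)"
  if "cg A B" "cg C D" "A\<in>carrier_mat k k" "B\<in>carrier_mat k k" "C\<in>carrier_mat k k" "D\<in>carrier_mat k k"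
  for A B C D
  unfolding cg_def
 proof (intro allI impI)
  fix i j assume "i < k" "j < k"
  then have e: "(A * C) $$ (i, j) = (\<Sum>l<k. A $$ (i, l) * C $$ (l, j))"
    "(B * D) $$ (i, j) = (\<Sum>l<k. B $$ (i, l) * D $$ (l, j))"
   using that by (auto simp: scalar_prod_def atLeast0LessThan)
  have "(A $$ (i, l) * C $$ (l, j)) mod n = (B $$ (i, l) * D $$ (l, j)) mod n" if "l < k" for l
   using \<open>cg A B\<close> \<open>cg C D\<close> that \<open>i < k\<close> \<open>j < k\<close> unfolding cg_def by (metis mod_mult_cong)
  then have "(\<Sum>l<k. (A $$ (i, l) * C $$ (l, j)) mod n) = (\<Sum>l<k. (B $$ (i, l) * D $$ (l, j)) mod n)"
   by simp
  moreover have "(\<Sum>l<k. (A $$ (i, l) * C $$ (l, j)) mod n) mod n = (A * C) $$ (i, j) mod n"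
   "(\<Sum>l<k. (B $$ (i, l) * D $$ (l, j)) mod n) mod n = (B * D) $$ (i, j) mod n"
   unfolding e by (rule mod_sum_eq)+
  ultimately show "(A * C) $$ (i, j) mod n = (B * D) $$ (i, j) mod n" by metis
 qed
 define N where "N = {x\<in>carrier G. cg (\<mu> x) (1\<^sub>m k)}"
 have one: "1\<^sub>m k\<in>carrier_mat k k" by simp
 have cgr: "cg A A" for A by (simp add: cg_def)
 have cgt: "cg A B ==> cg B C ==> cg A C" for A B C by (simp add: cg_def)
 have cgs: "cg A B ==> cg B A" for A B by (simp add: cg_def)
 have key: "inv h\<otimes>x\<in>N" if "x\<in>carrier G" "h\<in>carrier G" "cg (\<mu> x) (\<mu> h)" for x h
 proof -
  have "cg (\<mu> (inv h) * \<mu> x) (\<mu> (inv h) * \<mu> h)" by (rule cgm[OF cgr that(3)]) (use mc that in auto)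
  then show ?thesis using that m1 by (simp add: N_def flip: mm)
 qed
 have "fin_normal G N"
 proof (rule fin_normalI[where \<kappa> = "%x. \<lambda>z\<in>{..<k}\<times>{..<k}. \<mu> x $$ z mod n"])
  show "subgroup N G"
  proof (rule subgroupI)
   show "N ~= {}" using m1 cgr by (auto simp: N_def intro!: exI[of _ \<one>])
   show "inv x\<in>N" if "x\<in>N" for x
    using key[of \<one> x] that m1 cgs by (auto simp: N_def)
   show "x\<otimes>y\<in>N" if "x\<in>N" "y\<in>N" for x y
    using that cgm[of "\<mu> x" "1\<^sub>m k" "\<mu> y" "1\<^sub>m k"] mc by (auto simp: N_def mm)
  qed (auto simp: N_def)
  show "x\<otimes>y\<otimes>inv x\<in>N" if "x\<in>carrier G" "y\<in>N" for x y
  proof -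
   have y: "y\<in>carrier G" "cg (\<mu> y) (1\<^sub>m k)" using that by (auto simp: N_def)
   have "cg (\<mu> x * \<mu> y) (\<mu> x * 1\<^sub>m k)" by (rule cgm[OF cgr y(2)]) (use mc that y in auto)
   then have "cg (\<mu> (x\<otimes>y)) (\<mu> x)" using that y mc mm by (simp add: right_mult_one_mat[of _ k k])
   then have "cg (\<mu> (x\<otimes>y) * \<mu> (inv x)) (\<mu> x * \<mu> (inv x))"
    by (rule cgm[OF _ cgr]) (use mc that y in auto)
   then show ?thesis using that y m1 by (simp add: N_def flip: mm)
  qed
  have "(%x. \<lambda>z\<in>{..<k}\<times>{..<k}. \<mu> x $$ z mod n) ` carrier G\<subseteq>PiE ({..<k}\<times>{..<k}) (%_. {0..<n})"
   by (rule image_subsetI, rule PiE_I) (use n in auto)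
  then show "finite ((%x. \<lambda>z\<in>{..<k}\<times>{..<k}. \<mu> x $$ z mod n) ` carrier G)"
   by (rule finite_subset) (intro finite_PiE; simp)
  show "inv h\<otimes>x\<in>N" if "x\<in>carrier G" "h\<in>carrier G"
   "(\<lambda>z\<in>{..<k}\<times>{..<k}. \<mu> x $$ z mod n) = (\<lambda>z\<in>{..<k}\<times>{..<k}. \<mu> h $$ z mod n)" for x h
  proof (rule key[OF that(1,2)])
   have "\<mu> x $$ (i, j) mod n = \<mu> h $$ (i, j) mod n" if "i < k" "j < k" for i j
    using fun_cong[OF \<open>(\<lambda>z\<in>{..<k}\<times>{..<k}. \<mu> x $$ z mod n) = _\<close>, of "(i, j)"] that by simp
   then show "cg (\<mu> x) (\<mu> h)" by (simp add: cg_def)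
  qed
 qed
 moreover have "g\<notin>N"
 proof
  assume "g\<in>N"
  then have "\<mu> g $$ (i, j) mod n = 1\<^sub>m k $$ (i, j) mod n" using ij by (auto simp: N_def cg_def)
  then have "n dvd \<mu> g $$ (i, j) - 1\<^sub>m k $$ (i, j)" by (simp only: mod_eq_dvd_iff)
  moreover have "\<mu> g $$ (i, j) - 1\<^sub>m k $$ (i, j) ~= 0" using ij(3) by (simp only: right_minus_eq not_False_eq_True)
  ultimately have "\<bar>n\<bar>\<le>\<bar>\<mu> g $$ (i, j) - 1\<^sub>m k $$ (i, j)\<bar>" using dvd_imp_le_int by blast
  then show False unfolding n_def by linarith
 qed
 ultimately show "\<exists>N. fin_normal G N\<and>g\<notin>N" by blast
qed

text \<open>Tree automorphisms preserve the finite levels, so an element moving a vertex is detected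
  by its permutation of that level.\<close>

lemma (in group) self_similar_residually_finite:
 assumes "self_similar G"
 shows "residually_finite G"
 unfolding residually_finite_alt[OF group_axioms]
proof (intro ballI impI)
 fix g assume g: "g\<in>carrier G" "g ~= \<one>"
 obtain m \<phi> where fa: "faithful_action G (tree_verts m) \<phi>" and ta: "\<phi> ` carrier G\<subseteq>tree_aut m"
  using assms by (auto simp: self_similar_def)
 interpret A: faithful_action G "tree_verts m" \<phi> by (rule fa)
 have tv: "u\<in>tree_verts m" if "u @ [i]\<in>tree_verts m" for u i using that by (auto simp: tree_verts_def)
 have len: "length (\<phi> x w) = length w" if "x\<in>carrier G" "w\<in>tree_verts m" for x w
  using that(2)
 proof (induction w rule: rev_induct)
  case Nil
  then show ?case using ta that(1) by (auto simp: tree_aut_def)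
 next
  case (snoc i u)
  have "\<phi> x\<in>tree_aut m" using ta that(1) by blast
  moreover have "is_child u (u @ [i])" by (simp add: is_child_def)
  ultimately have "is_child (\<phi> x u) (\<phi> x (u @ [i]))" using snoc(2) tv by (auto simp: tree_aut_def)
  then show ?case using snoc.IH[OF tv[OF snoc(2)]] by (auto simp: is_child_def)
 qed
 have ex: "\<phi> x\<in>extensional (tree_verts m)" if "x\<in>carrier G" for x
  using A.bij_prop0[OF that] by (simp add: Bij_def)
 have "\<phi> g ~= \<phi> \<one>" using A.faithful g by (auto simp: inj_on_def)
 then obtain w where w: "w\<in>tree_verts m" "\<phi> g w ~= \<phi> \<one> w"
  using extensionalityI[OF ex[OF g(1)] ex[OF one_closed]] by blast
 have i1: "\<phi> \<one> u = u" if "u\<in>tree_verts m" for u using fun_cong[OF A.id_eq_one, of u] that by simp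
 define Y where "Y = {u\<in>tree_verts m. length u = length w}"
 have "Y\<subseteq>{u. set u\<subseteq>{..<m}\<and>length u = length w}" by (auto simp: Y_def tree_verts_def)
 then have finY: "finite Y" using finite_lists_length_eq[of "{..<m}" "length w"] finite_subset by blast
 have Ycl: "\<phi> x u\<in>Y" if "x\<in>carrier G" "u\<in>Y" for x u
  using len[OF that(1)] A.element_image[OF that(1) _ HOL.refl] that(2) by (simp add: Y_def)
 have mult: "\<phi> (x\<otimes>y) u = \<phi> x (\<phi> y u)" if "x\<in>carrier G" "y\<in>carrier G" "u\<in>Y" for x y u
  using A.composition_rule that by (auto simp: Y_def)
 have i1: "\<phi> \<one> u = u" if "u\<in>Y" for u using i1 that by (simp add: Y_def)
 define N where "N = {x\<in>carrier G. \<forall>u\<in>Y. \<phi> x u = u}"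
 have key: "inv h\<otimes>x\<in>N" if xh: "x\<in>carrier G" "h\<in>carrier G" "!!u. u\<in>Y ==> \<phi> x u = \<phi> h u" for x h
 proof -
  have "\<phi> (inv h\<otimes>x) u = u" if u: "u\<in>Y" for u
  proof -
   have "\<phi> (inv h\<otimes>x) u = \<phi> (inv h) (\<phi> h u)" using mult u xh by simp
   also have "\<dots> = \<phi> (inv h\<otimes>h) u" using mult[of "inv h" h u] u \<open>h\<in>_\<close> by simp
   finally have "\<phi> (inv h\<otimes>x) u = \<phi> (inv h\<otimes>h) u" .
   then show ?thesis using i1[OF u] \<open>h\<in>_\<close> by simp
  qed
  then show ?thesis using xh by (simp add: N_def)
 qed
 have "fin_normal G N"
 proof (rule fin_normalI[where \<kappa> = "%x. restrict (\<phi> x) Y"])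
  show "subgroup N G"
  proof (rule subgroupI)
   show "N ~= {}" using i1 by (auto simp: N_def)
   show "inv x\<in>N" if "x\<in>N" for x using key[of \<one> x] that i1 by (auto simp: N_def)
  qed (auto simp: N_def mult)
  show "x\<otimes>y\<otimes>inv x\<in>N" if "x\<in>carrier G" "y\<in>N" for x y
  proof -
   have "\<phi> (x\<otimes>y\<otimes>inv x) u = u" if u: "u\<in>Y" for u
   proof -
    have "\<phi> (x\<otimes>y\<otimes>inv x) u = \<phi> x (\<phi> (inv x) u)"
     using u Ycl mult \<open>x\<in>_\<close> \<open>y\<in>_\<close> by (simp add: N_def)
    also have "\<dots> = \<phi> (x\<otimes>inv x) u" using u mult[of x "inv x"] \<open>x\<in>_\<close> by simp
    finally show ?thesis using i1[OF u] \<open>x\<in>_\<close> by simp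
   qed
   then show ?thesis using that by (simp add: N_def)
  qed
  have "(%x. restrict (\<phi> x) Y) ` carrier G\<subseteq>PiE Y (%_. Y)" using Ycl by auto
  then show "finite ((%x. restrict (\<phi> x) Y) ` carrier G)"
   by (rule finite_subset) (use finY in \<open>intro finite_PiE; simp\<close>)
  show "inv h\<otimes>x\<in>N" if "x\<in>carrier G" "h\<in>carrier G" "restrict (\<phi> x) Y = restrict (\<phi> h) Y" for x h
   using key[OF that(1,2)] that(3) by (metis restrict_apply')
 qed
 moreover have "g\<notin>N" using w i1 by (auto simp: N_def Y_def)
 ultimately show "\<exists>N. fin_normal G N\<and>g\<notin>N" by blast
qed

text \<open>The cyclic subgroup generated by \<open>g\<close> is told apart from the trivial one,
  which cannot happen in a quotient killing \<open>g\<close>.\<close>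

lemma (in group) subgroup_separable_residually_finite:
 assumes "subgroup_separable G"
 shows "residually_finite G"
 unfolding residually_finite_def
proof (intro ballI impI)
 fix g assume g: "g\<in>carrier G" "g ~= \<one>"
 let ?H = "generate G {g}" and ?K = "generate G {}"
 have fg: "subgroup (generate G S) G\<and>finitely_generated (G(|carrier := generate G S|))"
  if "S\<subseteq>carrier G" "finite S" for S
 proof -
  have s: "subgroup (generate G S) G" using generate_is_subgroup[OF that(1)] .
  have "S\<subseteq>generate G S" by (auto intro: generate.incl)
  then show ?thesis using s generate_consistent[OF _ s, of S] that(2)
   by (auto simp: finitely_generated_def)
 qed
 have K: "?K = {\<one>}" by (rule generate_empty)
 have "?H ~= ?K" using g generate.incl[of g "{g}" G] unfolding K by auto
 then obtain N where N: "N \<lhd> G" "finite (carrier (G Mod N))"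
  "(%g. N #> g) ` ?H ~= (%g. N #> g) ` ?K"
  using assms fg[of "{g}"] fg[of "{}"] g unfolding subgroup_separable_def
  by (metis empty_subsetI finite.emptyI finite.insertI insert_subset)
 have "g\<notin>N"
 proof
  assume gN: "g\<in>N"
  have sN: "subgroup N G" using N(1) by (rule normal_imp_subgroup)
  have "?H\<subseteq>N" using generate_subgroup_incl[OF _ sN, of "{g}"] gN by simp
  then have "N #> h = N" if "h\<in>?H" for h
   using that coset_join2[OF _ sN, of h] subgroup.mem_carrier[OF sN] by blast
  moreover have "\<one>\<in>?H" by (rule generate.one)
  moreover have "N #> \<one> = N" using coset_join2[OF _ sN, of \<one>] subgroup.one_closed[OF sN] by simp
  ultimately have "(%g. N #> g) ` ?H = (%g. N #> g) ` ?K" unfolding K by auto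
  then show False using N(3) by blast
 qed
 then show "\<exists>N. N \<lhd> G\<and>finite (carrier (G Mod N))\<and>g\<notin>N" using N by blast
qed

section \<open>Extensions of a Heisenberg group by a free group\<close>

lemma (in group) weval_hom:
 assumes F: "subgroup F G" and h: "h\<in>hom (G(|carrier := F|)) K" and K: "group K"
  and x: "x\<in>S \<rightarrow> F" and w: "w\<in>words S"
 shows "weval G x w\<in>F" "h (weval G x w) = weval K (%i. h (x i)) w"
proof -
 interpret F: subgroup F G by (rule F)
 interpret FG: group "G(|carrier := F|)" by (rule F.subgroup_is_group[OF group_axioms])
 interpret h: group_hom "G(|carrier := F|)" K h
  using h K FG.group_axioms by (simp add: group_hom_def group_hom_axioms_def)
 have hm: "h (a\<otimes>b) = h a \<otimes>\<^bsub>K\<^esub> h b" if "a\<in>F" "b\<in>F" for a b using h.hom_mult[of a b] that by simp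
 have hi: "h (inv a) = inv\<^bsub>K\<^esub> h a" if "a\<in>F" for a
  using h.hom_inv[of a] that m_inv_consistent[OF F that] by simp
 have h1: "h \<one> = \<one>\<^bsub>K\<^esub>" using h.hom_one by simp
 have "weval G x w\<in>F\<and>h (weval G x w) = weval K (%i. h (x i)) w"
  using w
 proof (induction w)
  case (Cons p w)
  obtain a b where p: "p = (a, b)" by (cases p)
  then have "x a\<in>F" using Cons.prems x by auto
  then show ?case using Cons p by (simp add: hm hi)
 qed (simp add: h1)
 then show "weval G x w\<in>F" "h (weval G x w) = weval K (%i. h (x i)) w" by blast+
qed

lemma (in group) weval_subgroup:
 assumes "subgroup F G" "x\<in>S \<rightarrow> F" "w\<in>words S"
 shows "weval G x w\<in>F"
 using weval_hom(1)[of F "%_. \<one>" G x S w] assms group_axioms by (auto simp: hom_def Pi_iff)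

lemma weval_cong: "w\<in>words S ==> (!!i. i\<in>S ==> f i = f' i) ==> weval K f w = weval K f' w"
proof (induction w)
 case (Cons p w)
 then show ?case by (cases p) simp
qed simp

lemma ma_inv: "ma A (inv\<^bsub>HH\<^esub> v) = inv\<^bsub>HH\<^esub> ma A v"
 by (cases A; cases v) (simp add: HH_inv)

lemma ma_cong0: "v\<in>cong0 k ==> ma A v\<in>cong0 k"
 by (cases A; cases v) (simp add: cong0_def)

text \<open>The dilation \<open>dil\<close> commutes with the action of \<open>SL\<^sub>2(\<int>)\<close>.\<close>

fun dil :: "hh => hh" where "dil (x, y, z) = (2 * x, 2 * y, 4 * z)"

lemma dil_hm: "dil (hm v w) = hm (dil v) (dil w)" by (cases v; cases w) simp

lemma dil_ma: "dil (ma A v) = ma A (dil v)" by (cases A; cases v) simp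

lemma dil_inv: "dil (inv\<^bsub>HH\<^esub> v) = inv\<^bsub>HH\<^esub> dil v" by (cases v) (simp add: HH_inv)

lemma dil_inj: "dil v = dil w ==> v = w" by (cases v; cases w) simp

fun hsize :: "hh => nat" where "hsize (x, y, z) = nat (\<bar>x\<bar> + \<bar>y\<bar> + \<bar>z\<bar>)"

lemma hsize_dil: "v ~= (0, 0, 0) ==> hsize v < hsize (dil v)"
 by (cases v) auto

text \<open>The group \<open>HH \<rtimes> SL\<^sub>2(\<int>)\<close> in dimension \<open>4\<close>, and another factor \<open>SL\<^sub>2(\<int>)\<close>.\<close>

fun R6 :: "hh => m2 => m2 => nat => nat => int" where
 "R6 (x, y, z) (a, b, c, d) (p, q, s, t) i j =
  [[1, x * c - y * a, x * d - y * b, z, 0, 0], [0, a, b, x, 0, 0], [0, c, d, y, 0, 0], [0, 0, 0, 1, 0, 0],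
   [0, 0, 0, 0, p, q], [0, 0, 0, 0, s, t]] ! i ! j"

lemma lt6: "{..<6} = {0, 1, 2, 3, 4, 5 :: nat}" by auto

text \<open>The first row contains the row vector (-y, x) A. The determinant enters because A
  preserves the alternating form of two vectors, which is what this row of the product
  requires.\<close>

lemma R6_mult:
 assumes det: "mdet A = 1" and ij: "i < 6" "j < 6"
 shows "R6 (hm v (ma A v')) (mm A A') (mm B B') i j = (\<Sum>k\<in>{..<6}. R6 v A B i k * R6 v' A' B' k j)"
proof -
 obtain x y z where v: "v = (x, y, z)" by (cases v)
 obtain x' y' z' where v': "v' = (x', y', z')" by (cases v')
 obtain a b c d where A: "A = (a, b, c, d)" by (cases A)
 obtain a' b' c' d' where A': "A' = (a', b', c', d')" by (cases A')
 obtain p q s t where B: "B = (p, q, s, t)" by (cases B)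
 obtain p' q' s' t' where B': "B' = (p', q', s', t')" by (cases B')
 have D: "a * d - b * c = 1" using det by (simp add: A)
 have 1: "(x + (a * x' + b * y')) * (c * u + d * w) - (y + (c * x' + d * y')) * (a * u + b * w) =
   (x' * w - y' * u) + ((x * c - y * a) * u + (x * d - y * b) * w)" for u w
 proof -
  have "(x + (a * x' + b * y')) * (c * u + d * w) - (y + (c * x' + d * y')) * (a * u + b * w) =
    (a * d - b * c) * (x' * w - y' * u) + ((x * c - y * a) * u + (x * d - y * b) * w)"
   by (simp add: algebra_simps)
  then show ?thesis using D by simp
 qed
 have 2: "z + z' + x * (c * x' + d * y') - y * (a * x' + b * y') = z' + ((x * c - y * a) * x' + ((x * d - y * b) * y' + z))"
  by (simp add: algebra_simps)
 have "i\<in>{0, 1, 2, 3, 4, 5}" "j\<in>{0, 1, 2, 3, 4, 5}" using ij unfolding lt6[symmetric] by auto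
 then show ?thesis
  unfolding v v' A A' B B' lt6 by (elim insertE emptyE) (simp_all add: 1 2)
qed

lemma UL0_pow: "(1, 2, 0, 1) [^]\<^bsub>SL2\<^esub> (n::nat) = (1, 2 * int n, 0, 1)"
 by (induction n) (simp_all add: algebra_simps)

lemma UL0_int_pow: "(1, 2, 0, 1) [^]\<^bsub>SL2\<^esub> (n::int) = (1, 2 * n, 0, 1)"
proof (cases n rule: int_cases2)
 case (nonneg m)
 then show ?thesis by (simp add: int_pow_int UL0_pow)
next
 case (nonpos m)
 then show ?thesis by (simp add: SL2.int_pow_neg int_pow_int UL0_pow SL2_inv)
qed

text \<open>In rank one the cyclic group generated by U takes the place of Sanov's group.\<close>

lemma UL0_generated: "generate SL2 (UL ` {0}) = {(1, 2 * n, 0, 1) | n. True}"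
proof
 have "subgroup {(1, 2 * n, 0, 1) | n :: int. True} SL2"
 proof (rule SL2.subgroupI)
  show "inv\<^bsub>SL2\<^esub> a\<in>{(1, 2 * n, 0, 1) | n :: int. True}" if a: "a\<in>{(1, 2 * n, 0, 1) | n :: int. True}" for a
  proof -
   obtain n :: int where n: "a = (1, 2 * n, 0, 1)" using a by blast
   have "inv\<^bsub>SL2\<^esub> a = (1, 2 * (- n), 0, 1)" by (simp add: n SL2_inv)
   then show ?thesis by blast
  qed
  show "a \<otimes>\<^bsub>SL2\<^esub> b\<in>{(1, 2 * n, 0, 1) | n :: int. True}"
   if ab: "a\<in>{(1, 2 * n, 0, 1) | n :: int. True}" "b\<in>{(1, 2 * n, 0, 1) | n :: int. True}" for a b
  proof -
   obtain n m :: int where n: "a = (1, 2 * n, 0, 1)" "b = (1, 2 * m, 0, 1)" using ab by blast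
   have "a \<otimes>\<^bsub>SL2\<^esub> b = (1, 2 * (m + n), 0, 1)" by (simp add: n)
   then show ?thesis by blast
  qed
 qed auto
 moreover have "UL 0\<in>{(1, 2 * n, 0, 1) | n :: int. True}"
  unfolding UL_def by (intro CollectI exI[of _ 1]) simp
 then have "UL ` {0}\<subseteq>{(1, 2 * n, 0, 1) | n :: int. True}" by blast
 ultimately show "generate SL2 (UL ` {0})\<subseteq>{(1, 2 * n, 0, 1) | n :: int. True}"
  by (intro SL2.generate_subgroup_incl)
 have g: "subgroup (generate SL2 (UL ` {0})) SL2" using UL_closed[of "{0}"] by (intro SL2.generate_is_subgroup) auto
 have "UL 0\<in>generate SL2 (UL ` {0})" by (auto intro: generate.incl)
 then have "(1, 2, 0, 1) [^]\<^bsub>SL2\<^esub> (n::int)\<in>generate SL2 (UL ` {0})" for n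
  using SL2.subgroup_int_pow_closed[OF g, of "(1, 2, 0, 1)" n] by (simp add: UL_def)
 then show "{(1, 2 * n, 0, 1) | n :: int. True}\<subseteq>generate SL2 (UL ` {0})" unfolding UL0_int_pow by blast
qed

text \<open>The elements \<open>x i\<close> freely generate a complement of \<open>J\<close> in
  \<open>F\<close>, expressed by \<open>lab\<close> for a single target: its factor \<open>G\<close>
  yields the section and homomorphisms from \<open>F\<close> to \<open>G\<close>, its factor
  \<open>SL2\<close> the matrices.\<close>

locale heis_free = heis_normal G J \<zeta> M for G (structure) and J :: "'a set" and \<zeta> :: "'a => hh" and M :: int +
 fixes F :: "'a set" and r :: nat and x :: "nat => 'a"
 assumes F: "subgroup F G" and F_idx: "fidx G (carrier G) F" and JF: "J\<subseteq>F"
  and x_F: "x\<in>{..<r} \<rightarrow> F" and x_Lin: "x\<in>{..<r} \<rightarrow> Lin" and F_gen: "F = generate G (J\<union>x ` {..<r})"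
  and lab: "lam\<in>{..<r} \<rightarrow> carrier (G \<times>\<times> SL2) ==>
   \<exists>\<sigma>\<in>hom (G(|carrier := F|)) (G \<times>\<times> SL2). (\<forall>j\<in>J. \<sigma> j = \<one>\<^bsub>G \<times>\<times> SL2\<^esub>)\<and>(\<forall>i < r. \<sigma> (x i) = lam i)"
begin

sublocale F: subgroup F G by (rule F)

lemma labG:
 assumes "lam\<in>{..<r} \<rightarrow> carrier G"
 shows "\<exists>\<sigma>. \<sigma>\<in>hom (G(|carrier := F|)) G\<and>(\<forall>j\<in>J. \<sigma> j = \<one>)\<and>(\<forall>i < r. \<sigma> (x i) = lam i)"
proof -
 have "(%i. (lam i, \<one>\<^bsub>SL2\<^esub>))\<in>{..<r} \<rightarrow> carrier (G \<times>\<times> SL2)" using assms by (auto simp: DirProd_def)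
 from lab[OF this] obtain \<sigma> where \<sigma>: "\<sigma>\<in>hom (G(|carrier := F|)) (G \<times>\<times> SL2)" "\<forall>j\<in>J. \<sigma> j = \<one>\<^bsub>G \<times>\<times> SL2\<^esub>"
  "\<forall>i < r. \<sigma> (x i) = (lam i, \<one>\<^bsub>SL2\<^esub>)" by blast
 have "(%g. fst (\<sigma> g))\<in>hom (G(|carrier := F|)) G"
  using \<sigma>(1) by (auto simp: hom_def DirProd_def Pi_iff mem_Times_iff split_beta)
 then show ?thesis using \<sigma>(2,3) by (intro exI[of _ "%g. fst (\<sigma> g)"]) simp
qed

lemma labS:
 assumes "lam\<in>{..<r} \<rightarrow> carrier SL2"
 shows "\<exists>\<sigma>. \<sigma>\<in>hom (G(|carrier := F|)) SL2\<and>(\<forall>j\<in>J. \<sigma> j = \<one>\<^bsub>SL2\<^esub>)\<and>(\<forall>i < r. \<sigma> (x i) = lam i)"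
proof -
 have "(%i. (\<one>, lam i))\<in>{..<r} \<rightarrow> carrier (G \<times>\<times> SL2)" using assms by (auto simp: DirProd_def)
 from lab[OF this] obtain \<sigma> where \<sigma>: "\<sigma>\<in>hom (G(|carrier := F|)) (G \<times>\<times> SL2)" "\<forall>j\<in>J. \<sigma> j = \<one>\<^bsub>G \<times>\<times> SL2\<^esub>"
  "\<forall>i < r. \<sigma> (x i) = (\<one>, lam i)" by blast
 have "(%g. snd (\<sigma> g))\<in>hom (G(|carrier := F|)) SL2"
  using \<sigma>(1) by (auto simp: hom_def DirProd_def Pi_iff mem_Times_iff split_beta)
 then show ?thesis using \<sigma>(2,3) by (intro exI[of _ "%g. snd (\<sigma> g)"]) simp
qed

section \<open>Coordinates of a semidirect product\<close>

lemma x_carrier: "x\<in>{..<r} \<rightarrow> carrier G" using x_F F.subset by blast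

lemma F_words:
 assumes "g\<in>F"
 obtains w j where "w\<in>words {..<r}" "reduced w" "j\<in>J" "g = weval G x w\<otimes>j"
 using generate_normal_words[OF J x_carrier, of g] assms F_gen by blast

lemma hom_words:
 assumes h: "h\<in>hom (G(|carrier := F|)) K" "group K" "!!j. j\<in>J ==> h j = \<one>\<^bsub>K\<^esub>"
  and w: "w\<in>words {..<r}" "j\<in>J"
 shows "h (weval G x w\<otimes>j) = weval K (%i. h (x i)) w"
proof -
 interpret K: group K by (rule h(2))
 note W = weval_hom[OF F h(1,2) x_F w(1)]
 have "h (weval G x w\<otimes>j) = h (weval G x w) \<otimes>\<^bsub>K\<^esub> h j"
  using h(1) W(1) w(2) JF by (auto simp: hom_def)
 moreover have "h (weval G x w)\<in>carrier K" using hom_in_carrier[OF h(1)] W(1) by simp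
 ultimately show ?thesis using W(2) h(3)[OF w(2)] by simp
qed

text \<open>Modulo \<open>J\<close> an element is a reduced word in the \<open>x i\<close>, and
  freeness of the images leaves only the empty word.\<close>

lemma free_kernel:
 assumes h: "h\<in>hom (G(|carrier := F|)) SL2" "!!j. j\<in>J ==> h j = \<one>\<^bsub>SL2\<^esub>" "!!i. i < r ==> h (x i) = f i"
  and free: "!!w. reduced w ==> w ~= [] ==> w\<in>words {..<r} ==> weval SL2 f w ~= (1, 0, 0, 1)"
  and g: "g\<in>F" "h g = (1, 0, 0, 1)"
 shows "g\<in>J"
proof -
 obtain w j where w: "w\<in>words {..<r}" "reduced w" "j\<in>J" "g = weval G x w\<otimes>j" by (rule F_words[OF g(1)])
 have "weval SL2 f w = weval SL2 (%i. h (x i)) w" by (rule weval_cong[OF w(1)]) (simp add: h(3))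
 also have "\<dots> = h g" unfolding w(4) using hom_words[OF h(1) SL2.group_axioms h(2) w(1,3)] by simp
 finally have "w = []" using free[OF w(2) _ w(1)] g(2) by auto
 then show ?thesis using w by simp
qed

text \<open>The retraction of \<open>F\<close> onto the complement generated by the
  \<open>x i\<close>, with kernel \<open>J\<close>.\<close>

definition sec :: "'a => 'a" where
 "sec = (SOME \<sigma>. \<sigma>\<in>hom (G(|carrier := F|)) G\<and>(\<forall>j\<in>J. \<sigma> j = \<one>)\<and>(\<forall>i < r. \<sigma> (x i) = x i))"

lemma sec_props: "sec\<in>hom (G(|carrier := F|)) G" "j\<in>J ==> sec j = \<one>" "i < r ==> sec (x i) = x i"
 using someI_ex[OF labG[OF x_carrier], folded sec_def] by blast+

lemma sec_mult: "g\<in>F ==> h\<in>F ==> sec (g\<otimes>h) = sec g\<otimes>sec h"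
 using sec_props(1) by (simp add: hom_def)

lemma sec_Lin: assumes "g\<in>F" shows "sec g\<in>Lin" "sec g\<in>carrier G" "g\<otimes>inv (sec g)\<in>J"
proof -
 obtain w j where w: "w\<in>words {..<r}" "reduced w" "j\<in>J" "g = weval G x w\<otimes>j" by (rule F_words[OF assms])
 have "sec g = weval G (%i. sec (x i)) w"
  unfolding w(4) using hom_words[OF sec_props(1) group_axioms sec_props(2) w(1,3)] by simp
 also have "\<dots> = weval G x w" by (rule weval_cong[OF w(1)]) (simp add: sec_props(3))
 finally have s: "sec g = weval G x w" .
 show "sec g\<in>Lin" unfolding s by (rule weval_subgroup[OF Lin_subgroup x_Lin w(1)])
 show c: "sec g\<in>carrier G" unfolding s by (rule weval_closed[OF x_carrier w(1)])
 have "g\<otimes>inv (sec g) = sec g\<otimes>j\<otimes>inv (sec g)" using w(4) s by simp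
 then show "g\<otimes>inv (sec g)\<in>J" using conj_J[OF c w(3)] by simp
qed

text \<open>The coordinates of the \<open>J\<close>-part of \<open>g\<close>; together with
  \<open>A g\<close> they multiply as in the semidirect product with \<open>SL2\<close>, see
  \<open>dd_mult\<close>.\<close>

definition dd :: "'a => hh" where "dd g = \<zeta> (g\<otimes>inv (sec g))"

abbreviation "A g \<equiv> mat_of (sec g)"

lemma lin_sec: "g\<in>F ==> lin (sec g) (A g)" by (rule lin_mat_of[OF sec_Lin(1)])

lemma det_A: "g\<in>F ==> mdet (A g) = 1" using lin_sec by (simp add: lin_def)

lemma \<zeta>_conj_sec: "g\<in>F ==> j\<in>J ==> \<zeta> (sec g\<otimes>j\<otimes>inv (sec g)) = ma (A g) (\<zeta> j)"
 using lin_sec by (simp add: lin_def)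

lemma A_mult: "g\<in>F ==> h\<in>F ==> A (g\<otimes>h) = mm (A g) (A h)"
 by (simp add: sec_mult mat_of_mult sec_Lin)

lemma dd_mult: assumes "g\<in>F" "h\<in>F" shows "dd (g\<otimes>h) = hm (dd g) (ma (A g) (dd h))"
proof -
 have c: "g\<in>carrier G" "h\<in>carrier G" "sec g\<in>carrier G" "sec h\<in>carrier G" using assms sec_Lin(2) by auto
 have "g\<otimes>h\<otimes>inv (sec (g\<otimes>h)) = (g\<otimes>inv (sec g))\<otimes>(sec g\<otimes>(h\<otimes>inv (sec h))\<otimes>inv (sec g))"
  using c by (simp add: sec_mult assms inv_mult_group m_assoc)
 then show ?thesis
  unfolding dd_def using \<zeta>_m[OF sec_Lin(3)[OF assms(1)] conj_J[OF c(3) sec_Lin(3)[OF assms(2)]]]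
   \<zeta>_conj_sec[OF assms(1) sec_Lin(3)[OF assms(2)]] by simp
qed

lemma dd_J: "j\<in>J ==> dd j = \<zeta> j" by (simp add: dd_def sec_props(2))

lemma A_J: "j\<in>J ==> A j = (1, 0, 0, 1)" using mat_of_eq[OF lin_one] by (simp add: sec_props(2))

lemma dd_inv: assumes "g\<in>F" shows "dd (inv g) = inv\<^bsub>HH\<^esub> ma (A (inv g)) (dd g)"
proof -
 have "hm (dd (inv g)) (ma (A (inv g)) (dd g)) = (0, 0, 0)"
  using dd_mult[of "inv g" g] assms dd_J[OF J.one_closed] by (simp add: \<zeta>_one)
 then show ?thesis using HH.inv_equality[of "dd (inv g)" "ma (A (inv g)) (dd g)"] by simp
qed

text \<open>The action on \<open>J\<close> may have a large kernel on the complement, so the free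
  family \<open>conjL\<close> is added as a second block. If both blocks are trivial, the second
  puts the element into \<open>J\<close>, and there \<zeta> identifies it. The representation is
  then induced from \<open>F\<close> to \<open>G\<close>.\<close>

theorem linear: "linear_over_int G"
proof -
 have "conjL\<in>{..<r} \<rightarrow> carrier SL2" by (rule conjL_closed)
 from labS[OF this] obtain \<mu> where \<mu>: "\<mu>\<in>hom (G(|carrier := F|)) SL2" "\<forall>j\<in>J. \<mu> j = \<one>\<^bsub>SL2\<^esub>" "\<forall>i < r. \<mu> (x i) = conjL i"
  by blast
 let ?R = "%g. R6 (dd g) (A g) (\<mu> g)"
 have "faithful_rep (G(|carrier := F|)) {..<6} ?R"
  unfolding faithful_rep_def int_rep_def
 proof (intro conjI ballI impI)
  fix g h i j assume g: "g\<in>carrier (G(|carrier := F|))" "h\<in>carrier (G(|carrier := F|))" and ij: "i\<in>{..<6::nat}" "j\<in>{..<6::nat}"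
  have "\<mu> (g\<otimes>h) = mm (\<mu> g) (\<mu> h)" using \<mu>(1) g by (simp add: hom_def)
  then show "?R (g \<otimes>\<^bsub>G(|carrier := F|)\<^esub> h) i j = (\<Sum>k\<in>{..<6}. ?R g i k * ?R h k j)"
   using g ij by (simp add: dd_mult A_mult R6_mult det_A)
 next
  fix i j assume ij: "i\<in>{..<6::nat}" "j\<in>{..<6::nat}"
  have 1: "dd \<one> = (0, 0, 0)" "A \<one> = (1, 0, 0, 1)" "\<mu> \<one> = (1, 0, 0, 1)"
   using dd_J[OF J.one_closed] A_J[OF J.one_closed] \<mu>(2) J.one_closed by (simp_all add: \<zeta>_one)
  show "?R \<one>\<^bsub>G(|carrier := F|)\<^esub> i j = of_bool (i = j)"
   using ij unfolding lt6 by (elim insertE emptyE) (simp_all add: 1)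
 next
  fix g assume g: "g\<in>carrier (G(|carrier := F|))" and e: "\<forall>i\<in>{..<6::nat}. \<forall>j\<in>{..<6}. ?R g i j = of_bool (i = j)"
  obtain a b c d where \<mu>g: "\<mu> g = (a, b, c, d)" by (cases "\<mu> g")
  obtain p q s where dg: "dd g = (p, q, s)" by (cases "dd g")
  obtain a' b' c' d' where Ag: "A g = (a', b', c', d')" by (cases "A g")
  have e': "?R g i j = of_bool (i = j)" if "i < 6" "j < 6" for i j using e that by simp
  have "\<mu> g = (1, 0, 0, 1)" using e'[of 4 4] e'[of 4 5] e'[of 5 4] e'[of 5 5] by (simp add: \<mu>g dg Ag)
  then have gJ: "g\<in>J"
   using free_kernel[OF \<mu>(1), of conjL g] \<mu>(2,3) conjL_free g by auto
  have "dd g = (0, 0, 0)" using e'[of 0 3] e'[of 1 3] e'[of 2 3] by (simp add: \<mu>g dg Ag)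
  then have "\<zeta> g = \<zeta> \<one>" using dd_J[OF gJ] \<zeta>_one by simp
  then show "g = \<one>\<^bsub>G(|carrier := F|)\<^esub>" using \<zeta>_eq[OF gJ J.one_closed] by simp
 qed simp
 from faithful_rep_induced[OF F F_idx this] show ?thesis
  using faithful_rep_linear by (metis empty_iff lessThan_iff zero_less_numeral)
qed

text \<open>The domain of the virtual endomorphism that undoes \<open>dil\<close> on the
  \<open>J\<close>-part and keeps the complement.\<close>

definition H1 :: "'a set" where "H1 = {g\<in>F. \<exists>j\<in>J. dd g = dil (\<zeta> j)}"

definition th :: "'a => 'a" where "th g = (SOME j. j\<in>J\<and>dd g = dil (\<zeta> j))"

lemma th: "g\<in>H1 ==> th g\<in>J" "g\<in>H1 ==> dil (\<zeta> (th g)) = dd g"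
 unfolding th_def H1_def by (metis (mono_tags, lifting) mem_Collect_eq someI_ex)+

lemma th_eq: "g\<in>F ==> j\<in>J ==> dd g = dil (\<zeta> j) ==> g\<in>H1\<and>th g = j"
proof -
 assume a: "g\<in>F" "j\<in>J" "dd g = dil (\<zeta> j)"
 then have g: "g\<in>H1" by (auto simp: H1_def)
 have "\<zeta> (th g) = \<zeta> j" using th(2)[OF g] a(3) by (rule_tac dil_inj) simp
 then show ?thesis using g \<zeta>_eq[OF th(1)[OF g] a(2)] by simp
qed

text \<open>The dilation commutes with \<open>hm\<close> and with every \<open>ma A\<close>, so its
  inverse respects the semidirect multiplication.\<close>

lemma H1_mult:
 assumes "g\<in>H1" "h\<in>H1"
 shows "g\<otimes>h\<in>H1" "th (g\<otimes>h) = th g\<otimes>(sec g\<otimes>th h\<otimes>inv (sec g))"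
proof -
 have F: "g\<in>F" "h\<in>F" using assms by (auto simp: H1_def)
 have j: "sec g\<otimes>th h\<otimes>inv (sec g)\<in>J" using conj_J[OF sec_Lin(2)[OF F(1)] th(1)[OF assms(2)]] .
 have "dd (g\<otimes>h) = dil (\<zeta> (th g\<otimes>(sec g\<otimes>th h\<otimes>inv (sec g))))"
  using assms F j by (simp only: dd_mult \<zeta>_m th dil_hm dil_ma \<zeta>_conj_sec)
 moreover have "th g\<otimes>(sec g\<otimes>th h\<otimes>inv (sec g))\<in>J" using J.m_closed[OF th(1)[OF assms(1)] j] .
 ultimately show "g\<otimes>h\<in>H1" "th (g\<otimes>h) = th g\<otimes>(sec g\<otimes>th h\<otimes>inv (sec g))"
  using th_eq[of "g\<otimes>h"] F by auto
qed

lemma H1_subgroup: "subgroup H1 G"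
proof (rule subgroupI)
 show "H1\<subseteq>carrier G" using F.subset unfolding H1_def by blast
 have "dd \<one> = dil (\<zeta> \<one>)" using dd_J[OF J.one_closed] by (simp add: \<zeta>_one)
 then have "\<one>\<in>H1" using th_eq[OF F.one_closed J.one_closed] by blast
 then show "H1 ~= {}" by blast
 show "inv g\<in>H1" if g: "g\<in>H1" for g
 proof -
  have gF: "g\<in>F" "inv g\<in>F" using g by (auto simp: H1_def)
  let ?j = "inv (sec (inv g)\<otimes>th g\<otimes>inv (sec (inv g)))"
  have c: "sec (inv g)\<otimes>th g\<otimes>inv (sec (inv g))\<in>J" using conj_J[OF sec_Lin(2)[OF gF(2)] th(1)[OF g]] .
  have "dd (inv g) = inv\<^bsub>HH\<^esub> ma (A (inv g)) (dil (\<zeta> (th g)))" using dd_inv[OF gF(1)] th(2)[OF g] by simp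
  also have "\<dots> = dil (\<zeta> ?j)"
   by (simp only: \<zeta>_inv[OF c] \<zeta>_conj_sec[OF gF(2) th(1)[OF g]] dil_inv dil_ma)
  finally have "dd (inv g) = dil (\<zeta> ?j)" .
  then show ?thesis using th_eq[OF gF(2) J.m_inv_closed[OF c]] by blast
 qed
qed (rule H1_mult(1))

lemma H1_idx: "fidx G (carrier G) H1"
proof (rule fidx_trans[OF F_idx _ subset_refl subgroup.subset[OF H1_subgroup]])
 \<comment> \<open>The modulus is 4 M because (4 M u, 4 M v, 4 M w) is the dilation of (2 M u, 2 M
   v, M w), which has a preimage in \<open>J\<close>.\<close>
 define R where "R = (%(a :: int, b :: int, c :: int). (a mod (4 * M), b mod (4 * M), c mod (4 * M)))"
 show "fidx G F H1"
 proof (rule fidxI[where \<kappa> = "%g. R (dd g)"])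
  let ?I = "{0..<4 * M}"
  have "R v\<in>?I\<times>?I\<times>?I" for v using M_pos by (cases v) (simp add: R_def)
  then have "(%g. R (dd g)) ` F\<subseteq>?I\<times>?I\<times>?I" by blast
  then show "finite ((%g. R (dd g)) ` F)" by (rule finite_subset) simp
  fix a b assume ab: "a\<in>F" "b\<in>F" "R (dd a) = R (dd b)"
  have i: "hm (inv\<^bsub>HH\<^esub> dd b) (dd a)\<in>cong0 (4 * M)"
   using ab(3) by (cases "dd a"; cases "dd b") (simp del: hm.simps add: cong0_same_residues R_def)
  have iF: "inv b\<in>F" using ab by simp
  have "dd (inv b\<otimes>a) = hm (dd (inv b)) (ma (A (inv b)) (dd a))" by (rule dd_mult[OF iF ab(1)])
  also have "dd (inv b) = ma (A (inv b)) (inv\<^bsub>HH\<^esub> dd b)" by (simp add: dd_inv[OF ab(2)] ma_inv)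
  also have "hm (ma (A (inv b)) (inv\<^bsub>HH\<^esub> dd b)) (ma (A (inv b)) (dd a)) = ma (A (inv b)) (hm (inv\<^bsub>HH\<^esub> dd b) (dd a))"
   by (simp only: ma_hm[OF det_A[OF iF]])
  finally have "dd (inv b\<otimes>a)\<in>cong0 (4 * M)" using ma_cong0[OF i] by simp
  then obtain u v w where uvw: "dd (inv b\<otimes>a) = (4 * M * u, 4 * M * v, 4 * M * w)" by (auto simp: cong0_def elim!: dvdE)
  have c: "(2 * M * u, 2 * M * v, M * w)\<in>cong0 M" by (simp add: cong0_def)
  have "dd (inv b\<otimes>a) = dil (\<zeta> (pre (2 * M * u, 2 * M * v, M * w)))" by (simp add: pre(2)[OF c] uvw)
  then show "inv b\<otimes>a\<in>H1" using th_eq[OF F.m_closed[OF iF ab(1)] pre(1)[OF c]] by blast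
 qed (rule F.subset)
qed

lemma f1_hom: "(%g. th g\<otimes>sec g)\<in>hom (G(|carrier := H1|)) G"
proof (rule homI)
 fix g assume "g\<in>carrier (G(|carrier := H1|))"
 then have "g\<in>H1" "g\<in>F" by (auto simp: H1_def)
 then show "th g\<otimes>sec g\<in>carrier G" using th(1) sec_Lin(2) by simp
next
 fix g h assume "g\<in>carrier (G(|carrier := H1|))" "h\<in>carrier (G(|carrier := H1|))"
 then have gh: "g\<in>H1" "h\<in>H1" and F: "g\<in>F" "h\<in>F" by (auto simp: H1_def)
 then show "th (g \<otimes>\<^bsub>G(|carrier := H1|)\<^esub> h)\<otimes>sec (g \<otimes>\<^bsub>G(|carrier := H1|)\<^esub> h) = th g\<otimes>sec g\<otimes>(th h\<otimes>sec h)"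
  using th(1)[OF gh(1)] th(1)[OF gh(2)] sec_Lin(2)[OF F(1)] sec_Lin(2)[OF F(2)]
  by (simp add: H1_mult sec_mult m_assoc)
qed

text \<open>Undoing the dilation strictly shrinks nonzero coordinates, so descent ends at the
  identity.\<close>

lemma f1_core:
 assumes K: "K\<subseteq>J" "K\<subseteq>H1" "!!k. k\<in>K ==> th k\<otimes>sec k\<in>K" and "k\<in>K"
 shows "k = \<one>"
 using assms(4)
proof (induction "hsize (\<zeta> k)" arbitrary: k rule: less_induct)
 case less
 have kJ: "k\<in>J" "k\<in>H1" using less.prems K by auto
 have t: "th k\<in>J" "th k\<in>K" using th(1)[OF kJ(2)] K(3)[OF less.prems] sec_props(2)[OF kJ(1)] by auto
 have \<zeta>k: "\<zeta> k = dil (\<zeta> (th k))" using th(2)[OF kJ(2)] dd_J[OF kJ(1)] by simp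
 have "\<zeta> (th k) = (0, 0, 0)"
 proof (rule ccontr)
  assume "\<zeta> (th k) ~= (0, 0, 0)"
  moreover from hsize_dil[OF this] have "th k = \<one>" using less.hyps[OF _ t(2)] \<zeta>k by simp
  ultimately show False by (simp add: \<zeta>_one)
 qed
 then have "\<zeta> k = \<zeta> \<one>" using \<zeta>k \<zeta>_one by simp
 then show ?case using \<zeta>_eq[OF kJ(1) J.one_closed] by simp
qed

text \<open>The inverse dilation excludes nontrivial invariant normal subgroups inside
  \<open>J\<close>; the two further virtual endomorphisms have to force a common invariant normal
  subgroup into \<open>J\<close>.\<close>

lemma self_similarI:
 assumes H2: "subgroup H2 G" "fidx G (carrier G) H2" "f2\<in>hom (G(|carrier := H2|)) G"
  and H3: "subgroup H3 G" "fidx G (carrier G) H3" "f3\<in>hom (G(|carrier := H3|)) G"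
  and core: "!!K. K \<lhd> G ==> K\<subseteq>F ==> K\<subseteq>H2 ==> K\<subseteq>H3 ==> f2 ` K\<subseteq>K ==> f3 ` K\<subseteq>K ==> K\<subseteq>J"
 shows "self_similar G"
proof -
 define H where "H i = (if i = 0 then H1 else if i = 1 then H2 else H3)" for i :: nat
 define f where "f i = (if i = 0 then (%g. th g\<otimes>sec g) else if i = 1 then f2 else f3)" for i :: nat
 show ?thesis
 proof (rule self_similar_virtual_endos[where I = "{0, 1, 2 :: nat}" and H = H and f = f])
  show "subgroup (H i) G" "fidx G (carrier G) (H i)" "f i\<in>hom (G(|carrier := H i|)) G" if "i\<in>{0, 1, 2}" for i
   using that H1_subgroup H1_idx f1_hom H2 H3 by (auto simp: H_def f_def)
  fix K assume K: "K \<lhd> G" and inv: "!!i. i\<in>{0, 1, 2 :: nat} ==> K\<subseteq>H i\<and>f i ` K\<subseteq>K"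
  have K1: "K\<subseteq>H1" "!!k. k\<in>K ==> th k\<otimes>sec k\<in>K" using inv[of 0] by (auto simp: H_def f_def)
  have "K\<subseteq>F" using K1(1) by (auto simp: H1_def)
  moreover have "K\<subseteq>H2" "f2 ` K\<subseteq>K" "K\<subseteq>H3" "f3 ` K\<subseteq>K" using inv[of 1] inv[of 2] by (simp_all add: H_def f_def)
  ultimately have KJ: "K\<subseteq>J" using core[OF K] by blast
  have "K\<subseteq>{\<one>}" using f1_core[OF KJ K1] by blast
  then show "K = {\<one>}" using subgroup.one_closed[OF normal_imp_subgroup[OF K]] by blast
 qed auto
qed

text \<open>On the image \<open>\<mu>(F)\<close>, generated by one or two matrices, conjugation by \<open>diag(1, 3)\<close> is a virtual
 endomorphism without invariant normal subgroups.\<close>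

theorem self_similar: "self_similar G"
proof (cases "r = 0")
 case True
 have "F = J" unfolding F_gen True using generateI[OF J.subgroup_axioms, of J] by (auto intro: generate.incl)
 \<comment> \<open>With F = J nothing has to be forced, and \<open>sec\<close> fills the two
   remaining places.\<close>
 then show ?thesis
  using self_similarI[OF F F_idx sec_props(1) F F_idx sec_props(1)] by blast
next
 case False
 define D where "D = {..<min r 2}"
 have D: "D\<subseteq>{..<r}" "D\<subseteq>{0, 1}" by (auto simp: D_def)
 \<comment> \<open>Generators beyond the first two are sent to 1, so that the image is exactly
   Sanov's group or the cyclic group.\<close>
 define lam where "lam i = (if i\<in>D then UL i else (1, 0, 0, 1))" for i
 have "lam\<in>{..<r} \<rightarrow> carrier SL2" using UL_closed[of UNIV] by (auto simp: lam_def)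
 from labS[OF this] obtain \<mu> where \<mu>: "\<mu>\<in>hom (G(|carrier := F|)) SL2" "!!j. j\<in>J ==> \<mu> j = \<one>\<^bsub>SL2\<^esub>"
  "!!i. i < r ==> \<mu> (x i) = lam i" by blast
 have \<mu>m: "\<mu> (g\<otimes>h) = mm (\<mu> g) (\<mu> h)" if "g\<in>F" "h\<in>F" for g h using \<mu>(1) that by (simp add: hom_def)
 have \<mu>1: "\<mu> \<one> = (1, 0, 0, 1)" using \<mu>(2)[OF J.one_closed] by simp
 have \<mu>c: "mdet (\<mu> g) = 1" if "g\<in>F" for g using hom_in_carrier[OF \<mu>(1)] that by simp
 have \<mu>i: "\<mu> (inv g) = inv\<^bsub>SL2\<^esub> \<mu> g" if "g\<in>F" for g
  using \<mu>m[of "inv g" g] \<mu>1 \<mu>c that by (intro SL2.inv_equality[symmetric]) simp_all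
 define Sd where "Sd = generate SL2 (UL ` D)"
 have Sd: "subgroup Sd SL2" unfolding Sd_def using UL_closed[of D] by (intro SL2.generate_is_subgroup) auto
 have \<mu>Sd: "\<mu> g\<in>Sd" if g: "g\<in>F" for g
 proof -
  obtain w j where w: "w\<in>words {..<r}" "reduced w" "j\<in>J" "g = weval G x w\<otimes>j" by (rule F_words[OF g])
  have "\<mu> (x i)\<in>Sd" if "i < r" for i
  proof (cases "i\<in>D")
   case True
   then show ?thesis unfolding \<mu>(3)[OF that] lam_def Sd_def by (auto intro: generate.incl)
  next
   case False
   then show ?thesis using subgroup.one_closed[OF Sd] unfolding \<mu>(3)[OF that] lam_def by simp
  qed
  then have "(%i. \<mu> (x i))\<in>{..<r} \<rightarrow> Sd" by auto
  from SL2.weval_subgroup[OF Sd this w(1)] show ?thesis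
   unfolding w(4) using hom_words[OF \<mu>(1) SL2.group_axioms \<mu>(2) w(1,3)] by simp
 qed
 \<comment> \<open>On the subgroup generated by the first one or two \<open>x i\<close> the map
   \<mu> is an isomorphism onto \<open>Sd\<close>; its inverse \<eta> brings \<open>con3\<close>
   back into \<open>G\<close>.\<close>
 define P where "P = generate G (x ` D)"
 have xD: "x\<in>D \<rightarrow> F" "x\<in>D \<rightarrow> carrier G" using x_F x_carrier D(1) by auto
 have PF: "P\<subseteq>F" unfolding P_def using xD(1) by (intro generate_subgroup_incl[OF _ F]) auto
 have P: "subgroup P G" unfolding P_def using xD(2) by (intro generate_is_subgroup) auto
 have inj: "p = \<one>" if p: "p\<in>P" "\<mu> p = (1, 0, 0, 1)" for p
 proof -
  have "p\<in>generate G ({\<one>}\<union>x ` D)" using p(1) mono_generate[of "x ` D" "{\<one>}\<union>x ` D"] unfolding P_def by blast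
  then obtain w j where w: "w\<in>words D" "reduced w" "j\<in>{\<one>}" "p = weval G x w\<otimes>j"
   using generate_normal_words[OF one_is_normal xD(2)] by blast
  then have pw: "p = weval G x w" using weval_closed[OF xD(2) w(1)] by simp
  have "\<mu> p = weval SL2 (%i. \<mu> (x i)) w" unfolding pw by (rule weval_hom(2)[OF F \<mu>(1) SL2.group_axioms xD(1) w(1)])
  also have "\<dots> = weval SL2 UL w" by (rule weval_cong[OF w(1)]) (use \<mu>(3) D in \<open>auto simp: lam_def\<close>)
  finally have "weval SL2 UL w = (1, 0, 0, 1)" using p(2) by simp
  moreover have "w\<in>words {0, 1}" using w(1) D(2) by (auto simp: words_def)
  ultimately have "w = []" using UL_free[OF w(2)] by blast
  then show ?thesis using pw by simp
 qed
 have inj': "p = q" if pq: "p\<in>P" "q\<in>P" "\<mu> p = \<mu> q" for p q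
 proof -
  interpret P: subgroup P G by (rule P)
  have F': "p\<in>F" "q\<in>F" using pq PF by auto
  have "\<mu> (inv p\<otimes>q) = (1, 0, 0, 1)" using F' pq(3) \<mu>c SL2.l_inv[of "\<mu> q"] by (simp add: \<mu>m \<mu>i)
  then have "inv p\<otimes>q = \<one>" using inj pq by simp
  then show ?thesis using pq F' by (metis F.mem_carrier inv_closed inv_inv inv_equality)
 qed
 have surj: "\<exists>p\<in>P. \<mu> p = B" if "B\<in>Sd" for B
 proof -
  interpret P: subgroup P G by (rule P)
  have "subgroup (\<mu> ` P) SL2"
  proof (rule SL2.subgroupI)
   show "\<mu> ` P\<subseteq>carrier SL2" using \<mu>c PF by auto
   show "\<mu> ` P ~= {}" using P.one_closed by blast
   show "inv\<^bsub>SL2\<^esub> a\<in>\<mu> ` P" if a: "a\<in>\<mu> ` P" for a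
   proof -
    obtain p where p: "p\<in>P" "a = \<mu> p" using a by blast
    have "inv\<^bsub>SL2\<^esub> a = \<mu> (inv p)" using \<mu>i[of p] p PF by auto
    then show ?thesis using P.m_inv_closed[OF p(1)] by blast
   qed
   show "a \<otimes>\<^bsub>SL2\<^esub> b\<in>\<mu> ` P" if ab: "a\<in>\<mu> ` P" "b\<in>\<mu> ` P" for a b
   proof -
    obtain p q where p: "p\<in>P" "a = \<mu> p" "q\<in>P" "b = \<mu> q" using ab by blast
    have pq: "p\<in>F" "q\<in>F" using p PF by blast+
    have "a \<otimes>\<^bsub>SL2\<^esub> b = \<mu> (p\<otimes>q)" unfolding p(2,4) \<mu>m[OF pq] by simp
    then show ?thesis using P.m_closed[OF p(1,3)] by blast
   qed
  qed
  moreover have "UL ` D\<subseteq>\<mu> ` P"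
  proof
   fix B assume "B\<in>UL ` D"
   then obtain i where i: "i\<in>D" "B = UL i" by blast
   then have "B = \<mu> (x i)" using \<mu>(3) D(1) by (auto simp: lam_def)
   moreover have "x i\<in>P" unfolding P_def using i(1) by (auto intro: generate.incl)
   ultimately show "B\<in>\<mu> ` P" by blast
  qed
  ultimately have "Sd\<subseteq>\<mu> ` P" unfolding Sd_def by (intro SL2.generate_subgroup_incl)
  then show ?thesis using that by blast
 qed
 have "\<forall>B\<in>Sd. \<exists>p. p\<in>P\<and>\<mu> p = B" using surj by blast
 from bchoice[OF this] obtain \<eta> where \<eta>: "!!B. B\<in>Sd ==> \<eta> B\<in>P" "!!B. B\<in>Sd ==> \<mu> (\<eta> B) = B" by blast
 have \<eta>m: "\<eta> (mm B C) = \<eta> B\<otimes>\<eta> C" if "B\<in>Sd" "C\<in>Sd" for B C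
 proof (rule inj')
  have BC: "mm B C\<in>Sd" using subgroup.m_closed[OF Sd that] by simp
  then show "\<eta> (mm B C)\<in>P" by (rule \<eta>(1))
  show "\<eta> B\<otimes>\<eta> C\<in>P" using subgroup.m_closed[OF P \<eta>(1)[OF that(1)] \<eta>(1)[OF that(2)]] .
  show "\<mu> (\<eta> (mm B C)) = \<mu> (\<eta> B\<otimes>\<eta> C)"
   unfolding \<mu>m[OF subsetD[OF PF \<eta>(1)[OF that(1)]] subsetD[OF PF \<eta>(1)[OF that(2)]]]
    \<eta>(2)[OF BC] \<eta>(2)[OF that(1)] \<eta>(2)[OF that(2)] ..
 qed
 have Sd_cases: "Sd = sanov\<or>Sd = {(1, 2 * n, 0, 1) | n. True}"
 proof (cases "r = 1")
  case True
  then have "D = {0}" by (auto simp: D_def)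
  then show ?thesis using UL0_generated by (simp add: Sd_def)
 next
  case r: False
  then have "D = {0, 1}" using False by (auto simp: D_def)
  then show ?thesis using sanov_generated by (simp add: Sd_def)
 qed
 have con: "con3 B\<in>Sd" if B: "B\<in>Sd" "3 dvd fst (snd B)" for B
  using Sd_cases
 proof
  assume "Sd = sanov"
  then show ?thesis using con3_sanov B by simp
 next
  assume S: "Sd = {(1, 2 * n, 0, 1) | n. True}"
  then obtain n where n: "B = (1, 2 * n, 0, 1)" using B(1) by blast
  then have "3 dvd n" using B(2) by (simp add: n) presburger
  then obtain m where "n = 3 * m" by blast
  then have "con3 B = (1, 2 * m, 0, 1)" by (simp add: n)
  then show ?thesis using S by blast
 qed
 have con_core: "B = (1, 0, 0, 1)"
  if K: "K\<subseteq>Sd" "!!B. B\<in>K ==> 3 dvd fst (snd B)\<and>con3 B\<in>K"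
   "!!C B. C\<in>Sd ==> B\<in>K ==> mm (mm C B) (inv\<^bsub>SL2\<^esub> C)\<in>K" and B: "B\<in>K" for K B
  using Sd_cases
 proof
  assume "Sd = sanov"
  then show ?thesis using con3_sanov_core[of K B] K B by simp
 next
  assume "Sd = {(1, 2 * n, 0, 1) | n. True}"
  then obtain n where n: "B = (1, 2 * n, 0, 1)" using K(1) B by blast
  then show ?thesis using con3_core_upper[OF K(2), of 1 "2 * n" 0 1] B by simp
 qed
 define H3 where "H3 = {g\<in>F. 3 dvd fst (snd (\<mu> g))}"
 define f3 where "f3 g = \<eta> (con3 (\<mu> g))" for g
 have \<mu>f3: "\<mu> (f3 g) = con3 (\<mu> g)" "f3 g\<in>P" if "g\<in>H3" for g
  using con[OF \<mu>Sd] \<eta> that by (auto simp: H3_def f3_def)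
 have H3: "subgroup H3 G"
 proof (rule subgroupI)
  show "H3\<subseteq>carrier G" using F.subset unfolding H3_def by blast
  have "\<one>\<in>H3" by (simp add: H3_def \<mu>1)
  then show "H3 ~= {}" by blast
  show "inv g\<in>H3" if "g\<in>H3" for g
   using that \<mu>c[of g] by (cases "\<mu> g") (simp add: H3_def \<mu>i SL2_inv)
  show "g\<otimes>h\<in>H3" if "g\<in>H3" "h\<in>H3" for g h
   using that con3_mult(2)[of "\<mu> g" "\<mu> h"] by (simp add: H3_def \<mu>m)
 qed
 \<comment> \<open>The second columns modulo 3 determine the upper right entry of a quotient of two
   matrices modulo 3.\<close>
 have "fidx G F H3"
 proof (rule fidxI[where \<kappa> = "%g. (fst (snd (\<mu> g)) mod 3, snd (snd (snd (\<mu> g))) mod 3)"])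
  have "(%g. (fst (snd (\<mu> g)) mod 3, snd (snd (snd (\<mu> g))) mod 3)) ` F\<subseteq>{0..<3}\<times>{0..<3}" by auto
  then show "finite ((%g. (fst (snd (\<mu> g)) mod 3, snd (snd (snd (\<mu> g))) mod 3)) ` F)"
   by (rule finite_subset) simp
  fix a b assume ab: "a\<in>F" "b\<in>F"
   "(fst (snd (\<mu> a)) mod 3, snd (snd (snd (\<mu> a))) mod 3) = (fst (snd (\<mu> b)) mod 3, snd (snd (snd (\<mu> b))) mod 3)"
  obtain p q s t where A: "\<mu> a = (p, q, s, t)" by (cases "\<mu> a")
  obtain p' q' s' t' where B: "\<mu> b = (p', q', s', t')" by (cases "\<mu> b")
  have "3 dvd q - q'" "3 dvd t - t'" using ab(3) by (simp_all add: A B mod_eq_dvd_iff)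
  then have "3 dvd (q - q') * t' - q' * (t - t')" by (rule dvd_diff[OF dvd_mult2 dvd_mult])
  moreover have "(q - q') * t' - q' * (t - t') = t' * q - q' * t" by (simp add: algebra_simps)
  ultimately have "3 dvd t' * q - q' * t" by simp
  then show "inv b\<otimes>a\<in>H3" using ab \<mu>c[OF ab(2)] by (simp add: H3_def \<mu>m \<mu>i A B SL2_inv)
 qed (rule F.subset)
 then have H3_idx: "fidx G (carrier G) H3"
  by (rule fidx_trans[OF F_idx _ subset_refl subgroup.subset[OF H3]])
 have f3: "f3\<in>hom (G(|carrier := H3|)) G"
 proof (rule homI)
  show "f3 g\<in>carrier G" if "g\<in>carrier (G(|carrier := H3|))" for g
   using \<mu>f3(2)[of g] that subgroup.mem_carrier[OF P] by simp
  fix g h assume "g\<in>carrier (G(|carrier := H3|))" "h\<in>carrier (G(|carrier := H3|))"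
  then have gh: "g\<in>F" "h\<in>F" "3 dvd fst (snd (\<mu> g))" "3 dvd fst (snd (\<mu> h))" by (auto simp: H3_def)
  show "f3 (g \<otimes>\<^bsub>G(|carrier := H3|)\<^esub> h) = f3 g\<otimes>f3 h"
   using \<eta>m[OF con[OF \<mu>Sd[OF gh(1)] gh(3)] con[OF \<mu>Sd[OF gh(2)] gh(4)]] gh
   by (simp add: f3_def \<mu>m con3_mult(1))
 qed
 \<comment> \<open>The image of such a \<open>K\<close> is normalized by \<open>Sd\<close>, through
   conjugation by \<open>P\<close>, and invariant under \<open>con3\<close>; hence it is trivial by
   \<open>con_core\<close>.\<close>
 have core3: "\<mu> k = (1, 0, 0, 1)" if K: "K \<lhd> G" "K\<subseteq>H3" "f3 ` K\<subseteq>K" and k: "k\<in>K" for K k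
 proof (rule con_core[of "\<mu> ` K"])
  have KF: "K\<subseteq>F" using K(2) by (auto simp: H3_def)
  show "\<mu> ` K\<subseteq>Sd" using \<mu>Sd KF by blast
  show "3 dvd fst (snd B)\<and>con3 B\<in>\<mu> ` K" if B: "B\<in>\<mu> ` K" for B
  proof -
   obtain l where l: "l\<in>K" "B = \<mu> l" using B by blast
   then have "l\<in>H3" "f3 l\<in>K" using K by auto
   then show ?thesis using \<mu>f3(1)[of l] l(2) by (auto simp: H3_def intro!: image_eqI[of _ \<mu> "f3 l"])
  qed
  show "mm (mm C B) (inv\<^bsub>SL2\<^esub> C)\<in>\<mu> ` K" if CB: "C\<in>Sd" "B\<in>\<mu> ` K" for C B
  proof -
   obtain l where l: "l\<in>K" "B = \<mu> l" using CB(2) by blast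
   obtain p where p: "p\<in>P" "\<mu> p = C" using surj[OF CB(1)] by blast
   have F': "p\<in>F" "l\<in>F" using p l PF KF by auto
   have "p\<otimes>l\<otimes>inv p\<in>K" using normal.inv_op_closed2[OF K(1) F.mem_carrier[OF F'(1)] l(1)] .
   moreover have "\<mu> (p\<otimes>l\<otimes>inv p) = mm (mm C B) (inv\<^bsub>SL2\<^esub> C)" using F' by (simp add: \<mu>m \<mu>i p(2) l(2))
   ultimately show ?thesis by (metis imageI)
  qed
  show "\<mu> k\<in>\<mu> ` K" using k by blast
 qed
 show ?thesis
 proof (cases "r = 1")
  case r1: True
  \<comment> \<open>In rank one \<mu> is already injective modulo \<open>J\<close>, and
    \<open>sec\<close> fills the second place.\<close>
  show ?thesis
  proof (rule self_similarI[OF F F_idx sec_props(1) H3 H3_idx f3])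
   fix K assume K: "K \<lhd> G" "K\<subseteq>F" "K\<subseteq>H3" "f3 ` K\<subseteq>K"
   show "K\<subseteq>J"
   proof
    fix k assume k: "k\<in>K"
    show "k\<in>J"
    proof (rule free_kernel[OF \<mu>(1,2), of UL])
     show "\<mu> (x i) = UL i" if "i < r" for i using \<mu>(3)[OF that] that r1 by (simp add: lam_def D_def)
     show "weval SL2 UL w ~= (1, 0, 0, 1)" if w: "reduced w" "w ~= []" "w\<in>words {..<r}" for w
     proof (rule UL_free[OF w(1,2)])
      show "w\<in>words {0, 1}" using w(3) r1 by (auto simp: words_def)
     qed
    qed (use k K core3[OF K(1,3,4) k] in auto)
   qed
  qed
 next
  case r2: False
  then have r: "r\<ge>2" using False by simp
  then have x01: "x 0\<in>F" "x 1\<in>F" using x_F by auto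
  \<comment> \<open>These conjugates are mapped by \<mu> to the free family \<open>conjL\<close>.
    The homomorphism sending \<open>x i\<close> to \<open>y i\<close> thus also detects the
    generators that \<mu> kills.\<close>
  define y where "y i = x 0 [^] i\<otimes>x 1\<otimes>inv (x 0 [^] i)" for i :: nat
  have pw: "x 0 [^] (i::nat)\<in>F" "\<mu> (x 0 [^] i) = (1, 2 * int i, 0, 1)" for i
  proof -
   have "x 0 [^] i\<in>F\<and>\<mu> (x 0 [^] i) = (1, 2, 0, 1) [^]\<^bsub>SL2\<^esub> i"
   proof (induction i)
    case (Suc i)
    have "\<mu> (x 0) = (1, 2, 0, 1)" using \<mu>(3)[of 0] r by (simp add: lam_def D_def UL_def)
    then show ?case using Suc x01 by (simp add: \<mu>m)
   qed (simp add: \<mu>1)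
   then show "x 0 [^] (i::nat)\<in>F" "\<mu> (x 0 [^] i) = (1, 2 * int i, 0, 1)" by (simp_all add: UL0_pow)
  qed
  have yF: "y i\<in>F" for i using pw(1)[of i] x01 by (simp add: y_def)
  have \<mu>y: "\<mu> (y i) = conjL i" for i
  proof -
   have "\<mu> (x 1) = (1, 0, 2, 1)" using \<mu>(3)[of 1] r by (simp add: lam_def D_def UL_def)
   then show ?thesis
    using pw[of i] x01 by (simp add: y_def \<mu>m \<mu>i SL2_inv conjL_def algebra_simps)
  qed
  have "y\<in>{..<r} \<rightarrow> carrier G" using yF by auto
  from labG[OF this] obtain f2 where f2: "f2\<in>hom (G(|carrier := F|)) G" "!!j. j\<in>J ==> f2 j = \<one>"
   "!!i. i < r ==> f2 (x i) = y i" by blast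
  have f2F: "f2 g\<in>F" if g: "g\<in>F" for g
  proof -
   obtain w j where w: "w\<in>words {..<r}" "reduced w" "j\<in>J" "g = weval G x w\<otimes>j" by (rule F_words[OF g])
   have "(%i. f2 (x i))\<in>{..<r} \<rightarrow> F" using yF f2(3) by auto
   from weval_subgroup[OF F this w(1)] show ?thesis
    unfolding w(4) using hom_words[OF f2(1) group_axioms f2(2) w(1,3)] by simp
  qed
  have \<mu>f2: "(%g. \<mu> (f2 g))\<in>hom (G(|carrier := F|)) SL2"
  proof (rule homI)
   show "\<mu> (f2 g)\<in>carrier SL2" if "g\<in>carrier (G(|carrier := F|))" for g using \<mu>c f2F that by simp
   fix g h assume gh: "g\<in>carrier (G(|carrier := F|))" "h\<in>carrier (G(|carrier := F|))"
   then have "f2 (g\<otimes>h) = f2 g\<otimes>f2 h" using f2(1) by (simp add: hom_def)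
   then show "\<mu> (f2 (g \<otimes>\<^bsub>G(|carrier := F|)\<^esub> h)) = \<mu> (f2 g) \<otimes>\<^bsub>SL2\<^esub> \<mu> (f2 h)" using gh f2F by (simp add: \<mu>m)
  qed
  show ?thesis
  proof (rule self_similarI[OF F F_idx f2(1) H3 H3_idx f3])
   fix K assume K: "K \<lhd> G" "K\<subseteq>F" "K\<subseteq>H3" "f2 ` K\<subseteq>K" "f3 ` K\<subseteq>K"
   show "K\<subseteq>J"
   proof
    fix k assume k: "k\<in>K"
    show "k\<in>J"
    proof (rule free_kernel[OF \<mu>f2, of conjL])
     show "\<mu> (f2 k) = (1, 0, 0, 1)" using core3[OF K(1,3,5)] k K(4) by blast
    qed (use k K f2 \<mu>y \<mu>1 conjL_free in auto)
   qed
  qed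
 qed
qed

end

section \<open>The equivalences\<close>

context gog_nilp
begin

text \<open>The finite set is enlarged by the cosets of \<open>JLin\<close>, so that a point
  stabilizer consists of elements of \<open>JLin\<close>. Each free generator can then be multiplied
  by an element of \<open>J\<close> to act linearly; generation together with \<open>J\<close> and
  the values under homomorphisms trivial on \<open>J\<close> do not change.\<close>

theorem heis_free_exists:
 assumes adm: "admissible J" and hn: "heis_normal PG J \<zeta> M"
 shows "\<exists>F r x. heis_free PG J \<zeta> M F r x"
proof -
 interpret heis_normal PG J \<zeta> M by (rule hn)
 obtain Y :: "('v => ('v, 'e, 'g) gel set) set" and act
  where Y: "finite Y" "Y ~= {}" "act\<in>hom PG (permgrp Y)"
   "!!v a y. v\<in>Vs ==> a\<in>carrier (Gv v) ==> y\<in>Y ==> act (\<iota> v a) y = y\<longleftrightarrow>\<iota> v a\<in>J"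
  using admissible_finite_action[OF adm] by blast
 obtain y1 where y1: "y1\<in>Y" using Y(2) by blast
 have actm: "act (k\<cdot>l) y = act k (act l y)" if "k\<in>\<P>" "l\<in>\<P>" for k l y
  using Y(3) that by (simp add: hom_def)
 have actY: "act k y\<in>Y\<longleftrightarrow>y\<in>Y" if "k\<in>\<P>" for k y
  using permutes_in_image[of "act k" Y] hom_in_carrier[OF Y(3) that] by simp
 have act1: "act \<e> y = y" for y using hom_one[OF Y(3) G.group_axioms group_permgrp] by simp
 define co where "co k = k <#\<^bsub>PG\<^esub> JLin" for k
 have co_mult: "k <#\<^bsub>PG\<^esub> co l = co (k\<cdot>l)" if "k\<in>\<P>" "l\<in>\<P>" for k l
  using G.l_coset_mult[OF JLin_subgroup that] by (simp add: co_def)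
 have co_eq: "co k = co l\<longleftrightarrow>iv l\<cdot>k\<in>JLin" if "k\<in>\<P>" "l\<in>\<P>" for k l
  using G.l_coset_eq_iff[OF JLin_subgroup that] by (simp add: co_def)
 have J_JLin: "j\<in>JLin" if j: "j\<in>J" for j
 proof -
  have "iv j\<cdot>j\<in>Lin" using subgroup.one_closed[OF Lin_subgroup] j by simp
  moreover have "iv j\<in>J" "j\<in>\<P>" using j by simp_all
  ultimately show ?thesis unfolding JLin_def by blast
 qed
 have finC: "finite (co ` \<P>)"
 proof -
  obtain S where S: "finite S" "S\<subseteq>\<P>" "\<forall>a\<in>\<P>. \<exists>s\<in>S. iv s\<cdot>a\<in>JLin"
   using JLin_fidx by (auto simp: fidx_def)
  have "co ` \<P>\<subseteq>co ` S"
  proof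
   fix c assume "c\<in>co ` \<P>"
   then obtain a where a: "a\<in>\<P>" "c = co a" by blast
   then obtain s where s: "s\<in>S" "iv s\<cdot>a\<in>JLin" using S(3) by blast
   then have "co a = co s" using co_eq[OF a(1), of s] S(2) by blast
   then show "c\<in>co ` S" using a(2) s(1) by blast
  qed
  then show ?thesis by (rule finite_subset) (use S(1) in simp)
 qed
 define Y' where "Y' = Y\<times>co ` \<P>"
 have finY': "finite Y'" using Y(1) finC by (simp add: Y'_def)
 define act' where "act' k z = (if z\<in>Y' then (act k (fst z), k <#\<^bsub>PG\<^esub> snd z) else z)"
  for k and z :: "('v => ('v, 'e, 'g) gel set)\<times>('v, 'e, 'g) gel set"
 have act'v: "act' k (y, co l) = (act k y, co (k\<cdot>l))" if "k\<in>\<P>" "l\<in>\<P>" "y\<in>Y" for k l y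
  using that by (simp add: act'_def Y'_def co_mult)
 have Y'E: "\<exists>y l. z = (y, co l)\<and>y\<in>Y\<and>l\<in>\<P>" if "z\<in>Y'" for z using that by (auto simp: Y'_def)
 have Y'I: "(y, co l)\<in>Y'" if "y\<in>Y" "l\<in>\<P>" for y l using that by (simp add: Y'_def)
 have act'hom: "act'\<in>hom PG (permgrp Y')"
 proof (rule hom_permgrpI)
  show "Group.group PG" by (rule G.group_axioms)
  show "act' k z\<in>Y'" if k: "k\<in>\<P>" and z: "z\<in>Y'" for k z
  proof -
   obtain y l where yl: "z = (y, co l)" "y\<in>Y" "l\<in>\<P>" using Y'E[OF z] by blast
   show ?thesis unfolding yl(1) act'v[OF k yl(3,2)] using Y'I actY[OF k] yl k by simp
  qed
  show "act' k z = z" if "z\<notin>Y'" for k z using that by (simp add: act'_def)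
  show "act' \<e> z = z" if z: "z\<in>Y'" for z
  proof -
   obtain y l where yl: "z = (y, co l)" "y\<in>Y" "l\<in>\<P>" using Y'E[OF z] by blast
   show ?thesis unfolding yl(1) act'v[OF G.one_closed yl(3,2)] using yl by (simp add: act1)
  qed
  show "act' (k\<cdot>k') z = act' k (act' k' z)" if k: "k\<in>\<P>" "k'\<in>\<P>" and z: "z\<in>Y'" for k k' z
  proof -
   obtain y l where yl: "z = (y, co l)" "y\<in>Y" "l\<in>\<P>" using Y'E[OF z] by blast
   have 1: "k'\<cdot>l\<in>\<P>" "act k' y\<in>Y" using k yl actY by auto
   show ?thesis
    unfolding yl(1) act'v[OF k(2) yl(3,2)] act'v[OF G.m_closed[OF k] yl(3,2)] act'v[OF k(1) 1]
    using k yl by (simp add: actm G.m_assoc)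
  qed
 qed
 have stab: "act' (\<iota> v a) z = z\<longleftrightarrow>\<iota> v a\<in>J" if v: "v\<in>Vs" "a\<in>carrier (Gv v)" and z: "z\<in>Y'" for v a z
 proof -
  obtain y l where yl: "z = (y, co l)" "y\<in>Y" "l\<in>\<P>" using Y'E[OF z] by blast
  have c: "\<iota> v a\<in>\<P>" using v by simp
  have "co (\<iota> v a\<cdot>l) = co l" if j: "\<iota> v a\<in>J"
  proof -
   have "iv l\<cdot>\<iota> v a\<cdot>l\<in>J" using J.inv_op_closed1[OF yl(3) j] .
   then show ?thesis using J_JLin co_eq[of "\<iota> v a\<cdot>l" l] c yl(3) by (simp add: G.m_assoc)
  qed
  then show ?thesis unfolding yl(1) act'v[OF c yl(3,2)] using Y(4)[OF v yl(2)] by auto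
 qed
 define y0 where "y0 = (y1, co \<e>)"
 have y0: "y0\<in>Y'" unfolding y0_def by (rule Y'I[OF y1 G.one_closed])
 define F where "F = {g\<in>\<P>. act' g y0 = y0}"
 \<comment> \<open>Both factors are needed for the same generators, and
   \<open>free_complement\<close> chooses generators for one given target.\<close>
 have K: "Group.group (PG \<times>\<times> SL2)" by (rule DirProd_group[OF G.group_axioms SL2.group_axioms])
 obtain r :: nat and \<gamma> where \<gamma>: "\<gamma>\<in>{..<r} \<rightarrow> F" "F = generate PG (J\<union>\<gamma> ` {..<r})"
  and lab: "!!lam. lam\<in>{..<r} \<rightarrow> carrier (PG \<times>\<times> SL2) ==> \<exists>\<sigma>\<in>hom (PG(|carrier := F|)) (PG \<times>\<times> SL2).
   (\<forall>j\<in>J. \<sigma> j = \<one>\<^bsub>PG \<times>\<times> SL2\<^esub>)\<and>(\<forall>i < r. \<sigma> (\<gamma> i) = lam i)"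
  using free_complement[OF adm K finY' y0 act'hom stab] unfolding F_def by blast
 have Fc: "F\<subseteq>\<P>" by (simp add: F_def)
 have "\<gamma> i\<in>\<P>" if "i < r" for i using \<gamma>(1) Fc that by auto
 then have "J\<union>\<gamma> ` {..<r}\<subseteq>\<P>" using J.subset by auto
 then have F: "subgroup F PG" unfolding \<gamma>(2) by (rule G.generate_is_subgroup)
 have FI: "g\<in>F" if "g\<in>\<P>" "act' g y0 = y0" for g using that by (simp add: F_def)
 have FD: "act' g y0 = y0" if "g\<in>F" for g using that by (simp add: F_def)
 have JF: "J\<subseteq>F" 
 proof
  fix j assume "j\<in>J"
  then have "j\<in>generate PG (J\<union>\<gamma> ` {..<r})" by (intro generate.incl) simp
  then show "j\<in>F" by (simp only: flip: \<gamma>(2))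
 qed
 interpret F: subgroup F PG by (rule F)
 have FJ: "g\<in>JLin" if g: "g\<in>F" for g
 proof -
  note gc = F.mem_carrier[OF g]
  have "co (g\<cdot>\<e>) = co \<e>"
   using FD[OF g] unfolding y0_def act'v[OF gc G.one_closed y1] by simp
  then show ?thesis using co_eq[OF gc G.one_closed] gc by simp
 qed
 have F_idx: "fidx PG (\<P>) F"
 proof (rule G.fidxI[where \<kappa> = "%g. act' g y0"])
  have "act' g y0\<in>Y'" if "g\<in>\<P>" for g
   using permutes_in_image[of "act' g" Y'] hom_in_carrier[OF act'hom that] y0 by simp
  then have "(%g. act' g y0) ` \<P>\<subseteq>Y'" by blast
  then show "finite ((%g. act' g y0) ` \<P>)" by (rule finite_subset) (rule finY')
  fix a b assume ab: "a\<in>\<P>" "b\<in>\<P>" "act' a y0 = act' b y0"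
  have m: "act' (iv b\<cdot>k) y0 = act' (iv b) (act' k y0)" if "k\<in>\<P>" for k
   using act'hom that ab(2) by (simp add: hom_def)
  have "act' \<e> y0 = y0" using hom_one[OF act'hom G.group_axioms group_permgrp] by simp
  then have "act' (iv b\<cdot>a) y0 = y0" using m[OF ab(1)] m[OF ab(2)] ab by simp
  then show "iv b\<cdot>a\<in>F" using FI ab by simp
 qed simp
 have "\<forall>i\<in>{..<r}. \<exists>u. u\<in>J\<and>u\<cdot>\<gamma> i\<in>Lin"
  using FJ \<gamma>(1) unfolding JLin_def by blast
 from bchoice[OF this] obtain u where u: "\<forall>i\<in>{..<r}. u i\<in>J\<and>u i\<cdot>\<gamma> i\<in>Lin" by blast
 define x where "x i = u i\<cdot>\<gamma> i" for i
 have uF: "u i\<in>F" "\<gamma> i\<in>F" "u i\<in>J" if "i < r" for i using u \<gamma>(1) JF that by auto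
 have xF: "x i\<in>F" if "i < r" for i unfolding x_def using uF[OF that] by simp
 have "F = generate PG (J\<union>x ` {..<r})"
 proof
  have sub: "J\<union>x ` {..<r}\<subseteq>F" using JF xF by auto
  then show "generate PG (J\<union>x ` {..<r})\<subseteq>F" by (rule G.generate_subgroup_incl[OF _ F])
  have S: "subgroup (generate PG (J\<union>x ` {..<r})) PG" by (rule G.generate_is_subgroup) (use sub Fc in blast)
  have J': "j\<in>generate PG (J\<union>x ` {..<r})" if "j\<in>J" for j using that by (auto intro: generate.incl)
  have "\<gamma> i\<in>generate PG (J\<union>x ` {..<r})" if i: "i < r" for i
  proof -
   have "x i\<in>generate PG (J\<union>x ` {..<r})" using i by (auto intro: generate.incl)
   then have "iv u i\<cdot>x i\<in>generate PG (J\<union>x ` {..<r})"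
    by (rule subgroup.m_closed[OF S subgroup.m_inv_closed[OF S J'[OF uF(3)[OF i]]]])
   moreover have "iv u i\<cdot>x i = \<gamma> i" using uF(1,2)[OF i] by (simp add: x_def)
   ultimately show ?thesis by simp
  qed
  then have "J\<union>\<gamma> ` {..<r}\<subseteq>generate PG (J\<union>x ` {..<r})" using J' by blast
  then show "F\<subseteq>generate PG (J\<union>x ` {..<r})" unfolding \<gamma>(2) by (rule G.generate_subgroup_incl[OF _ S])
 qed
 moreover have "\<exists>\<sigma>\<in>hom (PG(|carrier := F|)) (PG \<times>\<times> SL2). (\<forall>j\<in>J. \<sigma> j = \<one>\<^bsub>PG \<times>\<times> SL2\<^esub>)\<and>(\<forall>i < r. \<sigma> (x i) = lam i)"
  if lam: "lam\<in>{..<r} \<rightarrow> carrier (PG \<times>\<times> SL2)" for lam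
 proof -
  obtain \<sigma> where \<sigma>: "\<sigma>\<in>hom (PG(|carrier := F|)) (PG \<times>\<times> SL2)" "\<forall>j\<in>J. \<sigma> j = \<one>\<^bsub>PG \<times>\<times> SL2\<^esub>" "\<forall>i < r. \<sigma> (\<gamma> i) = lam i"
   using lab[OF lam] by blast
  have "\<sigma> (x i) = lam i" if i: "i < r" for i
  proof -
   have "\<sigma> (x i) = \<sigma> (u i) \<otimes>\<^bsub>PG \<times>\<times> SL2\<^esub> \<sigma> (\<gamma> i)"
    using \<sigma>(1) uF(1,2)[OF i] unfolding x_def hom_def by simp
   also have "\<dots> = lam i" using \<sigma>(2,3) uF(3)[OF i] i lam Group.group.is_monoid[OF K] by (simp add: monoid.l_one Pi_iff del: one_DirProd mult_DirProd)
   finally show ?thesis .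
  qed
  then show ?thesis using \<sigma> by blast
 qed
 moreover have "x\<in>{..<r} \<rightarrow> F" "x\<in>{..<r} \<rightarrow> Lin" using xF u by (auto simp: x_def)
 ultimately have "heis_free PG J \<zeta> M F r x"
  by (intro heis_free.intro[OF hn] heis_free_axioms.intro F F_idx JF)
 then show ?thesis by blast
qed

theorem residually_finite_consequences:
 assumes RF: "residually_finite PG" and e: "e\<in>Ar"
  and com: "commensurable (Gv (src e)(|carrier := Ge e|)) heisenberg_group"
 shows "self_similar PG" "linear_over_int PG" "subgroup_separable PG"
proof -
 obtain J \<zeta> M where J: "admissible J" "heis_normal PG J \<zeta> M" using heis_admissible[OF assms] by blast
 obtain F r x where "heis_free PG J \<zeta> M F r x" using heis_free_exists[OF J] by blast
 then show "self_similar PG" "linear_over_int PG" by (rule heis_free.self_similar, rule heis_free.linear)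
 show "subgroup_separable PG" by (rule subgroup_separableI[OF J])
qed

end

theorem theorem1p3:
  fixes X T :: "('v, 'e) pre_digraph"
    and Gv :: "'v \<Rightarrow> 'g monoid"
    and Ge :: "'e \<Rightarrow> 'g set"
    and \<phi> :: "'e \<Rightarrow> 'g \<Rightarrow> 'g"
  defines "G \<equiv> fundamental_group X Gv Ge \<phi> T"
  assumes "graph_of_groups X Gv Ge \<phi>"
    and "maximal_subtree T X"
    and "\<And>v. v \<in> verts X \<Longrightarrow>
           finitely_generated (Gv v) \<and> torsion_free (Gv v) \<and> nilpotent (Gv v)"
    and "\<And>e. e \<in> arcs X \<Longrightarrow>
           finite_index_subgroup (Ge e) (Gv (tail X e)) \<and> Ge e \<noteq> carrier (Gv (tail X e))"
    and "\<And>e. e \<in> arcs X \<Longrightarrow>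
           finite_index_subgroup (\<phi> e ` Ge e) (Gv (head X e)) \<and>
           \<phi> e ` Ge e \<noteq> carrier (Gv (head X e))"
    and "\<exists>e \<in> arcs X. commensurable (Gv (tail X e)\<lparr>carrier := Ge e\<rparr>) heisenberg_group"
  shows "(self_similar G \<longleftrightarrow> residually_finite G) \<and>
         (residually_finite G \<longleftrightarrow> linear_over_int G) \<and>
         (linear_over_int G \<longleftrightarrow> subgroup_separable G)"
proof -
 interpret gog_nilp X Gv Ge \<phi> T
  by (intro gog_nilp.intro gog_tree.intro gog_tree_axioms.intro gog_nilp_axioms.intro) (fact assms)+
 obtain e where e: "e\<in>arcs X" "commensurable (Gv (tail X e)(|carrier := Ge e|)) heisenberg_group"
  using assms(7) by blast
 note RF = residually_finite_consequences[OF _ e]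
 note conv = G.self_similar_residually_finite G.linear_residually_finite G.subgroup_separable_residually_finite
 show ?thesis unfolding G_def using RF conv by blast
qed

end
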